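(* Let $n\ge 1$ and let $\vec u(t)=(u(t),\dot u(t))$ be a global solution in $\mathcal H$ of the Klein-Gordon equation $$(\partial_t^2-\Delta_x+1)u=N(u,x,t)\,u,\qquad \vec u(0)=(u_0,\dot u_0)\in\mathcal H,$$ on $\mathbb R^n$. Assume that $E:=\sup_{t\ge 0}\|\vec u(t)\|_{\mathcal H}<\infty$ and that, for some $\sigma>1$, $E_u:=\sup_{t\ge 0}\|\langle x\rangle^{\sigma}N(u(t),x,t)u(t)\|_{L^2_x(\mathbb R^n)}<\infty$. Let $\Omega_\alpha^*\vec u(0)\in\mathcal H$ be the free channel wave operator applied to $\vec u(0)$ (defined in the context). Then there is $\vec u_{wlc}(t)\in\mathcal H$ such that $$\|\vec u(t)-U_0(t,0)\Omega_\alpha^*\vec u(0)-\vec u_{wlc}(t)\|_{\mathcal H}\to0\qquad\text{as }t\to\infty,$$ and $\vec u_{wlc}$ is sub-ballistic in the sense that, for every $\epsilon\in(0,1/2)$, as $t\to\infty$ (i.e. for all sufficiently large $t$), $$(\vec u_{wlc}(t),\mathcal X^N\vec u_{wlc}(t))_{\mathcal H}\lesssim_{E,\epsilon}\max\{t^{N(1/2+\epsilon)},\,t^{N(1/\sigma+\epsilon)}\}\qquad\text{for all }N\ge0 .$$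
   Context: Notation. $\langle x\rangle=\sqrt{1+|x|^2}$; $p=-i\nabla_x$, and functions of $p$ are Fourier multipliers, in particular $\langle p\rangle=\sqrt{1-\Delta_x}$. $\mathcal H=H^1(\mathbb R^n)\times L^2(\mathbb R^n)$ with inner product $(\vec u,\vec v)_{\mathcal H}=(\langle p\rangle u_1,\langle p\rangle v_1)_{L^2}+(u_2,v_2)_{L^2}$. $u(t)=u(\cdot,t)$, $\dot u(t)=\partial_tu(\cdot,t)$. When $N(u,x,t)$ depends on $u$, $N(u(t),x,t)$ is regarded as a time-dependent multiplication operator along the given orbit. $X\lesssim_aY$ means $X\le CY$ with $C=C(a)>0$. (The exponent $N\ge0$ in $\mathcal X^N$ is unrelated to the interaction $N(u,x,t)$.) Matrix operator: $$\mathcal X=\begin{pmatrix}\langle p\rangle^{-1}\langle x\rangle\langle p\rangle&0\\0&\langle x\rangle\end{pmatrix},\quad\text{so}\quad \mathcal X^N=\begin{pmatrix}\langle p\rangle^{-1}\langle x\rangle^N\langle p\rangle&0\\0&\langle x\rangle^N\end{pmatrix}.$$ Free evolution: $U_0(t,0)(f,g)=\big(\cos(t\langle p\rangle)f+\tfrac{\sin(t\langle p\rangle)}{\langle p\rangle}g,\ -\sin(t\langle p\rangle)\langle p\rangle f+\cos(t\langle p\rangle)g\big)$ and $U_0(0,t)=U_0(-t,0)$. Cut-offs: $F_c,F_1$ are smooth cut-off functions on $\mathbb R$ with $F_j(\lambda)=1$ for $\lambda\ge1$ and $F_j(\lambda)=0$ for $\lambda<1/2$ ($j=c,1$). $F_c(\frac{|x|}{t^\alpha}\le1)$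 is multiplication by $1-F_c(|x|/t^\alpha)$; $F_1(t^\beta|p|>1)$ is the Fourier multiplier $F_1(t^\beta|\xi|)$; $F_1(|p|\le t^\beta)$ is the Fourier multiplier $1-F_1(|\xi|/t^\beta)$. Free channel wave operator: for $(\alpha,\beta)\in\mathscr I_{\mathrm{loc}}:=\{(\alpha,\beta)\in(0,1)^2:\beta<\min\{1-\alpha,\frac{\sigma-1}{\sigma}\}\}$ let $F_\alpha(x,p,t)=F_c(\frac{|x|}{t^\alpha}\le1)F_1(t^\beta|p|>1)F_1(|p|\le t^\beta)$, $\mathcal F_\alpha=\mathrm{diag}(\langle p\rangle^{-1}F_\alpha\langle p\rangle,\ F_\alpha)$, and $\Omega_\alpha^*\vec u(0):=\lim_{t\to\infty}\mathcal F_\alpha(x,p,t)U_0(0,t)\vec u(t)$ (strong limit in $\mathcal H$). Under the stated hypotheses this limit exists and is independent of $(\alpha,\beta)\in\mathscr I_{\mathrm{loc}}$. *)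

theory Defs
  imports "HOL-Analysis.Analysis" "HOL-Library.Function_Algebras"
begin

text \<open>Elements of \<open>L\<^sup>2\<close> are represented by Borel functions. Everything below sees a function only up to
  null sets, and all limits are taken in norms that do not distinguish representatives.\<close>

type_synonym 'n scalar_field = "real ^ 'n \<Rightarrow> complex"
type_synonym 'n state = "'n scalar_field \<times> 'n scalar_field"

definition L2 :: "'n::finite scalar_field set" where
  "L2 = {f. f \<in> borel_measurable lborel \<and> integrable lborel (\<lambda>x. (cmod (f x))\<^sup>2)}"

definition L2_inner :: "'n::finite scalar_field \<Rightarrow> 'n scalar_field \<Rightarrow> complex" where
  "L2_inner f g = (LINT x|lborel. f x * cnj (g x))"

definition L2_norm :: "'n::finite scalar_field \<Rightarrow> real" where
  "L2_norm f = sqrt (LINT x|lborel. (cmod (f x))\<^sup>2)"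

definition japanese :: "real ^ 'n::finite \<Rightarrow> real" where
  "japanese x = sqrt (1 + (norm x)\<^sup>2)"


definition fourier_L1 :: "'n::finite scalar_field \<Rightarrow> 'n scalar_field" where
  "fourier_L1 f \<xi> =
     complex_of_real ((2 * pi) powr (- real CARD('n) / 2)) * (LINT x|lborel. cis (- (x \<bullet> \<xi>)) * f x)"

text \<open>The unitary (Plancherel) transform on \<open>L\<^sup>2\<close>: the \<open>L\<^sup>2\<close>-limit of the integral transforms of the
  truncations of \<open>f\<close> to balls, which are in \<open>L\<^sup>1 \<inter> L\<^sup>2\<close>. It is unique up to null sets.\<close>

definition fourier :: "'n::finite scalar_field \<Rightarrow> 'n scalar_field" where
  "fourier f = (SOME g. g \<in> L2 \<and>
     (\<lambda>k. L2_norm (fourier_L1 (\<lambda>x. indicator (cball 0 (real k)) x * f x) - g)) \<longlonglongrightarrow> 0)"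

definition inv_fourier :: "'n::finite scalar_field \<Rightarrow> 'n scalar_field" where
  "inv_fourier g x = fourier g (- x)"

text \<open>\<open>m(p)\<close> with \<open>p = -i\<nabla>\<close>; meaningful when \<open>f\<close> and \<open>\<xi> \<mapsto> m \<xi> * fourier f \<xi>\<close> are both in \<open>L\<^sup>2\<close>.\<close>

definition fourier_mult :: "(real ^ 'n::finite \<Rightarrow> real) \<Rightarrow> 'n scalar_field \<Rightarrow> 'n scalar_field" where
  "fourier_mult m f = inv_fourier (\<lambda>\<xi>. complex_of_real (m \<xi>) * fourier f \<xi>)"

definition pos_mult :: "(real ^ 'n::finite \<Rightarrow> real) \<Rightarrow> 'n scalar_field \<Rightarrow> 'n scalar_field" where
  "pos_mult w f x = complex_of_real (w x) * f x"

abbreviation jp :: "'n::finite scalar_field \<Rightarrow> 'n scalar_field" where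
  "jp \<equiv> fourier_mult japanese"

abbreviation jp_inv :: "'n::finite scalar_field \<Rightarrow> 'n scalar_field" where
  "jp_inv \<equiv> fourier_mult (\<lambda>\<xi>. 1 / japanese \<xi>)"


definition H1 :: "'n::finite scalar_field set" where
  "H1 = {f \<in> L2. (\<lambda>\<xi>. complex_of_real (japanese \<xi>) * fourier f \<xi>) \<in> L2}"

definition energy_space :: "'n::finite state set" where
  "energy_space = H1 \<times> L2"

definition H_inner :: "'n::finite state \<Rightarrow> 'n state \<Rightarrow> complex" where
  "H_inner u v = L2_inner (jp (fst u)) (jp (fst v)) + L2_inner (snd u) (snd v)"

definition H_norm :: "'n::finite state \<Rightarrow> real" where
  "H_norm u = sqrt (Re (H_inner u u))"


text \<open>\<open>X_pow M\<close> is \<open>\<X>\<^sup>M\<close>, an unbounded operator on the energy space with natural domain \<open>X_dom M\<close>.\<close>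

definition X_dom :: "real \<Rightarrow> 'n::finite state set" where
  "X_dom M = {u \<in> energy_space. pos_mult (\<lambda>x. japanese x powr M) (jp (fst u)) \<in> L2 \<and>
                                pos_mult (\<lambda>x. japanese x powr M) (snd u) \<in> L2}"

definition X_pow :: "real \<Rightarrow> 'n::finite state \<Rightarrow> 'n state" where
  "X_pow M u = (jp_inv (pos_mult (\<lambda>x. japanese x powr M) (jp (fst u))),
                pos_mult (\<lambda>x. japanese x powr M) (snd u))"


text \<open>\<open>U0 t\<close> is \<open>U\<^sub>0(t,0)\<close>, so \<open>U\<^sub>0(0,t)\<close> is \<open>U0 (-t)\<close>.\<close>

definition U0 :: "real \<Rightarrow> 'n::finite state \<Rightarrow> 'n state" where
  "U0 t u =
     (fourier_mult (\<lambda>\<xi>. cos (t * japanese \<xi>)) (fst u)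
        + fourier_mult (\<lambda>\<xi>. sin (t * japanese \<xi>) / japanese \<xi>) (snd u),
      fourier_mult (\<lambda>\<xi>. - sin (t * japanese \<xi>) * japanese \<xi>) (fst u)
        + fourier_mult (\<lambda>\<xi>. cos (t * japanese \<xi>)) (snd u))"


text \<open>The interaction \<open>N\<close> may depend on the whole profile \<open>u(t)\<close>, so both pointwise nonlinearities and
  nonlocal ones are covered; \<open>interaction N u t\<close> is \<open>N(u(t),x,t) u(t)\<close> as a function of \<open>x\<close>.\<close>

type_synonym 'n interaction = "'n scalar_field \<Rightarrow> real ^ 'n \<Rightarrow> real \<Rightarrow> complex"

definition interaction :: "'n::finite interaction \<Rightarrow> (real \<Rightarrow> 'n state) \<Rightarrow> real \<Rightarrow> 'n scalar_field" where
  "interaction N u t x = N (fst (u t)) x t * fst (u t) x"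

text \<open>Finite-energy solutions on \<open>[0,\<infinity>)\<close>: continuous curves \<open>u = (u, \<partial>\<^sub>tu)\<close> in the energy space that satisfy
  the equation in the weak (\<open>H\<^sup>-\<^sup>1\<close>) sense. The last clause is
  \<open>\<langle>\<partial>\<^sub>t\<^sup>2 u, \<phi>\<rangle> + (\<langle>p\<rangle>u, \<langle>p\<rangle>\<phi>) = (N u, \<phi>)\<close> integrated over \<open>[0,t]\<close>, where \<open>-\<Delta> + 1 = \<langle>p\<rangle>\<^sup>2\<close>; the integrated
  form is needed because \<open>N(u(t),x,t)u(t)\<close> need not be continuous in \<open>t\<close>.\<close>

definition KG_solution :: "'n::finite interaction \<Rightarrow> (real \<Rightarrow> 'n state) \<Rightarrow> bool" where
  "KG_solution N u \<longleftrightarrow>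
     (\<forall>t\<ge>0. u t \<in> energy_space \<and> interaction N u t \<in> L2) \<and>
     (\<forall>s\<ge>0. ((\<lambda>t. H_norm (u t - u s)) \<longlongrightarrow> 0) (at s within {0..})) \<and>
     (\<forall>\<phi>\<in>H1. \<forall>t\<ge>0. ((\<lambda>s. L2_inner (fst (u s)) \<phi>) has_vector_derivative L2_inner (snd (u t)) \<phi>)
                       (at t within {0..})) \<and>
     (\<forall>\<phi>\<in>H1. \<forall>t\<ge>0. ((\<lambda>s. L2_inner (interaction N u s) \<phi> - L2_inner (jp (fst (u s))) (jp \<phi>))
                       has_integral (L2_inner (snd (u t)) \<phi> - L2_inner (snd (u 0)) \<phi>)) {0..t})"


definition smooth_cutoff :: "(real \<Rightarrow> real) \<Rightarrow> bool" where
  "smooth_cutoff F \<longleftrightarrow>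
     (\<forall>k x. (deriv ^^ k) F field_differentiable (at x)) \<and>
     (\<forall>x\<ge>1. F x = 1) \<and> (\<forall>x<1/2. F x = 0)"

definition I_loc :: "real \<Rightarrow> (real \<times> real) set" where
  "I_loc \<sigma> = {(\<alpha>, \<beta>). 0 < \<alpha> \<and> \<alpha> < 1 \<and> 0 < \<beta> \<and> \<beta> < 1 \<and> \<beta> < min (1 - \<alpha>) ((\<sigma> - 1) / \<sigma>)}"

definition F_loc ::
  "(real \<Rightarrow> real) \<Rightarrow> (real \<Rightarrow> real) \<Rightarrow> real \<Rightarrow> real \<Rightarrow> real \<Rightarrow> 'n::finite scalar_field \<Rightarrow> 'n scalar_field" where
  "F_loc Fc F1 \<alpha> \<beta> t f =
     pos_mult (\<lambda>x. 1 - Fc (norm x / t powr \<alpha>))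
       (fourier_mult (\<lambda>\<xi>. F1 (t powr \<beta> * norm \<xi>))
         (fourier_mult (\<lambda>\<xi>. 1 - F1 (norm \<xi> / t powr \<beta>)) f))"

definition F_mat ::
  "(real \<Rightarrow> real) \<Rightarrow> (real \<Rightarrow> real) \<Rightarrow> real \<Rightarrow> real \<Rightarrow> real \<Rightarrow> 'n::finite state \<Rightarrow> 'n state" where
  "F_mat Fc F1 \<alpha> \<beta> t u =
     (jp_inv (F_loc Fc F1 \<alpha> \<beta> t (jp (fst u))), F_loc Fc F1 \<alpha> \<beta> t (snd u))"

text \<open>\<open>\<omega>\<close> is the free channel wave operator applied to \<open>u(0)\<close>, i.e. the strong limit defining it
  exists in the energy space and equals \<open>\<omega>\<close>.\<close>

definition is_free_channel ::
  "(real \<Rightarrow> real) \<Rightarrow> (real \<Rightarrow> real) \<Rightarrow> real \<Rightarrow> real \<Rightarrow> (real \<Rightarrow> 'n::finite state) \<Rightarrow> 'n state \<Rightarrow> bool" where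
  "is_free_channel Fc F1 \<alpha> \<beta> u \<omega> \<longleftrightarrow>
     \<omega> \<in> energy_space \<and> ((\<lambda>t. H_norm (F_mat Fc F1 \<alpha> \<beta> t (U0 (- t) (u t)) - \<omega>)) \<longlongrightarrow> 0) at_top"

end

theory Submission
  imports Defs "HOL-Complex_Analysis.Complex_Analysis" "HOL-Probability.Probability"
begin

text \<open>In the interaction picture put \<open>\<Omega>(t) = exp (\<plusminus> \<i> t \<langle>p\<rangle>) (\<langle>p\<rangle>u \<plusminus> \<i> u')\<close>. Since the source has weight
 \<open>\<langle>x\<rangle>\<^sup>\<sigma>\<close> and \<open>exp (\<i> t \<langle>p\<rangle>)\<close> decays from weighted spaces at nonzero velocity, \<open>\<Omega>(t)\<close> converges
 weakly to some \<open>\<omega>\<close>. In each direction, \<open>\<Omega>(t) - \<omega>\<close> is split by logistic cut-offs of the velocity into an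
 outgoing part, controlled by Duhamel integrals from \<open>t\<close> to infinity, and an incoming part, controlled by
 those from 0 to \<open>t\<close>; propagation of half spaces is exponentially precise by Paley--Wiener. This gives local
 decay of \<open>\<Omega>(t) - \<omega>\<close>, which identifies \<open>\<omega>\<close> as the free channel, and the decay of
 \<open>u - U\<^sub>0 \<omega>\<close> outside radius \<open>t\<^sup>m\<^sup>+\<^sup>\<epsilon>\<close>, \<open>m = max(1/2, 1/\<sigma>)\<close>; a diagonal choice of \<open>\<epsilon>\<close>
 defines the remainder.\<close>

text \<open>The exponents come from three requirements on a velocity threshold \<open>th\<close> and
  a radius \<open>R\<close>. Waves faster than \<open>th\<close> beyond \<open>R\<close> meet a
  future source of size \<open>R powr (1 - sg) / th\<close>, the others a past source of size
  \<open>t * R powr - sg\<close>, and the cut-offs are compatible only if \<open>th * R\<close> is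
  large (uncertainty principle). For \<open>th = t powr (m - 1)\<close> and
  \<open>R = t powr (m + ep)\<close> the first two tend to zero if \<open>m * sg >= 1\<close>, the
  third needs \<open>m >= 1/2\<close>. Hence \<sigma> may be replaced by
  \<open>min \<sigma> 2\<close>, and two integrations by parts suffice.

  The obstacle is the infinite time interval of the future source, over which an error
  \<open>exp (- l / 2)\<close>, however small, is not summable. It is used up to time
  \<open>T = exp (l / 4)\<close> only. Afterwards dispersive decay contributes
  \<open>T powr (1 - sg)\<close>; its constants lose powers of \<open>t\<close> at low velocity, and
  the exponentially large \<open>T\<close> beats them. Logistic cut-offs are chosen because they
  continue analytically to a strip, which no compactly supported cut-off does, and still have
  exponential tails.\<close>

notation (input) tendsto (infixr "--->" 55)
notation (input) LIMSEQ ("((_)/ ----> (_))" [60, 60] 60)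
abbreviation (input) "meas f == f : borel_measurable borel"
notation (input) inner (infix ".*" 70)
notation (input) scaleR (infixr "*r" 75)
abbreviation (input) Ev (binder "EV " 10) where "Ev P == eventually P at_top"
abbreviation (input) "null f == (f ---> 0) at_top"
abbreviation (input) "jb == japanese"
abbreviation (input) "FT == fourier_L1"
abbreviation (input) "ind == indicator"
abbreviation (input) "cor == complex_of_real"

section \<open>The Hilbert space\<close>

lemma borel_measurable_cnj [measurable]:
 "f : borel_measurable M ==> (%x. cnj (f x)) : borel_measurable M"
 by (rule measurable_compose[OF _ borel_measurable_continuous_onI]) (auto intro: continuous_intros)

lemma L2_D:
 assumes "f : L2"
 shows "meas f" "integrable lborel (%x. (cmod (f x))^2)" using assms by (auto simp: L2_def)

lemma L2_I:
 assumes "meas f" "integrable lborel (%x. (cmod (f x))^2)"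
 shows "f : L2" using assms by (auto simp: L2_def)

lemma L2_dominated:
 assumes "meas f" "integrable lborel g" "!!x. (cmod (f x))^2 <= g x"
 shows "f : L2"
proof (rule L2_I)
 show "integrable lborel (%x. (cmod (f x))^2)"
 proof (rule Bochner_Integration.integrable_bound[OF assms(2)])
  show "AE x in lborel. norm ((cmod (f x))^2) <= norm (g x)" using assms(3) by (intro AE_I2) (metis abs_ge_self abs_power2 order_trans real_norm_def)
 qed (use assms(1) in auto)
qed (use assms in auto)

lemma cmod_sq_add: "(cmod (a + b))^2 <= 2 * (cmod a)^2 + 2 * (cmod b)^2"
proof -
 have "(cmod (a + b))^2 <= (cmod a + cmod b)^2" by (intro power_mono norm_triangle_ineq) auto
 also have "... <= 2 * (cmod a)^2 + 2 * (cmod b)^2" using sum_squares_bound[of "cmod a" "cmod b"] by (auto simp: power2_eq_square algebra_simps)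
 finally show ?thesis .
qed

lemma L2_add: "f : L2 ==> g : L2 ==> (%x. f x + g x) : L2"
 by (rule L2_dominated[of _ "%x. 2 * (cmod (f x))^2 + 2 * (cmod (g x))^2"]) (auto simp: L2_def intro: cmod_sq_add)

lemma L2_bmult:
 assumes "f : L2" "meas m" "!!x. cmod (m x) <= B"
 shows "(%x. m x * f x) : L2"
proof (rule L2_dominated[of _ "%x. B^2 * (cmod (f x))^2"])
 show "(cmod (m x * f x))^2 <= B^2 * (cmod (f x))^2" for x by (auto simp: norm_mult power_mult_distrib intro!: mult_right_mono power_mono assms(3))
qed (use L2_D[OF assms(1)] assms(2) in auto)

lemma L2_cmult: "f : L2 ==> (%x. c * f x) : L2" by (rule L2_bmult[of f "%_. c" "cmod c"]) auto

lemma L2_scaleR: "f : L2 ==> (%x. r *r f x) : L2" using L2_cmult[of f "of_real r"] by (simp add: scaleR_conv_of_real)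

lemma L2_uminus: "f : L2 ==> (%x. - f x) : L2" by (simp add: L2_def)

lemma L2_diff: "f : L2 ==> g : L2 ==> (%x. f x - g x) : L2" using L2_add[of f "%x. - g x"] by (simp add: L2_uminus)

lemma L2_zero: "(%_. 0) : L2" by (simp add: L2_def)

lemma cmod_mult_bound: "cmod (a * b) <= ((cmod a)^2 + (cmod b)^2) / 2" using sum_squares_bound[of "cmod a" "cmod b"] by (simp add: norm_mult)

lemma L2_mult_integrable:
 assumes "f : L2" "g : L2"
 shows "integrable lborel (%x. f x * g x)"
proof (rule Bochner_Integration.integrable_bound[of _ "%x. ((cmod (f x))^2 + (cmod (g x))^2) / 2"])
 show "AE x in lborel. cmod (f x * g x) <= norm (((cmod (f x))^2 + (cmod (g x))^2) / 2)" using cmod_mult_bound by auto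
qed (use assms in \<open>auto simp: L2_def\<close>)

lemma L2_cnj: "f : L2 ==> (%x. cnj (f x)) : L2" by (auto simp: L2_def)

lemma L2_inner_integrable: "f : L2 ==> g : L2 ==> integrable lborel (%x. f x * cnj (g x))" by (intro L2_mult_integrable L2_cnj)

section \<open>Square integrable functions modulo null sets as an inner product space\<close>

text \<open>Membership is part of the relation, which makes it a partial equivalence: functions
  outside \<open>L2\<close> belong to no class.\<close>

definition aeq :: "'n::finite scalar_field => 'n scalar_field => bool" where "aeq f g \<longleftrightarrow> f : L2 & g : L2 & (AE x in lborel. f x = g x)"

lemma part_equivp_aeq: "part_equivp aeq"
proof (rule part_equivpI)
 show "EX x :: 'a scalar_field. aeq x x" using L2_zero by (auto simp: aeq_def)
 show "symp (aeq :: 'a scalar_field => _)" by (rule sympI) (auto simp: aeq_def elim: eventually_mono)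
 show "transp (aeq :: 'a scalar_field => _)"
 proof (rule transpI)
  fix f g h :: "'a scalar_field" assume "aeq f g" "aeq g h"
  then show "aeq f h" unfolding aeq_def by (auto elim: eventually_elim2)
 qed
qed

quotient_type (overloaded) 'n l2 = "real ^ ('n::finite) => complex" / partial: aeq by (rule part_equivp_aeq)

lemma L2_inner_aeq:
 assumes "aeq f f'" "aeq g g'"
 shows "L2_inner f g = L2_inner f' g'"
proof -
 have "AE x in lborel. f x * cnj (g x) = f' x * cnj (g' x)" using assms by (auto simp: aeq_def elim: eventually_elim2)
 moreover have "(%x. f x * cnj (g x)) : borel_measurable lborel" "(%x. f' x * cnj (g' x)) : borel_measurable lborel"
  using assms by (auto simp: aeq_def L2_def)
 ultimately show ?thesis unfolding L2_inner_def by (intro integral_cong_AE) auto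
qed

definition bm :: "(real ^ 'n::finite => complex) => bool" where "bm m \<longleftrightarrow> m : borel_measurable borel & (EX B. ALL x. cmod (m x) <= B)"

lemma L2_bm: "bm m ==> f : L2 ==> (%x. m x * f x) : L2" unfolding bm_def using L2_bmult by blast

instantiation l2 :: (finite) real_vector
begin

lift_definition zero_l2 :: "'a l2" is "%_. 0" by (simp add: aeq_def L2_zero)

lift_definition plus_l2 :: "'a l2 => 'a l2 => 'a l2" is "%f g x. f x + g x" unfolding aeq_def by (auto intro!: L2_add elim: eventually_elim2)

lift_definition minus_l2 :: "'a l2 => 'a l2 => 'a l2" is "%f g x. f x - g x" unfolding aeq_def by (auto intro!: L2_diff elim: eventually_elim2)

lift_definition uminus_l2 :: "'a l2 => 'a l2" is "%f x. - f x" unfolding aeq_def by (auto intro!: L2_uminus)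

lift_definition scaleR_l2 :: "real => 'a l2 => 'a l2" is "%r f x. r *r f x" unfolding aeq_def by (auto intro!: L2_scaleR elim: eventually_mono)

instance
proof
 fix a b c :: "'a l2" and r s :: real
 show "a + b + c = a + (b + c)" by transfer (auto simp: aeq_def add.assoc intro!: L2_add)
 show "a + b = b + a" by transfer (auto simp: aeq_def add.commute intro!: L2_add)
 show "0 + a = a" by transfer (auto simp: aeq_def)
 show "- a + a = 0" by transfer (auto simp: aeq_def L2_zero)
 show "a - b = a + - b" by transfer (auto simp: aeq_def intro!: L2_diff)
 show "r *r (a + b) = r *r a + r *r b" by transfer (auto simp: aeq_def scaleR_add_right intro!: L2_add L2_scaleR)
 show "(r + s) *r a = r *r a + s *r a" by transfer (auto simp: aeq_def scaleR_add_left intro!: L2_add L2_scaleR)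
 show "r *r s *r a = (r * s) *r a" by transfer (auto simp: aeq_def intro!: L2_scaleR)
 show "1 *r a = a" by transfer (auto simp: aeq_def)
qed

end

lift_definition cinner :: "'n::finite l2 => 'n l2 => complex" is L2_inner by (rule L2_inner_aeq)

text \<open>Symbols that are not bounded and measurable get the zero operator, so that
  \<open>mul m\<close> is linear and bounded for every \<open>m\<close>. Constant symbols play the
  part of complex scalars, since the type carries a real vector space structure.\<close>

lift_definition mul :: "(real ^ 'n => complex) => 'n::finite l2 => 'n l2" is "%m f. if bm m then (%x. m x * f x) else (%_. 0)"
 unfolding aeq_def by (auto intro!: L2_bm L2_zero elim: eventually_mono)

abbreviation (input) "chi A == mul (ind A)"

lemma cinner_add_left: "cinner (X + Y) Z = cinner X Z + cinner Y Z"
proof transfer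
 fix X Y Z :: "'a scalar_field" assume "aeq X X" "aeq Y Y" "aeq Z Z"
 then show "L2_inner (%x. X x + Y x) Z = L2_inner X Z + L2_inner Y Z"
  unfolding L2_inner_def aeq_def using L2_inner_integrable[of X Z] L2_inner_integrable[of Y Z] by (simp add: distrib_right)
qed

lemma cinner_commute: "cinner Y X = cnj (cinner X Y)"
proof transfer
 fix X Y :: "'a scalar_field" assume "aeq X X" "aeq Y Y"
 then show "L2_inner Y X = cnj (L2_inner X Y)" unfolding L2_inner_def by (subst Bochner_Integration.integral_cnj[symmetric]) (simp add: mult.commute)
qed

lemma cinner_add_right: "cinner Z (X + Y) = cinner Z X + cinner Z Y" by (subst (1 2 3) cinner_commute) (simp add: cinner_add_left)

lemma cinner_scaleR_left: "cinner (r *r X) Y = of_real r * cinner X Y"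
 by transfer (simp add: L2_inner_def aeq_def L2_inner_integrable scaleR_conv_of_real mult.assoc)

lemma cinner_self: "cinner X X = of_real (Re (cinner X X))" "Re (cinner X X) >= 0"
proof -
 have "cinner X X = cnj (cinner X X)" by (rule cinner_commute)
 then show "cinner X X = of_real (Re (cinner X X))" by (metis Reals_cnj_iff of_real_Re)
 show "Re (cinner X X) >= 0"
 proof transfer
  fix X :: "'a scalar_field" assume "aeq X X"
  have "Re (L2_inner X X) = (LINT x|lborel. Re (X x * cnj (X x)))"
   using \<open>aeq X X\<close> unfolding L2_inner_def aeq_def by (intro integral_Re[symmetric] L2_inner_integrable) auto
  also have "... >= 0" by (intro integral_nonneg_AE) auto
  finally show "0 <= Re (L2_inner X X)" .
 qed
qed

lemma L2_inner_self: "f : L2 ==> L2_inner f f = of_real (LINT x|lborel. (cmod (f x))^2)"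
 unfolding L2_inner_def by (simp add: complex_norm_square[symmetric] del: of_real_power of_real_mult)

lemma cinner_self_eq_0: "Re (cinner X X) = 0 \<longleftrightarrow> X = 0"
proof transfer
 fix X :: "'a scalar_field" assume X: "aeq X X"
 then have "Re (L2_inner X X) = (LINT x|lborel. (cmod (X x))^2)" by (simp add: L2_inner_self aeq_def)
 moreover have "(LINT x|lborel. (cmod (X x))^2) = 0 \<longleftrightarrow> (AE x in lborel. (cmod (X x))^2 = 0)"
  using X by (intro integral_nonneg_eq_0_iff_AE) (auto simp: aeq_def L2_def)
 ultimately show "Re (L2_inner X X) = 0 \<longleftrightarrow> aeq X (%_. 0)" using X by (simp add: aeq_def L2_zero)
qed

text \<open>The real inner product is the real part of the sesquilinear form \<open>cinner\<close>.
  Both induce the same norm, while \<open>cinner\<close> retains the phases.\<close>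

instantiation l2 :: (finite) real_inner
begin

definition inner_l2 :: "'a l2 => 'a l2 => real" where "inner_l2 X Y = Re (cinner X Y)"
definition norm_l2 :: "'a l2 => real" where "norm_l2 X = sqrt (inner X X)"
definition sgn_l2 :: "'a l2 => 'a l2" where "sgn_l2 X = X /\<^sub>R norm X"
definition dist_l2 :: "'a l2 => 'a l2 => real" where "dist_l2 X Y = norm (X - Y)"
definition uniformity_l2 :: "('a l2 \<times> 'a l2) filter" where "uniformity_l2 = (INF e\<in>{0 <..}. principal {(x, y). dist x y < e})"
definition open_l2 :: "'a l2 set => bool" where "open_l2 U = (ALL x:U. eventually (%(x', y). x' = x --> y : U) uniformity)"

instance
proof
 fix x y z :: "'a l2" and r :: real
 show "inner x y = inner y x" unfolding inner_l2_def by (subst cinner_commute) simp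
 show "inner (x + y) z = inner x z + inner y z" by (simp add: inner_l2_def cinner_add_left)
 show "inner (r *r x) y = r * inner x y" by (simp add: inner_l2_def cinner_scaleR_left)
 show "0 <= inner x x" by (simp add: inner_l2_def cinner_self(2))
 show "inner x x = 0 \<longleftrightarrow> x = 0" by (simp add: inner_l2_def cinner_self_eq_0)
qed (simp_all add: norm_l2_def sgn_l2_def dist_l2_def uniformity_l2_def open_l2_def)

end

lemma norm_l2_square: "(norm X)^2 = Re (cinner X X)" by (simp add: norm_l2_def inner_l2_def cinner_self(2))

lemma cinner_eq_norm: "cinner X X = of_real ((norm X)^2)" using cinner_self(1) by (simp add: norm_l2_square)

definition cls :: "'n::finite scalar_field => 'n l2" where "cls f = abs_l2 f"
definition rp :: "'n::finite l2 => 'n scalar_field" where "rp X = rep_l2 X"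

lemma rp_L2 [simp]: "rp X : L2" using Quotient_rep_reflp[OF Quotient_l2, of X] by (simp add: rp_def aeq_def)

lemma cls_rp [simp]: "cls (rp X) = X" using Quotient_abs_rep[OF Quotient_l2] by (simp add: rp_def cls_def)

lemma cls_eq_iff: "f : L2 ==> g : L2 ==> cls f = cls g \<longleftrightarrow> (AE x in lborel. f x = g x)"
 using Quotient_rel[OF Quotient_l2, of f g] by (auto simp: cls_def aeq_def)

lemma rp_cls: "f : L2 ==> AE x in lborel. rp (cls f) x = f x" by (subst cls_eq_iff[symmetric]) auto

lemma l2_cases: obtains f where "f : L2" "X = cls f" using rp_L2 cls_rp by metis

lemma aeq_refl: "f : L2 ==> aeq f f" by (simp add: aeq_def)

lemma cls_add: "f : L2 ==> g : L2 ==> cls f + cls g = cls (%x. f x + g x)" unfolding cls_def by (simp add: plus_l2.abs_eq aeq_refl)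

lemma cls_diff: "f : L2 ==> g : L2 ==> cls f - cls g = cls (%x. f x - g x)" unfolding cls_def by (simp add: minus_l2.abs_eq aeq_refl)

lemma cls_scaleR: "f : L2 ==> r *r cls f = cls (%x. of_real r * f x)" unfolding cls_def by (simp add: scaleR_l2.abs_eq aeq_refl scaleR_conv_of_real)

lemma cls_cinner: "f : L2 ==> g : L2 ==> cinner (cls f) (cls g) = L2_inner f g" unfolding cls_def by (simp add: cinner.abs_eq aeq_refl)

lemma cls_mul: "f : L2 ==> bm m ==> mul m (cls f) = cls (%x. m x * f x)" unfolding cls_def by (simp add: mul.abs_eq aeq_refl)

lemma cls_norm: "f : L2 ==> norm (cls f) = L2_norm f" by (simp add: norm_l2_def inner_l2_def cls_cinner L2_inner_self L2_norm_def)

lemma L2_AE: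
 assumes g: "g : L2" and f: "meas f" and ae: "AE x in lborel. f x = g x"
 shows "f : L2" "cls f = cls g"
proof -
 have [measurable]: "meas f" "meas g" using L2_D(1)[OF g] f by auto
 have "integrable lborel (%x. (cmod (f x))^2) \<longleftrightarrow> integrable lborel (%x. (cmod (g x))^2)"
 proof (rule Bochner_Integration.integrable_cong_AE)
  show "AE x in lborel. (cmod (f x))^2 = (cmod (g x))^2" using ae by eventually_elim simp
 qed measurable
 then show "f : L2" using L2_D(2)[OF g] by (intro L2_I f) simp
 from cls_eq_iff[OF this g] show "cls f = cls g" using ae by simp
qed

lemma ball_borel: "{x :: real ^ 'n::finite. norm x <= r} : sets borel" by (intro borel_closed closed_Collect_le continuous_intros)

section \<open>Multiplication by bounded functions\<close>

lemma bmI: "meas m ==> (!!x. cmod (m x) <= B) ==> bm m" by (auto simp: bm_def)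

lemma bm_measurable: "bm m ==> meas m" by (simp add: bm_def)

lemma bm_bound: "bm m ==> EX B>=0. ALL x. cmod (m x) <= B" unfolding bm_def by (meson norm_ge_zero order_trans)

lemma bm_const [simp]: "bm (%_. c)" by (rule bmI[of _ "cmod c"]) auto

lemma bm_mult [intro]: assumes "bm m" "bm m'" shows "bm (%x. m x * m' x)"
proof -
 obtain B where "B >= 0" "ALL x. cmod (m x) <= B" using bm_bound[OF assms(1)] by blast
 moreover obtain B' where "B' >= 0" "ALL x. cmod (m' x) <= B'" using bm_bound[OF assms(2)] by blast
 ultimately have "!!x. cmod (m x * m' x) <= B * B'" by (simp add: norm_mult mult_mono)
 then show ?thesis using assms by (intro bmI) (auto simp: bm_def)
qed

lemma bm_add [intro]: assumes "bm m" "bm m'" shows "bm (%x. m x + m' x)"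
proof -
 obtain B where "B >= 0" "ALL x. cmod (m x) <= B" using bm_bound[OF assms(1)] by blast
 moreover obtain B' where "B' >= 0" "ALL x. cmod (m' x) <= B'" using bm_bound[OF assms(2)] by blast
 ultimately have "!!x. cmod (m x + m' x) <= B + B'" by (meson add_mono norm_triangle_le)
 then show ?thesis using assms by (intro bmI) (auto simp: bm_def)
qed

lemma bm_uminus [intro]: "bm m ==> bm (%x. - m x)" using bm_mult[of "%_. -1" m] by simp

lemma bm_diff [intro]: "bm m ==> bm m' ==> bm (%x. m x - m' x)" using bm_add[of m "%x. - m' x"] by (simp add: bm_uminus)

lemma bm_cnj [intro]: "bm m ==> bm (%x. cnj (m x))" by (auto simp: bm_def)

lemma bm_indicator [intro]: "S : sets borel ==> bm (ind S)" by (rule bmI[of _ 1]) (auto simp: indicator_def)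

lemma mul_add: "mul m (X + Y) = mul m X + mul m Y"
proof transfer
 fix m :: "real ^ 'a => complex" and X Y :: "'a scalar_field" assume "aeq X X" "aeq Y Y"
 then show "aeq (if bm m then %x. m x * (X x + Y x) else (%_. 0))
  (%x. (if bm m then %x. m x * X x else (%_. 0)) x + (if bm m then %x. m x * Y x else (%_. 0)) x)"
  by (auto simp: aeq_def distrib_left L2_bm L2_add L2_zero)
qed

lemma mul_scaleR: "mul m (r *r X) = r *r mul m X"
proof transfer
 fix m :: "real ^ 'a => complex" and X :: "'a scalar_field" and r :: real assume "aeq X X"
 then show "aeq (if bm m then %x. m x * (r *r X x) else (%_. 0)) (%x. r *r (if bm m then %x. m x * X x else (%_. 0)) x)"
  by (auto simp: aeq_def L2_bm L2_scaleR L2_zero)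
qed

lemma linear_mul: "linear (mul m)" by (rule linearI) (simp_all add: mul_add mul_scaleR)

lemmas mul_diff = linear_diff[OF linear_mul]
lemmas mul_zero [simp] = linear_0[OF linear_mul]

lemma mul_mul: "bm m ==> bm m' ==> mul m (mul m' X) = mul (%x. m x * m' x) X" by (cases X rule: l2_cases) (simp add: cls_mul L2_bm bm_mult mult.assoc)

lemma mul_commute: "bm m ==> bm m' ==> mul m (mul m' X) = mul m' (mul m X)" by (simp add: mul_mul mult.commute)

lemma mul_add_left: "bm m ==> bm m' ==> mul m X + mul m' X = mul (%x. m x + m' x) X"
 by (cases X rule: l2_cases) (simp add: cls_mul L2_bm bm_add cls_add distrib_right)

lemma mul_diff_left: "bm m ==> bm m' ==> mul m X - mul m' X = mul (%x. m x - m' x) X"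
 by (cases X rule: l2_cases) (simp add: cls_mul L2_bm bm_diff cls_diff left_diff_distrib)

lemma mul_one [simp]: "mul (%_. 1) X = X" by (cases X rule: l2_cases) (simp add: cls_mul)

lemma mul_of_real: "mul (%_. of_real r) X = r *r X" by (cases X rule: l2_cases) (simp add: cls_mul cls_scaleR)

lemma mul_0_left [simp]: "mul (%_. 0) X = 0" using mul_of_real[of 0] by simp

lemma cinner_mul_left:
 assumes "bm m" shows "cinner (mul m X) Y = cinner X (mul (%x. cnj (m x)) Y)"
proof -
 obtain f g where "f : L2" "X = cls f" "g : L2" "Y = cls g" using l2_cases by metis
 then show ?thesis using assms
  by (simp add: cls_mul cls_cinner L2_bm bm_cnj) (simp add: L2_inner_def mult_ac)
qed

lemma cinner_mul_right:
 assumes "bm m" shows "cinner X (mul m Y) = cinner (mul (%x. cnj (m x)) X) Y" using assms by (simp add: cinner_mul_left bm_cnj)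

lemma cinner_diff_left: "cinner (X - Y) Z = cinner X Z - cinner Y Z" using cinner_add_left[of "X - Y" Y Z] by simp

lemma cinner_diff_right: "cinner Z (X - Y) = cinner Z X - cinner Z Y" using cinner_add_right[of Z "X - Y" Y] by simp

lemma cinner_zero_left [simp]: "cinner 0 X = 0" using cinner_diff_left[of 0 0 X] by simp

lemma cinner_zero_right [simp]: "cinner X 0 = 0" using cinner_diff_right[of X 0 0] by simp

lemma cinner_scaleR_right: "cinner X (r *r Y) = of_real r * cinner X Y" by (subst (1 2) cinner_commute) (simp add: cinner_scaleR_left)

lemma norm_mul_mono:
 assumes "bm m" "bm m'" "!!x. cmod (m x) <= cmod (m' x)"
 shows "norm (mul m X) <= norm (mul m' X)"
proof -
 obtain f where f: "f : L2" "X = cls f" using l2_cases by metis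
 have "L2_norm (%x. m x * f x) <= L2_norm (%x. m' x * f x)"
  unfolding L2_norm_def by (intro real_sqrt_le_mono integral_mono L2_D L2_bm assms f)
   (auto simp: norm_mult assms(3) intro!: power_mono mult_right_mono)
 then show ?thesis using f assms by (simp add: cls_mul cls_norm L2_bm)
qed

lemma norm_mul_const: "norm (mul (%_. c) X) = cmod c * norm X"
proof -
 have "norm (mul (%_. c) X) = norm (mul (%_. of_real (cmod c)) X)" by (intro antisym norm_mul_mono) auto
 then show ?thesis by (simp add: mul_of_real)
qed

lemma norm_mul_le:
 assumes "meas m" "!!x. cmod (m x) <= B"
 shows "norm (mul m X) <= B * norm X"
proof -
 have "B >= 0" using assms(2)[of 0] norm_ge_zero order_trans by blast
 have "norm (mul m X) <= norm (mul (%_. of_real B) X)" using assms \<open>B >= 0\<close> by (intro norm_mul_mono bmI[of m B]) auto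
 then show ?thesis using \<open>B >= 0\<close> by (simp add: norm_mul_const)
qed

lemma bounded_linear_mul: "bounded_linear (mul m)"
proof (cases "bm m")
 case True
 then obtain B where "!!x. cmod (m x) <= B" using bm_bound by blast
 then show ?thesis using norm_mul_le[of m B] True by (intro bounded_linear_intro[of _ B]) (auto simp: mul_add mul_scaleR mult.commute bm_def)
next
 case False
 then have "mul m X = 0" for X by transfer (auto simp: aeq_def L2_zero)
 then have "mul m = (%_. 0)" by auto
 then show ?thesis by simp
qed

lemma cinner_const_left: "cinner (mul (%_. c) X) Y = c * cinner X Y"
proof -
 obtain f g where "f : L2" "X = cls f" "g : L2" "Y = cls g" using l2_cases by metis
 then show ?thesis
  by (simp add: cls_mul cls_cinner L2_cmult) (simp add: L2_inner_def mult.assoc)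
qed

lemma cinner_const_right: "cinner X (mul (%_. c) Y) = cnj c * cinner X Y" by (subst (1 2) cinner_commute) (simp add: cinner_const_left)

text \<open>Rotating \<open>X\<close> by the phase of the pairing reduces the claim to the real
  Cauchy-Schwarz inequality.\<close>

lemma cinner_norm_le: "cmod (cinner X Y) <= norm X * norm Y"
proof -
 define c where "c = cnj (sgn (cinner X Y))"
 have c: "c * cinner X Y = of_real (cmod (cinner X Y))" "cmod c <= 1" unfolding c_def
  by (auto simp: sgn_eq norm_divide mult.commute[of "cnj _"] complex_norm_square[symmetric] power2_eq_square)
 have "cmod (cinner X Y) = inner (mul (%_. c) X) Y" by (simp add: inner_l2_def cinner_const_left c)
 also have "... <= norm (mul (%_. c) X) * norm Y" by (rule norm_cauchy_schwarz)
 also have "... <= norm X * norm Y" using mult_right_mono[OF c(2), of "norm X"] by (intro mult_right_mono) (auto simp: norm_mul_const)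
 finally show ?thesis .
qed

lemma bounded_bilinear_cinner: "bounded_bilinear cinner" by unfold_locales
  (auto simp: cinner_add_left cinner_add_right cinner_scaleR_left cinner_scaleR_right scaleR_conv_of_real intro!: exI[of _ 1] cinner_norm_le)

lemma norm_le_cinnerI:
 assumes "!!Y. cmod (cinner X Y) <= B * norm Y" shows "norm X <= B"
proof (cases "X = 0")
 case False
 have "norm X * norm X <= B * norm X" using assms[of X] by (simp add: cinner_eq_norm norm_power power2_eq_square norm_mult)
 then show ?thesis using False by simp
next
 case True
 show ?thesis proof (cases "EX Y :: 'a l2. norm Y > 0")
  case True
  then obtain Y :: "'a l2" where "norm Y > 0" by blast
  then show ?thesis using assms[of Y] \<open>X = 0\<close> by (simp add: zero_le_mult_iff)
 next
  case False
  \<comment> \<open>For \<open>X = 0\<close> the claim is \<open>B >= 0\<close>, which the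
    hypothesis yields only in the presence of a nonzero \<open>Y\<close>; the unit box supplies
    one.\<close>
  let ?f = "ind (box 0 (One :: real ^ 'a)) :: _ => complex"
  have f: "?f : L2" by (rule L2_dominated[of _ "ind (box 0 One)"]) (auto simp: indicator_def intro!: integrable_real_indicator)
  have "(LINT x|lborel. (cmod (?f x))^2) = (LINT x|lborel. ind (box 0 (One :: real ^ 'a)) x)"
   by (rule Bochner_Integration.integral_cong) (auto simp: indicator_def)
  then have "L2_norm ?f = 1" by (simp add: L2_norm_def)
  then show ?thesis using False f cls_norm by (metis zero_less_one)
 qed
qed

lemma l2_eqI:
 assumes "!!Y. cinner X Y = cinner X' Y" shows "X = X'"
proof -
 have "norm (X - X') <= 0" by (rule norm_le_cinnerI) (simp add: cinner_diff_left assms)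
 then show ?thesis by simp
qed

text \<open>Dominated convergence with the majorant \<open>(2 * B)^2 * (cmod (f x))^2\<close>. The
  convergence is strong, not in operator norm, and this is all that the removal of cut-offs requires
  later.\<close>

lemma mul_tendsto:
 assumes "!!k. m k : borel_measurable borel" "!!k x. cmod (m k x) <= B"
  and "meas m'" "AE x in lborel. (%k. m k x) ----> m' x" "!!x. cmod (m' x) <= B"
 shows "(%k. mul (m k) X) ----> mul m' X"
proof -
 obtain f where f: "f : L2" "X = cls f" using l2_cases by metis
 have bm: "bm (m k)" "bm m'" for k using assms bmI by blast+
 have B: "B >= 0" using assms(2)[of 0 0] norm_ge_zero order_trans by blast
 have fm [measurable]: "meas f" using f by (simp add: L2_def)
 note [measurable] = assms(1,3)
 have "(%k. LINT x|lborel. (cmod ((m k x - m' x) * f x))^2) ----> (LINT x|(lborel :: (real ^ 'a) measure). 0)"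
 proof (rule Bochner_Integration.integral_dominated_convergence[where w = "%x. (2 * B)^2 * (cmod (f x))^2"])
  show "integrable lborel (%x. (2 * B)^2 * (cmod (f x))^2)" using f by (simp add: L2_def)
  show "AE x in lborel. (%k. (cmod ((m k x - m' x) * f x))^2) ----> 0" using assms(4)
  proof eventually_elim
   case (elim x)
   have "(%k. (cmod ((m k x - m' x) * f x))^2) ----> (cmod ((m' x - m' x) * f x))^2" by (intro tendsto_intros elim)
   then show ?case by simp
  qed
  fix k
  have "cmod (m k x - m' x) <= 2 * B" for x using assms(2)[of k x] assms(5)[of x] norm_triangle_ineq4[of "m k x" "m' x"] by linarith
  then have "(cmod ((m k x - m' x) * f x))^2 <= (2 * B * cmod (f x))^2" for x unfolding norm_mult by (intro power_mono mult_right_mono) auto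
  then show "AE x in lborel. norm ((cmod ((m k x - m' x) * f x))^2) <= (2 * B)^2 * (cmod (f x))^2" by (auto simp: power_mult_distrib)
 qed auto
 then have "(%k. sqrt (LINT x|lborel. (cmod ((m k x - m' x) * f x))^2)) ----> sqrt 0" by (intro tendsto_real_sqrt) simp
 then have "(%k. norm (mul (%x. m k x - m' x) X)) ----> 0" using f by (simp add: cls_mul bm bm_diff cls_norm L2_bm L2_norm_def)
 then have "(%k. norm (mul (m k) X - mul m' X)) ----> 0" by (simp add: mul_diff_left bm)
 then show ?thesis by (simp add: tendsto_norm_zero_iff LIM_zero_iff)
qed

section \<open>Completeness\<close>

lemma ennreal_norm_cls:
 assumes "f : L2" shows "(\<integral>\<^sup>+x. ennreal ((cmod (f x))^2) \<partial>lborel) = ennreal ((norm (cls f))^2)"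
proof -
 have "(norm (cls f))^2 = (LINT x|lborel. (cmod (f x))^2)" using assms by (simp add: cls_norm L2_norm_def)
 then show ?thesis using L2_D[OF assms] by (simp add: nn_integral_eq_integral)
qed

lemma L2_nn_integralI:
 assumes "meas f" "(\<integral>\<^sup>+x. ennreal ((cmod (f x))^2) \<partial>lborel) < \<infinity>"
 shows "f : L2" using assms by (intro L2_I integrableI_bounded) auto

lemma L2_nn_integral_le:
 assumes "meas f" "(\<integral>\<^sup>+x. ennreal ((cmod (f x))^2) \<partial>lborel) <= ennreal (B^2)" "B >= 0"
 shows "f : L2" "norm (cls f) <= B"
proof -
 show f: "f : L2" using assms by (intro L2_nn_integralI) (auto simp: le_less_trans)
 have "(norm (cls f))^2 <= B^2" using assms ennreal_norm_cls[OF f] by (simp add: ennreal_le_iff)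
 then show "norm (cls f) <= B" using assms(3) by (rule power2_le_imp_le)
qed

text \<open>Riesz--Fischer: a rapidly Cauchy subsequence converges almost everywhere, because
 \<open>|d| <= (2\<^sup>-\<^sup>k + 2\<^sup>k |d|\<^sup>2) / 2\<close>, and Fatou's lemma identifies the limit.\<close>

instance l2 :: (finite) banach
proof
 fix X :: "nat => 'a l2" assume X: "Cauchy X"
 have "EX M. ALL m>=M. ALL n>=M. norm (X m - X n) < (1/2) ^ k" for k :: nat using X by (rule CauchyD) simp
 then obtain M where M: "!!k m n. m >= M k ==> n >= M k ==> norm (X m - X n) < (1/2) ^ k" by metis
 define r where "r k = Max (M ` {..k})" for k
 have rM: "r j >= M k" if "k <= j" for j k unfolding r_def using that by (intro Max_ge) auto
 define f where "f k = rp (X (r k))" for k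
 have fL2: "f k : L2" and cf: "cls (f k) = X (r k)" for k by (auto simp: f_def)
 have fm [measurable]: "meas (f k)" for k using fL2 by (simp add: L2_def)
 have df: "(\<integral>\<^sup>+x. ennreal ((cmod (f j x - f i x))^2) \<partial>lborel) <= ennreal (((1/2) ^ k)^2)" if "k <= i" "k <= j" for i j k
 proof -
  have "norm (cls (%x. f j x - f i x)) <= (1/2) ^ k" using M[of k "r j" "r i"] that rM by (simp add: cls_diff[symmetric] fL2 cf less_imp_le)
  then show ?thesis by (subst ennreal_norm_cls) (auto intro!: L2_diff fL2 ennreal_leI power_mono simp del: power_divide)
 qed
 have "(\<integral>\<^sup>+x. (\<Sum>k. ennreal (2 ^ k * (cmod (f (Suc k) x - f k x))^2)) \<partial>lborel)
   = (\<Sum>k. \<integral>\<^sup>+x. ennreal (2 ^ k * (cmod (f (Suc k) x - f k x))^2) \<partial>lborel)" by (intro nn_integral_suminf) auto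
 also have "... <= (\<Sum>k. ennreal ((1/2) ^ k))"
 proof (intro suminf_le allI)
  fix k :: nat
  have "(\<integral>\<^sup>+x. ennreal (2 ^ k * (cmod (f (Suc k) x - f k x))^2) \<partial>lborel)
    = ennreal (2 ^ k) * (\<integral>\<^sup>+x. ennreal ((cmod (f (Suc k) x - f k x))^2) \<partial>lborel)"
   by (subst nn_integral_cmult[symmetric]) (auto simp: ennreal_mult)
  also have "... <= ennreal (2 ^ k) * ennreal (((1/2) ^ k)^2)" by (intro mult_left_mono df) auto
  also have "... = ennreal ((1/2) ^ k)" by (subst ennreal_mult[symmetric]) (auto simp: power2_eq_square power_one_over divide_simps)
  finally show "(\<integral>\<^sup>+x. ennreal (2 ^ k * (cmod (f (Suc k) x - f k x))^2) \<partial>lborel) <= ennreal ((1/2) ^ k)" .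
 qed auto
 also have "... < \<infinity>" by (subst suminf_ennreal2) (auto simp: summable_geometric)
 finally have "AE x in lborel. (\<Sum>k. ennreal (2 ^ k * (cmod (f (Suc k) x - f k x))^2)) ~= \<infinity>" by (intro nn_integral_PInf_AE) auto
 then have conv: "AE x in lborel. (%k. f k x) ----> lim (%k. f k x)"
 proof eventually_elim
  case (elim x)
  then have s: "summable (%k. 2 ^ k * (cmod (f (Suc k) x - f k x))^2)" by (intro summable_suminf_not_top) auto
  have "summable (%k. cmod (f (Suc k) x - f k x))"
  proof (rule summable_comparison_test'[where N = 0])
   show "summable (%k. ((1/2) ^ k + 2 ^ k * (cmod (f (Suc k) x - f k x))^2) / 2)" by (intro summable_divide summable_add s summable_geometric) auto
   fix k :: nat
   define d where "d = cmod (f (Suc k) x - f k x)"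
   have "0 <= ((1 - 2 ^ k * d)^2) / 2 ^ k" by simp
   also have "... = (1/2) ^ k + 2 ^ k * d^2 - 2 * d" by (simp add: field_simps power2_eq_square power_one_over)
   finally show "norm (cmod (f (Suc k) x - f k x)) <= ((1/2) ^ k + 2 ^ k * (cmod (f (Suc k) x - f k x))^2) / 2" by (simp add: d_def)
  qed
  then have "summable (%k. f (Suc k) x - f k x)" by (rule summable_norm_cancel)
  then have "convergent (%n. \<Sum>k<n. f (Suc k) x - f k x)" by (simp add: summable_iff_convergent)
  then have "convergent (%n. (f n x - f 0 x) + f 0 x)" using sum_lessThan_telescope[of "%n. f n x"] by (intro convergent_add convergent_const) simp
  then show ?case by (simp add: convergent_LIMSEQ_iff)
 qed
 define g where "g x = lim (%k. f k x)" for x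
 have gm [measurable]: "meas g" unfolding g_def by (rule borel_measurable_lim_metric) auto
 have gf: "(%x. g x - f m x) : L2 & norm (cls (%x. g x - f m x)) <= (1/2) ^ m" for m
 proof -
  have "(\<integral>\<^sup>+x. ennreal ((cmod (g x - f m x))^2) \<partial>lborel)
    = (\<integral>\<^sup>+x. liminf (%k. ennreal ((cmod (f k x - f m x))^2)) \<partial>lborel)"
  proof (rule nn_integral_cong_AE, use conv in eventually_elim)
   case (elim x)
   then have "(%k. ennreal ((cmod (f k x - f m x))^2)) ----> ennreal ((cmod (g x - f m x))^2)" unfolding g_def by (intro tendsto_intros)
   then show ?case by (rule lim_imp_Liminf[symmetric, rotated]) simp
  qed
  also have "... <= liminf (%k. \<integral>\<^sup>+x. ennreal ((cmod (f k x - f m x))^2) \<partial>lborel)" by (intro nn_integral_liminf) auto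
  also have "... <= ennreal (((1/2) ^ m)^2)" by (rule Liminf_le) (auto intro!: eventually_sequentiallyI[of m] df)
  finally show ?thesis using L2_nn_integral_le[of "%x. g x - f m x" "(1/2) ^ m"] by auto
 qed
 have gL2: "g : L2" using L2_add[OF conjunct1[OF gf[of 0]] fL2[of 0]] by simp
 have "X ----> cls g"
 proof (rule LIMSEQ_I)
  fix e :: real assume "e > 0"
  then obtain k where k: "(1/2) ^ k < e / 2" using real_arch_pow_inv[of "e/2" "1/2"] by auto
  have "norm (X n - cls g) < e" if "n >= M k" for n
  proof -
   have "norm (X n - cls g) <= norm (X n - X (r k)) + norm (cls g - X (r k))"
    by (metis norm_minus_commute norm_triangle_ineq4 diff_diff_eq2 diff_add_cancel norm_triangle_sub add.commute dist_norm dist_triangle2)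
   also have "cls g - X (r k) = cls (%x. g x - f k x)" by (simp add: cf[symmetric] cls_diff gL2 fL2)
   also have "norm (X n - X (r k)) + norm (cls (%x. g x - f k x)) < e" using M[OF that rM[of k k]] gf[of k] k by auto
   finally show ?thesis .
  qed
  then show "EX no. ALL n>=no. norm (X n - cls g) < e" by blast
 qed
 then show "convergent X" by (rule convergentI)
qed

section \<open>The Plancherel theorem\<close>

lemma borel_measurable_cis [measurable]:
 "f : borel_measurable M ==> (%x. cis (f x)) : borel_measurable M"
 by (rule measurable_compose[OF _ borel_measurable_continuous_onI]) (auto intro: continuous_intros)

lemma
 fixes f :: "'a::euclidean_space => real => complex"
 assumes "!!b. b : Basis ==> integrable lborel (f b)"
 shows integral_lborel_prod: "(LINT x|(lborel :: 'a measure). (\<Prod>b\<in>Basis. f b (x .* b))) = (\<Prod>b\<in>Basis. LINT x|lborel. f b x)"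
  and integrable_lborel_prod: "integrable (lborel :: 'a measure) (%x. \<Prod>b\<in>Basis. f b (x .* b))"
proof -
 interpret product_sigma_finite "%_ :: 'a. lborel :: real measure" by standard
 have [measurable]: "meas (f b)" if "b : Basis" for b using borel_measurable_integrable[OF assms[OF that]] by simp
 have m: "(%f. \<Sum>b\<in>Basis. f b *r b) : (\<Pi>\<^sub>M b\<in>Basis. lborel) \<rightarrow>\<^sub>M (borel :: 'a measure)" by measurable
 have eq: "(\<Prod>b\<in>Basis. f b ((\<Sum>b\<in>Basis. x b *r b) .* b)) = (\<Prod>b\<in>Basis. f b (x b))" for x
  by (intro prod.cong refl arg_cong2[where f = f]) simp
 show "(LINT x|(lborel :: 'a measure). (\<Prod>b\<in>Basis. f b (x .* b))) = (\<Prod>b\<in>Basis. LINT x|lborel. f b x)"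
  using assms by (subst lborel_eq, subst integral_distr[OF m]) (simp_all add: eq product_integral_prod)
 show "integrable (lborel :: 'a measure) (%x. \<Prod>b\<in>Basis. f b (x .* b))"
  using assms by (subst lborel_eq, subst integrable_distr_eq[OF m]) (simp_all add: eq product_integrable_prod)
qed

text \<open>After rescaling by \<open>a\<close>, this is the characteristic function of the standard
  normal distribution.\<close>

lemma gauss_fourier_1:
 assumes "a > 0"
 shows "integrable lborel (%t::real. cis (- (t * z)) * of_real (exp (- (a * t)\<^sup>2 / 2)))"
  and "(LINT t|lborel. cis (- (t * z)) * of_real (exp (- (a * t)\<^sup>2 / 2))) = of_real (sqrt (2 * pi) / a * exp (- (z / a)\<^sup>2 / 2))"
proof -
 let ?h = "%t::real. cis (- (t * (z / a))) * of_real (exp (- t\<^sup>2 / 2))"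
 have g: "integrable lborel (%t::real. exp (- t\<^sup>2 / 2))"
  using integrable_mult_right[OF integrable_normal_density[of 1 0], of "sqrt (2 * pi)"] by (simp add: std_normal_density_def)
 have h: "integrable lborel ?h" by (rule Bochner_Integration.integrable_bound[OF g]) (auto simp: norm_mult)
 have "of_real (exp (- (z / a)\<^sup>2 / 2)) = char std_normal_distribution (- (z / a))" by (simp add: char_std_normal_distribution)
 also have "... = (LINT t|lborel. std_normal_density t *r iexp (- (z / a) * t))" unfolding char_def by (subst integral_density) auto
 also have "... = (LINT t|lborel. of_real (1 / sqrt (2 * pi)) * ?h t)" by (intro Bochner_Integration.integral_cong refl)
   (simp add: std_normal_density_def scaleR_conv_of_real cis_conv_exp mult_ac)
 also have "... = of_real (1 / sqrt (2 * pi)) * (LINT t|lborel. ?h t)" by simp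
 finally have hv: "(LINT t|lborel. ?h t) = of_real (sqrt (2 * pi) * exp (- (z / a)\<^sup>2 / 2))" by (simp add: field_simps)
 have eq: "?h (a * t) = cis (- (t * z)) * of_real (exp (- (a * t)\<^sup>2 / 2))" for t using assms by simp
 show "integrable lborel (%t::real. cis (- (t * z)) * of_real (exp (- (a * t)\<^sup>2 / 2)))"
  using lborel_integrable_real_affine[OF h, of a 0] assms by (simp add: eq)
 have "(LINT t|lborel. ?h t) = a *r (LINT t|lborel. ?h (0 + a * t))" using assms by (subst lborel_integral_real_affine[of a _ 0]) auto
 then show "(LINT t|lborel. cis (- (t * z)) * of_real (exp (- (a * t)\<^sup>2 / 2)))
   = of_real (sqrt (2 * pi) / a * exp (- (z / a)\<^sup>2 / 2))" using assms unfolding hv by (simp add: eq scaleR_conv_of_real field_simps)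
qed

lemma cis_sum: "finite A ==> cis (\<Sum>b\<in>A. f b) = (\<Prod>b\<in>A. cis (f b))"
 by (induction A rule: finite_induct) (auto simp: cis_mult[symmetric])

lemma
 fixes z :: "'a::euclidean_space"
 assumes "a > 0"
 shows gauss_fourier_integrable: "integrable lborel (%x. cis (- (x .* z)) * of_real (exp (- (a * norm x)\<^sup>2 / 2)))"
  and gauss_fourier: "(LINT x|lborel. cis (- (x .* z)) * of_real (exp (- (a * norm x)\<^sup>2 / 2)))
   = of_real ((sqrt (2 * pi) / a) ^ DIM('a) * exp (- (norm z / a)\<^sup>2 / 2))"
proof -
 let ?f = "%b t. cis (- (t * (z .* b))) * of_real (exp (- (a * t)\<^sup>2 / 2)) :: complex"
 have sq: "exp (- (c * norm x)\<^sup>2 / 2) = (\<Prod>b\<in>Basis. exp (- (c * (x .* b))\<^sup>2 / 2))" for x :: 'a and c :: real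
 proof -
  have "(norm x)^2 = (\<Sum>b\<in>Basis. (x .* b)^2)" by (subst power2_norm_eq_inner, subst euclidean_inner) (simp add: power2_eq_square)
  then show ?thesis by (subst exp_sum[symmetric]) (auto simp: power_mult_distrib sum_distrib_left sum_negf sum_divide_distrib)
 qed
 have eq: "cis (- (x .* z)) * of_real (exp (- (a * norm x)\<^sup>2 / 2)) = (\<Prod>b\<in>Basis. ?f b (x .* b))" for x
  unfolding sq by (subst euclidean_inner, subst sum_negf[symmetric], subst cis_sum) (auto simp: prod.distrib)
 show "integrable lborel (%x. cis (- (x .* z)) * of_real (exp (- (a * norm x)\<^sup>2 / 2)))"
  unfolding eq by (rule integrable_lborel_prod) (rule gauss_fourier_1[OF assms])
 have "(LINT x|lborel. cis (- (x .* z)) * of_real (exp (- (a * norm x)\<^sup>2 / 2)))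
  = (\<Prod>b\<in>Basis. of_real (sqrt (2 * pi) / a * exp (- ((z .* b) / a)\<^sup>2 / 2)))" unfolding eq
  by (subst integral_lborel_prod, rule gauss_fourier_1(1)[OF assms], subst gauss_fourier_1(2)[OF assms]) simp
 also have "... = of_real ((sqrt (2 * pi) / a) ^ DIM('a) * exp (- (norm z / a)\<^sup>2 / 2))"
 proof -
  have "(\<Prod>b\<in>(Basis :: 'a set). sqrt (2 * pi) / a * exp (- ((z .* b) / a)\<^sup>2 / 2))
   = (sqrt (2 * pi) / a) ^ DIM('a) * exp (- (norm z / a)\<^sup>2 / 2)" using sq[of "1/a" z] by (subst prod.distrib) simp
  then show ?thesis by (metis of_real_prod)
 qed
 finally show "(LINT x|lborel. cis (- (x .* z)) * of_real (exp (- (a * norm x)\<^sup>2 / 2)))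
   = of_real ((sqrt (2 * pi) / a) ^ DIM('a) * exp (- (norm z / a)\<^sup>2 / 2))" .
qed

section \<open>Translations and their strong continuity\<close>

lemma lborel_shift: "distr lborel borel (%x. x + h) = (lborel :: 'a::euclidean_space measure)"
 using lborel_distr_plus[of h] by (simp add: add.commute[of _ h])

lemma integral_shift:
 fixes f :: "'a::euclidean_space => 'b::{banach, second_countable_topology}"
 assumes "meas f"
 shows "(LINT x|lborel. f (x + h)) = (LINT x|lborel. f x)"
proof -
 have "(LINT x|distr lborel borel (%x. x + h). f x) = (LINT x|lborel. f (x + h))" by (rule integral_distr) (use assms in auto)
 then show ?thesis by (simp add: lborel_shift)
qed

lemma integrable_shift:
 fixes f :: "'a::euclidean_space => 'b::{banach, second_countable_topology}"
 assumes "integrable lborel f"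
 shows "integrable lborel (%x. f (x + h))"
proof -
 have "meas f" using assms by auto
 then show ?thesis using integrable_distr_eq[of "%x. x + h" lborel borel f] assms by (simp add: lborel_shift)
qed

lemma AE_shift:
 fixes P :: "'a::euclidean_space => bool"
 assumes "AE x in lborel. P x" shows "AE x in lborel. P (x + h)"
proof -
 have "AE x in distr lborel borel (%x. x + h). P x" unfolding lborel_shift by (rule assms)
 then show ?thesis by (rule AE_distrD[rotated]) simp
qed

lemma L2_shift: "f : L2 ==> (%x. f (x + h)) : L2" using integrable_shift[of "%x. (cmod (f x))^2" h] by (auto simp: L2_def)

lift_definition translate :: "real ^ 'n::finite => 'n l2 => 'n l2" is "%h f x. f (x + h)"
proof -
 fix h :: "real ^ 'n" and f g :: "'n scalar_field"
 assume "aeq f g"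
 then show "aeq (%x. f (x + h)) (%x. g (x + h))" unfolding aeq_def using AE_shift[of "%x. f x = g x" h] by (auto intro: L2_shift)
qed

lemma cls_shift: "f : L2 ==> translate h (cls f) = cls (%x. f (x + h))" unfolding cls_def by (simp add: translate.abs_eq aeq_refl)

lemma shift_add: "translate h (X + Y) = translate h X + translate h Y" by transfer (auto simp: aeq_def L2_shift L2_add)

lemma shift_const: "translate h (mul (%_. c) X) = mul (%_. c) (translate h X)"
proof -
 obtain f where "f : L2" "X = cls f" using l2_cases by metis
 then show ?thesis by (simp add: cls_mul cls_shift L2_shift L2_cmult)
qed

lemma norm_shift: "norm (translate h X) = norm X"
proof -
 obtain f where f: "f : L2" "X = cls f" using l2_cases by metis
 then have "meas f" by (simp add: L2_def)
 then have "L2_norm (%x. f (x + h)) = L2_norm f" unfolding L2_norm_def by (subst integral_shift[of "%x. (cmod (f x))^2"]) auto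
 then show ?thesis using f by (simp add: cls_shift cls_norm L2_shift)
qed

lemma shift_diff: "translate h (X - Y) = translate h X - translate h Y" using shift_add[of h "X - Y" Y] by simp

text \<open>Open boxes are stable under intersection and generate the Borel sets, so a Dynkin class
  argument carries \<open>P\<close> from boxes to all Borel subsets of a large box; linear
  combinations and a dominated limit do the rest. Its use is the continuity of translations, which
  is elementary only for boxes.\<close>

lemma l2_box_induct:
 fixes P :: "'n::finite l2 => bool"
 assumes box: "!!a b :: real ^ 'n. P (cls (ind (box a b)))"
  and add: "!!X Y. P X ==> P Y ==> P (X + Y)"
  and const: "!!c X. P X ==> P (mul (%_. c) X)"
  and lim: "!!Xs X. (!!k :: nat. P (Xs k)) ==> Xs ----> X ==> P X"
 shows "P X"
proof -
 \<comment> \<open>Indicators are cut down to the bounded boxes \<open>C k\<close>, so that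
   complements remain square integrable.\<close>
 define C where "C k = box (- (real k *r One)) (real k *r One :: real ^ 'n)" for k :: nat
 have C: "(ind (C k) :: _ => complex) : L2" for k unfolding C_def by (rule L2_dominated[of _ "ind (C k)"])
   (auto simp: indicator_def C_def intro!: integrable_real_indicator)
 have Cb [measurable]: "C k : sets borel" for k by (simp add: C_def)
 have diff: "P (X - Y)" if "P X" "P Y" for X Y using add[OF that(1) const[OF that(2), of "-1"]] mul_of_real[of "-1" Y] by simp
 have zero: "P 0" using const[OF box[of 0 0], of 0] by simp
 have sum: "P (\<Sum>i\<in>I. Y i)" if "finite I" "!!i. i : I ==> P (Y i)" for I :: "complex set" and Y
  using that by (induction I rule: finite_induct) (auto intro: zero add)
 have sum': "P (\<Sum>i<j. Y i)" if "!!i. P (Y i)" for j :: nat and Y by (induction j) (auto intro: zero add that)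
 have chi_P: "P (chi A (cls (ind (C k))))" if "A : sets borel" for A k
 proof -
  have "Int_stable (range (%(a, b). box a b :: (real ^ 'n) set))" by (auto simp: Int_stable_def box_Int_box)
  moreover have "range (%(a, b). box a b :: (real ^ 'n) set) \<subseteq> Pow UNIV" by simp
  moreover have "A : sigma_sets UNIV (range (%(a, b). box a b))" using that by (simp add: borel_eq_box)
  ultimately show ?thesis proof (induction rule: sigma_sets_induct_disjoint)
   case (basic A)
   then obtain a b where "A = box a b" by auto
   moreover have "box a b \<inter> C k = box (\<Sum>i\<in>Basis. max (a .* i) (- (real k *r One) .* i) *r i)
     (\<Sum>i\<in>Basis. min (b .* i) ((real k *r One) .* i) *r i)" unfolding C_def by (rule box_Int_box)
   ultimately show ?case using box C by (simp add: cls_mul bm_indicator indicator_inter_arith[symmetric])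
  next
   case empty
   then show ?case using zero by (simp add: indicator_def[abs_def])
  next
   case (compl A)
   have A: "A : sets borel" using compl(1) by (simp add: borel_eq_box)
   have "mul (ind (UNIV - A)) (cls (ind (C k))) =
    mul (ind (box (- (real k *r One)) (real k *r One))) (cls (ind (C k))) - chi A (cls (ind (C k)))"
    using A C by (simp add: cls_mul bm_indicator cls_diff L2_bm cls_eq_iff L2_diff) (auto intro!: AE_I2 simp: indicator_def C_def)
   moreover have "mul (ind (C k)) (cls (ind (C k))) = cls (ind (C k))"
    using C by (simp add: cls_mul bm_indicator indicator_inter_arith[symmetric])
   ultimately show ?case using diff[OF box compl(2)] by (simp add: C_def)
  next
   case (union A)
   have A [measurable]: "A i : sets borel" for i using union(2) by (auto simp: borel_eq_box)
   have "(%j. mul (ind (\<Union>i<j. A i)) (cls (ind (C k)))) ----> mul (ind (\<Union>i. A i)) (cls (ind (C k)))"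
   proof (rule mul_tendsto[where B = 1])
    show "AE x in lborel. (%j. ind (\<Union>i<j. A i) x :: complex) ----> ind (\<Union>i. A i) x" by (intro AE_I2 LIMSEQ_indicator_UN)
   qed (auto simp: indicator_def)
   moreover have "P (mul (ind (\<Union>i<j. A i)) (cls (ind (C k))))" for j
   proof (induction j)
    case (Suc j)
    have "(ind (\<Union>i<Suc j. A i) :: _ => complex) = (%x. ind (\<Union>i<j. A i) x + ind (A j) x)"
    proof
     fix x
     have "\<not> (EX i<j. x : A i)" if "x : A j" using that disjoint_family_onD[OF union(1), of _ j] by fastforce
     then show "(ind (\<Union>i<Suc j. A i) x :: complex) = ind (\<Union>i<j. A i) x + ind (A j) x"
      by (auto simp: indicator_def less_Suc_eq)
    qed
    then show ?case using add[OF Suc union(3)[of j]] by (simp add: mul_add_left bm_indicator)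
   qed (use zero in \<open>simp add: indicator_def[abs_def]\<close>)
   ultimately show ?case by (rule lim[rotated])
  qed
 qed
 obtain f where f: "f : L2" "X = cls f" using l2_cases by metis
 then have [measurable]: "meas f" by (simp add: L2_def)
 obtain s where s: "!!i. simple_function borel (s i)" "!!x. (%i. s i x) ----> f x" "!!i x. cmod (s i x) <= 2 * cmod (f x)"
  using borel_measurable_implies_sequence_metric[of f borel 0] by (auto simp: dist_norm)
 note [measurable] = borel_measurable_simple_function[OF s(1)]
 have sf: "P (cls (%x. s i x * ind (C k) x))" for i k
 proof -
  have fin: "finite (range (s i))" using s(1)[of i] by (simp add: simple_function_def)
  have A: "s i -` {y} : sets borel" for y using s(1)[of i] by (metis simple_functionD(2) space_borel Int_UNIV_right)
  have "(\<Sum>y\<in>I. mul (%_. y) (mul (ind (s i -` {y})) (cls (ind (C k)))))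
    = mul (%x. \<Sum>y\<in>I. y * ind (s i -` {y}) x) (cls (ind (C k))) & bm (%x. \<Sum>y\<in>I. y * ind (s i -` {y}) x)"
   if "finite I" for I using that
  proof (induction I rule: finite_induct)
   case (insert y I)
   have b: "bm (%x. y * ind (s i -` {y}) x)" using A by (intro bm_mult bm_indicator) auto
   have e: "mul (%_. y) (mul (ind (s i -` {y})) (cls (ind (C k))))
     = mul (%x. y * ind (s i -` {y}) x) (cls (ind (C k)))" using A by (intro mul_mul bm_indicator) auto
   show ?case unfolding sum.insert[OF insert(1,2)] e conjunct1[OF insert(3)] by (intro conjI mul_add_left bm_add b conjunct2[OF insert(3)])
  qed auto
  then have *: "(\<Sum>y\<in>range (s i). mul (%_. y) (mul (ind (s i -` {y})) (cls (ind (C k)))))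
    = cls (%x. (\<Sum>y\<in>range (s i). y * ind (s i -` {y}) x) * ind (C k) x)" using fin C by (simp add: cls_mul)
  have "(\<Sum>y\<in>range (s i). y * ind (s i -` {y}) x) = s i x" for x
   using fin by (subst sum.remove[of _ "s i x"]) (auto intro!: sum.neutral simp: indicator_def)
  then have "P (cls (%x. (\<Sum>y\<in>range (s i). y * ind (s i -` {y}) x) * ind (C k) x)) ==> ?thesis" by (simp only:)
  moreover have "P (\<Sum>y\<in>range (s i). mul (%_. y) (mul (ind (s i -` {y})) (cls (ind (C k)))))" by (intro sum fin const chi_P A)
  ultimately show ?thesis unfolding * by blast
 qed
 \<comment> \<open>The truncated simple approximations are written as multiples of \<open>f\<close>
   itself. The quotients \<open>s k x / f x\<close> are bounded by 2, which is the uniform bound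
   that \<open>mul_tendsto\<close> asks for.\<close>
 have "(%k. mul (%x. (if f x = 0 then 0 else s k x / f x) * ind (C k) x) (cls f)) ----> mul (%x. if f x = 0 then 0 else 1) (cls f)"
 proof (rule mul_tendsto[where B = 2])
  show "cmod ((if f x = 0 then 0 else s k x / f x) * ind (C k) x) <= 2" for k x
   using s(3)[of k x] by (auto simp: norm_divide divide_simps indicator_def)
  show "AE x in lborel. (%k. (if f x = 0 then 0 else s k x / f x) * ind (C k) x) ----> (if f x = 0 then 0 else 1)"
  proof (intro AE_I2)
   fix x :: "real ^ 'n"
   obtain K :: nat where K: "norm x < real K" using reals_Archimedean2 by blast
   have "x : C k" if "k >= K" for k
   proof -
    have "abs (x .* b) < real k" if "b : Basis" for b using Basis_le_norm[OF that, of x] K \<open>k >= K\<close> by simp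
    then show ?thesis unfolding C_def mem_box by (force simp: abs_less_iff)
   qed
   then have "(%k. ind (C k) x :: complex) ----> 1" by (intro tendsto_eventually eventually_sequentiallyI[of K]) auto
   from tendsto_mult[OF tendsto_divide[OF s(2)[of x] tendsto_const[of "f x"]] this]
   show "(%k. (if f x = 0 then 0 else s k x / f x) * ind (C k) x) ----> (if f x = 0 then 0 else 1)" by (cases "f x = 0") auto
  qed
 qed auto
 moreover have "mul (%x. (if f x = 0 then 0 else s k x / f x) * ind (C k) x) (cls f) = cls (%x. s k x * ind (C k) x)" for k
 proof -
  have *: "bm (%x. (if f x = 0 then 0 else s k x / f x) * ind (C k) x)"
   using s(3)[of k] by (intro bmI[of _ 2]) (auto simp: norm_divide divide_simps indicator_def)
  have eq: "(if f x = 0 then 0 else s k x / f x) * ind (C k) x * f x = s k x * ind (C k) x" for x using s(3)[of k x] by auto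
  show ?thesis unfolding cls_mul[OF f(1) *] eq ..
 qed
 moreover have "mul (%x. if f x = 0 then 0 else 1) (cls f) = cls f"
 proof -
  have *: "bm (%x. if f x = 0 then 0 else 1)" by (intro bmI[of _ 1]) auto
  have eq: "(if f x = 0 then 0 else 1) * f x = f x" for x by auto
  show ?thesis unfolding cls_mul[OF f(1) *] eq ..
 qed
 ultimately show ?thesis using lim[OF sf] f by simp
qed

lemma cbox_box_null: "cbox a b - box a b : null_sets (lborel :: 'a::euclidean_space measure)" using negligible_frontier_interval[of a b]
 by (subst null_sets_completion_iff[symmetric]) (auto simp: negligible_iff_null_sets)

text \<open>The indicator of a box is locally constant off the boundary, a null set, so dominated
  convergence settles boxes. The passage to limits uses that translations are isometries.\<close>

lemma shift_tendsto:
 fixes h :: "nat => real ^ 'n::finite"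
 assumes "h ----> 0" shows "(%k. translate (h k) X) ----> X"
proof (induction X rule: l2_box_induct)
 case (1 a b)
 let ?B = "box a b"
 have B: "(ind ?B :: _ => complex) : L2" by (rule L2_dominated[of _ "ind ?B"])
   (auto simp: indicator_def intro!: integrable_real_indicator emeasure_bounded_finite bounded_box)
 obtain M where M: "!!k. norm (h k) <= M" using convergent_imp_Bseq[OF convergentI[OF assms]] by (auto simp: Bseq_def)
 obtain r where r: "!!x. x : ?B ==> norm x <= r" using bounded_box[of a b] unfolding bounded_iff by blast
 have "(%k. LINT x|lborel. (cmod (ind ?B (x + h k) - ind ?B x))^2) ----> (LINT x|(lborel :: (real ^ 'n) measure). 0)"
 proof (rule Bochner_Integration.integral_dominated_convergence[where w = "ind (cball 0 (r + M))"])
  show "integrable lborel (ind (cball (0 :: real ^ 'n) (r + M)) :: _ => real)"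
   using emeasure_compact_finite[OF compact_cball, of "0 :: real ^ 'n" "r + M"] by (intro integrable_real_indicator) auto
  fix k
  have "x : cball 0 (r + M)" if "x : ?B \<or> x + h k : ?B" for x
  proof -
   have "norm x <= norm (x + h k) + norm (h k)" by (metis add_diff_cancel norm_triangle_ineq4)
   then show ?thesis using that r[of x] r[of "x + h k"] M[of k] order_trans[OF norm_ge_zero M[of k]] by auto
  qed
  then show "AE x in lborel. norm ((cmod (ind ?B (x + h k) - ind ?B x))^2) <= ind (cball 0 (r + M)) x"
   by (intro AE_I2) (auto simp: indicator_def)
 next
  have "AE x in lborel. x \<notin> cbox a b - ?B" by (rule AE_not_in[OF cbox_box_null])
  then show "AE x in lborel. (%k. (cmod (ind ?B (x + h k) - ind ?B x))^2) ----> 0"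
  proof eventually_elim
   case (elim x)
   have lim: "(%k. x + h k) ----> x" using tendsto_add[OF tendsto_const assms, of x] by simp
   have "\<forall>\<^sub>F k in sequentially. ind ?B (x + h k) = (ind ?B x :: complex)"
   proof (cases "x : ?B")
    case True
    then show ?thesis using topological_tendstoD[OF lim open_box True] by (auto elim: eventually_mono)
   next
    case False
    then have "x : - cbox a b" using elim by auto
    then have "\<forall>\<^sub>F k in sequentially. x + h k : - cbox a b" using topological_tendstoD[OF lim] by (metis closed_cbox open_Compl)
    then show ?thesis using False box_subset_cbox[of a b] by (auto elim!: eventually_mono simp: indicator_def)
   qed
   then have "\<forall>\<^sub>F k in sequentially. (cmod (ind ?B (x + h k) - ind ?B x))^2 = 0" by eventually_elim simp
   then show ?case by (rule tendsto_eventually)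
  qed
 qed auto
 then have "(%k. sqrt (LINT x|lborel. (cmod (ind ?B (x + h k) - ind ?B x))^2)) ----> sqrt 0" by (intro tendsto_real_sqrt) simp
 then have "(%k. norm (translate (h k) (cls (ind ?B)) - cls (ind ?B))) ----> 0"
  using B by (simp add: cls_shift cls_diff cls_norm L2_shift L2_diff L2_norm_def)
 then show ?case by (simp add: tendsto_norm_zero_iff LIM_zero_iff)
next
 case (2 X Y)
 then show ?case by (auto simp: shift_add intro: tendsto_add)
next
 case (3 c X)
 then show ?case by (auto simp: shift_const intro: bounded_linear.tendsto[OF bounded_linear_mul])
next
 case (4 Xs X)
 show ?case
 proof (rule LIMSEQ_I)
  fix e :: real assume e: "e > 0"
  then obtain j where j: "norm (Xs j - X) < e / 3" using LIMSEQ_D[OF 4(2), of "e / 3"] by force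
  obtain K where K: "!!k. k >= K ==> norm (translate (h k) (Xs j) - Xs j) < e / 3" using LIMSEQ_D[OF 4(1)[of j], of "e / 3"] e by force
  have "norm (translate (h k) X - X) < e" if "k >= K" for k
  proof -
   have eq: "translate (h k) X - X = (translate (h k) (Xs j) - Xs j) + (Xs j - X) - translate (h k) (Xs j - X)" by (simp add: shift_diff)
   have "norm (translate (h k) X - X) <= norm ((translate (h k) (Xs j) - Xs j) + (Xs j - X)) + norm (translate (h k) (Xs j - X))"
    unfolding eq by (rule norm_triangle_ineq4)
   also have "... <= norm (translate (h k) (Xs j) - Xs j) + norm (Xs j - X) + norm (Xs j - X)"
    using norm_triangle_ineq[of "translate (h k) (Xs j) - Xs j" "Xs j - X"] by (simp add: norm_shift)
   also have "... < e" using K[OF that] j by simp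
   finally show ?thesis .
  qed
  then show "EX K. ALL k>=K. norm (translate (h k) X - X) < e" by blast
 qed
qed

lemma integral_scale:
 fixes f :: "'a::euclidean_space => 'b::{banach, second_countable_topology}"
 assumes [measurable]: "meas f" and "c > 0"
 shows "(LINT x|lborel. f x) = c ^ DIM('a) *r (LINT x|lborel. f (c *r x))" using assms(2)
 by (subst lborel_affine[of c 0]) (simp_all add: integral_density integral_distr)

section \<open>The Plancherel identity for integrable functions\<close>

definition ft_const :: "'n::finite itself => real" where "ft_const _ = (2 * pi) powr (- real CARD('n) / 2)"

lemma ft_const_sq: "(ft_const TYPE('n::finite))^2 * (2 * pi) ^ CARD('n) = 1"
proof -
 have "(a powr (- real m / 2))^2 * a ^ m = 1" if "a > 0" for a :: real and m :: nat
  using that by (simp add: power2_eq_square powr_add[symmetric] powr_realpow[symmetric])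
 from this[of "2 * pi" "CARD('n)"] show ?thesis unfolding ft_const_def by simp
qed

lemma fourier_L1_def': "FT f xi = of_real (ft_const TYPE('n)) * (LINT x|lborel. cis (- (x .* xi)) * f x)"
 for f :: "'n::finite scalar_field" by (simp add: fourier_L1_def ft_const_def)

text \<open>The squared modulus of the transform \<open>J\<close> is the transform of the
  autocorrelation \<open>A\<close>. Integrated against the Gaussians \<open>g k\<close>, it becomes
  an average of \<open>A\<close> against Gaussians that concentrate at the origin, and
  \<open>A\<close> is continuous there, with value the squared norm of \<open>f\<close>, by
  \<open>shift_tendsto\<close>.\<close>

lemma plancherel_L1:
 fixes f :: "'n::finite scalar_field"
 assumes f: "f : L2" and int: "integrable lborel f"
 shows "FT f : L2" "norm (cls (FT f)) = norm (cls f)"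
proof -
 define J where "J xi = (LINT x|lborel. cis (- (x .* xi)) * f x)" for xi
 define A where "A w = (LINT y|lborel. f (y + w) * cnj (f y))" for w
 define g where "g k xi = exp (- (inverse (real (Suc k)) * norm xi)\<^sup>2 / 2)" for k and xi :: "real ^ 'n"
 define L where "L = (LINT x|lborel. cmod (f x))"
 have fm [measurable]: "meas f" using f by (simp add: L2_def)
 have Jm [measurable]: "meas J" unfolding J_def[abs_def] by measurable
 have gm [measurable]: "meas (g k)" for k unfolding g_def[abs_def] by measurable
 have int_c: "integrable lborel (%x. cis (- (x .* xi)) * f x)" for xi by (rule Bochner_Integration.integrable_bound[OF int]) (auto simp: norm_mult)
 have Jb: "cmod (J xi) <= L" for xi unfolding J_def L_def by (rule order_trans[OF integral_norm_bound]) (simp add: norm_mult)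
 have H: "integrable (lborel \<Otimes>\<^sub>M lborel) (%(y, w). cis (- (w .* xi)) * f (y + w) * cnj (f y))" for xi
 proof (rule lborel_pair.Fubini_integrable)
  have "(LINT w|lborel. cmod (f (y + w))) = L" for y unfolding L_def using integral_shift[of "%w. cmod (f w)" y] by (simp add: add.commute)
  then show "integrable lborel (%y. LINT w|lborel. norm (case (y, w) of (y, w) => cis (- (w .* xi)) * f (y + w) * cnj (f y)))"
   using int by (simp add: norm_mult)
  have "integrable lborel (%w. cis (- (w .* xi)) * f (y + w) * cnj (f y))" for y
   by (rule Bochner_Integration.integrable_bound[of _ "%w. f (w + y) * cnj (f y)"]) (auto simp: norm_mult add.commute intro!: integrable_shift int)
  then show "AE y in lborel. integrable lborel (%w. case (y, w) of (y, w) => cis (- (w .* xi)) * f (y + w) * cnj (f y))" by simp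
 qed measurable
 have Aint: "integrable lborel A" using lborel_pair.integrable_snd[OF H[of 0]] by (simp add: A_def[abs_def])
 then have Am [measurable]: "meas A" by auto
 have JJ: "J xi * cnj (J xi) = (LINT w|lborel. cis (- (w .* xi)) * A w)" for xi
 proof -
  have "J xi * cnj (J xi) = (LINT y|lborel. J xi * cnj (cis (- (y .* xi)) * f y))"
  proof -
   have "cnj (J xi) = (LINT y|lborel. cnj (cis (- (y .* xi)) * f y))" unfolding J_def by (rule Bochner_Integration.integral_cnj[symmetric])
   then show ?thesis by simp
  qed
  also have "... = (LINT y|lborel. LINT w|lborel. cis (- (w .* xi)) * f (y + w) * cnj (f y))"
  proof (intro Bochner_Integration.integral_cong refl)
   fix y
   have "J xi = (LINT w|lborel. cis (- ((w + y) .* xi)) * f (w + y))" unfolding J_def by (rule integral_shift[symmetric]) measurable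
   then have "J xi * cnj (cis (- (y .* xi)) * f y) = (LINT w|lborel. cis (- ((w + y) .* xi)) * f (w + y) * cnj (cis (- (y .* xi)) * f y))" by simp
   also have "... = (LINT w|lborel. cis (- (w .* xi)) * f (y + w) * cnj (f y))"
   proof (intro Bochner_Integration.integral_cong refl)
    fix w
    have "cis (- (w .* xi)) = cis (- ((w + y) .* xi)) * cnj (cis (- (y .* xi)))" by (simp add: cis_cnj cis_mult inner_add_left)
    then show "cis (- ((w + y) .* xi)) * f (w + y) * cnj (cis (- (y .* xi)) * f y)
      = cis (- (w .* xi)) * f (y + w) * cnj (f y)" by (simp add: add.commute mult_ac)
   qed
   finally show "J xi * cnj (cis (- (y .* xi)) * f y) = (LINT w|lborel. cis (- (w .* xi)) * f (y + w) * cnj (f y))" .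
  qed
  also have "... = (LINT w|lborel. LINT y|lborel. cis (- (w .* xi)) * f (y + w) * cnj (f y))" using lborel_pair.Fubini_integral[OF H] by simp
  also have "... = (LINT w|lborel. cis (- (w .* xi)) * A w)" by (simp add: A_def mult.assoc)
  finally show ?thesis .
 qed
 have gi: "integrable lborel (g k)" for k using integrable_Re[OF gauss_fourier_integrable[of "inverse (real (Suc k))" "0 :: real ^ 'n"]]
  by (simp add: g_def[abs_def])
 have g0: "0 <= g k xi" for k xi by (simp add: g_def)
 have I: "of_real (LINT xi|lborel. g k xi * (cmod (J xi))^2)
   = of_real (sqrt (2 * pi) ^ CARD('n)) * (LINT z|lborel. A (inverse (real (Suc k)) *r z) * of_real (exp (- (norm z)\<^sup>2 / 2)))" for k
 proof -
  define e where "e = inverse (real (Suc k))"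
  have e: "e > 0" by (simp add: e_def)
  have K: "integrable (lborel \<Otimes>\<^sub>M lborel) (%(xi, w). cis (- (xi .* w)) * of_real (g k xi) * A w)"
  proof (rule lborel_pair.Fubini_integrable)
   show "integrable lborel (%xi. LINT w|lborel. norm (case (xi, w) of (xi, w) => cis (- (xi .* w)) * of_real (g k xi) * A w))"
    using gi[of k] by (simp add: norm_mult abs_of_nonneg[OF g0])
   have "integrable lborel (%w. cis (- (xi .* w)) * of_real (g k xi) * A w)" for xi
    by (rule Bochner_Integration.integrable_bound[of _ "%w. of_real (g k xi) * A w"]) (auto simp: norm_mult intro!: Aint)
   then show "AE xi in lborel. integrable lborel (%w. case (xi, w) of (xi, w) => cis (- (xi .* w)) * of_real (g k xi) * A w)" by simp
  qed measurable
  have "of_real (LINT xi|lborel. g k xi * (cmod (J xi))^2) = (LINT xi|lborel. of_real (g k xi) * (J xi * cnj (J xi)))"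
   by (subst integral_complex_of_real[symmetric]) (simp only: of_real_mult complex_norm_square)
  also have "... = (LINT xi|lborel. LINT w|lborel. cis (- (xi .* w)) * of_real (g k xi) * A w)"
   unfolding JJ by (subst integral_mult_right_zero[symmetric]) (simp add: inner_commute mult_ac)
  also have "... = (LINT w|lborel. LINT xi|lborel. cis (- (xi .* w)) * of_real (g k xi) * A w)" using lborel_pair.Fubini_integral[OF K] by simp
  also have "... = (LINT w|lborel. of_real ((sqrt (2 * pi) / e) ^ CARD('n) * exp (- (norm w / e)\<^sup>2 / 2)) * A w)"
  proof (intro Bochner_Integration.integral_cong refl)
   fix w :: "real ^ 'n"
   have "(LINT xi|lborel. cis (- (xi .* w)) * of_real (g k xi)) = of_real ((sqrt (2 * pi) / e) ^ CARD('n) * exp (- (norm w / e)\<^sup>2 / 2))"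
    using gauss_fourier[OF e, of w] unfolding g_def e_def[symmetric] by simp
   then show "(LINT xi|lborel. cis (- (xi .* w)) * of_real (g k xi) * A w)
     = of_real ((sqrt (2 * pi) / e) ^ CARD('n) * exp (- (norm w / e)\<^sup>2 / 2)) * A w" by simp
  qed
  also have "... = e ^ CARD('n) *r (LINT z|lborel. of_real ((sqrt (2 * pi) / e) ^ CARD('n) * exp (- (norm (e *r z) / e)\<^sup>2 / 2)) * A (e *r z))"
   using e by (subst integral_scale[of _ e]) auto
  also have "... = of_real (sqrt (2 * pi) ^ CARD('n)) * (LINT z|lborel. A (e *r z) * of_real (exp (- (norm z)\<^sup>2 / 2)))"
  proof -
   have "norm (e *r z) / e = norm z" for z :: "real ^ 'n" using e by simp
   then show ?thesis using e by (simp add: scaleR_conv_of_real[where 'a = complex] power_divide mult.assoc mult.commute[of "A _"])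
  qed
  finally show ?thesis unfolding e_def .
 qed
 define X where "X = cls f"
 have AX: "A w = cinner (translate w X) X" for w using f by (simp add: A_def X_def cls_shift cls_cinner L2_shift L2_inner_def)
 have "(%k. LINT z|lborel. A (inverse (real (Suc k)) *r z) * of_real (exp (- (norm z)\<^sup>2 / 2)))
   ----> (LINT z|(lborel :: (real ^ 'n) measure). cor ((norm X)^2) * of_real (exp (- (norm z)\<^sup>2 / 2)))"
 proof (rule Bochner_Integration.integral_dominated_convergence[where w = "%z. (norm X)^2 * exp (- (norm z)\<^sup>2 / 2)"])
  show "integrable lborel (%z. (norm X)^2 * exp (- (norm (z :: real ^ 'n))\<^sup>2 / 2))"
   using integrable_Re[OF gauss_fourier_integrable[of 1 "0 :: real ^ 'n"]] by simp
  show "AE z in lborel. (%k. A (inverse (real (Suc k)) *r z) * of_real (exp (- (norm z)\<^sup>2 / 2)))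
    ----> of_real ((norm X)^2) * of_real (exp (- (norm z)\<^sup>2 / 2))"
  proof (intro AE_I2 tendsto_mult tendsto_const)
   fix z :: "real ^ 'n"
   have "(%k. inverse (real (Suc k)) *r z) ----> 0 *r z" by (intro tendsto_intros LIMSEQ_inverse_real_of_nat)
   then have "(%k. translate (inverse (real (Suc k)) *r z) X) ----> X" by (intro shift_tendsto) simp
   then have "(%k. A (inverse (real (Suc k)) *r z)) ----> cinner X X"
    unfolding AX by (intro bounded_bilinear.tendsto[OF bounded_bilinear_cinner] tendsto_const)
   then show "(%k. A (inverse (real (Suc k)) *r z)) ----> of_real ((norm X)^2)" by (simp add: cinner_eq_norm)
  qed
  have "cmod (A w) <= (norm X)^2" for w using cinner_norm_le[of "translate w X" X] by (simp add: AX norm_shift power2_eq_square)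
  then show "AE z in lborel. norm (A (inverse (real (Suc k)) *r z) * of_real (exp (- (norm z)\<^sup>2 / 2)))
    <= (norm X)^2 * exp (- (norm z)\<^sup>2 / 2)" for k by (auto simp: norm_mult intro!: mult_right_mono)
 qed measurable
 also have "(LINT z|(lborel :: (real ^ 'n) measure). cor ((norm X)^2) * of_real (exp (- (norm z)\<^sup>2 / 2)))
   = of_real ((norm X)^2 * sqrt (2 * pi) ^ CARD('n))" using gauss_fourier[of 1 "0 :: real ^ 'n"] by simp
 finally have "(%k. cor (LINT xi|lborel. g k xi * (cmod (J xi))^2)) ---->
   of_real (sqrt (2 * pi) ^ CARD('n)) * of_real ((norm X)^2 * sqrt (2 * pi) ^ CARD('n))" unfolding I by (intro tendsto_mult tendsto_const)
 also have "of_real (sqrt (2 * pi) ^ CARD('n)) * of_real ((norm X)^2 * sqrt (2 * pi) ^ CARD('n)) = cor ((2 * pi) ^ CARD('n) * (norm X)^2)"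
 proof -
  have "sqrt (2 * pi) ^ m * (a * sqrt (2 * pi) ^ m) = (2 * pi) ^ m * a" for m a
  proof -
   have "(2 * pi) ^ m = sqrt (2 * pi) ^ m * sqrt (2 * pi) ^ m" by (subst power_mult_distrib[symmetric]) simp
   then show ?thesis by simp
  qed
  then show ?thesis by (metis of_real_mult)
 qed
 finally have lim: "(%k. LINT xi|lborel. g k xi * (cmod (J xi))^2) ----> (2 * pi) ^ CARD('n) * (norm X)^2"
  by (simp add: tendsto_of_real_iff del: of_real_mult of_real_power)
 have gJ: "integrable lborel (%xi. g k xi * (cmod (J xi))^2)" for k
 proof (rule Bochner_Integration.integrable_bound[of _ "%xi. g k xi * L^2"])
  show "AE xi in lborel. norm (g k xi * (cmod (J xi))^2) <= norm (g k xi * L^2)"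
   by (auto simp: abs_mult abs_of_nonneg[OF g0] intro!: mult_left_mono power_mono Jb g0)
 qed (use gi[of k] in auto)
 have g1: "(%k. g k xi) ----> 1" for xi
 proof -
  have "(%k. g k xi) ----> exp (- (0 * norm xi)\<^sup>2 / 2)" unfolding g_def by (intro tendsto_intros LIMSEQ_inverse_real_of_nat) auto
  then show ?thesis by simp
 qed
 have "(\<integral>\<^sup>+xi. ennreal ((cmod (J xi))^2) \<partial>lborel) = (\<integral>\<^sup>+xi. liminf (%k. ennreal (g k xi * (cmod (J xi))^2)) \<partial>lborel)"
 proof (intro nn_integral_cong)
  fix xi
  have "(%k. ennreal (g k xi * (cmod (J xi))^2)) ----> ennreal (1 * (cmod (J xi))^2)" by (intro tendsto_intros g1)
  then show "ennreal ((cmod (J xi))^2) = liminf (%k. ennreal (g k xi * (cmod (J xi))^2))"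
   using lim_imp_Liminf[of sequentially "%k. ennreal (g k xi * (cmod (J xi))^2)"] by simp
 qed
 also have "... <= liminf (%k. \<integral>\<^sup>+xi. ennreal (g k xi * (cmod (J xi))^2) \<partial>lborel)" by (intro nn_integral_liminf) auto
 also have "... = liminf (%k. ennreal (LINT xi|lborel. g k xi * (cmod (J xi))^2))" by (subst nn_integral_eq_integral[OF gJ]) (auto simp: g_def)
 also have "... = ennreal ((2 * pi) ^ CARD('n) * (norm X)^2)" using tendsto_ennrealI[OF lim] by (intro lim_imp_Liminf) auto
 finally have fin: "(\<integral>\<^sup>+xi. ennreal ((cmod (J xi))^2) \<partial>lborel) < \<infinity>" by (simp add: le_less_trans)
 then have JL2: "J : L2" by (intro L2_nn_integralI) auto
 \<comment> \<open>Fatou's lemma has made \<open>(cmod (J xi))^2\<close> integrable, and only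
   therefore can it serve as its own majorant here.\<close>
 have "(%k. LINT xi|lborel. g k xi * (cmod (J xi))^2) ----> (LINT xi|lborel. (cmod (J xi))^2)"
 proof (rule Bochner_Integration.integral_dominated_convergence[where w = "%xi. (cmod (J xi))^2"])
  show "integrable lborel (%xi. (cmod (J xi))^2)" using JL2 by (simp add: L2_def)
  show "AE xi in lborel. (%k. g k xi * (cmod (J xi))^2) ----> (cmod (J xi))^2" using tendsto_mult[OF g1 tendsto_const] by simp
  show "AE xi in lborel. norm (g k xi * (cmod (J xi))^2) <= (cmod (J xi))^2" for k by (auto simp: abs_mult g_def intro!: mult_left_le_one_le)
 qed measurable
 then have J2: "(LINT xi|lborel. (cmod (J xi))^2) = (2 * pi) ^ CARD('n) * (norm X)^2" using lim LIMSEQ_unique by blast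
 have FJ: "FT f = (%xi. of_real (ft_const TYPE('n)) * J xi)" by (simp add: fun_eq_iff fourier_L1_def' J_def)
 show F: "FT f : L2" unfolding FJ by (rule L2_cmult[OF JL2])
 have "(norm (cls (FT f)))^2 = (LINT xi|lborel. (cmod (FT f xi))^2)" using F by (simp add: cls_norm L2_norm_def)
 also have "... = (ft_const TYPE('n))^2 * (LINT xi|lborel. (cmod (J xi))^2)" by (simp add: FJ norm_mult power_mult_distrib)
 also have "... = (norm X)^2" using ft_const_sq[where 'n = 'n] unfolding J2 by (simp add: mult.assoc[symmetric])
 finally show "norm (cls (FT f)) = norm (cls f)" by (simp add: X_def)
qed

section \<open>Extension of the transform to all classes and inversion\<close>

text \<open>Functions of bounded support form the dense class on which identities are proved before
  \<open>bs_induct\<close> passes to limits: they are integrable, all their moments are square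
  integrable, and their transforms continue analytically along every line.\<close>

definition bs :: "'n::finite scalar_field => bool" where "bs f \<longleftrightarrow> f : L2 & (EX r. ALL x. norm x > r --> f x = 0)"

lemma bs_L2: "bs f ==> f : L2" by (simp add: bs_def)

lemma bs_integrable:
 assumes "bs f" shows "integrable lborel f"
proof -
 obtain r where r: "!!x. norm x > r ==> f x = 0" and f: "f : L2" using assms by (auto simp: bs_def)
 show ?thesis proof (rule Bochner_Integration.integrable_bound[of _ "%x. (cmod (f x))^2 + ind (cball 0 r) x"])
  show "integrable lborel (%x. (cmod (f x))^2 + ind (cball 0 r) x)"
   using f emeasure_compact_finite[OF compact_cball, of "0 :: real ^ 'a" r]
   by (intro Bochner_Integration.integrable_add integrable_real_indicator) (auto simp: L2_def)
  show "AE x in lborel. cmod (f x) <= norm ((cmod (f x))^2 + ind (cball 0 r) x :: real)"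
  proof (intro AE_I2)
   fix x
   have "cmod (f x) <= (cmod (f x))^2 + 1"
    using sum_squares_bound[of "cmod (f x)" 1] by (auto simp: power2_eq_square) (smt (verit) norm_ge_zero zero_le_mult_iff)
   then show "cmod (f x) <= norm ((cmod (f x))^2 + ind (cball 0 r) x :: real)"
    using r[of x] by (cases "norm x > r") (auto simp: indicator_def abs_of_nonneg)
  qed
 qed (use f in \<open>auto simp: L2_def\<close>)
qed

lemma bs_bmult:
 assumes "bs f" "bm m" shows "bs (%x. m x * f x)" using assms L2_bm[of m f] by (auto simp: bs_def)

lemma bs_trunc: "f : L2 ==> bs (%x. ind (cball 0 r) x * f x)"
 unfolding bs_def using L2_bm[OF bm_indicator, of "cball 0 r" f] by (auto intro!: exI[of _ r])

definition tr :: "nat => 'n::finite l2 => 'n l2" where "tr k X = mul (ind (cball 0 (real k))) X"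

lemma tr_tendsto: "(%k. tr k X) ----> X"
proof -
 have "(%k. mul (ind (cball 0 (real k))) X) ----> mul (%_. 1) X"
 proof (rule mul_tendsto[where B = 1])
  show "AE x in (lborel :: (real ^ 'a) measure). (%k. ind (cball 0 (real k)) x) ----> (1 :: complex)"
  proof (intro AE_I2)
   fix x :: "real ^ 'a"
   obtain K :: nat where "norm x < real K" using reals_Archimedean2 by blast
   then show "(%k. ind (cball 0 (real k)) x) ----> (1 :: complex)" by (intro tendsto_eventually eventually_sequentiallyI[of K]) auto
  qed
 qed (auto split: split_indicator intro!: borel_measurable_indicator)
 then show ?thesis by (simp add: tr_def)
qed

lemma bs_induct:
 fixes P :: "'n::finite l2 => bool"
 assumes "!!f. bs f ==> P (cls f)"
  and "!!Xs X. (!!k :: nat. P (Xs k)) ==> Xs ----> X ==> P X"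
 shows "P X"
proof -
 obtain f where f: "f : L2" "X = cls f" using l2_cases by metis
 have "P (tr k X)" for k
  using assms(1)[OF bs_trunc[OF f(1), of "real k"]] f by (simp add: tr_def cls_mul bm_indicator)
 then show ?thesis using assms(2)[OF _ tr_tendsto] by blast
qed

lemma LIMSEQ_le_all: "(!!k. X k <= Y k) ==> X ----> x ==> Y ----> y ==> x <= y" for x y :: real by (rule LIMSEQ_le) auto

lemma LIMSEQ_eq_all:
 assumes "!!k. X k = Y k" "X ----> x" "Y ----> y"
 shows "x = (y :: 'a::t2_space)" using LIMSEQ_unique[of X x y] assms(2,3) ext[of X Y, OF assms(1)] by simp

lemma bs_add: assumes "bs f" "bs g" shows "bs (%x. f x + g x)"
proof -
 obtain r s where "ALL x. norm x > r --> f x = 0" "ALL x. norm x > s --> g x = 0" using assms by (auto simp: bs_def)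
 then have "ALL x. norm x > max r s --> f x + g x = 0" by auto
 then show ?thesis unfolding bs_def using L2_add[OF bs_L2 bs_L2] assms by blast
qed

lemma bs_cmult: "bs f ==> bs (%x. c * f x)" using bs_bmult[of f "%_. c"] by simp

lemma fourier_L1_int: "integrable lborel f ==> integrable lborel (%x. cis (- (x .* xi)) * f x)" for f :: "'n::finite scalar_field"
 by (rule Bochner_Integration.integrable_bound[of _ f]) (auto simp: norm_mult)

lemma fourier_L1_add:
 assumes "integrable lborel f" "integrable lborel g"
 shows "FT (%x. f x + g x) = (%xi. FT f xi + FT g xi)" using fourier_L1_int[OF assms(1)] fourier_L1_int[OF assms(2)]
 by (simp add: fun_eq_iff fourier_L1_def distrib_left)

lemma fourier_L1_cmult: "FT (%x. c * f x) = (%xi. c * FT f xi)"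
proof -
 have "(LINT x|lborel. cis (- (x .* xi)) * (c * f x)) = c * (LINT x|lborel. cis (- (x .* xi)) * f x)" for xi
  by (subst integral_mult_right_zero[symmetric]) (simp add: mult_ac)
 then show ?thesis by (simp add: fun_eq_iff fourier_L1_def)
qed

lemma plancherel_bs:
 assumes "bs f" shows "FT f : L2" "norm (cls (FT f)) = norm (cls f)" using plancherel_L1 bs_L2 bs_integrable assms by blast+

lemma plancherel_bs_diff:
 assumes "bs f" "bs g"
 shows "norm (cls (FT f) - cls (FT g)) = norm (cls f - cls g)"
proof -
 have d: "bs (%x. f x + (-1) * g x)" by (intro bs_add bs_cmult assms)
 have "FT (%x. f x + (-1) * g x) = (%xi. FT f xi - FT g xi)"
  by (subst fourier_L1_add[OF bs_integrable[OF assms(1)] bs_integrable[OF bs_cmult[OF assms(2)]]], subst fourier_L1_cmult) simp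
 then show ?thesis using plancherel_bs(2)[OF d] by (simp add: cls_diff plancherel_bs assms bs_L2)
qed

text \<open>This justifies the choice operator in \<open>fourier\<close>: the transform is isometric
  on truncations, so the transformed truncations form a Cauchy sequence, and the space is
  complete.\<close>

lemma fourier_spec:
 assumes f: "f : L2"
 shows fourier_L2: "fourier f : L2"
  and fourier_lim: "(%k. cls (FT (%x. ind (cball 0 (real k)) x * f x))) ----> cls (fourier f)"
proof -
 define fk where "fk k = (%x. ind (cball 0 (real k)) x * f x)" for k :: nat
 have bs: "bs (fk k)" for k unfolding fk_def by (rule bs_trunc[OF f])
 have eq: "L2_norm (FT (fk k) - g) = norm (cls (FT (fk k)) - cls g)" if "g : L2" for k g
  using that plancherel_bs(1)[OF bs] by (simp add: cls_diff cls_norm L2_diff fun_diff_def)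
 have "(%k. cls (fk k)) ----> cls f" using tr_tendsto[of "cls f"] f by (simp add: tr_def fk_def cls_mul bm_indicator)
 then have "Cauchy (%k. cls (fk k))" by (rule LIMSEQ_imp_Cauchy)
 then have "Cauchy (%k. cls (FT (fk k)))" by (simp add: Cauchy_def dist_norm plancherel_bs_diff bs)
 then obtain Y where "(%k. cls (FT (fk k))) ----> Y" using Cauchy_convergent convergentD by blast
 then have "(%k. norm (cls (FT (fk k)) - cls (rp Y))) ----> 0" by (simp add: tendsto_norm_zero_iff LIM_zero_iff)
 then have "EX g. g : L2 & (%k. L2_norm (FT (fk k) - g)) ----> 0" by (intro exI[of _ "rp Y"]) (simp add: eq)
 then have *: "fourier f : L2 & (%k. L2_norm (FT (fk k) - fourier f)) ----> 0" unfolding fourier_def fk_def by (rule someI_ex)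
 then show "fourier f : L2" by simp
 show "(%k. cls (FT (%x. ind (cball 0 (real k)) x * f x))) ----> cls (fourier f)"
  using conjunct2[OF *] unfolding eq[OF conjunct1[OF *]] fk_def[symmetric] by (simp add: tendsto_norm_zero_iff LIM_zero_iff)
qed

definition FF :: "'n::finite l2 => 'n l2" where "FF X = cls (fourier (rp X))"

text \<open>The transforms of the truncations agree at every frequency, so the predicate inside the
  choice operator is the same and even the chosen functions coincide. This makes \<open>FF\<close>
  independent of representatives.\<close>

lemma fourier_cong:
 assumes "f : L2" "g : L2" "AE x in lborel. f x = g x" shows "fourier f = fourier g"
proof -
 have "FT (%x. ind (cball 0 (real k)) x * f x) = FT (%x. ind (cball 0 (real k)) x * g x)" for k
 proof (rule ext)
  fix xi
  have [measurable]: "meas f" "meas g" using assms by (simp_all add: L2_def)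
  have [measurable]: "cball (0 :: real ^ 'a) (real k) : sets borel" by simp
  have "(LINT x|lborel. cis (- (x .* xi)) * (ind (cball 0 (real k)) x * f x))
   = (LINT x|lborel. cis (- (x .* xi)) * (ind (cball 0 (real k)) x * g x))"
  proof (rule integral_cong_AE)
   show "AE x in lborel. cis (- (x .* xi)) * (ind (cball 0 (real k)) x * f x)
     = cis (- (x .* xi)) * (ind (cball 0 (real k)) x * g x)" using assms(3) by eventually_elim simp
  qed measurable
  then show "FT (%x. ind (cball 0 (real k)) x * f x) xi = FT (%x. ind (cball 0 (real k)) x * g x) xi" by (simp add: fourier_L1_def)
 qed
 then show ?thesis by (simp add: fourier_def)
qed

lemma FF_cls: "f : L2 ==> FF (cls f) = cls (fourier f)" unfolding FF_def using fourier_cong[OF rp_L2 _ rp_cls, of f] by simp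

lemma FF_lim: "f : L2 ==> (%k. cls (FT (%x. ind (cball 0 (real k)) x * f x))) ----> FF (cls f)" using fourier_lim by (simp add: FF_cls)

lemma FF_bs:
 assumes "bs f" shows "FF (cls f) = cls (FT f)"
proof -
 obtain r where r: "!!x. norm x > r ==> f x = 0" using assms by (auto simp: bs_def)
 obtain K :: nat where K: "r < real K" using reals_Archimedean2 by blast
 have "(%x. ind (cball 0 (real k)) x * f x) = f" if "k >= K" for k using r K that by (auto simp: fun_eq_iff indicator_def)
 then have "(%k. cls (FT (%x. ind (cball 0 (real k)) x * f x))) ----> cls (FT f)"
  by (intro tendsto_eventually eventually_sequentiallyI[of K]) simp
 then show ?thesis using FF_lim[OF bs_L2[OF assms]] LIMSEQ_unique by blast
qed

lemma FF_dist: "norm (FF X - FF Y) = norm (X - Y)"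
proof -
 obtain f g where f: "f : L2" "X = cls f" "g : L2" "Y = cls g" using l2_cases by metis
 have "(%k. norm (cls (FT (%x. ind (cball 0 (real k)) x * f x)) - cls (FT (%x. ind (cball 0 (real k)) x * g x))))
   ----> norm (FF X - FF Y)" using f by (intro tendsto_intros) (auto intro: FF_lim)
 moreover have "(%k. norm (tr k X - tr k Y)) ----> norm (X - Y)" by (intro tendsto_intros tr_tendsto)
 ultimately show ?thesis using f by (simp add: plancherel_bs_diff bs_trunc tr_def cls_mul bm_indicator LIMSEQ_unique)
qed

lemma isometry_tendsto:
 fixes T :: "'a::real_normed_vector => 'b::real_normed_vector"
 assumes "!!X Y. norm (T X - T Y) = norm (X - Y)" "(Xs ---> X) F"
 shows "((%k. T (Xs k)) ---> T X) F" using assms(2) by (simp add: tendsto_iff dist_norm assms(1))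

lemma FF_tendsto: "Xs ----> X ==> (%k. FF (Xs k)) ----> FF X" by (rule isometry_tendsto[OF FF_dist])

lemma FF_const: "FF (mul (%_. c) X) = mul (%_. c) (FF X)"
proof (induction X rule: bs_induct)
 case (1 f)
 then show ?case using bs_cmult[of f c] by (simp add: FF_bs cls_mul bs_L2 plancherel_bs fourier_L1_cmult)
next
 case (2 Xs X)
 show ?case by (rule LIMSEQ_eq_all[OF 2(1)]; (intro bounded_linear.tendsto[OF bounded_linear_mul] FF_tendsto)?; rule 2(2))
qed

lemma FF_add: "FF (X + Y) = FF X + FF Y"
proof (induction X rule: bs_induct)
 case (1 f)
 show ?case
 proof (induction Y rule: bs_induct)
  case (1 g)
  then show ?case using bs_add[of f g] \<open>bs f\<close> by (simp add: FF_bs cls_add bs_L2 plancherel_bs fourier_L1_add bs_integrable)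
 next
  case (2 Ys Y)
  show ?case by (rule LIMSEQ_eq_all[OF 2(1)]; (intro tendsto_intros FF_tendsto)?; rule 2(2))
 qed
next
 case (2 Xs X)
 show ?case by (rule LIMSEQ_eq_all[OF 2(1)]; (intro tendsto_intros FF_tendsto)?; rule 2(2))
qed

lemma FF_scaleR: "FF (r *r X) = r *r FF X" using FF_const[of "of_real r" X] by (simp add: mul_of_real)

lemma linear_FF: "linear FF" by (rule linearI) (simp_all add: FF_add FF_scaleR)

lemma norm_FF: "norm (FF X) = norm X" using FF_dist[of X 0] by (simp add: linear_0[OF linear_FF])

text \<open>Polarization gives the real part; complex linearity, applied to
  \<open>mul (%_. \<i>) X\<close>, gives the imaginary part.\<close>

lemma cinner_isometry:
 fixes T :: "'n::finite l2 => 'n l2"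
 assumes "!!X Y. T (X + Y) = T X + T Y" "!!c X. T (mul (%_. c) X) = mul (%_. c) (T X)" "!!X. norm (T X) = norm X"
 shows "cinner (T X) (T Y) = cinner X Y"
proof -
 have re: "inner (T X) (T Y) = inner X Y" for X Y using assms(1)[of X Y] assms(3)[of "X + Y"] assms(3)[of X] assms(3)[of Y]
  by (simp add: power2_norm_eq_inner[symmetric] dot_norm)
 have "Im (cinner U V) = - inner (mul (%_. \<i>) U) V" for U V :: "'n l2" by (simp add: inner_l2_def cinner_const_left)
 then have "Im (cinner (T X) (T Y)) = Im (cinner X Y)" using re[of "mul (%_. \<i>) X" Y] by (simp add: assms(2))
 then show ?thesis using re[of X Y] by (simp add: inner_l2_def complex_eq_iff)
qed

lemma cinner_FF: "cinner (FF X) (FF Y) = cinner X Y" by (rule cinner_isometry) (auto simp: FF_add FF_const norm_FF)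

lemma lborel_reflect: "distr lborel borel uminus = (lborel :: 'a::euclidean_space measure)"
 using lborel_affine[of "-1" "0 :: 'a"] by (simp add: density_1)

lemma integral_reflect:
 fixes f :: "'a::euclidean_space => 'b::{banach, second_countable_topology}"
 assumes "meas f"
 shows "(LINT x|lborel. f (- x)) = (LINT x|lborel. f x)"
proof -
 have "(LINT x|distr lborel borel uminus. f x) = (LINT x|lborel. f (- x))" by (rule integral_distr) (use assms in auto)
 then show ?thesis by (simp add: lborel_reflect)
qed

lemma integrable_reflect:
 fixes f :: "'a::euclidean_space => 'b::{banach, second_countable_topology}"
 assumes "integrable lborel f"
 shows "integrable lborel (%x. f (- x))"
proof -
 have "meas f" using assms by auto
 then show ?thesis using integrable_distr_eq[of "uminus" lborel borel f] assms by (simp add: lborel_reflect)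
qed

lemma AE_reflect:
 fixes P :: "'a::euclidean_space => bool"
 assumes "AE x in lborel. P x" shows "AE x in lborel. P (- x)"
proof -
 have "AE x in distr lborel borel uminus. P x" unfolding lborel_reflect by (rule assms)
 then show ?thesis by (rule AE_distrD[rotated]) simp
qed

lemma L2_reflect: "f : L2 ==> (%x. f (- x)) : L2" using integrable_reflect[of "%x. (cmod (f x))^2"] by (auto simp: L2_def)

lift_definition refl2 :: "'n::finite l2 => 'n l2" is "%f x. f (- x)"
proof -
 fix f g :: "'n scalar_field"
 assume "aeq f g"
 then show "aeq (%x. f (- x)) (%x. g (- x))" unfolding aeq_def using AE_reflect[of "%x. f x = g x"] by (auto intro: L2_reflect)
qed

lemma cls_refl2: "f : L2 ==> refl2 (cls f) = cls (%x. f (- x))" unfolding cls_def by (simp add: refl2.abs_eq aeq_refl)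

lemma refl2_add: "refl2 (X + Y) = refl2 X + refl2 Y" by transfer (auto simp: aeq_def L2_reflect L2_add)

lemma refl2_const: "refl2 (mul (%_. c) X) = mul (%_. c) (refl2 X)"
proof -
 obtain f where "f : L2" "X = cls f" using l2_cases by metis
 then show ?thesis by (simp add: cls_mul cls_refl2 L2_reflect L2_cmult)
qed

lemma norm_refl2: "norm (refl2 X) = norm X"
proof -
 obtain f where f: "f : L2" "X = cls f" using l2_cases by metis
 then have "meas f" by (simp add: L2_def)
 then have "L2_norm (%x. f (- x)) = L2_norm f" unfolding L2_norm_def by (subst integral_reflect[of "%x. (cmod (f x))^2"]) auto
 then show ?thesis using f by (simp add: cls_refl2 cls_norm L2_reflect)
qed

lemma refl2_diff: "refl2 (X - Y) = refl2 X - refl2 Y" using refl2_add[of "X - Y" Y] by simp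

lemma refl2_tendsto: "Xs ----> X ==> (%k. refl2 (Xs k)) ----> refl2 X"
 by (rule isometry_tendsto[of refl2]) (simp_all add: refl2_diff[symmetric] norm_refl2)

definition FI :: "'n::finite l2 => 'n l2" where "FI X = refl2 (FF X)"

lemma FI_tendsto: "Xs ----> X ==> (%k. FI (Xs k)) ----> FI X" unfolding FI_def by (intro refl2_tendsto FF_tendsto)

lemma FF_refl2: "FF (refl2 X) = refl2 (FF X)"
proof (induction X rule: bs_induct)
 case (1 f)
 then have b: "bs (%x. f (- x))" unfolding bs_def using L2_reflect by (metis norm_minus_cancel)
 have fm [measurable]: "meas f" using 1 by (simp add: bs_def L2_def)
 have "FT (%x. f (- x)) = (%xi. FT f (- xi))"
 proof
  fix xi
  have "(LINT x|lborel. cis (- (x .* xi)) * f (- x)) = (LINT x|lborel. cis (- (x .* - xi)) * f x)"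
   using integral_reflect[of "%x. cis (- (x .* - xi)) * f x"] by simp
  then show "FT (%x. f (- x)) xi = FT f (- xi)" by (simp add: fourier_L1_def)
 qed
 then show ?case using 1 b by (simp add: cls_refl2 FF_bs bs_L2 plancherel_bs)
next
 case (2 Xs X)
 show ?case by (rule LIMSEQ_eq_all[OF 2(1)]; (intro FF_tendsto refl2_tendsto)?; rule 2(2))
qed

lemma cinner_tendsto: "(Xs ---> X) G ==> (Ys ---> Y) G ==> ((%k. cinner (Xs k) (Ys k)) ---> cinner X Y) G"
 by (rule bounded_bilinear.tendsto[OF bounded_bilinear_cinner])

text \<open>On functions of bounded support this is Fubini's theorem. It identifies
  \<open>FI\<close> as the adjoint of the isometry \<open>FF\<close>, hence as a left inverse; since
  \<open>FF\<close> commutes with the reflection, \<open>FI\<close> is a right inverse too.\<close>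

lemma cinner_FF_FI: "cinner (FF X) Y = cinner X (FI Y)"
proof (induction X rule: bs_induct)
 case (1 f)
 show ?case
 proof (induction Y rule: bs_induct)
  case (1 g)
  have [measurable]: "meas f" "meas g" using \<open>bs f\<close> 1 by (simp_all add: bs_def L2_def)
  let ?c = "cor ((2 * pi) powr (- real CARD('a) / 2))"
  note fi = bs_integrable[OF \<open>bs f\<close>] and gi = bs_integrable[OF 1]
  have H: "integrable (lborel \<Otimes>\<^sub>M lborel) (%(xi, x). cis (- (x .* xi)) * f x * cnj (g xi))"
  proof (rule lborel_pair.Fubini_integrable)
   show "integrable lborel (%xi. LINT x|lborel. norm (case (xi, x) of (xi, x) => cis (- (x .* xi)) * f x * cnj (g xi)))"
    using gi by (simp add: norm_mult)
   have "integrable lborel (%x. cis (- (x .* xi)) * f x * cnj (g xi))" for xi by (intro integrable_mult_left fourier_L1_int fi)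
   then show "AE xi in lborel. integrable lborel (%x. case (xi, x) of (xi, x) => cis (- (x .* xi)) * f x * cnj (g xi))" by simp
  qed measurable
  have "(LINT x|lborel. cis (- (x .* xi)) * f x * cnj (g xi)) = (LINT x|lborel. cis (- (x .* xi)) * f x) * cnj (g xi)" for xi
   by (rule integral_mult_left_zero)
  then have "cinner (FF (cls f)) (cls g) = ?c * (LINT xi|lborel. LINT x|lborel. cis (- (x .* xi)) * f x * cnj (g xi))"
   using \<open>bs f\<close> 1 by (simp only: FF_bs cls_cinner plancherel_bs bs_L2 L2_inner_def fourier_L1_def mult.assoc integral_mult_right_zero)
  also have "... = ?c * (LINT x|lborel. LINT xi|lborel. cis (- (x .* xi)) * f x * cnj (g xi))" using lborel_pair.Fubini_integral[OF H] by simp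
  also have "... = (LINT x|lborel. f x * cnj (FT g (- x)))"
  proof -
   have "cnj (LINT xi|lborel. cis (- (xi .* - x)) * g xi) = (LINT xi|lborel. cis (- (x .* xi)) * cnj (g xi))" for x
    by (subst Bochner_Integration.integral_cnj[symmetric]) (simp add: cis_cnj inner_commute)
   moreover have "(LINT xi|lborel. cis (- (x .* xi)) * f x * cnj (g xi)) = f x * (LINT xi|lborel. cis (- (x .* xi)) * cnj (g xi))" for x
    by (subst integral_mult_right_zero[symmetric]) (simp add: mult_ac)
   ultimately show ?thesis by (subst integral_mult_right_zero[symmetric]) (simp add: fourier_L1_def mult.left_commute)
  qed
  also have "... = cinner (cls f) (FI (cls g))"
   using \<open>bs f\<close> 1 by (simp add: FI_def FF_bs cls_refl2 cls_cinner plancherel_bs bs_L2 L2_inner_def L2_reflect)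
  finally show ?case .
 next
  case (2 Ys Y)
  show ?case by (rule LIMSEQ_eq_all[OF 2(1)]; (intro cinner_tendsto tendsto_const FI_tendsto)?; rule 2(2))
 qed
next
 case (2 Xs X)
 show ?case by (rule LIMSEQ_eq_all[OF 2(1)]; (intro cinner_tendsto tendsto_const FF_tendsto)?; rule 2(2))
qed

lemma FI_FF [simp]: "FI (FF X) = X"
proof (rule l2_eqI)
 fix Y
 have "cinner Y (FI (FF X)) = cinner Y X" by (simp add: cinner_FF_FI[symmetric] cinner_FF)
 then show "cinner (FI (FF X)) Y = cinner X Y" by (subst (1 2) cinner_commute) simp
qed

lemma FF_FI [simp]: "FF (FI X) = X" unfolding FI_def FF_refl2 by (simp add: FI_def[symmetric])

lemma FI_add: "FI (X + Y) = FI X + FI Y" by (simp add: FI_def FF_add refl2_add)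
lemma FI_const: "FI (mul (%_. c) X) = mul (%_. c) (FI X)" by (simp add: FI_def FF_const refl2_const)
lemma FI_scaleR: "FI (r *r X) = r *r FI X" using FI_const[of "of_real r" X] by (simp add: mul_of_real)
lemma norm_FI: "norm (FI X) = norm X" by (simp add: FI_def norm_FF norm_refl2)

lemma linear_FI: "linear FI" by (rule linearI) (simp_all add: FI_add FI_scaleR)

lemmas FF_diff = linear_diff[OF linear_FF]
lemmas FI_diff = linear_diff[OF linear_FI]

lemma cinner_FI_FF: "cinner (FI X) Y = cinner X (FF Y)" using cinner_FF_FI[of "FI X" "FF Y"] cinner_FF[of "FI X" Y] by simp

section \<open>Fourier multipliers as bounded operators\<close>

definition Mop :: "(real ^ 'n => complex) => 'n::finite l2 => 'n l2" where "Mop m X = FI (mul m (FF X))"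

lemma FF_Mop [simp]: "FF (Mop m X) = mul m (FF X)" by (simp add: Mop_def)
lemma Mop_add: "Mop m (X + Y) = Mop m X + Mop m Y" by (simp add: Mop_def FF_add mul_add FI_add)
lemma Mop_diff: "Mop m (X - Y) = Mop m X - Mop m Y" by (simp add: Mop_def FF_diff mul_diff FI_diff)
lemma Mop_const: "Mop (%_. c) X = mul (%_. c) X" by (simp add: Mop_def FI_const)
lemma Mop_one [simp]: "Mop (%_. 1) X = X" by (simp add: Mop_def)
lemma Mop_Mop: "bm m ==> bm m' ==> Mop m (Mop m' X) = Mop (%x. m x * m' x) X" by (simp add: Mop_def mul_mul)
lemma Mop_commute: "bm m ==> bm m' ==> Mop m (Mop m' X) = Mop m' (Mop m X)" by (simp add: Mop_Mop mult.commute)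
lemma Mop_add_left: "bm m ==> bm m' ==> Mop m X + Mop m' X = Mop (%x. m x + m' x) X" by (simp add: Mop_def mul_add_left FI_add[symmetric])
lemma Mop_diff_left: "bm m ==> bm m' ==> Mop m X - Mop m' X = Mop (%x. m x - m' x) X" by (simp add: Mop_def mul_diff_left FI_diff[symmetric])
lemma cinner_Mop_left: "bm m ==> cinner (Mop m X) Y = cinner X (Mop (%x. cnj (m x)) Y)"
 unfolding Mop_def by (simp only: cinner_FI_FF cinner_mul_left cinner_FF_FI)
lemma norm_Mop_le: "meas m ==> (!!x. cmod (m x) <= B) ==> norm (Mop m X) <= B * norm X"
 using norm_mul_le[of m B "FF X"] by (simp add: Mop_def norm_FI norm_FF)
lemma Mop_tendsto:
 assumes "!!k. m k : borel_measurable borel" "!!k x. cmod (m k x) <= B"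
  and "meas m'" "AE x in lborel. (%k. m k x) ----> m' x" "!!x. cmod (m' x) <= B"
 shows "(%k. Mop (m k) X) ----> Mop m' X" unfolding Mop_def by (intro FI_tendsto mul_tendsto[where B = B] assms)
lemma linear_Mop: "linear (Mop m)" by (rule linearI) (simp add: Mop_add, simp add: Mop_def FF_scaleR mul_scaleR FI_scaleR)
lemma bounded_linear_Mop: "bounded_linear (Mop m)"
proof -
 obtain B where "!!X. norm (mul m X) <= norm X * B" using bounded_linear.bounded[OF bounded_linear_mul, of m] by blast
 then have "norm (Mop m X) <= norm X * B" for X using norm_FF[of X] unfolding Mop_def norm_FI by metis
 then show ?thesis
  using linear_Mop[of m] by (auto simp: bounded_linear_def bounded_linear_axioms_def)
qed

lemma inv_fourier_L2: "g : L2 ==> inv_fourier g : L2" unfolding inv_fourier_def[abs_def] by (intro L2_reflect fourier_L2)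

lemma cls_fourier: "f : L2 ==> cls (fourier f) = FF (cls f)" by (simp add: FF_cls)

lemma cls_inv_fourier: "g : L2 ==> cls (inv_fourier g) = FI (cls g)"
 unfolding inv_fourier_def[abs_def] by (simp add: FI_def FF_cls cls_refl2 fourier_L2)

section \<open>Derivatives and analytic continuation of Fourier transforms\<close>

text \<open>Averaging over a unit segment in direction \<open>e\<close> does not change an integral,
  by translation invariance. This replaces slicing the space into lines: integration by parts and
  contour shifts are done on unit segments, and end point terms cancel after integration over
  \<open>xi\<close>.\<close>

lemma average_along_line:
 fixes K :: "real ^ 'n::finite => complex" and e :: "real ^ 'n"
 assumes K: "integrable lborel K"
 shows "integrable lborel (%xi. LINT r|lborel. ind {0..1::real} r *r K (xi + r *r e))"
  and "(LINT xi|lborel. LINT r|lborel. ind {0..1::real} r *r K (xi + r *r e)) = (LINT xi|lborel. K xi)"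
proof -
 have [measurable]: "meas K" using K by auto
 let ?f = "%(r, xi). ind {0..1::real} r *r K (xi + r *r e)"
 have I: "integrable (lborel \<Otimes>\<^sub>M lborel) ?f"
 proof (rule lborel_pair.Fubini_integrable)
  have "(LINT xi|lborel. cmod (K (xi + r *r e))) = (LINT xi|lborel. cmod (K xi))" for r by (rule integral_shift) measurable
  then show "integrable lborel (%r. LINT xi|lborel. norm (?f (r, xi)))" by (auto intro!: integrable_real_indicator)
  show "AE r in lborel. integrable lborel (%xi. ?f (r, xi))" by (auto intro!: integrable_shift K)
 qed measurable
 show "integrable lborel (%xi. LINT r|lborel. ind {0..1::real} r *r K (xi + r *r e))" using lborel_pair.integrable_snd[OF I] by simp
 have "(LINT xi|lborel. LINT r|lborel. ind {0..1::real} r *r K (xi + r *r e))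
  = (LINT r|lborel. LINT xi|lborel. ind {0..1::real} r *r K (xi + r *r e))" using lborel_pair.Fubini_integral[OF I] by simp
 also have "... = (LINT r|lborel. ind {0..1::real} r *r (LINT xi|lborel. K xi))" by (simp add: integral_shift)
 finally show "(LINT xi|lborel. LINT r|lborel. ind {0..1::real} r *r K (xi + r *r e)) = (LINT xi|lborel. K xi)" by simp
qed

text \<open>Continuous differentiability in the single direction \<open>e\<close>. The derivative is
  required at \<open>r = 0\<close> for every base point, which by translation gives it at all
  \<open>r\<close>.\<close>

definition edif :: "real ^ 'n::finite => (real ^ 'n => complex) => (real ^ 'n => complex) => bool" where
 "edif e H dH \<longleftrightarrow> continuous_on UNIV H & continuous_on UNIV dH &
   (ALL xi. ((%r::real. H (xi + r *r e)) has_vector_derivative dH xi) (at 0))"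

lemma edifD:
 assumes "edif e H dH"
 shows "((%r::real. H (xi + r *r e)) has_vector_derivative dH (xi + r *r e)) (at r)"
proof -
 have "((%s. H ((xi + r *r e) + s *r e)) has_vector_derivative dH (xi + r *r e)) (at (r - r))" using assms by (simp add: edif_def)
 then have "(((%s. H ((xi + r *r e) + s *r e)) \<circ> (%s. s - r)) has_vector_derivative 1 *r dH (xi + r *r e)) (at r)"
  by (intro vector_diff_chain_at) (auto intro!: derivative_eq_intros)
 then show ?thesis by (simp add: o_def algebra_simps)
qed

lemma edif_measurable:
 assumes "edif e H dH" shows "meas H" "meas dH" using assms by (auto simp: edif_def intro: borel_measurable_continuous_onI)

lemma edif_add: "edif e H dH ==> edif e G dG ==> edif e (%xi. H xi + G xi) (%xi. dH xi + dG xi)"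
 by (auto simp: edif_def intro!: continuous_intros derivative_intros)

lemma edif_mult:
 assumes "edif e H dH" "edif e G dG"
 shows "edif e (%xi. H xi * G xi) (%xi. dH xi * G xi + H xi * dG xi)" using assms unfolding edif_def
 by (auto intro!: continuous_intros has_vector_derivative_eq_rhs[OF has_vector_derivative_mult] simp: add.commute)

lemma edif_const: "edif e (%_. c) (%_. 0)" by (auto simp: edif_def)

lemma edif_cnj: "edif e H dH ==> edif e (%xi. cnj (H xi)) (%xi. cnj (dH xi))"
 by (auto simp: edif_def intro!: continuous_intros has_vector_derivative_cnj)

lemma edif_chain:
 assumes "edif e H dH" "!!xi. (f has_field_derivative f' (H xi)) (at (H xi))" "continuous_on (range H) f'"
 shows "edif e (%xi. f (H xi)) (%xi. f' (H xi) * dH xi)"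
proof -
 have cf: "continuous_on (range H) f" using assms(2) by (intro continuous_at_imp_continuous_on ballI) (auto dest: DERIV_isCont)
 have "((%r. f (H (xi + r *r e))) has_vector_derivative dH xi * f' (H xi)) (at 0)" for xi using assms(1,2) unfolding edif_def
  by (intro field_vector_diff_chain_at[unfolded o_def, where g = f]) auto
 moreover have "continuous_on UNIV (%xi. f (H xi))" "continuous_on UNIV (%xi. f' (H xi))" using assms(1) unfolding edif_def
  by (auto intro: continuous_on_compose2[OF cf] continuous_on_compose2[OF assms(3)])
 ultimately show ?thesis using assms(1) unfolding edif_def by (auto intro!: continuous_intros simp: mult.commute)
qed

text \<open>The average of \<open>dK\<close> over a unit segment is
  \<open>K (xi + e) - K xi\<close>, whose integral vanishes by translation invariance. No pointwise
  decay of \<open>K\<close> at infinity enters.\<close>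

lemma integral_edif_zero:
 assumes "edif e K dK" "integrable lborel K" "integrable lborel dK"
 shows "(LINT xi|lborel. dK xi) = 0"
proof -
 have "(LINT r|lborel. ind {0..1::real} r *r dK (xi + r *r e)) = K (xi + e) - K xi" for xi
 proof -
  have "continuous_on UNIV dK" using assms(1) by (simp add: edif_def)
  then have "continuous_on {0..1} (%r::real. dK (xi + r *r e))" by (rule continuous_on_compose2) (auto intro!: continuous_intros)
  then have "(LINT r|lborel. ind {0..1::real} r *r dK (xi + r *r e)) = K (xi + 1 *r e) - K (xi + 0 *r e)"
   by (intro integral_FTC_Icc) (auto intro: has_vector_derivative_at_within[OF edifD[OF assms(1)]])
  then show ?thesis by simp
 qed
 then have "(LINT xi|lborel. dK xi) = (LINT xi|lborel. K (xi + e) - K xi)" using average_along_line(2)[OF assms(3), of e] by simp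
 also have "... = (LINT xi|lborel. K (xi + e)) - (LINT xi|lborel. K xi)"
  using assms(2) integrable_shift by (intro Bochner_Integration.integral_diff) auto
 also have "... = 0" using assms(2) by (subst integral_shift) auto
 finally show ?thesis .
qed

lemma exp_minus_linear_bound: "cmod (exp u - 1 - u) <= exp (cmod u) * (cmod u)^2"
proof -
 have "norm (exp u - (\<Sum>i\<le>1. u ^ i / fact i)) <= exp (norm u) * (norm u ^ Suc 1) / fact 1" by (rule Taylor_exp_field)
 then show ?thesis by (simp add: power2_eq_square diff_diff_eq)
qed

text \<open>The quadratic Taylor remainder of the exponential is bounded uniformly on the set where
  \<open>g\<close> does not vanish, because \<open>a\<close> is bounded by \<open>r\<close> there;
  hence the difference quotient converges at rate \<open>cmod h\<close>.\<close>

lemma has_field_derivative_exp_integral: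
 fixes a :: "real ^ 'n::finite => real" and g :: "real ^ 'n => complex"
 assumes g: "integrable lborel g" and a [measurable]: "meas a"
  and r: "!!x. g x ~= 0 ==> abs (a x) <= r" "r >= 0"
 shows "integrable lborel (%x. exp (- \<i> * z * a x) * g x)"
  and "((%z. LINT x|lborel. exp (- \<i> * z * a x) * g x) has_field_derivative
   (LINT x|lborel. (- \<i> * a x) * (exp (- \<i> * z * a x) * g x))) (at z)"
proof -
 have [measurable]: "meas g" using g by auto
 have eb: "cmod (exp (- \<i> * z * a x)) * cmod (g x) <= exp (cmod z * r) * cmod (g x)" for x z
 proof (cases "g x = 0")
  case False
  have "cmod (exp (- \<i> * z * a x)) <= exp (cmod (- \<i> * z * a x))" by (rule norm_exp)
  also have "... <= exp (cmod z * r)" using r(1)[OF False] by (auto simp: norm_mult intro!: mult_left_mono)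
  finally show ?thesis by (intro mult_right_mono) auto
 qed auto
 have I: "integrable lborel (%x. exp (- \<i> * z * a x) * g x)" for z
  by (rule Bochner_Integration.integrable_bound[of _ "%x. exp (cmod z * r) * cmod (g x)"]) (use g eb[of z] in \<open>auto simp: norm_mult\<close>)
 then show "integrable lborel (%x. exp (- \<i> * z * a x) * g x)" .
 have I': "integrable lborel (%x. (- \<i> * a x) * (exp (- \<i> * z * a x) * g x))" for z
 proof (rule Bochner_Integration.integrable_bound[of _ "%x. r * (exp (- \<i> * z * a x) * g x)"])
  have "abs (a x) * cmod (exp (- \<i> * z * a x) * g x) <= r * cmod (exp (- \<i> * z * a x) * g x)" for x
   using r(1)[of x] by (cases "g x = 0") (auto intro!: mult_right_mono)
  then show "AE x in lborel. cmod ((- \<i> * a x) * (exp (- \<i> * z * a x) * g x)) <= cmod (r * (exp (- \<i> * z * a x) * g x))"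
   using r(2) by (auto simp: norm_mult)
 qed (use I[of z] in auto)
 define A where "A = (LINT x|lborel. cmod (g x))"
 define B where "B = exp (cmod z * r) * exp r * r^2 * A"
 have A: "A >= 0" unfolding A_def by (intro integral_nonneg_AE) auto
 have est: "cmod ((LINT x|lborel. exp (- \<i> * (z + h) * a x) * g x) - (LINT x|lborel. exp (- \<i> * z * a x) * g x)
   - (LINT x|lborel. (- \<i> * a x) * (exp (- \<i> * z * a x) * g x)) * h) <= B * (cmod h)^2" if h: "cmod h <= 1" for h
 proof -
  let ?d = "%x. exp (- \<i> * z * a x) * g x * (exp (- \<i> * h * a x) - 1 - (- \<i> * h * a x))"
  have "(LINT x|lborel. exp (- \<i> * (z + h) * a x) * g x) - (LINT x|lborel. exp (- \<i> * z * a x) * g x)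
   - (LINT x|lborel. (- \<i> * a x) * (exp (- \<i> * z * a x) * g x)) * h
   = (LINT x|lborel. exp (- \<i> * (z + h) * a x) * g x - exp (- \<i> * z * a x) * g x - (- \<i> * a x) * (exp (- \<i> * z * a x) * g x) * h)"
   using I[of "z + h"] I[of z] I'[of z] by (subst Bochner_Integration.integral_diff, simp, simp, subst Bochner_Integration.integral_diff)
    (auto simp del: mult_minus_left minus_mult_left)
  also have "... = (LINT x|lborel. ?d x)"
   by (intro Bochner_Integration.integral_cong refl) (simp add: algebra_simps exp_add exp_diff exp_minus field_simps)
  also have "cmod ... <= (LINT x|lborel. (exp (cmod z * r) * exp r * r^2 * (cmod h)^2) * cmod (g x))"
  proof (rule order_trans[OF integral_norm_bound])
   show "(LINT x|lborel. cmod (?d x)) <= (LINT x|lborel. (exp (cmod z * r) * exp r * r^2 * (cmod h)^2) * cmod (g x))"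
   proof (rule integral_mono')
    show "integrable lborel (%x. (exp (cmod z * r) * exp r * r^2 * (cmod h)^2) * cmod (g x))" using g by auto
    fix x :: "real ^ 'n"
    show "cmod (?d x) <= (exp (cmod z * r) * exp r * r^2 * (cmod h)^2) * cmod (g x)"
    proof (cases "g x = 0")
     case False
     let ?u = "- \<i> * h * a x"
     have u: "cmod ?u <= cmod h * r" using r(1)[OF False] by (auto simp: norm_mult intro!: mult_left_mono)
     have "cmod (exp ?u - 1 - ?u) <= exp (cmod ?u) * (cmod ?u)^2" by (rule exp_minus_linear_bound)
     also have "... <= exp r * (cmod h * r)^2"
     proof (intro mult_mono power_mono u)
      have "cmod ?u <= r" using u mult_right_mono[OF h r(2)] by simp
      then show "exp (cmod ?u) <= exp r" by simp
     qed auto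
     finally have "cmod (exp ?u - 1 - ?u) <= exp r * (cmod h * r)^2" .
     then have "(cmod (exp (- \<i> * z * a x)) * cmod (g x)) * cmod (exp ?u - 1 - ?u)
       <= (exp (cmod z * r) * cmod (g x)) * (exp r * (cmod h * r)^2)" by (intro mult_mono eb) auto
     then show ?thesis by (simp add: norm_mult power_mult_distrib mult_ac)
    qed simp
   qed auto
  qed
  also have "... = B * (cmod h)^2" by (simp add: B_def A_def mult_ac)
  finally show ?thesis .
 qed
 show "((%z. LINT x|lborel. exp (- \<i> * z * a x) * g x) has_field_derivative
   (LINT x|lborel. (- \<i> * a x) * (exp (- \<i> * z * a x) * g x))) (at z)"
  (is "(?f has_field_derivative ?D) _") unfolding has_field_derivative_def has_derivative_at
 proof (intro conjI)
  show "bounded_linear ((*) ?D)" by (rule bounded_linear_mult_right)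
  have "((%h. B * cmod h) ---> B * cmod 0) (at 0)" by (intro tendsto_intros)
  then have lim: "((%h. B * cmod h) ---> 0) (at 0)" by simp
  show "(%h. norm (?f (z + h) - ?f z - ?D * h) / norm h) \<midarrow>0\<rightarrow> 0"
  proof (rule tendsto_sandwich[OF _ _ tendsto_const lim])
   have "\<forall>\<^sub>F h in at 0. cmod h < 1 & h ~= 0" unfolding eventually_at by (auto intro!: exI[of _ 1])
   then show "\<forall>\<^sub>F h in at 0. norm (?f (z + h) - ?f z - ?D * h) / norm h <= B * cmod h"
   proof eventually_elim
    case (elim h)
    then show ?case using est[of h] by (simp add: divide_le_eq power2_eq_square mult.assoc)
   qed
  qed auto
 qed
qed

lemma fourier_L1_bound:
 fixes f :: "'n::finite scalar_field"
 shows "cmod (FT f xi) <= ft_const TYPE('n) * (LINT x|lborel. cmod (f x))"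
proof -
 have "cmod (LINT x|lborel. cis (- (x .* xi)) * f x) <= (LINT x|lborel. cmod (cis (- (x .* xi)) * f x))" by (rule integral_norm_bound)
 then have "cmod (LINT x|lborel. cis (- (x .* xi)) * f x) <= (LINT x|lborel. cmod (f x))" by (simp add: norm_mult)
 then show ?thesis unfolding fourier_L1_def' norm_mult by (intro mult_mono) (auto simp: ft_const_def)
qed

lemma fourier_L1_continuous:
 assumes f: "integrable lborel f" shows "continuous_on UNIV (FT f)"
proof (rule continuous_at_imp_continuous_on, rule ballI)
 fix xi :: "real ^ 'a"
 have [measurable]: "meas f" using f by auto
 show "isCont (FT f) xi" unfolding continuous_at_sequentially
 proof safe
  fix X :: "nat => real ^ 'a" assume X: "X ----> xi"
  have "(%k. LINT x|lborel. cis (- (x .* X k)) * f x) ----> (LINT x|lborel. cis (- (x .* xi)) * f x)"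
  proof (rule Bochner_Integration.integral_dominated_convergence[where w = "%x. cmod (f x)"])
   show "AE x in lborel. (%k. cis (- (x .* X k)) * f x) ----> cis (- (x .* xi)) * f x" by (intro AE_I2 tendsto_intros X)
  qed (use f in \<open>auto simp: norm_mult\<close>)
  then show "(FT f \<circ> X) ----> FT f xi" unfolding o_def fourier_L1_def by (intro tendsto_intros)
 qed
qed

lemma edif_fourier_L1:
 fixes f :: "'n::finite scalar_field"
 assumes f: "bs f"
 shows "edif e (FT f) (FT (%x. - \<i> * (x .* e) * f x))" unfolding edif_def
proof (intro conjI allI)
 obtain r where r: "!!x. norm x > r ==> f x = 0" using f by (auto simp: bs_def)
 define R where "R = max r 0 * norm e"
 have R: "abs (x .* e) <= R" if "f x ~= 0" for x
 proof -
  have "norm x <= max r 0" using r[of x] that by (cases "norm x > r") auto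
  then show ?thesis unfolding R_def using Cauchy_Schwarz_ineq2[of x e] mult_right_mono[of "norm x" "max r 0" "norm e"] by simp
 qed
 have xf: "integrable lborel (%x. - \<i> * (x .* e) * f x)"
 proof (rule Bochner_Integration.integrable_bound[of _ "%x. R * f x"])
  show "AE x in lborel. cmod (- \<i> * (x .* e) * f x) <= cmod (R * f x)"
  proof (intro AE_I2)
   fix x show "cmod (- \<i> * (x .* e) * f x) <= cmod (R * f x)" using R[of x] by (cases "f x = 0") (auto simp: norm_mult intro!: mult_right_mono)
  qed
 qed (use bs_integrable[OF f] in auto)
 show "continuous_on UNIV (FT f)" by (rule fourier_L1_continuous[OF bs_integrable[OF f]])
 show "continuous_on UNIV (FT (%x. - \<i> * (x .* e) * f x))" by (rule fourier_L1_continuous[OF xf])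
 fix xi
 define \<Phi> where "\<Phi> z = (LINT x|lborel. exp (- \<i> * z * (x .* e)) * (cis (- (x .* xi)) * f x))" for z
 have d: "(\<Phi> has_field_derivative (LINT x|lborel. (- \<i> * (x .* e)) * (exp (- \<i> * 0 * (x .* e)) * (cis (- (x .* xi)) * f x)))) (at 0)"
  unfolding \<Phi>_def by (rule has_field_derivative_exp_integral[where r = R])
   (use R fourier_L1_int[OF bs_integrable[OF f]] in \<open>auto simp: R_def\<close>)
 have eq: "FT f (xi + s *r e) = ft_const TYPE('n) * \<Phi> s" for s
 proof -
  have "cis (- (x .* (xi + s *r e))) = exp (- \<i> * of_real s * of_real (x .* e)) * cis (- (x .* xi))" for x
  proof -
   have "exp (- \<i> * of_real s * of_real (x .* e)) = cis (- (s * (x .* e)))" by (simp add: cis_conv_exp mult.assoc)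
   then show ?thesis by (simp add: cis_mult inner_add_right) (simp only: diff_conv_add_uminus add.commute)
  qed
  then show ?thesis by (simp add: fourier_L1_def' \<Phi>_def mult.assoc)
 qed
 have "((%s. \<Phi> (of_real s)) has_vector_derivative FT (%x. - \<i> * (x .* e) * f x) xi / ft_const TYPE('n)) (at 0)"
  using has_vector_derivative_real_field[of \<Phi> _ 0] d  by (simp add: fourier_L1_def' mult_ac ft_const_def)
 then have "((%s. ft_const TYPE('n) * \<Phi> (of_real s)) has_vector_derivative ft_const TYPE('n) * (FT (%x. - \<i> * (x .* e) * f x) xi / ft_const TYPE('n))) (at 0)"
  by (intro has_vector_derivative_mult_right)
 then show "((%s. FT f (xi + s *r e)) has_vector_derivative FT (%x. - \<i> * (x .* e) * f x) xi) (at 0)" unfolding eq by (simp add: ft_const_def)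
qed

text \<open>A derivative in frequency is multiplication by \<open>- \<i> * (x .* e)\<close> in
  space. As that factor is unbounded, the identity is stated under a weight \<open>w\<close> that
  absorbs it, and it is proved by pairing with functions of bounded support, for which
  \<open>integral_edif_zero\<close> applies.\<close>

lemma mul_FI_edif:
 assumes e: "edif e H dH" and H: "H : L2" "dH : L2"
  and w: "bm w" "bm (%x. of_real (x .* e) * w x)"
 shows "mul w (FI (cls dH)) = mul (%x. - \<i> * (of_real (x .* e) * w x)) (FI (cls H))"
proof (rule l2_eqI)
 have w': "bm (%x. - \<i> * (of_real (x .* e) * w x))" using bm_mult[OF bm_const w(2), of "- \<i>"] .
 fix Y
 show "cinner (mul w (FI (cls dH))) Y = cinner (mul (%x. - \<i> * (of_real (x .* e) * w x)) (FI (cls H))) Y"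
 proof (induction Y rule: bs_induct)
  case (1 g)
  define g1 where "g1 x = cnj (w x) * g x" for x
  define g2 where "g2 x = - \<i> * (x .* e) * g1 x" for x
  have g1: "bs g1" unfolding g1_def by (rule bs_bmult[OF 1 bm_cnj[OF w(1)]])
  have "bs (%x. cnj (\<i> * (of_real (x .* e) * w x)) * g x)" by (intro bs_bmult[OF 1] bm_cnj bm_mult[OF bm_const w(2)])
  then have g2: "bs g2" by (simp add: g2_def[abs_def] g1_def mult_ac)
  have ed: "edif e (%xi. H xi * cnj (FT g1 xi)) (%xi. dH xi * cnj (FT g1 xi) + H xi * cnj (FT g2 xi))"
   using edif_fourier_L1[OF g1, of e] unfolding g2_def[abs_def, symmetric] by (intro edif_mult e edif_cnj)
  have i: "integrable lborel (%xi. dH xi * cnj (FT g1 xi))" "integrable lborel (%xi. H xi * cnj (FT g2 xi))"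
   "integrable lborel (%xi. H xi * cnj (FT g1 xi))" by (intro L2_inner_integrable H plancherel_bs g1 g2)+
  have "(LINT xi|lborel. dH xi * cnj (FT g1 xi) + H xi * cnj (FT g2 xi)) = 0" by (rule integral_edif_zero[OF ed]) (use i in auto)
  then have "L2_inner dH (FT g1) = - L2_inner H (FT g2)" using i by (simp add: L2_inner_def eq_neg_iff_add_eq_0)
  then have *: "cinner (cls dH) (FF (cls g1)) = - cinner (cls H) (FF (cls g2))" by (simp add: FF_bs g1 g2 cls_cinner H plancherel_bs)
  have "cinner (mul w (FI (cls dH))) (cls g) = cinner (cls dH) (FF (cls g1))"
   using 1 by (simp add: cinner_mul_left w cls_mul bm_cnj bs_L2 g1_def[abs_def] cinner_FI_FF)
  also have "... = cinner (FI (cls H)) (- cls g2)"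
   unfolding * by (simp add: cinner_FI_FF linear_neg[OF linear_FF]) (metis cinner_diff_right cinner_zero_right diff_0)
  also have "- cls g2 = mul (%x. cnj (- \<i> * (of_real (x .* e) * w x))) (cls g)"
  proof -
   have "- cls g2 = mul (%_. -1) (cls g2)" using mul_of_real[of "-1" "cls g2"] by simp
   then show ?thesis using 1 w' g2 by (simp only: cls_mul bm_cnj bs_L2 bm_const) (simp add: g2_def g1_def mult_ac)
  qed
  finally show ?case by (simp only: cinner_mul_left[OF w'])
 next
  case (2 Ys Y)
  show ?case by (rule LIMSEQ_eq_all[OF 2(1)]; (intro cinner_tendsto tendsto_const)?; rule 2(2))
 qed
qed

lemma cnj_indicator [simp]: "cnj (ind A x) = ind A x" by (simp add: indicator_def)

lemma bs_mult_support:
 assumes f: "bs f" and m: "meas m" "!!x. f x ~= 0 ==> cmod (m x) <= B" "B >= 0"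
 shows "bs (%x. m x * f x)" "norm (cls (%x. m x * f x)) <= B * norm (cls f)"
proof -
 have [measurable]: "meas f" "meas m" using f m by (simp_all add: bs_def L2_def)
 let ?m = "%x. if f x = 0 then 0 else m x"
 have meas: "meas ?m" by measurable
 have b: "cmod (?m x) <= B" for x using m(2,3) by auto
 have bm: "bm ?m" by (rule bmI[OF meas b])
 have eq: "(%x. m x * f x) = (%x. ?m x * f x)" by auto
 show "bs (%x. m x * f x)" unfolding eq by (rule bs_bmult[OF f bm])
 show "norm (cls (%x. m x * f x)) <= B * norm (cls f)" unfolding eq cls_mul[OF bs_L2[OF f] bm, symmetric] by (rule norm_mul_le[OF meas b])
qed

text \<open>For a symbol \<open>\<mu>\<close> that continues holomorphically in the direction \<open>e\<close>, the integral pairing two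
 functions supported in half spaces can be shifted to \<open>xi - \<i> ka e\<close> (Cauchy's theorem on the
 rectangle with sides \<open>1\<close> and \<open>ka\<close>, averaged over \<open>xi\<close>); the exponential gain is
 the separation of the half spaces.\<close>

lemma paley_wiener_bs:
 fixes e :: "real ^ 'n::finite" and \<mu> :: "real ^ 'n => complex => complex"
 assumes ka: "0 < ka" "ka < ka'"
  and hol: "!!xi. \<mu> xi holomorphic_on {z. abs (Im z) < ka'}"
  and tr: "!!xi r z. \<mu> (xi + r *r e) z = \<mu> xi (z + of_real r)"
  and cont: "continuous_on (UNIV \<times> {0..ka}) (%p. \<mu> (fst p) (- \<i> * of_real (snd p)))"
  and bd: "!!xi y. 0 <= y ==> y <= ka ==> cmod (\<mu> xi (- \<i> * of_real y)) <= C"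
  and B: "!!xi. cmod (\<mu> xi (- \<i> * of_real ka)) <= B"
  and f: "bs f" "!!x. x .* e <= a ==> f x = 0" and g: "bs g" "!!x. b <= x .* e ==> g x = 0"
 shows "cmod (cinner (Mop (%xi. \<mu> xi 0) (cls f)) (cls g)) <= B * exp (- ka * (a - b)) * (norm (cls f) * norm (cls g))"
proof -
 have [measurable]: "meas f" "meas g" using f g by (simp_all add: bs_def L2_def)
 obtain r1 where r1: "!!x. norm x > r1 ==> f x = 0" using f by (auto simp: bs_def)
 obtain r2 where r2: "!!x. norm x > r2 ==> g x = 0" using g by (auto simp: bs_def)
 define R where "R = max (max r1 r2) 0 * norm e"
 have R0: "R >= 0" by (simp add: R_def)
 have R: "abs (x .* e) <= R" if "f x ~= 0 \<or> g x ~= 0" for x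
 proof -
  have "norm x <= max (max r1 r2) 0" using r1[of x] r2[of x] that by (cases "norm x > max r1 r2") auto
  then show ?thesis unfolding R_def using Cauchy_Schwarz_ineq2[of x e] mult_right_mono[of "norm x" "max (max r1 r2) 0" "norm e"] by simp
 qed
 define Hh where "Hh xi z = (LINT x|lborel. exp (- \<i> * z * of_real (x .* e)) * (cis (- (x .* xi)) * f x))" for xi z
 define Gg where "Gg xi z = (LINT x|lborel. exp (- \<i> * z * of_real (- (x .* e))) * (cis (x .* xi) * cnj (g x)))" for xi z
 define F where "F xi z = \<mu> xi z * Hh xi z * Gg xi z" for xi z
 let ?c = "ft_const TYPE('n)"
 have c0: "?c > 0" by (simp add: ft_const_def)
 have gint: "integrable lborel (%x. cis (x .* xi) * cnj (g x))" for xi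
  by (rule Bochner_Integration.integrable_bound[of _ g]) (use bs_integrable[OF g(1)] in \<open>auto simp: norm_mult\<close>)
 have Hhol: "Hh xi holomorphic_on S" for xi S unfolding holomorphic_on_def field_differentiable_def Hh_def[abs_def]
  by (intro ballI exI, rule has_field_derivative_at_within, rule has_field_derivative_exp_integral(2)[where r = R])
   (use R R0 fourier_L1_int[OF bs_integrable[OF f(1)]] in auto)
 have Ghol: "Gg xi holomorphic_on S" for xi S unfolding holomorphic_on_def field_differentiable_def Gg_def[abs_def]
  by (intro ballI exI, rule has_field_derivative_at_within, rule has_field_derivative_exp_integral(2)[where r = R]) (use R R0 gint in auto)
 have Fhol: "F xi holomorphic_on {z. abs (Im z) < ka'}" for xi unfolding F_def[abs_def] by (intro holomorphic_intros hol Hhol Ghol)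
 have ex1: "exp (- \<i> * (z + of_real s) * of_real t) = exp (- \<i> * z * of_real t) * cis (- (s * t))" for z s t
  by (simp add: cis_conv_exp exp_add[symmetric] algebra_simps)
 have Htr: "Hh (xi + s *r e) z = Hh xi (z + of_real s)" for xi s z
 proof -
  have "cis (- (x .* (xi + s *r e))) = cis (- (s * (x .* e))) * cis (- (x .* xi))" for x
   by (simp add: cis_mult inner_add_right) (simp only: diff_conv_add_uminus add.commute)
  then show ?thesis unfolding Hh_def ex1 by (simp add: mult.assoc)
 qed
 have Gtr: "Gg (xi + s *r e) z = Gg xi (z + of_real s)" for xi s z
 proof -
  have "cis (x .* (xi + s *r e)) = cis (- (s * - (x .* e))) * cis (x .* xi)" for x by (simp add: cis_mult inner_add_right add.commute)
  then show ?thesis unfolding Gg_def ex1 by (simp add: mult.assoc)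
 qed
 have Ftr: "F (xi + s *r e) z = F xi (z + of_real s)" for xi s z by (simp add: F_def tr Htr Gtr)
 define fy where "fy y x = of_real (exp (- y * (x .* e))) * f x" for y x
 define gy where "gy y x = of_real (exp (y * (x .* e))) * g x" for y x
 have Hy: "?c * Hh xi (- \<i> * of_real y) = FT (fy y) xi" for xi y unfolding Hh_def fourier_L1_def' fy_def
  by (simp add: exp_of_real[symmetric] mult_ac del: exp_of_real)
 have Gy: "?c * Gg xi (- \<i> * of_real y) = cnj (FT (gy y) xi)" for xi y
 proof -
  have "cnj (LINT x|lborel. cis (- (x .* xi)) * gy y x) = (LINT x|lborel. cnj (cis (- (x .* xi)) * gy y x))"
   by (rule Bochner_Integration.integral_cnj[symmetric])
  then show ?thesis unfolding Gg_def fourier_L1_def' gy_def by (simp add: exp_of_real[symmetric] mult_ac cis_cnj exp_cnj del: exp_of_real)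
 qed
 have expm: "meas (%x. cor (exp (s * (x .* e))))" for s by measurable
 have fy: "bs (fy y)" "norm (cls (fy y)) <= exp (ka * R) * norm (cls f)" if "0 <= y" "y <= ka" for y
 proof -
  have "exp (- y * (x .* e)) <= exp (ka * R)" if "f x ~= 0" for x
   using R[of x] that R0 mult_mono[of y ka "abs (x .* e)" R] \<open>0 <= y\<close> \<open>y <= ka\<close> ka
   by (auto simp: abs_real_def split: if_splits) (smt (verit) mult_nonneg_nonneg)
  then show "bs (fy y)" "norm (cls (fy y)) <= exp (ka * R) * norm (cls f)"
   unfolding fy_def using bs_mult_support[OF f(1) expm[of "- y"], of "exp (ka * R)"] by auto
 qed
 have gy: "bs (gy y)" "norm (cls (gy y)) <= exp (ka * R) * norm (cls g)" if "0 <= y" "y <= ka" for y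
 proof -
  have "exp (y * (x .* e)) <= exp (ka * R)" if "g x ~= 0" for x
   using R[of x] that R0 mult_mono[of y ka "abs (x .* e)" R] \<open>0 <= y\<close> \<open>y <= ka\<close> ka
   by (auto simp: abs_real_def split: if_splits) (smt (verit) mult_nonneg_nonneg mult_nonneg_nonpos)
  then show "bs (gy y)" "norm (cls (gy y)) <= exp (ka * R) * norm (cls g)"
   unfolding gy_def using bs_mult_support[OF g(1) expm[of y], of "exp (ka * R)"] by auto
 qed
 \<comment> \<open>Only at the full height \<open>ka\<close> do the half spaces enter; the factors
   \<open>exp (- ka * a)\<close> and \<open>exp (ka * b)\<close> of this bound and of the next one
   form the exponential gain.\<close>
 have fk: "norm (cls (fy ka)) <= exp (- ka * a) * norm (cls f)"
 proof -
  have "exp (- ka * (x .* e)) <= exp (- ka * a)" if "f x ~= 0" for x using f(2)[of x] that ka by (cases "x .* e <= a") auto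
  then show ?thesis unfolding fy_def using bs_mult_support(2)[OF f(1) expm[of "- ka"], of "exp (- ka * a)"] by auto
 qed
 have gk: "norm (cls (gy ka)) <= exp (ka * b) * norm (cls g)"
 proof -
  have "exp (ka * (x .* e)) <= exp (ka * b)" if "g x ~= 0" for x using g(2)[of x] that ka by (cases "b <= x .* e") auto
  then show ?thesis unfolding gy_def using bs_mult_support(2)[OF g(1) expm[of ka], of "exp (ka * b)"] by auto
 qed
 have Fy: "?c^2 * F xi (- \<i> * of_real y) = \<mu> xi (- \<i> * of_real y) * FT (fy y) xi * cnj (FT (gy y) xi)" for xi y
  unfolding F_def Hy[symmetric] Gy[symmetric] by (simp add: power2_eq_square mult_ac)
 have "(%p. ind (UNIV \<times> {0..ka}) p *r \<mu> (fst p) (- \<i> * of_real (snd p))) : borel_measurable (borel \<Otimes>\<^sub>M borel)"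
  unfolding borel_prod by (rule borel_measurable_continuous_on_indicator[OF _ cont]) (simp add: borel_prod[symmetric])
 from measurable_compose[OF measurable_pair_swap' this]
 have \<mu>m: "(%p. ind {0..ka} (fst p) *r \<mu> (snd p) (- \<i> * of_real (fst p))) : borel_measurable (borel \<Otimes>\<^sub>M borel)"
  by (simp add: split_beta' indicator_times)
 have HGm: "(%p. Hh (snd p) (- \<i> * of_real (fst p))) : borel_measurable (borel \<Otimes>\<^sub>M borel)"
  "(%p. Gg (snd p) (- \<i> * of_real (fst p))) : borel_measurable (borel \<Otimes>\<^sub>M borel)" unfolding Hh_def Gg_def by measurable
 have Fm: "(%(y, xi). ind {0..ka} y *r F xi (- \<i> * of_real y)) : borel_measurable (borel \<Otimes>\<^sub>M borel)"
  using borel_measurable_times[OF \<mu>m borel_measurable_times[OF HGm]] by (simp add: F_def mult.assoc split_beta')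
 have mm: "meas (%xi. \<mu> xi (- \<i> * of_real y))" if y: "0 <= y" "y <= ka" for y
 proof -
  have "continuous_on UNIV (%xi. \<mu> (fst (xi, y)) (- \<i> * of_real (snd (xi, y))))"
   by (rule continuous_on_compose2[OF cont]) (use y in \<open>auto intro!: continuous_intros\<close>)
  then show ?thesis by (intro borel_measurable_continuous_onI) simp
 qed
 have Fint: "integrable lborel (%xi. F xi (- \<i> * of_real y))" if y: "0 <= y" "y <= ka" for y
 proof -
  note m = mm[OF y]
  have "integrable lborel (%xi. ?c^2 * F xi (- \<i> * of_real y))" unfolding Fy
   by (intro L2_inner_integrable L2_bmult[OF _ m bd] plancherel_bs fy gy y)
  from integrable_mult_right[OF this, of "inverse (cor (?c^2))"] show ?thesis using c0 by (simp add: mult.assoc[symmetric])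
 qed
 \<comment> \<open>A crude bound that depends on the radius of the supports. It serves only the
   integrability needed for Fubini's theorem and does not enter the final estimate.\<close>
 define D where "D = C * (exp (ka * R) * norm (cls f)) * (exp (ka * R) * norm (cls g)) / ?c^2"
 have FD: "(LINT xi|lborel. cmod (F xi (- \<i> * of_real y))) <= D" if y: "0 <= y" "y <= ka" for y
 proof -
  have C0: "C >= 0" using bd[OF y, of 0] norm_ge_zero order_trans by blast
  let ?u = "FT (fy y)" and ?v = "FT (gy y)"
  have uv: "?u : L2" "?v : L2" by (intro plancherel_bs fy gy y)+
  then have u': "(%xi. of_real (cmod (?u xi))) : L2" "(%xi. of_real (cmod (?v xi))) : L2" by (auto simp: L2_def)
  have n: "norm (cls (%xi. of_real (cmod (?u xi)))) = norm (cls (fy y))" "norm (cls (%xi. of_real (cmod (?v xi)))) = norm (cls (gy y))"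
   using u' uv plancherel_bs(2)[OF fy(1)[OF y]] plancherel_bs(2)[OF gy(1)[OF y]] by (simp_all add: cls_norm L2_norm_def)
  have "(LINT xi|lborel. cmod (?u xi) * cmod (?v xi)) <= norm (cls (fy y)) * norm (cls (gy y))"
  proof -
   have "cor (LINT xi|lborel. cmod (?u xi) * cmod (?v xi)) = cinner (cls (%xi. of_real (cmod (?u xi)))) (cls (%xi. of_real (cmod (?v xi))))"
    using u' by (simp add: cls_cinner L2_inner_def integral_complex_of_real[symmetric])
   then have "abs (LINT xi|lborel. cmod (?u xi) * cmod (?v xi)) <= norm (cls (fy y)) * norm (cls (gy y))"
    using cinner_norm_le[of "cls (%xi. of_real (cmod (?u xi)))" "cls (%xi. of_real (cmod (?v xi)))"] by (metis n norm_of_real)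
   then show ?thesis by simp
  qed
  also have "... <= (exp (ka * R) * norm (cls f)) * (exp (ka * R) * norm (cls g))" by (intro mult_mono fy gy y) auto
  finally have uvb: "(LINT xi|lborel. cmod (?u xi) * cmod (?v xi)) <= (exp (ka * R) * norm (cls f)) * (exp (ka * R) * norm (cls g))" .
  have "(LINT xi|lborel. ?c^2 * cmod (F xi (- \<i> * of_real y))) <= (LINT xi|lborel. C * (cmod (?u xi) * cmod (?v xi)))"
  proof (rule integral_mono)
   show "integrable lborel (%xi. ?c^2 * cmod (F xi (- \<i> * of_real y)))" using Fint[OF y] by auto
   show "integrable lborel (%xi. C * (cmod (?u xi) * cmod (?v xi)))" using integrable_norm[OF L2_inner_integrable[OF uv]] by (simp add: norm_mult)
   fix xi :: "real ^ 'n"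
   have "?c^2 * cmod (F xi (- \<i> * of_real y)) = cmod (?c^2 * F xi (- \<i> * of_real y))" by (simp add: norm_mult norm_power c0 less_imp_le)
   also have "... = cmod (\<mu> xi (- \<i> * of_real y)) * (cmod (?u xi) * cmod (?v xi))" unfolding Fy by (simp add: norm_mult)
   also have "... <= C * (cmod (?u xi) * cmod (?v xi))" by (intro mult_right_mono bd y) auto
   finally show "?c^2 * cmod (F xi (- \<i> * of_real y)) <= C * (cmod (?u xi) * cmod (?v xi))" .
  qed
  then have "?c^2 * (LINT xi|lborel. cmod (F xi (- \<i> * of_real y))) <= C * (LINT xi|lborel. cmod (?u xi) * cmod (?v xi))" by simp
  also have "... <= C * ((exp (ka * R) * norm (cls f)) * (exp (ka * R) * norm (cls g)))" by (intro mult_left_mono uvb C0)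
  finally show ?thesis unfolding D_def using c0 by (simp add: pos_le_divide_eq mult_ac)
 qed
 have K: "integrable (lborel \<Otimes>\<^sub>M lborel) (%(y, xi). ind {0..ka} y *r F xi (- \<i> * of_real y))"
 proof (rule lborel_pair.Fubini_integrable)
  show "(%(y, xi). ind {0..ka} y *r F xi (- \<i> * of_real y)) : borel_measurable (lborel \<Otimes>\<^sub>M lborel)" using Fm by simp
  show "AE y in lborel. integrable lborel (%xi. case (y, xi) of (y, xi) => ind {0..ka} y *r F xi (- \<i> * of_real y))"
   using Fint by (auto simp: indicator_def)
  show "integrable lborel (%y. LINT xi|lborel. norm (case (y, xi) of (y, xi) => ind {0..ka} y *r F xi (- \<i> * of_real y)))"
  proof (rule Bochner_Integration.integrable_bound[of _ "%y. ind {0..ka} y * D"])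
   show "integrable lborel (%y. ind {0..ka} y * D)" using ka by (auto intro!: integrable_mult_left integrable_real_indicator)
   show "(%y. LINT xi|lborel. norm (case (y, xi) of (y, xi) => ind {0..ka} y *r F xi (- \<i> * of_real y))) : borel_measurable lborel"
    by (rule lborel.borel_measurable_lebesgue_integral)
     (use measurable_compose[OF Fm borel_measurable_norm] in \<open>simp add: split_beta' cong: measurable_cong_sets\<close>)
   show "AE y in lborel. norm (LINT xi|lborel. norm (case (y, xi) of (y, xi) => ind {0..ka} y *r F xi (- \<i> * of_real y))) <= norm (ind {0..ka} y * D)"
   proof (intro AE_I2)
    fix y
    show "norm (LINT xi|lborel. norm (case (y, xi) of (y, xi) => ind {0..ka} y *r F xi (- \<i> * of_real y))) <= norm (ind {0..ka} y * D)"
    proof (cases "y : {0..ka}")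
     case True
     moreover have "0 <= (LINT xi|lborel. cmod (F xi (- \<i> * of_real y)))" by (intro integral_nonneg_AE) auto
     ultimately show ?thesis using FD[of y] by simp
    qed simp
   qed
  qed
 qed
 \<comment> \<open>The integral over a vertical side of the rectangle at base point
   \<open>xi\<close>. The opposite side is \<open>Q (xi + e)\<close>, so the two sides cancel once
   integrated over \<open>xi\<close>.\<close>
 define Q where "Q xi = (LINT y|lborel. ind {0..ka} y *r F xi (- \<i> * of_real y))" for xi
 have Qint: "integrable lborel Q" using lborel_pair.integrable_snd[OF K] unfolding Q_def[abs_def] by simp
 have strip: "open {z. abs (Im z) < ka'}" "convex {z. abs (Im z) < ka'}"
 proof -
  show "open {z. abs (Im z) < ka'}" by (intro open_Collect_less continuous_intros)
  have "{z. abs (Im z) < ka'} = {z. Im z < ka'} \<inter> {z. Im z > - ka'}" by auto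
  then show "convex {z. abs (Im z) < ka'}" using convex_Int[OF convex_halfspace_Im_lt[of ka'] convex_halfspace_Im_gt[of "- ka'"]] by simp
 qed
 have rect: "(LINT r|lborel. ind {0..1::real} r *r F (xi + r *r e) 0) - (LINT r|lborel. ind {0..1::real} r *r F (xi + r *r e) (- \<i> * of_real ka))
   = \<i> * (Q (xi + e) - Q xi)" for xi
 proof -
  obtain P where P0: "!!z. z : {z. abs (Im z) < ka'} ==> (P has_field_derivative F xi z) (at z within {z. abs (Im z) < ka'})"
   using holomorphic_convex_primitive'[OF strip(2,1) Fhol] by blast
  have P: "(P has_field_derivative F xi z) (at z)" if "abs (Im z) < ka'" for z using P0[of z] that at_within_open[OF _ strip(1), of z] by simp
  have cF: "continuous_on {z. abs (Im z) < ka'} (F xi)" using Fhol by (rule holomorphic_on_imp_continuous_on)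
  have h: "(LINT r|lborel. ind {0..1::real} r *r F xi (z + of_real r)) = P (z + of_real 1) - P (z + of_real 0)" if z: "abs (Im z) < ka'" for z
  proof (rule integral_FTC_Icc)
   fix r :: real
   have d: "((%r. z + of_real r) has_vector_derivative 1) (at r)"
    unfolding has_vector_derivative_def by (auto intro!: derivative_eq_intros simp: scaleR_conv_of_real)
   have "abs (Im (z + of_real r)) < ka'" using z by simp
   from field_vector_diff_chain_at[OF d P[OF this]]
   show "((%r. P (z + of_real r)) has_vector_derivative F xi (z + of_real r)) (at r within {0..1})"
    by (auto simp: o_def intro: has_vector_derivative_at_within)
  next
   show "continuous_on {0..1} (%r. F xi (z + of_real r))" using z by (intro continuous_on_compose2[OF cF]) (auto intro!: continuous_intros)
  qed simp
  have v: "(LINT y|lborel. ind {0..ka} y *r F xi (- \<i> * of_real y + of_real s)) = \<i> * P (- \<i> * of_real ka + of_real s) - \<i> * P (- \<i> * of_real 0 + of_real s)" for s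
  proof (rule integral_FTC_Icc)
   fix y :: real assume y: "0 <= y" "y <= ka"
   have d: "((%y. - \<i> * of_real y + of_real s) has_vector_derivative - \<i>) (at y)"
    unfolding has_vector_derivative_def by (auto intro!: derivative_eq_intros simp: scaleR_conv_of_real)
   have "abs (Im (- \<i> * of_real y + of_real s)) < ka'" using y ka by simp
   from has_vector_derivative_mult_right[OF field_vector_diff_chain_at[OF d P[OF this]], of \<i>]
   show "((%y. \<i> * P (- \<i> * of_real y + of_real s)) has_vector_derivative F xi (- \<i> * of_real y + of_real s)) (at y within {0..ka})"
    by (auto simp: o_def mult.assoc[symmetric] intro: has_vector_derivative_at_within)
  next
   show "continuous_on {0..ka} (%y. F xi (- \<i> * of_real y + of_real s))"
    using ka by (intro continuous_on_compose2[OF cF]) (auto intro!: continuous_intros)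
  qed (use ka in simp)
  have Q1: "Q (xi + e) = (LINT y|lborel. ind {0..ka} y *r F xi (- \<i> * of_real y + of_real 1))" using Ftr[of xi 1] by (simp add: Q_def)
  have Q0: "Q xi = (LINT y|lborel. ind {0..ka} y *r F xi (- \<i> * of_real y + of_real 0))" by (simp add: Q_def)
  have Im: "abs (Im 0) < ka'" "abs (Im (- \<i> * of_real ka)) < ka'" using ka by auto
  show ?thesis unfolding Ftr Q1 Q0 v h[OF Im(1)] h[OF Im(2)] by (simp add: algebra_simps)
 qed
 have "(LINT xi|lborel. F xi 0) - (LINT xi|lborel. F xi (- \<i> * of_real ka)) = (LINT xi|lborel. \<i> * (Q (xi + e) - Q xi))"
 proof -
  have i0: "integrable lborel (%xi. F xi 0)" and ik: "integrable lborel (%xi. F xi (- \<i> * of_real ka))" using Fint[of 0] Fint[of ka] ka by auto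
  show ?thesis unfolding rect[symmetric] average_along_line(2)[OF i0, of e, symmetric] average_along_line(2)[OF ik, of e, symmetric]
   by (rule Bochner_Integration.integral_diff[symmetric]) (rule average_along_line(1) i0 ik)+
 qed
 also have "... = \<i> * ((LINT xi|lborel. Q (xi + e)) - (LINT xi|lborel. Q xi))" using Qint integrable_shift[OF Qint] by simp
 also have "... = 0" using Qint by (subst integral_shift) auto
 finally have eq: "(LINT xi|lborel. F xi 0) = (LINT xi|lborel. F xi (- \<i> * of_real ka))" by simp
 have m0: "bm (%xi. \<mu> xi (- \<i> * of_real y))" if "0 <= y" "y <= ka" for y by (rule bmI[OF mm[OF that] bd[OF that]])
 have pair: "cinner (mul (%xi. \<mu> xi (- \<i> * of_real y)) (cls (FT (fy y)))) (cls (FT (gy y)))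
   = ?c^2 * (LINT xi|lborel. F xi (- \<i> * of_real y))" if y: "0 <= y" "y <= ka" for y
 proof -
  have "cinner (mul (%xi. \<mu> xi (- \<i> * of_real y)) (cls (FT (fy y)))) (cls (FT (gy y)))
    = (LINT xi|lborel. ?c^2 * F xi (- \<i> * of_real y))" unfolding Fy cls_mul[OF plancherel_bs(1)[OF fy(1)[OF y]] m0[OF y]]
    cls_cinner[OF L2_bm[OF m0[OF y] plancherel_bs(1)[OF fy(1)[OF y]]] plancherel_bs(1)[OF gy(1)[OF y]]] L2_inner_def ..
  then show ?thesis by simp
 qed
 have "fy 0 = f" "gy 0 = g" by (auto simp: fy_def gy_def)
 then have "cinner (Mop (%xi. \<mu> xi 0) (cls f)) (cls g) = ?c^2 * (LINT xi|lborel. F xi 0)"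
  using pair[of 0] ka f g by (simp add: Mop_def cinner_FI_FF FF_bs)
 also have "... = cinner (mul (%xi. \<mu> xi (- \<i> * of_real ka)) (cls (FT (fy ka)))) (cls (FT (gy ka)))" unfolding eq using pair[of ka] ka by simp
 also have "cmod ... <= norm (mul (%xi. \<mu> xi (- \<i> * of_real ka)) (cls (FT (fy ka)))) * norm (cls (FT (gy ka)))" by (rule cinner_norm_le)
 also have "... <= (B * norm (cls (fy ka))) * norm (cls (gy ka))"
  using norm_mul_le[OF bm_measurable[OF m0[of ka]] B, of "cls (FT (fy ka))"] fy[of ka] gy[of ka] ka by (simp add: plancherel_bs mult_right_mono)
 also have "... <= (B * (exp (- ka * a) * norm (cls f))) * (exp (ka * b) * norm (cls g))"
 proof -
  have "B >= 0" using B[of 0] norm_ge_zero order_trans by blast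
  then show ?thesis by (intro mult_mono fk gk) auto
 qed
 also have "... = B * exp (- ka * (a - b)) * (norm (cls f) * norm (cls g))"
  by (simp add: exp_add[symmetric] algebra_simps exp_diff exp_minus field_simps)
 finally show ?thesis .
qed

text \<open>The bound for pairings does not involve the radii of the supports, so it survives the
  limit in both arguments and becomes an operator bound by duality.\<close>

lemma paley_wiener:
 fixes e :: "real ^ 'n::finite" and \<mu> :: "real ^ 'n => complex => complex"
 assumes ka: "0 < ka" "ka < ka'"
  and hol: "!!xi. \<mu> xi holomorphic_on {z. abs (Im z) < ka'}"
  and tr: "!!xi r z. \<mu> (xi + r *r e) z = \<mu> xi (z + of_real r)"
  and cont: "continuous_on (UNIV \<times> {0..ka}) (%p. \<mu> (fst p) (- \<i> * of_real (snd p)))"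
  and bd: "!!xi y. 0 <= y ==> y <= ka ==> cmod (\<mu> xi (- \<i> * of_real y)) <= C"
  and B: "!!xi. cmod (\<mu> xi (- \<i> * of_real ka)) <= B"
 shows "norm (chi {x. x .* e < b} (Mop (%xi. \<mu> xi 0) (chi {x. a < x .* e} X))) <= B * exp (- ka * (a - b)) * norm X"
proof (induction X rule: bs_induct)
 case (1 f)
 have half: "{x. x .* e < b} : sets borel" "{x. a < x .* e} : sets borel" by (intro borel_open open_Collect_less continuous_intros)+
 note bi = bm_indicator[OF half(1)] bm_indicator[OF half(2)]
 let ?f = "%x. ind {x. a < x .* e} x * f x"
 have B0: "B >= 0" using B[of 0] norm_ge_zero order_trans by blast
 have f: "bs ?f" by (rule bs_bmult[OF 1 bi(2)])
 have eqf: "chi {x. a < x .* e} (cls f) = cls ?f" by (rule cls_mul[OF bs_L2[OF 1] bi(2)])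
 have fn: "norm (cls ?f) <= norm (cls f)"
  unfolding eqf[symmetric] using norm_mul_le[OF bm_measurable[OF bi(2)], of 1 "cls f"] by (auto simp: indicator_def)
 let ?Z = "chi {x. x .* e < b} (Mop (%xi. \<mu> xi 0) (cls ?f))"
 have "cmod (cinner ?Z Y) <= (B * exp (- ka * (a - b)) * norm (cls f)) * norm Y" for Y
 proof (induction Y rule: bs_induct)
  case (1 g)
  let ?g = "%x. ind {x. x .* e < b} x * g x"
  have g: "bs ?g" by (rule bs_bmult[OF 1 bi(1)])
  have eqg: "chi {x. x .* e < b} (cls g) = cls ?g" by (rule cls_mul[OF bs_L2[OF 1] bi(1)])
  have gn: "norm (cls ?g) <= norm (cls g)"
   unfolding eqg[symmetric] using norm_mul_le[OF bm_measurable[OF bi(1)], of 1 "cls g"] by (auto simp: indicator_def)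
  have "cinner ?Z (cls g) = cinner (Mop (%xi. \<mu> xi 0) (cls ?f)) (cls ?g)" unfolding eqg[symmetric] by (simp add: cinner_mul_right bi) 
  also have "cmod ... <= B * exp (- ka * (a - b)) * (norm (cls ?f) * norm (cls ?g))" by (rule paley_wiener_bs[OF ka hol tr cont bd B f _ g]) auto
  also have "... <= B * exp (- ka * (a - b)) * (norm (cls f) * norm (cls g))" using B0 fn gn by (intro mult_left_mono mult_mono) auto
  finally show ?case by (simp add: mult_ac)
 next
  case (2 Ys Y)
  show ?case by (rule LIMSEQ_le_all[OF 2(1)]; (intro tendsto_norm cinner_tendsto tendsto_const tendsto_intros)?; rule 2(2))
 qed
 then show ?case unfolding eqf by (rule norm_le_cinnerI)
next
 case (2 Xs X)
 show ?case by (rule LIMSEQ_le_all[OF 2(1)]; (intro tendsto_norm bounded_linear.tendsto[OF bounded_linear_mul] bounded_linear.tendsto[OF bounded_linear_Mop] tendsto_intros)?; rule 2(2))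
qed

section \<open>Phase space localization of the free propagator\<close>

text \<open>Here \<open>j\<close> stands for the bracket of the momentum, \<open>p\<close> for its
  component along \<open>e\<close>, and \<open>w\<close> for the energy after the momentum is moved
  by \<open>- \<i> * y\<close> along \<open>e\<close>. Comparing real and imaginary parts of
  \<open>w^2\<close> gives all bounds. The essential one is that \<open>Im w\<close> has the sign of
  \<open>- y * p\<close>: oscillation turns into decay or growth according to the sign of the
  velocity.\<close>

lemma csqrt_strip:
 fixes j p y :: real
 assumes j: "1 <= j" and p: "abs p <= j" and y: "abs y <= 1/2"
 defines "w \<equiv> csqrt (Complex (j^2 - y^2) (- 2 * y * p))"
 shows "j / 2 <= Re w" "Re w <= 2 * j" "Im w = - (y * p / Re w)"
  "cmod ((of_real p - \<i> * of_real y) / w - of_real (p / j)) <= 8 * abs y"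
proof -
 have w2: "w^2 = Complex (j^2 - y^2) (- 2 * y * p)" by (simp add: w_def)
 have re0: "Re w >= 0" unfolding w_def by (rule Re_csqrt)
 have y2: "y^2 <= 1/4" using power_mono[OF y, of 2] by (simp add: power2_eq_square)
 have j2: "1 <= j^2" using j by (simp add: one_le_power)
 have e1: "(Re w)^2 - (Im w)^2 = j^2 - y^2" and e2: "2 * Re w * Im w = - 2 * y * p" using w2 by (simp_all add: complex_eq_iff power2_eq_square)
 have "(j / 2)^2 <= (Re w)^2"
 proof -
  have "(Re w)^2 >= j^2 - y^2" using e1 zero_le_power2[of "Im w"] by linarith
  moreover have "j^2 - y^2 >= j^2 / 4" using j2 y2 by linarith
  ultimately show ?thesis by (simp add: power_divide)
 qed
 then show r1: "j / 2 <= Re w" using re0 by (rule power2_le_imp_le)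
 then have rpos: "Re w > 0" using j by linarith
 show im: "Im w = - (y * p / Re w)" using e2 rpos by (simp add: field_simps)
 have "abs p / Re w <= 2" using r1 p rpos by (simp add: divide_le_eq)
 then have "abs (Im w) <= abs y * 2" using mult_left_mono[of "abs p / Re w" 2 "abs y"] rpos by (simp add: im abs_mult)
 then have "abs (Im w) <= 1" using y by simp
 then have "(Im w)^2 <= 1" using power_mono[of "abs (Im w)" 1 2] by simp
 moreover have "(2 * j)^2 = 4 * j^2" by (simp add: power_mult_distrib)
 ultimately have "(Re w)^2 <= (2 * j)^2" using e1 j2 zero_le_power2[of y] by linarith
 then show "Re w <= 2 * j" using j by (intro power2_le_imp_le[of "Re w" "2 * j"]) auto
 have w0: "w ~= 0" using rpos by auto
 have wj: "cmod (w - j) * cmod (w + j) = cmod (w^2 - j^2)" unfolding norm_mult[symmetric] by (simp add: power2_eq_square algebra_simps)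
 have "w^2 - j^2 = - of_real (y^2) - \<i> * of_real (2 * y * p)" unfolding w2 by (simp add: complex_eq_iff)
 then have "cmod (w^2 - j^2) <= cmod (- of_real (y^2) :: complex) + cmod (\<i> * of_real (2 * y * p))"
  using norm_triangle_ineq4[of "- of_real (y^2)" "\<i> * of_real (2 * y * p)"] by simp
 also have "... = abs y * abs y + 2 * abs y * abs p" by (simp add: norm_mult power2_eq_square abs_mult)
 also have "... <= abs y * (j / 2) + 2 * abs y * j" using y j p by (intro add_mono mult_left_mono) auto
 finally have "cmod (w^2 - j^2) <= 5 / 2 * abs y * j" by (simp add: mult_ac)
 moreover have "cmod (w + j) >= j" using complex_Re_le_cmod[of "w + j"] rpos by simp
 ultimately have "cmod (w - j) * j <= 5 / 2 * abs y * j" using wj mult_left_mono[of j "cmod (w + j)" "cmod (w - j)"] by simp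
 then have wjb: "cmod (w - j) <= 5 / 2 * abs y" using j by simp
 have "cmod (of_real p * (j - w) - \<i> * of_real y * j) <= cmod (of_real p * (j - w)) + cmod (\<i> * of_real y * j)" by (rule norm_triangle_ineq4)
 also have "... <= j * (5 / 2 * abs y) + abs y * j"
 proof -
  have "abs p * cmod (j - w) <= j * (5 / 2 * abs y)" using p wjb j by (intro mult_mono) (auto simp: norm_minus_commute)
  then show ?thesis using j by (simp add: norm_mult)
 qed
 also have "... <= 4 * abs y * j" using j by (simp add: mult_right_mono field_simps)
 finally have n: "cmod (of_real p * (j - w) - \<i> * of_real y * j) <= 4 * abs y * j" .
 have wb: "cmod w >= 1 / 2" using complex_Re_le_cmod[of w] r1 j by linarith
 have "(of_real p - \<i> * of_real y) / w - of_real (p / j) = (of_real p * (j - w) - \<i> * of_real y * j) / (w * j)"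
  using w0 j by (simp add: field_simps)
 then have "cmod ((of_real p - \<i> * of_real y) / w - of_real (p / j)) = cmod (of_real p * (j - w) - \<i> * of_real y * j) / (cmod w * j)"
  using j by (simp add: norm_divide norm_mult)
 also have "... <= (4 * abs y * j) / (1 / 2 * j)" using n wb j by (intro frac_le mult_mono) auto
 also have "... = 8 * abs y" using j by simp
 finally show "cmod ((of_real p - \<i> * of_real y) / w - of_real (p / j)) <= 8 * abs y" .
qed

lemma japanese_ge_1: "1 <= jb x" by (simp add: japanese_def)

lemma japanese_pos: "0 < jb x" using japanese_ge_1[of x] by linarith

lemma japanese_sq: "(jb x)^2 = 1 + (norm x)^2" by (simp add: japanese_def)

lemma norm_le_japanese: "norm x <= jb x" by (simp add: japanese_def real_le_rsqrt)

lemma continuous_on_japanese [continuous_intros]: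
 "continuous_on S f ==> continuous_on S (%x. jb (f x))" unfolding japanese_def by (intro continuous_intros)

lemma japanese_measurable [measurable]: "meas jb" by (intro borel_measurable_continuous_onI continuous_intros)

section \<open>Velocity, energy and logistic cut-offs at complex momenta\<close>

definition vel :: "real ^ 'n::finite => real ^ 'n => real" where "vel e xi = (xi .* e) / jb xi"

text \<open>For a unit vector \<open>e\<close>, the analytic continuation of \<open>z\<close>
  \<mapsto> \<open>jb (xi + z *r e)\<close> from real \<open>z\<close>.\<close>

definition jpc :: "real ^ 'n::finite => real ^ 'n => complex => complex" where
 "jpc e xi z = csqrt (of_real (1 + (norm xi)^2) + 2 * z * of_real (xi .* e) + z^2)"

definition velc :: "real ^ 'n::finite => real ^ 'n => complex => complex" where "velc e xi z = (of_real (xi .* e) + z) / jpc e xi z"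

text \<open>The logistic function is the smooth step of the whole argument: its poles keep a
  positive distance from the real axis, and it approaches 0 and 1 exponentially fast.\<close>

definition lgs :: "complex => complex" where "lgs w = 1 / (1 + exp (- w))"

definition slgs :: "real => real" where "slgs x = 1 / (1 + exp (- x))"

lemma slgs_bounds: "0 < slgs x" "slgs x < 1" "slgs x <= exp x"
proof -
 have "0 < 1 + exp (- x)" by (simp add: add_pos_pos)
 then show "0 < slgs x" "slgs x < 1" by (auto simp: slgs_def)
 have "1 / (1 + exp (- x)) <= 1 / exp (- x)" by (intro divide_left_mono mult_pos_pos add_pos_pos) auto
 then show "slgs x <= exp x" by (simp add: slgs_def exp_minus divide_inverse)
qed

lemma slgs_minus: "1 - slgs x = slgs (- x)" by (simp add: slgs_def exp_minus field_simps add_pos_pos[THEN less_imp_neq, THEN not_sym])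

lemma lgs_of_real: "lgs (of_real x) = of_real (slgs x)" by (simp add: lgs_def slgs_def exp_of_real[symmetric])

text \<open>Since 1 is less than a third of pi, the cosine of \<open>Im w\<close> is at least 1/2,
  so the denominator has real part at least 1.\<close>

lemma lgs_bounds:
 assumes "abs (Im w) <= 1"
 shows "1 + exp (- w) ~= 0" "cmod (lgs w) <= 1" "cmod (lgs w) <= 2 * exp (Re w)"
proof -
 have c: "cos (Im w) >= 1 / 2"
 proof -
  have "cos (pi / 3) <= cos (abs (Im w))" using assms pi_gt3 by (intro cos_monotone_0_pi_le) auto
  then show ?thesis by (simp add: cos_60)
 qed
 have re: "Re (1 + exp (- w)) = 1 + exp (- Re w) * cos (Im w)" by (simp add: Re_exp)
 have "exp (- Re w) * cos (Im w) >= exp (- Re w) * (1 / 2)" using c by (intro mult_left_mono) auto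
 then have r: "Re (1 + exp (- w)) >= 1 + exp (- Re w) / 2" unfolding re by simp
 then have r1: "Re (1 + exp (- w)) >= 1" using exp_gt_zero[of "- Re w"] by linarith
 then show ne: "1 + exp (- w) ~= 0" by (metis Re_complex_of_real not_one_le_zero of_real_0)
 have m1: "cmod (1 + exp (- w)) >= 1" using r1 complex_Re_le_cmod order_trans by blast
 then show "cmod (lgs w) <= 1" by (simp add: lgs_def norm_divide divide_le_eq)
 have m2: "cmod (1 + exp (- w)) >= exp (- Re w) / 2" using r complex_Re_le_cmod[of "1 + exp (- w)"] by linarith
 have "1 / cmod (1 + exp (- w)) <= 1 / (exp (- Re w) / 2)"
  using m2 order_less_le_trans[OF zero_less_one m1] by (intro divide_left_mono mult_pos_pos) auto
 then show "cmod (lgs w) <= 2 * exp (Re w)" by (simp add: lgs_def norm_divide exp_minus field_simps)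
qed

context
 fixes e :: "real ^ 'n::finite"
 assumes e: "norm e = 1"
begin

lemma abs_inner_le_japanese: "abs (xi .* e) <= jb xi" using Cauchy_Schwarz_ineq2[of xi e] norm_le_japanese[of xi] e by simp

lemma abs_vel_le_1: "abs (vel e xi) <= 1" using abs_inner_le_japanese[of xi] japanese_pos[of xi]
 unfolding vel_def abs_divide by (simp add: abs_of_pos)

lemma jpc_arg_translate:
 fixes z :: complex
 shows "of_real (1 + (norm (xi + r *r e))^2) + 2 * z * of_real ((xi + r *r e) .* e) + z^2
  = of_real (1 + (norm xi)^2) + 2 * (z + of_real r) * of_real (xi .* e) + (z + of_real r)^2"
proof -
 have "e .* e = 1" using e by (simp add: power2_norm_eq_inner[symmetric])
 then have n: "(norm (xi + r *r e))^2 = (norm xi)^2 + 2 * r * (xi .* e) + r^2" "(xi + r *r e) .* e = xi .* e + r"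
  unfolding power2_norm_eq_inner by (simp_all add: inner_add_left inner_add_right inner_commute[of e xi] power2_eq_square distrib_left)
 show ?thesis unfolding n by (simp add: power2_eq_square algebra_simps)
qed

text \<open>Moving the base point along \<open>e\<close> and moving the complex variable are the
  same operation, as the hypothesis \<open>tr\<close> of \<open>paley_wiener\<close>
  demands.\<close>

lemma jpc_translate: "jpc e (xi + r *r e) z = jpc e xi (z + of_real r)" unfolding jpc_def jpc_arg_translate ..

lemma velc_translate: "velc e (xi + r *r e) z = velc e xi (z + of_real r)"
proof -
 have "e .* e = 1" using e by (simp add: power2_norm_eq_inner[symmetric])
 then show ?thesis unfolding velc_def jpc_translate by (simp add: inner_add_left add_ac)
qed

lemma jpc_arg_imag:
 "of_real (1 + (norm xi)^2) + 2 * (- \<i> * of_real y) * of_real (xi .* e) + (- \<i> * of_real y)^2 = Complex ((jb xi)^2 - y^2) (- 2 * y * (xi .* e))"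
proof -
 have "(- \<i> * of_real y)^2 = - of_real (y^2)" by (simp add: power_mult_distrib)
 then show ?thesis by (simp add: complex_eq_iff japanese_sq)
qed

text \<open>The witness for \<rho> is the quotient of \<open>jb xi\<close> and the real part of the
  complex energy, which \<open>csqrt_strip\<close> keeps between 1/2 and 2.\<close>

lemma jpc_imag_bounds:
 assumes "abs y <= 1/2"
 shows "EX \<rho>. 1/2 <= \<rho> & \<rho> <= 2 & Im (jpc e xi (- \<i> * of_real y)) = - (y * vel e xi * \<rho>)"
  and "cmod (velc e xi (- \<i> * of_real y) - of_real (vel e xi)) <= 8 * abs y"
  and "Re (jpc e xi (- \<i> * of_real y)) > 0"
proof -
 note * = csqrt_strip[OF japanese_ge_1 abs_inner_le_japanese assms, of xi]
 let ?w = "jpc e xi (- \<i> * of_real y)"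
 have w: "?w = csqrt (Complex ((jb xi)^2 - y^2) (- 2 * y * (xi .* e)))" unfolding jpc_def jpc_arg_imag ..
 have r: "jb xi / 2 <= Re ?w" "Re ?w <= 2 * jb xi" "Im ?w = - (y * (xi .* e) / Re ?w)" unfolding w by (rule *)+
 then show pos: "Re ?w > 0" using japanese_pos[of xi] by linarith
 show "EX \<rho>. 1/2 <= \<rho> & \<rho> <= 2 & Im ?w = - (y * vel e xi * \<rho>)"
 proof (intro exI conjI)
  show "1/2 <= jb xi / Re ?w" using r(2) pos by (simp add: le_divide_eq)
  show "jb xi / Re ?w <= 2" using r(1) pos by (simp add: divide_le_eq)
  have *: "y * vel e xi * (jb xi / Re ?w) = y * (xi .* e) / Re ?w" using japanese_pos[of xi] by (simp add: vel_def)
  show "Im ?w = - (y * vel e xi * (jb xi / Re ?w))" unfolding * by (rule r(3))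
 qed
 show "cmod (velc e xi (- \<i> * of_real y) - of_real (vel e xi)) <= 8 * abs y"
 proof -
  have "of_real (xi .* e) + - \<i> * of_real y = of_real (xi .* e) - \<i> * of_real y" by simp
  then show ?thesis using *(4) unfolding velc_def w vel_def by (simp only:)
 qed
qed

text \<open>After translating the base point by \<open>Re z\<close> the variable is purely
  imaginary, and the radicand has real part at least \<open>1 - (Im z)^2\<close>.\<close>

lemma jpc_arg_nonneg:
 assumes "abs (Im z) < 1"
 shows "of_real (1 + (norm xi)^2) + 2 * z * of_real (xi .* e) + z^2 \<notin> \<real>\<^sub>\<le>\<^sub>0"
proof -
 have z: "- \<i> * of_real (- Im z) + of_real (Re z) = z" by (simp add: complex_eq_iff)
 have "of_real (1 + (norm xi)^2) + 2 * z * of_real (xi .* e) + z^2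
  = Complex ((jb (xi + Re z *r e))^2 - (- Im z)^2) (- 2 * (- Im z) * ((xi + Re z *r e) .* e))"
  unfolding jpc_arg_imag[symmetric] jpc_arg_translate z ..
 moreover have "(jb (xi + Re z *r e))^2 - (- Im z)^2 > 0"
 proof -
  have "(Im z)^2 < 1" using assms by (simp add: abs_square_less_1)
  then show ?thesis using one_le_power[OF japanese_ge_1, of "xi + Re z *r e" 2] by simp
 qed
 ultimately show ?thesis by (simp add: complex_nonpos_Reals_iff)
qed

lemma jpc_nonzero: assumes "abs (Im z) < 1" shows "jpc e xi z ~= 0"
 using jpc_arg_nonneg[OF assms, of xi] unfolding jpc_def by (metis csqrt_eq_0 nonpos_Reals_zero_I)

lemma velc_dist:
 assumes "abs (Im z) <= 1/2"
 shows "cmod (velc e xi z - of_real (vel e (xi + Re z *r e))) <= 8 * abs (Im z)"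
proof -
 have z: "- \<i> * of_real (- Im z) + of_real (Re z) = z" by (simp add: complex_eq_iff)
 have "velc e xi z = velc e (xi + Re z *r e) (- \<i> * of_real (- Im z))" unfolding velc_translate z ..
 then show ?thesis using jpc_imag_bounds(2)[of "- Im z" "xi + Re z *r e"] assms by simp
qed

lemma jpc_0: "jpc e xi 0 = of_real (jb xi)" by (simp add: jpc_def japanese_def add_nonneg_nonneg)

lemma velc_0: "velc e xi 0 = of_real (vel e xi)" by (simp add: velc_def jpc_0 vel_def)

text \<open>The symbol \<open>exp (- \<i> T \<langle>xi\<rangle>) * slgs (c v + d)\<close> on half spaces, after shifting \<open>xi\<close> by \<open>- \<i> ka e\<close>.\<close>

lemma half_space_bound:
 assumes ka: "0 < ka" "ka <= 1/4" and c: "16 * abs c * ka <= 1"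
  and B: "!!v \<rho> s. abs v <= 1 ==> 1/2 <= \<rho> ==> \<rho> <= 2 ==> 0 <= s ==> s <= 1 ==> s <= 6 * exp (c * v + d) ==> exp (- (T * ka * v * \<rho>)) * s <= B"
 shows "norm (chi {x. x .* e < b} (Mop (%xi. cis (- (T * jb xi)) * of_real (slgs (c * vel e xi + d)))
   (chi {x. a < x .* e} X))) <= B * exp (- ka * (a - b)) * norm X"
proof -
 define \<mu> where "\<mu> xi z = exp (- \<i> * of_real T * jpc e xi z) * lgs (of_real c * velc e xi z + of_real d)" for xi z
 \<comment> \<open>In the strip of half-width \<open>2 * ka\<close> the complex velocity differs
   from a real one by at most \<open>16 * ka\<close>. By the hypothesis on \<open>c\<close> the
   argument of \<open>lgs\<close> moves by at most 1, which keeps it in the range of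
   \<open>lgs_bounds\<close>.\<close>
 have im: "abs (Im (of_real c * velc e xi z + of_real d)) <= 1" "abs (Re (of_real c * velc e xi z + of_real d) - (c * vel e (xi + Re z *r e) + d)) <= 1"
  if "abs (Im z) <= 2 * ka" for xi z
 proof -
  let ?D = "of_real c * velc e xi z + of_real d - of_real (c * vel e (xi + Re z *r e) + d)"
  have "?D = of_real c * (velc e xi z - of_real (vel e (xi + Re z *r e)))" by (simp add: algebra_simps)
  then have "cmod ?D <= abs c * (8 * abs (Im z))" using velc_dist[of z xi] that ka by (simp add: norm_mult mult_left_mono)
  also have "... <= abs c * (8 * (2 * ka))" using that by (intro mult_left_mono) auto
  also have "... <= 1" using c by simp
  finally have *: "cmod ?D <= 1" .
  show "abs (Im (of_real c * velc e xi z + of_real d)) <= 1" "abs (Re (of_real c * velc e xi z + of_real d) - (c * vel e (xi + Re z *r e) + d)) <= 1"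
   using order_trans[OF abs_Im_le_cmod *] order_trans[OF abs_Re_le_cmod *] by simp_all
 qed
 have "norm (chi {x. x .* e < b} (Mop (%xi. \<mu> xi 0) (chi {x. a < x .* e} X))) <= B * exp (- ka * (a - b)) * norm X"
 proof (rule paley_wiener[where ka' = "2 * ka" and C = "exp (2 * abs T)"])
  show "0 < ka" "ka < 2 * ka" using ka by auto
  have "(%z. of_real (1 + (norm xi)^2) + 2 * z * of_real (xi .* e) + z^2) holomorphic_on {z. abs (Im z) < 2 * ka}" for xi :: "real ^ 'n"
   by (intro holomorphic_intros)
  then have jh: "jpc e xi holomorphic_on {z. abs (Im z) < 2 * ka}" for xi
   unfolding jpc_def[abs_def] using jpc_arg_nonneg ka by (intro holomorphic_on_csqrt') auto
  then have vh: "velc e xi holomorphic_on {z. abs (Im z) < 2 * ka}" for xi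
   unfolding velc_def[abs_def] using jpc_nonzero ka by (intro holomorphic_intros) auto
  show "\<mu> xi holomorphic_on {z. abs (Im z) < 2 * ka}" for xi
   unfolding \<mu>_def[abs_def] lgs_def using lgs_bounds(1)[OF im(1)] by (intro holomorphic_intros jh vh) auto
  show "\<mu> (xi + r *r e) z = \<mu> xi (z + of_real r)" for xi r z unfolding \<mu>_def jpc_translate velc_translate ..
  have half: "abs y < 1" if "0 <= y" "y <= ka" for y using that ka by auto
  have jc: "continuous_on (UNIV \<times> {0..ka}) (%p. jpc e (fst p) (- \<i> * of_real (snd p)))"
  proof -
   have c: "continuous_on (- \<real>\<^sub>\<le>\<^sub>0) csqrt" by (intro continuous_on_csqrt)
   let ?A = "%p. of_real (1 + (norm (fst p))^2) + 2 * (- \<i> * of_real (snd p)) * of_real (fst p .* e) + (- \<i> * of_real (snd p))^2 :: complex"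
   have "?A p \<notin> \<real>\<^sub>\<le>\<^sub>0" if "p : UNIV \<times> {0..ka}" for p
    using half[of "snd p"] that by (intro jpc_arg_nonneg) (auto simp: mem_Times_iff)
   then have "?A ` (UNIV \<times> {0..ka}) \<subseteq> - \<real>\<^sub>\<le>\<^sub>0" by blast
   moreover have "continuous_on (UNIV \<times> {0..ka}) ?A" by (intro continuous_intros)
   ultimately show ?thesis unfolding jpc_def by (intro continuous_on_compose2[OF c])
  qed
  have vc: "continuous_on (UNIV \<times> {0..ka}) (%p. velc e (fst p) (- \<i> * of_real (snd p)))"
   unfolding velc_def by (intro continuous_intros jc) (use jpc_nonzero half in auto)
  show "continuous_on (UNIV \<times> {0..ka}) (%p. \<mu> (fst p) (- \<i> * of_real (snd p)))" unfolding \<mu>_def lgs_def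
   by (intro continuous_intros jc vc) (use lgs_bounds(1)[OF im(1)] ka in auto)
  have nexp: "cmod (exp (- \<i> * of_real T * w)) = exp (T * Im w)" for w by simp
  show "cmod (\<mu> xi (- \<i> * of_real y)) <= exp (2 * abs T)" if y: "0 <= y" "y <= ka" for xi y
  proof -
   obtain \<rho> where \<rho>: "1/2 <= \<rho>" "\<rho> <= 2" "Im (jpc e xi (- \<i> * of_real y)) = - (y * vel e xi * \<rho>)"
    using jpc_imag_bounds(1)[of y xi] y ka by auto
   have "abs (y * vel e xi * \<rho>) <= 1 * 1 * 2" unfolding abs_mult using y ka \<rho> abs_vel_le_1[of xi] by (intro mult_mono) auto
   then have "abs (T * Im (jpc e xi (- \<i> * of_real y))) <= abs T * 2" unfolding \<rho>(3) abs_mult[of T] by (intro mult_left_mono) auto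
   then have "exp (T * Im (jpc e xi (- \<i> * of_real y))) <= exp (2 * abs T)" by simp
   moreover have "cmod (lgs (of_real c * velc e xi (- \<i> * of_real y) + of_real d)) <= 1" using y ka by (intro lgs_bounds(2) im) auto
   ultimately have "exp (T * Im (jpc e xi (- \<i> * of_real y))) * cmod (lgs (of_real c * velc e xi (- \<i> * of_real y) + of_real d)) <= exp (2 * abs T) * 1"
    by (intro mult_mono) auto
   then show ?thesis unfolding \<mu>_def norm_mult nexp by simp
  qed
  show "cmod (\<mu> xi (- \<i> * of_real ka)) <= B" for xi
  proof -
   let ?w = "of_real c * velc e xi (- \<i> * of_real ka) + of_real d"
   obtain \<rho> where \<rho>: "1/2 <= \<rho>" "\<rho> <= 2" "Im (jpc e xi (- \<i> * of_real ka)) = - (ka * vel e xi * \<rho>)"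
    using jpc_imag_bounds(1)[of ka xi] ka by auto
   have i: "abs (Im ?w) <= 1" "abs (Re ?w - (c * vel e xi + d)) <= 1" using im[where z = "- \<i> * of_real ka" and xi = xi] ka by auto
   have "cmod (lgs ?w) <= 2 * exp (Re ?w)" by (rule lgs_bounds(3)[OF i(1)])
   also have "... <= 2 * (exp 1 * exp (c * vel e xi + d))" using i(2) by (simp add: exp_add[symmetric])
   \<comment> \<open>The estimate \<open>2 * exp 1 <= 6\<close> is the origin of the factor 6 in the
     hypothesis on \<open>B\<close>.\<close>
   also have "... <= 6 * exp (c * vel e xi + d)" using mult_right_mono[OF exp_le, of "exp (c * vel e xi + d)"] by simp
   finally have "exp (- (T * ka * vel e xi * \<rho>)) * cmod (lgs ?w) <= B" by (intro B abs_vel_le_1 \<rho> lgs_bounds(2) i) auto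
   then show ?thesis unfolding \<mu>_def norm_mult nexp \<rho>(3) by (simp add: mult_ac)
  qed
 qed
 moreover have "\<mu> xi 0 = cis (- (T * jb xi)) * of_real (slgs (c * vel e xi + d))" for xi
  unfolding \<mu>_def jpc_0 velc_0 lgs_of_real[symmetric] cis_conv_exp by (simp add: mult.assoc)
 ultimately show ?thesis by simp
qed

text \<open>The contour is shifted by \<open>ka = l / E\<close>, where \<open>E\<close> is the
  position reached from \<open>a\<close> at speed \<open>th\<close>, and \<open>q\<close> is
  \<open>ka\<close> times the distance travelled. If the velocity is at least \<open>2 * th\<close>,
  the propagator supplies \<open>exp (- q)\<close>, because \<rho> is at least 1/2. Otherwise the
  logistic factor, centred at \<open>3 * th\<close> with width \<open>th / (4 * l)\<close>, is small
  enough to supply it. The condition \<open>64 * l^2 <= th * E\<close> is the uncertainty principle: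
  it says that the cut-off tolerates the shift.\<close>

lemma outgoing_bound:
 assumes s: "abs s = 1" and th: "0 < th" "th <= 1" and l: "1 <= l" and \<tau>: "0 <= \<tau>"
  and D: "\<tau> * th / 2 <= a + \<tau> * th" "64 * l^2 <= th * (a + \<tau> * th)"
 shows "norm (chi {x. x .* e < (a + \<tau> * th) / 2} (Mop (%xi. cis (- (s * \<tau> * jb xi)) * of_real (slgs (4 * l * (s * vel e xi / th - 3))))
   (chi {x. a < x .* e} X))) <= 6 * exp (- l / 2) * norm X"
proof -
 define E where "E = a + \<tau> * th"
 have l2: "1 <= l^2" "l <= l^2" using l by (auto simp: power2_eq_square mult_le_cancel_right1 one_le_mult_iff intro: order_trans[OF l])
 have E64: "64 * l^2 <= th * E" using D by (simp add: E_def)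
 then have "0 < th * E" using l2 by linarith
 then have E0: "0 < E" using th by (simp add: zero_less_mult_iff)
 have "th * E <= E" using th E0 by simp
 then have E64': "64 * l <= E" using E64 l2 by linarith
 define ka where "ka = l / E"
 have ka: "0 < ka" "ka <= 1/4" using l E0 E64' by (auto simp: ka_def divide_le_eq)
 have kaE: "ka * E = l" using E0 by (simp add: ka_def)
 define q where "q = ka * \<tau> * th"
 have q: "0 <= q" "q <= 2 * l"
 proof -
  show "0 <= q" unfolding q_def using ka \<tau> th by simp
  have "ka * (\<tau> * th) <= ka * (2 * E)" using D(1) ka by (intro mult_left_mono) (auto simp: E_def)
  then show "q <= 2 * l" using kaE by (simp add: q_def mult.assoc mult.left_commute)
 qed
 define c where "c = 4 * l * s / th"
 have c: "16 * abs c * ka <= 1"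
 proof -
  have "16 * abs c * ka = 64 * l^2 / (th * E)" using s th l by (simp add: c_def ka_def abs_mult power2_eq_square)
  also have "... <= 1" using E64 \<open>0 < th * E\<close> by (simp add: divide_le_eq)
  finally show ?thesis .
 qed
 have kaE2: "ka * (a - E / 2) = l / 2 - q" using kaE by (simp add: q_def E_def algebra_simps)
 have "norm (chi {x. x .* e < E / 2} (Mop (%xi. cis (- (s * \<tau> * jb xi)) * of_real (slgs (c * vel e xi + (- 12 * l))))
   (chi {x. a < x .* e} X))) <= (6 * exp (- q)) * exp (- ka * (a - E / 2)) * norm X"
 proof (rule half_space_bound[OF ka c])
  fix v \<rho> z :: real
  assume v: "abs v <= 1" and \<rho>: "1/2 <= \<rho>" "\<rho> <= 2" and z: "0 <= z" "z <= 1" "z <= 6 * exp (c * v + (- 12 * l))"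
  define r where "r = s * v / th"
  have e1: "s * \<tau> * ka * v * \<rho> = q * (r * \<rho>)" using th by (simp add: q_def r_def)
  have e2: "c * v + (- 12 * l) = 4 * l * r - 12 * l" by (simp add: c_def r_def)
  show "exp (- (s * \<tau> * ka * v * \<rho>)) * z <= 6 * exp (- q)"
  proof (cases "r >= 2")
   case True
   have "1 <= r * \<rho>" using True \<rho> mult_mono[of 2 r "1/2" \<rho>] by simp
   then have "q * 1 <= q * (r * \<rho>)" using q by (intro mult_left_mono) auto
   then have "exp (- (q * (r * \<rho>))) * z <= exp (- q) * 1" using z by (intro mult_mono) auto
   then show ?thesis unfolding e1 using exp_gt_zero[of "- q"] by linarith
  next
   case False
   have "- (q * (r * \<rho>)) <= 4 * l * max 0 (- r)"
   proof (cases "r >= 0")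
    case True
    then show ?thesis using q \<rho> l by (simp add: max_def)
   next
    case False
    have "q * (- r * \<rho>) <= (2 * l) * (- r * 2)" using q \<rho> False l by (intro mult_mono) (auto intro: mult_nonpos_nonneg)
    then show ?thesis using False by simp
   qed
   moreover have "4 * l * max 0 (- r) + (4 * l * r - 12 * l) <= - q"
   proof (cases "r >= 0")
    case True
    have "4 * l * r <= 4 * l * 2" using \<open>\<not> 2 <= r\<close> l by (intro mult_left_mono) auto
    moreover have "max 0 (- r) = 0" using True by simp
    ultimately show ?thesis using q by simp
   next
    case False
    then show ?thesis using q l by simp
   qed
   ultimately have "- (q * (r * \<rho>)) + (4 * l * r - 12 * l) <= - q" by linarith
   then have "exp (- (q * (r * \<rho>))) * exp (4 * l * r - 12 * l) <= exp (- q)" by (simp add: exp_add[symmetric])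
   moreover have "exp (- (q * (r * \<rho>))) * z <= exp (- (q * (r * \<rho>))) * (6 * exp (4 * l * r - 12 * l))"
    using z(3) unfolding e2 by (intro mult_left_mono) auto
   ultimately show ?thesis unfolding e1 by linarith
  qed
 qed
 also have "(6 * exp (- q)) * exp (- ka * (a - E / 2)) = 6 * exp (- l / 2)" using kaE2 by (simp add: exp_add[symmetric])
 finally show ?thesis unfolding E_def[symmetric] by (simp add: c_def algebra_simps)
qed

text \<open>The complementary cut-off essentially keeps velocities below \<open>4 * th\<close>, and
  in time \<tau> these cover only a small fraction of \<open>R\<close>. With
  \<open>ka = l / R\<close> the propagator costs at most \<open>exp (l / 4)\<close>, against the
  gain \<open>exp (l / 2)\<close> from the gap between \<open>R\<close> and \<open>R / 2\<close>;
  larger velocities are paid for by the tail of the logistic function.\<close>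

lemma incoming_bound:
 assumes s: "abs s = 1" and th: "0 < th" "th <= 1" and l: "1 <= l" and \<tau>: "0 <= \<tau>" "64 * (\<tau> * th) <= R"
  and R: "64 * l^2 <= th * R"
 shows "norm (chi {x. x .* e < R / 2} (Mop (%xi. cis (s * \<tau> * jb xi) * of_real (1 - slgs (4 * l * (s * vel e xi / th - 3))))
   (chi {x. R < x .* e} X))) <= 6 * exp (- l / 4) * norm X"
proof -
 have l2: "1 <= l^2" "l <= l^2" using l by (auto simp: power2_eq_square mult_le_cancel_right1 one_le_mult_iff intro: order_trans[OF l])
 have "0 < th * R" using l2 R by linarith
 then have R0: "0 < R" using th by (simp add: zero_less_mult_iff)
 have "th * R <= R" using th R0 by simp
 then have R64: "64 * l <= R" using R l2 by linarith
 define ka where "ka = l / R"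
 have ka: "0 < ka" "ka <= 1/4" using l R0 R64 by (auto simp: ka_def divide_le_eq)
 have kaR: "ka * R = l" using R0 by (simp add: ka_def)
 define q where "q = ka * \<tau> * th"
 have q: "0 <= q" "64 * q <= l"
 proof -
  show "0 <= q" unfolding q_def using ka \<tau> th by simp
  have "ka * (64 * (\<tau> * th)) <= ka * R" using \<tau>(2) ka by (intro mult_left_mono) auto
  then show "64 * q <= l" using kaR by (simp add: q_def mult_ac)
 qed
 define c where "c = - (4 * l * s / th)"
 have c: "16 * abs c * ka <= 1"
 proof -
  have "16 * abs c * ka = 64 * l^2 / (th * R)" using s th l by (simp add: c_def ka_def abs_mult power2_eq_square)
  also have "... <= 1" using R \<open>0 < th * R\<close> by (simp add: divide_le_eq)
  finally show ?thesis .
 qed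
 have "norm (chi {x. x .* e < R / 2} (Mop (%xi. cis (- (- (s * \<tau>) * jb xi)) * of_real (slgs (c * vel e xi + 12 * l)))
   (chi {x. R < x .* e} X))) <= (6 * exp (l / 4)) * exp (- ka * (R - R / 2)) * norm X"
 proof (rule half_space_bound[OF ka c])
  fix v \<rho> z :: real
  assume v: "abs v <= 1" and \<rho>: "1/2 <= \<rho>" "\<rho> <= 2" and z: "0 <= z" "z <= 1" "z <= 6 * exp (c * v + 12 * l)"
  define r where "r = s * v / th"
  have e1: "- (- (s * \<tau>) * ka * v * \<rho>) = q * (r * \<rho>)" using th by (simp add: q_def r_def)
  have e2: "c * v + 12 * l = 12 * l - 4 * l * r" by (simp add: c_def r_def)
  show "exp (- (- (s * \<tau>) * ka * v * \<rho>)) * z <= 6 * exp (l / 4)"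
  proof (cases "r <= 4")
   case True
   have "q * (r * \<rho>) <= q * 8"
   proof (intro mult_left_mono q)
    show "r * \<rho> <= 8" using True \<rho> mult_mono[of r 4 \<rho> 2] by (cases "r >= 0") (auto simp: mult_nonpos_nonneg intro: order_trans[of _ 0])
   qed
   then have "q * (r * \<rho>) <= l / 4" using q by linarith
   then have "exp (q * (r * \<rho>)) * z <= exp (l / 4) * 1" using z by (intro mult_mono) auto
   then show ?thesis unfolding e1 using exp_gt_zero[of "l / 4"] by linarith
  next
   case False
   then have r: "4 <= r" by simp
   have "q * (r * \<rho>) <= (l / 64) * (r * 2)" using q \<rho> r by (intro mult_mono) auto
   then have "q * (r * \<rho>) <= (l * r) / 32" by simp
   moreover have "4 * l <= l * r" using mult_left_mono[OF r, of l] l by simp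
   moreover have "4 * l * r = 4 * (l * r)" by simp
   ultimately have "q * (r * \<rho>) + (12 * l - 4 * l * r) <= l / 4" using l by linarith
   then have "exp (q * (r * \<rho>)) * exp (12 * l - 4 * l * r) <= exp (l / 4)" by (simp add: exp_add[symmetric])
   moreover have "exp (q * (r * \<rho>)) * z <= exp (q * (r * \<rho>)) * (6 * exp (12 * l - 4 * l * r))"
    using z(3) unfolding e2 by (intro mult_left_mono) auto
   ultimately show ?thesis unfolding e1 by linarith
  qed
 qed
 also have "(6 * exp (l / 4)) * exp (- ka * (R - R / 2)) = 6 * exp (- l / 4)" using kaR by (simp add: exp_add[symmetric])
 finally show ?thesis unfolding slgs_minus by (simp add: c_def algebra_simps)
qed

lemma free_bound:
 assumes "abs T <= R / 16" and l: "1 <= l" and R: "4 * l <= R"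
 shows "norm (chi {x. x .* e < R / 2} (Mop (%xi. cis (- (T * jb xi))) (chi {x. R < x .* e} X))) <= 2 * exp (- l / 4) * norm X"
proof -
 have R0: "R > 0" using l R by linarith
 define ka where "ka = l / R"
 have ka: "0 < ka" "ka <= 1/4" using l R0 R by (auto simp: ka_def divide_le_eq)
 have kaR: "ka * R = l" using R0 by (simp add: ka_def)
 \<comment> \<open>The bound for half spaces always carries a logistic factor. With both parameters
   zero it is the constant 1/2, which the factor 2 undoes.\<close>
 have eq: "Mop (%xi. cis (- (T * jb xi))) Y = 2 *r Mop (%xi. cis (- (T * jb xi)) * of_real (slgs (0 * vel e xi + 0))) Y" for Y
 proof -
  have b: "bm (%xi. cis (- (T * jb xi)) * of_real (slgs (0 * vel e xi + 0)))" by (intro bmI[of _ 1]) (auto simp: norm_mult slgs_def)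
  have "2 *r Mop (%xi. cis (- (T * jb xi)) * of_real (slgs (0 * vel e xi + 0))) Y
   = Mop (%_. of_real 2) (Mop (%xi. cis (- (T * jb xi)) * of_real (slgs (0 * vel e xi + 0))) Y)" by (simp only: Mop_const mul_of_real)
  also have "... = Mop (%xi. cis (- (T * jb xi))) Y" by (subst Mop_Mop[OF bm_const b]) (simp add: slgs_def)
  finally show ?thesis ..
 qed
 have "norm (chi {x. x .* e < R / 2} (Mop (%xi. cis (- (T * jb xi)) * of_real (slgs (0 * vel e xi + 0)))
   (chi {x. R < x .* e} X))) <= exp (l / 4) * exp (- ka * (R - R / 2)) * norm X"
 proof (rule half_space_bound[OF ka])
  fix v \<rho> z :: real
  assume v: "abs v <= 1" and \<rho>: "1/2 <= \<rho>" "\<rho> <= 2" and z: "0 <= z" "z <= 1"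
  have "abs (T * ka * v * \<rho>) <= R / 16 * ka * 1 * 2" unfolding abs_mult using assms(1) ka v \<rho> R0 by (intro mult_mono) auto
  also have "... = l / 8" using kaR by (simp add: mult.commute)
  finally have "- (T * ka * v * \<rho>) <= l / 4" using l by linarith
  then have "exp (- (T * ka * v * \<rho>)) * z <= exp (l / 4) * 1" using z by (intro mult_mono) auto
  then show "exp (- (T * ka * v * \<rho>)) * z <= exp (l / 4)" by simp
 qed simp
 also have "exp (l / 4) * exp (- ka * (R - R / 2)) = exp (- l / 4)" using kaR by (simp add: exp_add[symmetric])
 finally show ?thesis unfolding eq mul_scaleR by simp
qed

end

lemma japanese_nonzero: "jb xi ~= 0" using japanese_pos[of xi] by simp

section \<open>The free half-wave group and decaying weights\<close>

definition U :: "real => 'n::finite l2 => 'n l2" where "U s = Mop (%xi. cis (- (s * jb xi)))"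

text \<open>The exponent is negative, so the operator is bounded. By duality the growing weight on
  the source becomes this decaying weight on the test vector.\<close>

definition Wt :: "real => 'n::finite l2 => 'n l2" where "Wt sg = mul (%x. of_real (jb x powr - sg))"

lemma bm_cis: "meas m ==> bm (%xi. cis (m xi))" by (intro bmI[of _ 1]) auto

lemma bm_U [simp]: "bm (%xi. cis (- (s * jb xi)))" by (intro bm_cis) measurable

lemma japanese_powr_le_1: "0 <= sg ==> jb x powr - sg <= 1" using powr_mono[of "- sg" 0 "jb x"] japanese_ge_1[of x] japanese_pos[of x] by simp

lemma bm_Wt: "0 <= sg ==> bm (%x. of_real (jb x powr - sg))" by (intro bmI[of _ 1]) (auto simp: japanese_powr_le_1)

lemma U_U: "U s (U t X) = U (s + t) X" by (simp add: U_def Mop_Mop cis_mult) (simp add: algebra_simps)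

lemma U_0 [simp]: "U 0 X = X" by (simp add: U_def)

lemma norm_U: "norm (U s X) = norm X"
proof -
 have le: "norm (U s X) <= norm X" for s and X :: "'a l2" using norm_Mop_le[OF bm_measurable[OF bm_U[of s]], of 1 X] by (simp add: U_def)
 show ?thesis using le[of s X] le[of "- s" "U s X"] by (simp add: U_U)
qed

lemma linear_U: "linear (U s)" by (simp add: U_def linear_Mop)
lemmas U_diff = linear_diff[OF linear_U]
lemmas U_add = linear_add[OF linear_U]

lemma cinner_U: "cinner (U s X) Y = cinner X (U (- s) Y)"
proof -
 have "cnj (cis (- (s * jb xi))) = cis (- (- s * jb xi))" for xi :: "real ^ 'a" by (simp add: cis_cnj)
 then show ?thesis by (simp add: U_def cinner_Mop_left)
qed

lemma U_Mop: "bm m ==> U s (Mop m X) = Mop (%xi. cis (- (s * jb xi)) * m xi) X" by (simp add: U_def Mop_Mop)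

lemma U_Mop_commute: "bm m ==> U s (Mop m X) = Mop m (U s X)" by (simp add: U_def Mop_commute)

lemma U_tendsto:
 fixes X :: "'n::finite l2"
 assumes "r ----> s" shows "(%k. U (r k) X) ----> U s X" unfolding U_def by (rule Mop_tendsto[where B = 1]) (auto intro!: tendsto_intros assms)

lemma continuous_on_U: "continuous_on S (%s. U s X)"
proof (rule continuous_at_imp_continuous_on, rule ballI)
 fix s show "isCont (%s. U s X) s" unfolding continuous_at_sequentially o_def using U_tendsto by blast
qed

lemma norm_Wt_le: "0 <= sg ==> norm (Wt sg X) <= norm X"
 using norm_mul_le[OF bm_measurable[OF bm_Wt[of sg]], of 1 X] japanese_powr_le_1 by (auto simp: Wt_def)

lemma linear_Wt: "linear (Wt sg)" by (simp add: Wt_def linear_mul)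
lemmas Wt_diff = linear_diff[OF linear_Wt]

lemma continuous_on_Wt_U: "continuous_on S (%s. norm (Wt sg (U (c * s) X)))" unfolding Wt_def
 by (intro continuous_on_norm bounded_linear.continuous_on[OF bounded_linear_mul]
   continuous_on_compose2[OF continuous_on_U]) (auto intro!: continuous_intros)

lemma half_space_borel [measurable]:
 "{x :: real ^ 'n::finite. x .* e < b} : sets borel" "{x :: real ^ 'n. a < x .* e} : sets borel"
 "{x :: real ^ 'n. x .* e <= b} : sets borel" by (intro borel_open borel_closed open_Collect_less closed_Collect_le continuous_intros)+

lemma slab_borel [measurable]:
 "{x :: real ^ 'n::finite. a < x .* e & x .* e <= L} : sets borel" "{x :: real ^ 'n. abs (x .* e) < c} : sets borel"
proof -
 have "{x :: real ^ 'n. a < x .* e & x .* e <= L} = {x. a < x .* e} \<inter> {x. x .* e <= L}"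
  "{x :: real ^ 'n. abs (x .* e) < c} = {x. x .* e < c} \<inter> {x. - c < x .* e}" by auto
 then show "{x :: real ^ 'n. a < x .* e & x .* e <= L} : sets borel" "{x :: real ^ 'n. abs (x .* e) < c} : sets borel"
  by (simp_all only: sets.Int half_space_borel)
qed

text \<open>This converts weighted norms into half-space norms, which are what contour shifts
  control: where \<open>x .* e >= b\<close> the weight itself is at most
  \<open>b powr - sg\<close>.\<close>

lemma weight_split:
 assumes e: "norm e = 1" and b: "b > 0" and sg: "sg >= 0"
 shows "norm (Wt sg X) <= norm (chi {x. x .* e < b} X) + b powr - sg * norm X"
proof -
 let ?I = "ind {x. x .* e < b} :: _ => complex"
 have bI: "bm ?I" by (intro bm_indicator half_space_borel)
 have bW: "bm (%x. of_real (jb x powr - sg))" by (rule bm_Wt[OF sg])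
 have eq: "Wt sg X = mul (%x. of_real (jb x powr - sg) * ?I x) X + mul (%x. of_real (jb x powr - sg) * (1 - ?I x)) X"
  unfolding Wt_def by (subst mul_add_left) (auto intro!: bm_mult bW bI bm_diff simp: algebra_simps)
 have "norm (mul (%x. of_real (jb x powr - sg) * ?I x) X) <= norm (mul ?I X)"
  using japanese_powr_le_1[OF sg] by (intro norm_mul_mono bm_mult bW bI) (auto simp: indicator_def)
 moreover have "norm (mul (%x. of_real (jb x powr - sg) * (1 - ?I x)) X) <= b powr - sg * norm X"
 proof (rule norm_mul_le)
  show "meas (%x. of_real (jb x powr - sg) * (1 - ?I x))" by (intro bm_measurable bm_mult bW bm_diff bI bm_const)
  fix x
  have "b <= x .* e ==> jb x powr - sg <= b powr - sg" using abs_inner_le_japanese[OF e, of x] b sg by (intro powr_mono2') auto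
  then show "cmod (of_real (jb x powr - sg) * (1 - ?I x)) <= b powr - sg" by (auto simp: indicator_def)
 qed
 ultimately show ?thesis unfolding eq using norm_triangle_ineq add_mono order_trans by meson
qed

text \<open>The space is divided at \<open>jb x = s\<close>. Taken at \<open>s\<close> equal to the
  elapsed time, both terms have the same order if weight 1 gives decay of order 1 and weight 2 decay
  of order 2.\<close>

lemma weight_interpolation:
 assumes s: "s > 0" and sg: "1 <= sg" "sg <= 2"
 shows "norm (Wt sg X) <= s powr (2 - sg) * norm (Wt 2 X) + s powr (1 - sg) * norm (Wt 1 X)"
proof -
 let ?f = "%x. jb x powr - sg"
 let ?A = "{x. jb x <= s}"
 have "closed ?A" by (intro closed_Collect_le continuous_intros)
 then have A: "?A : sets borel" by (rule borel_closed)
 have bW: "bm (%x. of_real (jb x powr - r))" if "r >= 0" for r by (rule bm_Wt[OF that])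
 have eq: "Wt sg X = mul (%x. ind ?A x * of_real (?f x)) X + mul (%x. (1 - ind ?A x) * of_real (?f x)) X"
  unfolding Wt_def using sg A by (subst mul_add_left) (auto intro!: bm_mult bW bm_indicator bm_diff simp: algebra_simps)
 have "norm (Wt sg X) <= norm (mul (%x. ind ?A x * of_real (?f x)) X) + norm (mul (%x. (1 - ind ?A x) * of_real (?f x)) X)"
  unfolding eq by (rule norm_triangle_ineq)
 also have "... <= norm (mul (%x. of_real (s powr (2 - sg)) * of_real (jb x powr - 2)) X)
   + norm (mul (%x. of_real (s powr (1 - sg)) * of_real (jb x powr - 1)) X)"
 proof (intro add_mono norm_mul_mono)
  fix x
  have "jb x powr - sg = jb x powr (2 - sg) * jb x powr - 2" by (simp add: powr_add[symmetric])
  also have "jb x <= s ==> ... <= s powr (2 - sg) * jb x powr - 2" using sg japanese_pos[of x] by (intro mult_right_mono powr_mono2) auto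
  finally show "cmod (ind ?A x * of_real (?f x)) <= cmod (of_real (s powr (2 - sg)) * of_real (jb x powr - 2))"
   by (auto simp: indicator_def norm_mult norm_divide)
  have "jb x powr - sg = jb x powr (1 - sg) * jb x powr - 1" by (subst powr_add[symmetric]) simp
  also have "s <= jb x ==> ... <= s powr (1 - sg) * jb x powr - 1" using sg s by (intro mult_right_mono powr_mono2') auto
  finally show "cmod ((1 - ind ?A x) * of_real (?f x)) <= cmod (of_real (s powr (1 - sg)) * of_real (jb x powr - 1))"
   by (auto simp: indicator_def norm_mult norm_divide)
 next
  show "bm (%x. of_real (s powr (1 - sg)) * of_real (jb x powr - 1))"
   "bm (%x. of_real (s powr (2 - sg)) * of_real (jb x powr - 2))" by (intro bm_mult bW bm_const; simp)+
  show "bm (%x. ind ?A x * of_real (?f x))" "bm (%x. (1 - ind ?A x) * of_real (?f x))"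
   by (intro bm_mult bW bm_const bm_indicator bm_diff A; use sg in simp)+
 qed
 also have "... = s powr (2 - sg) * norm (Wt 2 X) + s powr (1 - sg) * norm (Wt 1 X)"
 proof -
  have n: "norm (mul (%x. of_real c * of_real (jb x powr - r)) X) = c * norm (Wt r X)" if "0 <= c" "0 <= r" for c r
   unfolding Wt_def mul_mul[OF bm_const bW[OF that(2)], symmetric] mul_of_real using that(1) by simp
  show ?thesis using n[of "s powr (2 - sg)" 2] n[of "s powr (1 - sg)" 1] by (simp only: powr_ge_zero zero_le_numeral zero_le_one)
 qed
 finally show ?thesis .
qed

section \<open>Dispersive decay by two integrations by parts\<close>

text \<open>A symbol with two derivatives along \<open>e\<close> under a common bound; two is the
  number that the integrations by parts consume.\<close>

definition sym2 where "sym2 e P d d1 d2 \<longleftrightarrow> edif e d d1 & edif e d1 d2 & (ALL xi. cmod (d xi) <= P & cmod (d1 xi) <= P & cmod (d2 xi) <= P)"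

lemma sym2_mult:
 assumes "sym2 e P d d1 d2" "sym2 e R r r1 r2"
 shows "sym2 e (4 * P * R) (%xi. d xi * r xi) (%xi. d1 xi * r xi + d xi * r1 xi) (%xi. d2 xi * r xi + 2 * (d1 xi * r1 xi) + d xi * r2 xi)"
 unfolding sym2_def
proof (intro conjI allI)
 have ed: "edif e d d1" "edif e d1 d2" "edif e r r1" "edif e r1 r2"
  and b: "!!xi. cmod (d xi) <= P" "!!xi. cmod (d1 xi) <= P" "!!xi. cmod (d2 xi) <= P"
   "!!xi. cmod (r xi) <= R" "!!xi. cmod (r1 xi) <= R" "!!xi. cmod (r2 xi) <= R" using assms by (auto simp: sym2_def)
 have P0: "P >= 0" "R >= 0" using order_trans[OF norm_ge_zero b(1)] order_trans[OF norm_ge_zero b(4)] by auto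
 show "edif e (%xi. d xi * r xi) (%xi. d1 xi * r xi + d xi * r1 xi)" by (intro edif_mult ed)
 have "edif e (%xi. d1 xi * r xi + d xi * r1 xi) (%xi. (d2 xi * r xi + d1 xi * r1 xi) + (d1 xi * r1 xi + d xi * r2 xi))"
  by (intro edif_mult edif_add ed)
 then show "edif e (%xi. d1 xi * r xi + d xi * r1 xi) (%xi. d2 xi * r xi + 2 * (d1 xi * r1 xi) + d xi * r2 xi)" by (simp add: algebra_simps)
 fix xi
 have m: "cmod (u * v) <= P * R" if "cmod u <= P" "cmod v <= R" for u v unfolding norm_mult using that P0 by (intro mult_mono) auto
 note mm = m[OF b(1)[of xi] b(4)[of xi]] m[OF b(1)[of xi] b(5)[of xi]] m[OF b(1)[of xi] b(6)[of xi]]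
  m[OF b(2)[of xi] b(4)[of xi]] m[OF b(2)[of xi] b(5)[of xi]] m[OF b(3)[of xi] b(4)[of xi]]
 have PR: "0 <= P * R" using P0 by simp
 have e4: "4 * P * R = 4 * (P * R)" by simp
 show "cmod (d xi * r xi) <= 4 * P * R" using mm PR unfolding e4 by linarith
 show "cmod (d1 xi * r xi + d xi * r1 xi) <= 4 * P * R" using norm_triangle_ineq[of "d1 xi * r xi" "d xi * r1 xi"] mm PR unfolding e4 by linarith
 have "cmod (2 * (d1 xi * r1 xi)) <= 2 * (P * R)" using mm(5) by (simp add: norm_mult)
 then show "cmod (d2 xi * r xi + 2 * (d1 xi * r1 xi) + d xi * r2 xi) <= 4 * P * R"
  using norm_triangle_ineq[of "d2 xi * r xi + 2 * (d1 xi * r1 xi)" "d xi * r2 xi"]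
   norm_triangle_ineq[of "d2 xi * r xi" "2 * (d1 xi * r1 xi)"] mm PR unfolding e4 by linarith
qed

lemma edif_inverse:
 assumes "edif e q q1" "!!xi. q xi ~= 0"
 shows "edif e (%xi. 1 / q xi) (%xi. - (1 / (q xi * q xi)) * q1 xi)"
proof (rule edif_chain[OF assms(1), of "%z. 1 / z" "%z. - (1 / (z * z))"])
 show "((%z. 1 / z) has_field_derivative - (1 / (q xi * q xi))) (at (q xi))" for xi using assms(2)[of xi] by (auto intro!: derivative_eq_intros)
 show "continuous_on (range q) (%z. - (1 / (z * z)))" using assms(2) by (auto intro!: continuous_intros)
qed

lemma sym2_inverse:
 assumes q: "sym2 e P q q1 q2" and m: "!!xi. m <= cmod (q xi)" "0 < m" "m <= 1" and P: "1 <= P"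
 shows "EX r1 r2. sym2 e (3 * P^2 / m ^ 3) (%xi. 1 / q xi) r1 r2"
proof -
 have ed: "edif e q q1" "edif e q1 q2"
  and b: "!!xi. cmod (q xi) <= P" "!!xi. cmod (q1 xi) <= P" "!!xi. cmod (q2 xi) <= P" using q by (auto simp: sym2_def)
 have q0: "q xi ~= 0" for xi using m(1)[of xi] m(2) by auto
 have e1: "edif e (%xi. 1 / q xi) (%xi. - (1 / (q xi * q xi)) * q1 xi)" by (rule edif_inverse[OF ed(1) q0])
 have e2: "edif e (%xi. - (1 / (q xi * q xi))) (%xi. 2 / (q xi * q xi * q xi) * q1 xi)"
 proof (rule edif_chain[OF ed(1), of "%z. - (1 / (z * z))" "%z. 2 / (z * z * z)"])
  show "((%z. - (1 / (z * z))) has_field_derivative 2 / (q xi * q xi * q xi)) (at (q xi))" for xi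
   using q0[of xi] by (auto intro!: derivative_eq_intros simp: field_simps)
  show "continuous_on (range q) (%z. 2 / (z * z * z))" using q0 by (auto intro!: continuous_intros)
 qed
 have e3: "edif e (%xi. - (1 / (q xi * q xi)) * q1 xi) (%xi. 2 / (q xi * q xi * q xi) * q1 xi * q1 xi + - (1 / (q xi * q xi)) * q2 xi)"
  by (intro edif_mult e2 ed)
 have m3: "m ^ 3 <= m" "m ^ 3 <= m^2" using m by (auto simp: power_le_one power_decreasing[of 2 3] power_decreasing[of 1 3, simplified])
 have P1: "1 <= P^2" "P <= P^2" using P by (auto simp: power2_eq_square one_le_mult_iff mult_le_cancel_right1 intro: mult_ge1_I)
 have iv: "cmod (1 / q xi) <= 1 / m" for xi using m(1)[of xi] m(2) by (simp add: norm_divide divide_simps)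
 have p1: "1 / m <= P^2 / m ^ 3" using P1 m3 m by (intro frac_le) auto
 have p2: "P / m^2 <= P^2 / m ^ 3" using P1 m3 m by (intro frac_le) auto
 have k2: "cmod (1 / (q xi * q xi) * z) <= P / m^2" if "cmod z <= P" for xi z
 proof -
  have "cmod (1 / q xi * (1 / q xi) * z) <= 1 / m * (1 / m) * P" unfolding norm_mult using iv[of xi] that m by (intro mult_mono) auto
  then show ?thesis by (simp add: power2_eq_square)
 qed
 have k3: "cmod (2 / (q xi * q xi * q xi) * q1 xi * q1 xi) <= 2 * (P^2 / m ^ 3)" for xi
 proof -
  have "cmod (2 * (1 / q xi * (1 / q xi) * (1 / q xi) * (q1 xi * q1 xi))) <= 2 * (1 / m * (1 / m) * (1 / m) * (P * P))"
   unfolding norm_mult using iv[of xi] b(2)[of xi] m P by (intro mult_mono) auto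
  then show ?thesis by (simp add: power2_eq_square power3_eq_cube mult.assoc)
 qed
 have pos: "0 <= P^2 / m ^ 3" using m by simp
 have e3P: "3 * P^2 / m ^ 3 = 3 * (P^2 / m ^ 3)" by simp
 have "sym2 e (3 * P^2 / m ^ 3) (%xi. 1 / q xi) (%xi. - (1 / (q xi * q xi)) * q1 xi)
   (%xi. 2 / (q xi * q xi * q xi) * q1 xi * q1 xi + - (1 / (q xi * q xi)) * q2 xi)" unfolding sym2_def e3P
 proof (intro conjI allI e1 e3)
  fix xi
  show "cmod (1 / q xi) <= 3 * (P^2 / m ^ 3)" using iv[of xi] p1 pos by linarith
  have "cmod (- (1 / (q xi * q xi)) * q1 xi) <= P / m^2" using k2[OF b(2)[of xi], of xi] by (simp add: norm_mult norm_divide)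
  then show "cmod (- (1 / (q xi * q xi)) * q1 xi) <= 3 * (P^2 / m ^ 3)" using p2 pos by linarith
  have "cmod (- (1 / (q xi * q xi)) * q2 xi) <= P / m^2" using k2[OF b(3)[of xi], of xi] by (simp add: norm_mult norm_divide)
  then show "cmod (2 / (q xi * q xi * q xi) * q1 xi * q1 xi + - (1 / (q xi * q xi)) * q2 xi) <= 3 * (P^2 / m ^ 3)"
   using norm_triangle_ineq[of "2 / (q xi * q xi * q xi) * q1 xi * q1 xi" "- (1 / (q xi * q xi)) * q2 xi"] k3[of xi] p2 pos by linarith
 qed
 then show ?thesis by blast
qed

context
 fixes e :: "real ^ 'n::finite"
 assumes e: "norm e = 1"
begin

definition vc where "vc xi = cor (vel e xi)"
definition ic :: "real ^ 'n => complex" where "ic xi = cor (1 / jb xi)"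

lemma edif_japanese: "edif e (%xi. cor (jb xi)) vc" unfolding edif_def
proof (intro conjI allI)
 show "continuous_on UNIV (%xi :: real ^ 'n. cor (jb xi))" by (intro continuous_intros)
 show "continuous_on UNIV vc" unfolding vc_def[abs_def] vel_def using japanese_nonzero by (intro continuous_intros) auto
 fix xi :: "real ^ 'n"
 have ee: "e .* e = 1" using e by (simp add: power2_norm_eq_inner[symmetric])
 have n: "(norm (xi + r *r e))^2 = (norm xi)^2 + 2 * r * (xi .* e) + r^2" for r
  unfolding power2_norm_eq_inner using ee by (simp add: inner_add_left inner_add_right inner_commute[of e xi] power2_eq_square distrib_left)
 have "((%r. sqrt (1 + ((norm xi)^2 + 2 * r * (xi .* e) + r^2))) has_real_derivative vel e xi) (at 0)"
 proof -
  have "0 < 1 + (norm xi)^2" by (simp add: add_pos_nonneg)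
  then show ?thesis by (auto intro!: derivative_eq_intros simp: vel_def japanese_def divide_simps)
 qed
 then have "((%r. jb (xi + r *r e)) has_real_derivative vel e xi) (at 0)" by (simp add: japanese_def n)
 then show "((%r. cor (jb (xi + r *r e))) has_vector_derivative vc xi) (at 0)"
  unfolding vc_def by (intro has_vector_derivative_of_real) (simp add: has_real_derivative_iff_has_vector_derivative)
qed

lemma edif_ic: "edif e ic (%xi. - (ic xi * ic xi) * vc xi)"
proof -
 have "edif e (%xi. 1 / cor (jb xi)) (%xi. - (1 / (of_real (jb xi) * of_real (jb xi))) * vc xi)"
  by (rule edif_inverse[OF edif_japanese]) (simp add: japanese_nonzero)
 then show ?thesis by (simp add: ic_def[abs_def])
qed

lemma edif_inner: "edif e (%xi. cor (xi .* e)) (%_. 1)" unfolding edif_def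
proof (intro conjI allI)
 fix xi :: "real ^ 'n"
 have ee: "e .* e = 1" using e by (simp add: power2_norm_eq_inner[symmetric])
 have "((%r. cor (xi .* e + r)) has_vector_derivative of_real 1) (at 0)"
  by (intro has_vector_derivative_of_real) (auto intro!: derivative_eq_intros simp: has_real_derivative_iff_has_vector_derivative[symmetric])
 then show "((%r. cor ((xi + r *r e) .* e)) has_vector_derivative 1) (at 0)" by (simp add: inner_add_left ee)
qed (auto intro!: continuous_intros)

lemma vc_ic: "vc xi = of_real (xi .* e) * ic xi" by (simp add: vc_def ic_def vel_def)

lemma edif_vc: "edif e vc (%xi. ic xi * (1 - vc xi * vc xi))"
proof -
 have "edif e (%xi. of_real (xi .* e) * ic xi) (%xi. 1 * ic xi + of_real (xi .* e) * (- (ic xi * ic xi) * vc xi))"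
  by (intro edif_mult edif_inner edif_ic)
 moreover have "1 * ic xi + of_real (xi .* e) * (- (ic xi * ic xi) * vc xi) = ic xi * (1 - vc xi * vc xi)" for xi by (simp add: vc_ic algebra_simps)
 ultimately show ?thesis by (simp add: vc_ic[abs_def])
qed

definition vc1 where "vc1 xi = ic xi * (1 - vc xi * vc xi)"
definition vc2 where "vc2 xi = - (ic xi * ic xi) * vc xi * (1 - vc xi * vc xi) + ic xi * (- (2 * (vc xi * vc1 xi)))"

lemma norm_vc: "cmod (vc xi) <= 1" and norm_ic: "cmod (ic xi) <= 1" and norm_vc1: "cmod (vc1 xi) <= 1" and norm_vc2: "cmod (vc2 xi) <= 3"
proof -
 show v: "cmod (vc xi) <= 1" using abs_vel_le_1[OF e] by (simp add: vc_def)
 show i: "cmod (ic xi) <= 1" using japanese_ge_1[of xi] japanese_pos[of xi] by (simp add: ic_def norm_divide)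
 have "(abs (vel e xi))^2 <= 1" using abs_vel_le_1[OF e, of xi] by (intro power_le_one) auto
 then have "abs (1 - vel e xi * vel e xi) <= 1" using zero_le_power2[of "vel e xi"] by (simp add: power2_eq_square abs_le_iff)
 moreover have "1 - vc xi * vc xi = of_real (1 - vel e xi * vel e xi)" by (simp add: vc_def)
 ultimately have q: "cmod (1 - vc xi * vc xi) <= 1" by (metis norm_of_real)
 show v1: "cmod (vc1 xi) <= 1" unfolding vc1_def norm_mult using i q mult_mono[of "cmod (ic xi)" 1 "cmod (1 - vc xi * vc xi)" 1] by simp
 have m: "cmod (a * b) <= 1" if "cmod a <= 1" "cmod b <= 1" for a b using that mult_mono[of "cmod a" 1 "cmod b" 1] by (simp add: norm_mult)
 have "cmod (- (ic xi * ic xi) * vc xi * (1 - vc xi * vc xi)) <= 1" using m[OF m[OF m[OF i i] v] q] by (simp add: norm_mult)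
 moreover have "cmod (ic xi * (- (2 * (vc xi * vc1 xi)))) <= 2" using m[OF i m[OF v v1]] by (simp add: norm_mult)
 ultimately show "cmod (vc2 xi) <= 3"
  unfolding vc2_def using norm_triangle_ineq[of "- (ic xi * ic xi) * vc xi * (1 - vc xi * vc xi)" "ic xi * (- (2 * (vc xi * vc1 xi)))"] by linarith
qed

lemma sym2_vc: "sym2 e 3 vc vc1 vc2"
proof -
 have 1: "edif e vc vc1" unfolding vc1_def[abs_def] by (rule edif_vc)
 have "edif e (%xi. ic xi * (1 + (-1) * (vc xi * vc xi)))
   (%xi. (- (ic xi * ic xi) * vc xi) * (1 + (-1) * (vc xi * vc xi)) + ic xi * (0 + (0 * (vc xi * vc xi) + (-1) * (vc1 xi * vc xi + vc xi * vc1 xi))))"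
  by (intro edif_mult edif_add edif_const edif_ic 1)
 moreover have "(- (ic xi * ic xi) * vc xi) * (1 + (-1) * (vc xi * vc xi)) + ic xi * (0 + (0 * (vc xi * vc xi) + (-1) * (vc1 xi * vc xi + vc xi * vc1 xi))) = vc2 xi" for xi
  unfolding vc2_def by (simp add: mult.commute)
 ultimately have 2: "edif e vc1 vc2" unfolding vc1_def[abs_def] by simp
 show ?thesis unfolding sym2_def using 1 2 norm_vc norm_vc1 norm_vc2 order_trans[of _ 1 3] by force
qed

lemma edif_cis: "edif e (%xi. cis (- (s * jb xi))) (%xi. - \<i> * s * vc xi * cis (- (s * jb xi)))"
proof -
 have "edif e (%xi. exp (- \<i> * of_real s * of_real (jb xi))) (%xi. (- \<i> * of_real s * exp (- \<i> * of_real s * of_real (jb xi))) * vc xi)"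
  by (rule edif_chain[OF edif_japanese, of "%z. exp (- \<i> * of_real s * z)" "%z. - \<i> * of_real s * exp (- \<i> * of_real s * z)"])
   (auto intro!: derivative_eq_intros continuous_intros)
 moreover have "exp (- \<i> * of_real s * of_real (jb xi)) = cis (- (s * jb xi))" for xi :: "real ^ 'n" by (simp add: cis_conv_exp mult.assoc)
 ultimately show ?thesis by (simp add: mult_ac)
qed

end

lemma L2_mult_bound:
 assumes f: "f : L2" and m: "meas m" "!!x. cmod (m x) <= B"
 shows "(%x. m x * f x) : L2" "norm (cls (%x. m x * f x)) <= B * norm (cls f)"
proof -
 have bm: "bm m" by (rule bmI[OF m])
 show "(%x. m x * f x) : L2" by (rule L2_bm[OF bm f])
 show "norm (cls (%x. m x * f x)) <= B * norm (cls f)" unfolding cls_mul[OF f bm, symmetric] by (rule norm_mul_le[OF m])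
qed

lemma L2_add_bound:
 assumes "f : L2" "norm (cls f) <= a" "g : L2" "norm (cls g) <= b"
 shows "(%x. f x + g x) : L2" "norm (cls (%x. f x + g x)) <= a + b"
proof -
 show "(%x. f x + g x) : L2" using assms by (intro L2_add)
 show "norm (cls (%x. f x + g x)) <= a + b"
  unfolding cls_add[OF assms(1,3), symmetric] using norm_triangle_ineq[of "cls f" "cls g"] assms(2,4) by linarith
qed

lemma norm_Wt_antimono: "0 <= r ==> r <= s ==> norm (Wt s X) <= norm (Wt r X)" unfolding Wt_def using japanese_ge_1
 by (intro norm_mul_mono bm_Wt) (auto intro!: powr_mono)

context
 fixes e :: "real ^ 'n::finite"
 assumes e: "norm e = 1"
begin

abbreviation (input) "v \<equiv> vc e"
abbreviation (input) "v1 \<equiv> vc1 e"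
abbreviation (input) "v2 \<equiv> vc2 e"

lemma v_edif: "edif e v v1" "edif e v1 v2" using sym2_vc[OF e] by (auto simp: sym2_def)

lemma v_meas [measurable]: "meas v" "meas v1" "meas v2" using v_edif edif_measurable by blast+

text \<open>One integration by parts in the oscillating factor, which costs one power of the weight.\<close>

lemma propagator_by_parts:
 assumes k: "k >= 1" and H: "edif e H Ha" "H : L2" "Ha : L2" and s: "s ~= 0"
 shows "norm (Wt k (FI (cls (%xi. cis (- (s * jb xi)) * (v xi * (v xi * H xi)))))) <=
  (norm (Wt (k - 1) (FI (cls (%xi. cis (- (s * jb xi)) * (v xi * H xi)))))
   + norm (Wt k (FI (cls (%xi. cis (- (s * jb xi)) * (v1 xi * H xi + v xi * Ha xi)))))) / abs s"
proof -
 let ?E = "%xi. cis (- (s * jb xi))"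
 define G where "G xi = ?E xi * (v xi * H xi)" for xi
 define D where "D xi = v1 xi * H xi + v xi * Ha xi" for xi
 define dG where "dG xi = (- \<i> * s * v xi * ?E xi) * (v xi * H xi) + ?E xi * D xi" for xi
 have Em: "meas ?E" by measurable
 have eG: "edif e G dG" unfolding G_def[abs_def] dG_def[abs_def] D_def by (intro edif_mult edif_cis[OF e] v_edif H)
 have D: "D : L2" unfolding D_def[abs_def]
  by (intro L2_add L2_mult_bound[OF H(2) v_meas(2), of 1] L2_mult_bound[OF H(3) v_meas(1), of 1] norm_vc1[OF e] norm_vc[OF e])
 have vH: "(%xi. v xi * H xi) : L2" by (rule L2_mult_bound[OF H(2) v_meas(1) norm_vc[OF e]])
 then have G: "G : L2" unfolding G_def[abs_def] by (rule L2_mult_bound[OF _ Em, of _ 1]) simp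
 have ED: "(%xi. ?E xi * D xi) : L2" by (rule L2_mult_bound[OF D Em, of 1]) simp
 have EvvH: "(%xi. ?E xi * (v xi * (v xi * H xi))) : L2" by (rule L2_mult_bound[OF L2_mult_bound(1)[OF vH v_meas(1) norm_vc[OF e]] Em, of 1]) simp
 have dGeq: "dG xi = (- \<i> * s) * (?E xi * (v xi * (v xi * H xi))) + ?E xi * D xi" for xi by (simp add: dG_def mult_ac)
 have dG: "dG : L2" unfolding dGeq[abs_def] by (intro L2_add L2_cmult EvvH ED)
 have bW: "bm (%x. cor (jb x powr - k))" by (rule bm_Wt) (use k in simp)
 have jk: "jb x powr - k = jb x powr - (k - 1) / jb x" for x :: "real ^ 'n" using powr_diff[of "jb x" "- (k - 1)" 1] japanese_pos[of x] by simp
 \<comment> \<open>The factor \<open>x .* e\<close> produced by the derivative lowers the weight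
   from \<open>k\<close> to \<open>k - 1\<close>.\<close>
 have bnd: "cmod (of_real (x .* e) * of_real (jb x powr - k)) <= cmod (cor (jb x powr - (k - 1)))" for x
 proof -
  have "abs (x .* e) / jb x <= 1" using abs_inner_le_japanese[OF e, of x] japanese_pos[of x] by simp
  then have "(abs (x .* e) / jb x) * jb x powr - (k - 1) <= 1 * jb x powr - (k - 1)" by (intro mult_right_mono) auto
  then show ?thesis unfolding norm_mult norm_of_real jk using japanese_pos[of x] by simp
 qed
 have bxW: "bm (%x. of_real (x .* e) * cor (jb x powr - k))"
 proof (rule bmI[of _ 1])
  show "cmod (of_real (x .* e) * of_real (jb x powr - k)) <= 1" for x using order_trans[OF bnd[of x]] japanese_powr_le_1[of "k - 1" x] k by simp
 qed measurable
 have "norm (Wt k (FI (cls dG))) = norm (mul (%x. - \<i> * (of_real (x .* e) * cor (jb x powr - k))) (FI (cls G)))"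
  unfolding Wt_def by (subst mul_FI_edif[OF eG G dG bW bxW]) simp
 also have "... <= norm (Wt (k - 1) (FI (cls G)))" unfolding Wt_def
  by (intro norm_mul_mono bm_mult[OF bm_const bxW] bm_Wt) (use k bnd in \<open>auto simp: norm_mult\<close>)
 finally have n1: "norm (Wt k (FI (cls dG))) <= norm (Wt (k - 1) (FI (cls G)))" .
 have "cls dG = mul (%_. - \<i> * s) (cls (%xi. ?E xi * (v xi * (v xi * H xi)))) + cls (%xi. ?E xi * D xi)"
  unfolding cls_mul[OF EvvH bm_const] cls_add[OF L2_cmult[OF EvvH] ED] dGeq[abs_def] ..
 then have "mul (%_. - \<i> * s) (cls (%xi. ?E xi * (v xi * (v xi * H xi)))) = cls dG - cls (%xi. ?E xi * D xi)" by simp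
 then have "Wt k (FI (mul (%_. - \<i> * s) (cls (%xi. ?E xi * (v xi * (v xi * H xi)))))) = Wt k (FI (cls dG)) - Wt k (FI (cls (%xi. ?E xi * D xi)))"
  by (simp add: FI_diff Wt_diff)
 moreover have "Wt k (FI (mul (%_. - \<i> * s) Z)) = mul (%_. - \<i> * s) (Wt k (FI Z))" for Z :: "'n l2"
  unfolding FI_const Wt_def by (rule mul_commute[OF bW bm_const])
 ultimately have eq: "mul (%_. - \<i> * s) (Wt k (FI (cls (%xi. ?E xi * (v xi * (v xi * H xi)))))) = Wt k (FI (cls dG)) - Wt k (FI (cls (%xi. ?E xi * D xi)))"
  by (simp only:)
 have "abs s * norm (Wt k (FI (cls (%xi. ?E xi * (v xi * (v xi * H xi)))))) = norm (Wt k (FI (cls dG)) - Wt k (FI (cls (%xi. ?E xi * D xi))))"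
  unfolding eq[symmetric] norm_mul_const by (simp add: norm_mult)
 also have "... <= norm (Wt (k - 1) (FI (cls G))) + norm (Wt k (FI (cls (%xi. ?E xi * D xi))))"
  using norm_triangle_ineq4 n1 by (meson add_right_mono order_trans)
 finally show ?thesis using s unfolding G_def[abs_def] D_def[abs_def] by (simp add: field_simps)
qed

lemma propagator_decay_1:
 assumes H: "edif e H Ha" "H : L2" "Ha : L2" and s: "s ~= 0"
 shows "norm (Wt 1 (FI (cls (%xi. cis (- (s * jb xi)) * (v xi * (v xi * H xi)))))) <= (2 * norm (cls H) + norm (cls Ha)) / abs s"
proof -
 let ?E = "%xi. cis (- (s * jb xi))"
 have Em: "meas ?E" by measurable
 note vH = L2_mult_bound[OF H(2) v_meas(1) norm_vc[OF e]]
 note v1H = L2_mult_bound[OF H(2) v_meas(2) norm_vc1[OF e]]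
 note vH1 = L2_mult_bound[OF H(3) v_meas(1) norm_vc[OF e]]
 have E: "norm (cls (%xi. ?E xi * F xi)) <= norm (cls F)" if "F : L2" for F using L2_mult_bound(2)[OF that Em, of 1] by simp
 have "norm (Wt (1 - 1) (FI (cls (%xi. ?E xi * (v xi * H xi))))) <= norm (cls H)"
  using order_trans[OF norm_Wt_le[of 0] order_trans[OF eq_refl[OF norm_FI] order_trans[OF E[OF vH(1)] vH(2)]]] by simp
 moreover have "norm (Wt 1 (FI (cls (%xi. ?E xi * (v1 xi * H xi + v xi * Ha xi))))) <= norm (cls H) + norm (cls Ha)"
 proof -
  have "norm (Wt 1 (FI (cls (%xi. ?E xi * (v1 xi * H xi + v xi * Ha xi))))) <= norm (cls (%xi. v1 xi * H xi + v xi * Ha xi))"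
   using order_trans[OF norm_Wt_le[of 1] order_trans[OF eq_refl[OF norm_FI] E[OF L2_add[OF v1H(1) vH1(1)]]]] by simp
  also have "... <= norm (cls H) + norm (cls Ha)" unfolding cls_add[OF v1H(1) vH1(1), symmetric]
   using norm_triangle_ineq[of "cls (%xi. v1 xi * H xi)" "cls (%xi. v xi * Ha xi)"] v1H(2) vH1(2) by simp
  finally show ?thesis .
 qed
 ultimately have "norm (Wt (1 - 1) (FI (cls (%xi. ?E xi * (v xi * H xi))))) + norm (Wt 1 (FI (cls (%xi. ?E xi * (v1 xi * H xi + v xi * Ha xi))))) <= 2 * norm (cls H) + norm (cls Ha)"
  by linarith
 then show ?thesis using propagator_by_parts[OF order_refl H s] s by (meson abs_ge_zero divide_right_mono order_trans)
qed

text \<open>The phase is stationary where the velocity vanishes, hence the factor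
  \<open>v xi ^ 4\<close>: each integration by parts uses two powers. One gives the rate
  \<open>1 / abs s\<close> in weight 1 with constant 4, two give \<open>1 / (abs s)^2\<close> in
  weight 2 with constant 18, and interpolation adds the constants to 22.\<close>

lemma propagator_decay:
 assumes sg: "1 <= sg" "sg <= 2" and H: "edif e H Ha" "edif e Ha Hb" "H : L2" "Ha : L2" "Hb : L2" and s: "s ~= 0"
 shows "norm (Wt sg (FI (cls (%xi. cis (- (s * jb xi)) * (v xi ^ 4 * H xi)))))
  <= 22 * (norm (cls H) + norm (cls Ha) + norm (cls Hb)) * abs s powr - sg"
proof -
 let ?E = "%xi. cis (- (s * jb xi))"
 define Q where "Q = norm (cls H) + norm (cls Ha) + norm (cls Hb)"
 define Y where "Y = FI (cls (%xi. ?E xi * (v xi ^ 4 * H xi)))"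
 note vb = L2_mult_bound[OF _ v_meas(1) norm_vc[OF e]] and v1b = L2_mult_bound[OF _ v_meas(2) norm_vc1[OF e]]
  and v2b = L2_mult_bound[OF _ v_meas(3) norm_vc2[OF e]]
 have nonneg: "0 <= norm (cls H)" "0 <= norm (cls Ha)" "0 <= norm (cls Hb)" by auto
 define A where "A xi = v xi * H xi" for xi
 define A1 where "A1 xi = v1 xi * H xi + v xi * Ha xi" for xi
 have eA: "edif e A A1" unfolding A_def[abs_def] A1_def[abs_def] by (intro edif_mult v_edif H)
 have A: "A : L2" "norm (cls A) <= norm (cls H)" unfolding A_def[abs_def] using vb[OF H(3)] by auto
 have A1: "A1 : L2" "norm (cls A1) <= norm (cls H) + norm (cls Ha)"
  unfolding A1_def[abs_def] using L2_add_bound[OF v1b[OF H(3)] vb[OF H(4)]] by simp_all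
 define B where "B xi = v xi * A xi" for xi
 define B1 where "B1 xi = v1 xi * A xi + v xi * A1 xi" for xi
 have eB: "edif e B B1" unfolding B_def[abs_def] B1_def[abs_def] by (intro edif_mult v_edif eA)
 have B: "B : L2" "norm (cls B) <= norm (cls H)" unfolding B_def[abs_def] using vb[OF A(1)] A(2) by auto
 have B1: "B1 : L2" "norm (cls B1) <= 2 * norm (cls H) + norm (cls Ha)"
  unfolding B1_def[abs_def] using L2_add_bound[OF v1b[OF A(1)] vb[OF A1(1)]] A(2) A1(2) by simp_all
 \<comment> \<open>Chosen so that \<open>v1 xi * B xi + v xi * B1 xi = v xi * (v xi * K xi)\<close>:
   the term in which the derivative fell on the amplitude still has two powers of the velocity for
   the second integration by parts.\<close>
 define K where "K xi = 3 * (v1 xi * H xi) + v xi * Ha xi" for xi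
 define K1 where "K1 xi = 3 * (v2 xi * H xi) + (4 * (v1 xi * Ha xi) + v xi * Hb xi)" for xi
 have eK: "edif e K K1"
 proof -
  have "edif e (%xi. 3 * (v1 xi * H xi) + v xi * Ha xi)
   (%xi. (0 * (v1 xi * H xi) + 3 * (v2 xi * H xi + v1 xi * Ha xi)) + (v1 xi * Ha xi + v xi * Hb xi))"
   by (intro edif_add edif_mult edif_const v_edif H)
  then show ?thesis unfolding K_def[abs_def] K1_def[abs_def] by (simp add: algebra_simps)
 qed
 have sm: "(%x. c * F x) : L2" "norm (cls (%x. c * F x)) <= cmod c * norm (cls F)" if "F : L2" for F :: "real ^ 'n => complex" and c
  using L2_mult_bound[OF that, of "%_. c" "cmod c"] by auto
 have K: "K : L2" "norm (cls K) <= 3 * norm (cls H) + norm (cls Ha)"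
  unfolding K_def[abs_def] using L2_add_bound[OF sm[OF v1b(1)[OF H(3)], of 3] vb[OF H(4)]] v1b(2)[OF H(3)] by simp_all
 have K1: "K1 : L2" "norm (cls K1) <= 9 * norm (cls H) + 4 * norm (cls Ha) + norm (cls Hb)" unfolding K1_def[abs_def]
  using L2_add_bound[OF sm[OF v2b(1)[OF H(3)], of 3] L2_add_bound[OF sm[OF v1b(1)[OF H(4)], of 4] vb[OF H(5)]]]
   v2b(2)[OF H(3)] v1b(2)[OF H(4)] by simp_all
 have bnd1: "2 * b + b1 <= 4 * Q" if "b <= norm (cls H)" "b1 <= 2 * norm (cls H) + norm (cls Ha)" for b b1 unfolding Q_def using that nonneg by argo
 have bnd2: "2 * b + b1 <= 3 * Q" if "b <= norm (cls H)" "b1 <= norm (cls H) + norm (cls Ha)" for b b1 unfolding Q_def using that nonneg by argo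
 have bnd3: "2 * b + b1 <= 15 * Q" if "b <= 3 * norm (cls H) + norm (cls Ha)" "b1 <= 9 * norm (cls H) + 4 * norm (cls Ha) + norm (cls Hb)" for b b1
  unfolding Q_def using that nonneg by argo
 have Wt1: "norm (Wt 1 Y) <= 4 * Q / abs s"
 proof -
  have "Y = FI (cls (%xi. ?E xi * (v xi * (v xi * B xi))))" unfolding Y_def B_def A_def by (simp add: power4_eq_xxxx mult.assoc)
  then have "norm (Wt 1 Y) <= (2 * norm (cls B) + norm (cls B1)) / abs s" using propagator_decay_1[OF eB B(1) B1(1) s] by simp
  also have "... <= 4 * Q / abs s" by (intro divide_right_mono abs_ge_zero bnd1 B B1)
  finally show ?thesis .
 qed
 have Wt2: "norm (Wt 2 Y) <= 18 * Q / (abs s)^2"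
 proof -
  have "Y = FI (cls (%xi. ?E xi * (v xi * (v xi * B xi))))" unfolding Y_def B_def A_def by (simp add: power4_eq_xxxx mult.assoc)
  then have *: "norm (Wt 2 Y) <= (norm (Wt (2 - 1) (FI (cls (%xi. ?E xi * (v xi * B xi)))))
   + norm (Wt 2 (FI (cls (%xi. ?E xi * (v1 xi * B xi + v xi * B1 xi)))))) / abs s" using propagator_by_parts[OF _ eB B(1) B1(1) s, of 2] by simp
  have t1: "norm (Wt (2 - 1) (FI (cls (%xi. ?E xi * (v xi * B xi))))) <= 3 * Q / abs s"
  proof -
   have "norm (Wt 1 (FI (cls (%xi. ?E xi * (v xi * (v xi * A xi)))))) <= (2 * norm (cls A) + norm (cls A1)) / abs s"
    by (rule propagator_decay_1[OF eA A(1) A1(1) s])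
   also have "... <= 3 * Q / abs s" by (intro divide_right_mono abs_ge_zero bnd2 A A1)
   finally show ?thesis by (simp add: B_def)
  qed
  have t2: "norm (Wt 2 (FI (cls (%xi. ?E xi * (v1 xi * B xi + v xi * B1 xi))))) <= 15 * Q / abs s"
  proof -
   have eq: "v1 xi * B xi + v xi * B1 xi = v xi * (v xi * K xi)" for xi by (simp add: B_def B1_def A_def A1_def K_def algebra_simps)
   have "norm (Wt 2 (FI (cls (%xi. ?E xi * (v xi * (v xi * K xi)))))) <= norm (Wt 1 (FI (cls (%xi. ?E xi * (v xi * (v xi * K xi))))))"
    by (rule norm_Wt_antimono) auto
   also have "... <= (2 * norm (cls K) + norm (cls K1)) / abs s" by (rule propagator_decay_1[OF eK K(1) K1(1) s])
   also have "... <= 15 * Q / abs s" by (intro divide_right_mono abs_ge_zero bnd3 K K1)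
   finally show ?thesis unfolding eq .
  qed
  have "norm (Wt 2 Y) <= (3 * Q / abs s + 15 * Q / abs s) / abs s" using order_trans[OF * divide_right_mono[OF add_mono[OF t1 t2]]] by simp
  also have "... = 18 * Q / (abs s)^2" using s by (simp add: field_simps power2_eq_square)
  finally show ?thesis .
 qed
 have sp: "abs s > 0" using s by simp
 have "norm (Wt sg Y) <= abs s powr (2 - sg) * norm (Wt 2 Y) + abs s powr (1 - sg) * norm (Wt 1 Y)" by (rule weight_interpolation[OF sp sg])
 also have "... <= abs s powr (2 - sg) * (18 * Q / (abs s)^2) + abs s powr (1 - sg) * (4 * Q / abs s)" by (intro add_mono mult_left_mono Wt1 Wt2) auto
 also have "... = 22 * Q * abs s powr - sg"
 proof -
  have "abs s powr (2 - sg) = abs s powr - sg * (abs s)^2" "abs s powr (1 - sg) = abs s powr - sg * abs s"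
   using sp by (simp_all add: powr_diff powr_minus powr_numeral field_simps)
  then show ?thesis using sp by (simp add: field_simps)
 qed
 finally show ?thesis by (simp add: Y_def Q_def)
qed

text \<open>In the slab every derivative of the transform costs a factor \<open>L\<close>. The
  amplitude and its two derivatives are bounded by 1, 2 and 4 times \<open>P * L^2\<close>, and 154
  is 22 times their sum 7.\<close>

lemma decay_estimate:
 assumes sg: "1 <= sg" "sg <= 2" and d: "sym2 e P d d1 d2" and L: "1 <= L" "- L <= a" and s: "s ~= 0"
 shows "norm (Wt sg (U s (Mop (%xi. v xi ^ 4 * d xi) (chi {x. a < x .* e & x .* e <= L} X)))) <= 154 * P * L^2 * abs s powr - sg * norm X"
proof -
 let ?S = "{x. a < x .* e & x .* e <= L}"
 have bS: "bm (ind ?S)" by (rule bm_indicator[OF slab_borel(1)])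
 have ed: "edif e d d1" "edif e d1 d2"
  and b: "!!xi. cmod (d xi) <= P" "!!xi. cmod (d1 xi) <= P" "!!xi. cmod (d2 xi) <= P" using d by (auto simp: sym2_def)
 have dm: "meas d" "meas d1" "meas d2" using ed edif_measurable by blast+
 have P0: "P >= 0" using order_trans[OF norm_ge_zero b(1)[of 0]] .
 have bvd: "bm (%xi. v xi ^ 4 * d xi)"
 proof (rule bmI)
  show "meas (%xi. v xi ^ 4 * d xi)" using dm(1) by measurable
  show "cmod (v xi ^ 4 * d xi) <= 1 * P" for xi
   unfolding norm_mult norm_power using norm_vc[OF e, of xi] b(1)[of xi] by (intro mult_mono power_le_one) auto
 qed
 show ?thesis proof (induction X rule: bs_induct)
  case (1 f)
  define h where "h x = ind ?S x * f x" for x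
  have h: "bs h" unfolding h_def[abs_def] by (rule bs_bmult[OF 1 bS])
  have eqh: "chi ?S (cls f) = cls h" unfolding h_def[abs_def] by (rule cls_mul[OF bs_L2[OF 1] bS])
  have hn: "norm (cls h) <= norm (cls f)"
   unfolding eqh[symmetric] using norm_mul_le[OF bm_measurable[OF bS], of 1 "cls f"] by (auto simp: indicator_def)
  define h1 where "h1 x = - \<i> * (x .* e) * h x" for x
  define h2 where "h2 x = - \<i> * (x .* e) * h1 x" for x
  have xm: "meas (%x. - \<i> * cor (x .* e))" by measurable
  have xb: "cmod (- \<i> * cor (x .* e)) <= L" if "h x ~= 0" for x using that L by (auto simp: h_def indicator_def norm_mult split: if_splits)
  have xb1: "cmod (- \<i> * cor (x .* e)) <= L" if "h1 x ~= 0" for x using that xb[of x] by (auto simp: h1_def)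
  have h1: "bs h1" "norm (cls h1) <= L * norm (cls h)" unfolding h1_def[abs_def] using bs_mult_support[OF h xm xb] L by auto
  have h2: "bs h2" "norm (cls h2) <= L * norm (cls h1)" unfolding h2_def[abs_def] using bs_mult_support[OF h1(1) xm xb1] L by auto
  let ?F = "FT"
  have e0: "edif e (?F h) (?F h1)" unfolding h1_def[abs_def] by (rule edif_fourier_L1[OF h])
  have e1: "edif e (?F h1) (?F h2)" unfolding h2_def[abs_def] by (rule edif_fourier_L1[OF h1(1)])
  have F: "?F h : L2" "?F h1 : L2" "?F h2 : L2" by (intro plancherel_bs h h1 h2)+
  have N: "norm (cls (?F h)) = norm (cls h)" "norm (cls (?F h1)) = norm (cls h1)" "norm (cls (?F h2)) = norm (cls h2)"
   by (intro plancherel_bs h h1 h2)+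
  define H where "H xi = d xi * ?F h xi" for xi
  define Ha where "Ha xi = d1 xi * ?F h xi + d xi * ?F h1 xi" for xi
  define Hb where "Hb xi = (d2 xi * ?F h xi + d1 xi * ?F h1 xi) + (d1 xi * ?F h1 xi + d xi * ?F h2 xi)" for xi
  have eH: "edif e H Ha" unfolding H_def[abs_def] Ha_def[abs_def] by (intro edif_mult ed e0)
  have eH1: "edif e Ha Hb" unfolding Ha_def[abs_def] Hb_def[abs_def] by (intro edif_add edif_mult ed e0 e1)
  note p00 = L2_mult_bound[OF F(1) dm(1) b(1)] and p10 = L2_mult_bound[OF F(1) dm(2) b(2)] and p20 = L2_mult_bound[OF F(1) dm(3) b(3)]
   and p01 = L2_mult_bound[OF F(2) dm(1) b(1)] and p11 = L2_mult_bound[OF F(2) dm(2) b(2)] and p02 = L2_mult_bound[OF F(3) dm(1) b(1)]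
  let ?n = "norm (cls h)"
  have q: "P * norm (cls (?F h)) <= P * L^2 * ?n" "P * norm (cls (?F h1)) <= P * L^2 * ?n" "P * norm (cls (?F h2)) <= P * L^2 * ?n"
  proof -
   have l2: "1 <= L^2" "L <= L^2" using L(1) by (auto simp: power2_eq_square intro: mult_ge1_I)
   have "norm (cls h1) <= L^2 * ?n" using h1(2) mult_right_mono[OF l2(2), of ?n] by simp
   moreover have "norm (cls h2) <= L^2 * ?n" using order_trans[OF h2(2) mult_left_mono[OF h1(2), of L]] L by (simp add: power2_eq_square mult.assoc)
   moreover have "norm (cls h) <= L^2 * ?n" using mult_right_mono[OF l2(1), of ?n] by simp
   ultimately show "P * norm (cls (?F h)) <= P * L^2 * ?n" "P * norm (cls (?F h1)) <= P * L^2 * ?n" "P * norm (cls (?F h2)) <= P * L^2 * ?n"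
    unfolding N mult.assoc using P0 by (auto intro!: mult_left_mono)
  qed
  have HL: "H : L2" "Ha : L2" "Hb : L2" unfolding H_def[abs_def] Ha_def[abs_def] Hb_def[abs_def] by (intro p00 L2_add p10 p01 p20 p11 p02)+
  have nH: "norm (cls H) <= P * L^2 * ?n" unfolding H_def[abs_def] using p00(2) q(1) by linarith
  have nH1: "norm (cls Ha) <= 2 * (P * L^2 * ?n)" unfolding Ha_def[abs_def] cls_add[OF p10(1) p01(1), symmetric]
   using norm_triangle_ineq[of "cls (%xi. d1 xi * ?F h xi)" "cls (%xi. d xi * ?F h1 xi)"] p10(2) p01(2) q by linarith
  have nH2: "norm (cls Hb) <= 4 * (P * L^2 * ?n)" unfolding Hb_def[abs_def] cls_add[OF L2_add[OF p20(1) p11(1)] L2_add[OF p11(1) p02(1)], symmetric]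
    cls_add[OF p20(1) p11(1), symmetric] cls_add[OF p11(1) p02(1), symmetric]
   using norm_triangle_ineq[of "cls (%xi. d2 xi * ?F h xi) + cls (%xi. d1 xi * ?F h1 xi)" "cls (%xi. d1 xi * ?F h1 xi) + cls (%xi. d xi * ?F h2 xi)"]
    norm_triangle_ineq[of "cls (%xi. d2 xi * ?F h xi)" "cls (%xi. d1 xi * ?F h1 xi)"]
    norm_triangle_ineq[of "cls (%xi. d1 xi * ?F h1 xi)" "cls (%xi. d xi * ?F h2 xi)"] p20(2) p11(2) p02(2) q by linarith
  have vH: "(%xi. v xi ^ 4 * H xi) : L2" by (rule L2_mult_bound[OF HL(1), of _ 1]) (auto simp: norm_power intro!: power_le_one norm_vc[OF e])
  have "U s (Mop (%xi. v xi ^ 4 * d xi) (cls h)) = FI (cls (%xi. cis (- (s * jb xi)) * (v xi ^ 4 * H xi)))"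
   unfolding U_def Mop_def FF_FI FF_bs[OF h] cls_mul[OF F(1) bvd] using cls_mul[OF vH bm_U, of s] by (simp add: H_def mult.assoc)
  then have "norm (Wt sg (U s (Mop (%xi. v xi ^ 4 * d xi) (cls h)))) <= 22 * (norm (cls H) + norm (cls Ha) + norm (cls Hb)) * abs s powr - sg"
   using propagator_decay[OF sg eH eH1 HL s] by simp
  also have "... <= 22 * (7 * (P * L^2 * ?n)) * abs s powr - sg" using nH nH1 nH2 by (intro mult_right_mono mult_left_mono) auto
  also have "... <= 22 * (7 * (P * L^2 * norm (cls f))) * abs s powr - sg" using hn P0 by (intro mult_right_mono mult_left_mono) auto
  finally show ?case unfolding eqh by (simp add: mult_ac)
 next
  case (2 Xs X)
  show ?case unfolding Wt_def U_def by (rule LIMSEQ_le_all[OF 2(1)[unfolded Wt_def U_def]]; (intro tendsto_norm bounded_linear.tendsto[OF bounded_linear_mul] bounded_linear.tendsto[OF bounded_linear_Mop] tendsto_intros)?; rule 2(2))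
 qed
qed

lemma edif_lgs_vel:
 shows "edif e (%xi. of_real (slgs (c * vel e xi + d0))) (%xi. of_real (slgs (c * vel e xi + d0) * (1 - slgs (c * vel e xi + d0))) * (c * v1 xi))"
proof -
 have e1: "edif e (%xi. of_real c * v xi + of_real d0) (%xi. (0 * v xi + of_real c * v1 xi) + 0)" by (intro edif_add edif_mult edif_const v_edif)
 have r: "of_real c * v xi + of_real d0 = of_real (c * vel e xi + d0)" for xi by (simp add: vc_def[OF e])
 have ne: "1 + exp (- cor x) ~= 0" for x using lgs_bounds(1)[of "of_real x"] by simp
 have dl: "(lgs has_field_derivative lgs (of_real x) * (1 - lgs (of_real x))) (at (of_real x))" for x :: real
 proof -
  have "(lgs has_field_derivative exp (- of_real x) / (1 + exp (- of_real x))^2) (at (of_real x))"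
   unfolding lgs_def[abs_def] using ne[of x] by (auto intro!: derivative_eq_intros simp: power2_eq_square)
  moreover have "exp (- of_real x) / (1 + exp (- of_real x))^2 = lgs (of_real x) * (1 - lgs (of_real x))"
   unfolding lgs_def using ne[of x] by (simp add: field_simps power2_eq_square)
  ultimately show ?thesis by simp
 qed
 have cl: "continuous_on (range (%xi. of_real c * v xi + of_real d0)) (%z. lgs z * (1 - lgs z))"
 proof -
  have "1 + exp (- (of_real c * v xi + of_real d0)) ~= 0" for xi unfolding r by (rule ne)
  then show ?thesis unfolding lgs_def by (intro continuous_intros) auto
 qed
 have "edif e (%xi. lgs (of_real c * v xi + of_real d0))
  (%xi. (lgs (of_real c * v xi + of_real d0) * (1 - lgs (of_real c * v xi + of_real d0))) * ((0 * v xi + of_real c * v1 xi) + 0))"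
  by (rule edif_chain[OF e1 _ cl]) (unfold r, rule dl)
 then show ?thesis unfolding r lgs_of_real by simp
qed

text \<open>Each derivative of the logistic factor costs a power of \<open>c\<close>. As
  \<open>1 <= abs c\<close>, the bound \<open>c^2 + 3 * abs c\<close> of the second derivative fits
  under \<open>4 * c^2\<close>.\<close>

lemma sym2_lgs_vel:
 assumes c: "1 <= abs c"
 shows "EX f1 f2. sym2 e (4 * c^2) (%xi. of_real (slgs (c * vel e xi + d0))) f1 f2"
proof -
 define S where "S xi = cor (slgs (c * vel e xi + d0))" for xi
 define S1 where "S1 xi = S xi * (1 + (-1) * S xi) * (c * v1 xi)" for xi
 define S2 where "S2 xi = (S1 xi * (1 + (-1) * S xi) + S xi * (0 + (0 * S xi + (-1) * S1 xi))) * (c * v1 xi) + (S xi * (1 + (-1) * S xi)) * (0 * v1 xi + c * v2 xi)" for xi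
 have e1: "edif e S S1" unfolding S_def[abs_def] S1_def[abs_def] using edif_lgs_vel[of c d0] by simp
 have e2: "edif e S1 S2" unfolding S1_def[abs_def] S2_def[abs_def] by (intro edif_mult edif_add edif_const v_edif e1[unfolded S1_def[abs_def]])
 have s01: "0 <= slgs x" "slgs x <= 1" for x using slgs_bounds[of x] by auto
 have sb: "cmod (S xi) <= 1" "cmod (1 + (-1) * S xi) <= 1" for xi
 proof -
  show "cmod (S xi) <= 1" using s01 by (simp add: S_def)
  have "1 + (-1) * S xi = of_real (1 - slgs (c * vel e xi + d0))" by (simp add: S_def)
  then show "cmod (1 + (-1) * S xi) <= 1" using s01[of "c * vel e xi + d0"] by (metis abs_of_nonneg diff_ge_0_iff_ge diff_le_eq le_add_same_cancel1 norm_of_real)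
 qed
 have cc: "1 <= c^2" "abs c <= c^2"
  using c mult_mono[of 1 "abs c" 1 "abs c"] mult_right_mono[OF c, of "abs c"] by (auto simp: power2_eq_square abs_mult_self_eq)
 have SS: "cmod (S xi * (1 + (-1) * S xi)) <= 1" for xi
  unfolding norm_mult[of "S xi"] using sb[of xi] mult_mono[of "cmod (S xi)" 1 "cmod (1 + (-1) * S xi)" 1] by simp
 have cv: "cmod (c * v1 xi) <= abs c" "cmod (c * v2 xi) <= 3 * abs c" for xi
  using mult_left_mono[OF norm_vc1[OF e, of xi], of "abs c"] mult_left_mono[OF norm_vc2[OF e, of xi], of "abs c"] by (simp_all add: norm_mult)
 have S1b: "cmod (S1 xi) <= abs c" for xi
  unfolding S1_def norm_mult[of "S xi * (1 + (-1) * S xi)"] using SS[of xi] cv[of xi] mult_mono[of "cmod (S xi * (1 + (-1) * S xi))" 1 "cmod (c * v1 xi)" "abs c"] by simp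
 have S2b: "cmod (S2 xi) <= c^2 + 3 * abs c" for xi
 proof -
  have "S1 xi * (1 + (-1) * S xi) + S xi * (0 + (0 * S xi + (-1) * S1 xi)) = S1 xi * of_real (1 - 2 * slgs (c * vel e xi + d0))"
   by (simp add: S_def algebra_simps)
  then have "cmod (S1 xi * (1 + (-1) * S xi) + S xi * (0 + (0 * S xi + (-1) * S1 xi))) <= abs c * 1"
   using S1b[of xi] s01[of "c * vel e xi + d0"] by (simp only: norm_mult norm_of_real) (intro mult_mono; auto)
  then have "cmod ((S1 xi * (1 + (-1) * S xi) + S xi * (0 + (0 * S xi + (-1) * S1 xi))) * (c * v1 xi)) <= (abs c * 1) * abs c"
   unfolding norm_mult[of "S1 xi * (1 + (-1) * S xi) + S xi * (0 + (0 * S xi + (-1) * S1 xi))"] using cv by (intro mult_mono) auto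
  moreover have "cmod ((S xi * (1 + (-1) * S xi)) * (0 * v1 xi + c * v2 xi)) <= 1 * (3 * abs c)"
   unfolding norm_mult[of "S xi * (1 + (-1) * S xi)"] using SS[of xi] cv(2)[of xi] by (intro mult_mono) auto
  ultimately show ?thesis unfolding S2_def
   using norm_triangle_ineq[of "(S1 xi * (1 + (-1) * S xi) + S xi * (0 + (0 * S xi + (-1) * S1 xi))) * (c * v1 xi)" "(S xi * (1 + (-1) * S xi)) * (0 * v1 xi + c * v2 xi)"]
   by (simp add: power2_eq_square)
 qed
 have "sym2 e (4 * c^2) S S1 S2" unfolding sym2_def
 proof (intro conjI allI e1 e2)
  fix xi
  show "cmod (S xi) <= 4 * c^2" "cmod (S1 xi) <= 4 * c^2" "cmod (S2 xi) <= 4 * c^2" using sb(1)[of xi] S1b[of xi] S2b[of xi] cc by linarith+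
 qed
 then show ?thesis unfolding S_def[abs_def] by blast
qed

text \<open>The number produced by \<open>sym2_mult\<close> and \<open>sym2_inverse\<close>: 4 times
  the 4 of the logistic factor times 3 times the square of 5185, where 5184 bounds the fourth power
  of the velocity with its derivatives and 1 is added for \<open>\<delta> ^ 4\<close>.\<close>

definition low_const :: real where "low_const = 48 * 5185^2"

text \<open>Multiplied by \<open>v xi ^ 4\<close>, this symbol is the logistic cut-off times a
  function close to 1 where the velocity exceeds \<delta>. It therefore replaces the cut-off in
  \<open>decay_estimate\<close>, at the polynomial price \<open>1 / \<delta> ^ 12\<close>.\<close>

lemma sym2_cutoff:
 assumes c: "1 <= abs c" and \<delta>: "0 < \<delta>" "\<delta> <= 1"
 shows "EX f1 f2. sym2 e (low_const * c^2 / \<delta> ^ 12) (%xi. of_real (slgs (c * vel e xi + d0)) * (1 / (v xi ^ 4 + of_real (\<delta> ^ 4)))) f1 f2"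
proof -
 obtain g1 g2 where g: "sym2 e (4 * c^2) (%xi. of_real (slgs (c * vel e xi + d0))) g1 g2" using sym2_lgs_vel[OF c] by blast
 obtain u1 u2 where u: "sym2 e 36 (%xi. v xi * v xi) u1 u2" using sym2_mult[OF sym2_vc[OF e] sym2_vc[OF e]] by auto
 obtain w1 w2 where w: "sym2 e 5184 (%xi. (v xi * v xi) * (v xi * v xi)) w1 w2" using sym2_mult[OF u u] by auto
 have d4: "\<delta> ^ 4 <= 1" "0 < \<delta> ^ 4" using \<delta> by (auto intro: power_le_one)
 have q: "sym2 e 5185 (%xi. v xi ^ 4 + of_real (\<delta> ^ 4)) w1 w2"
 proof -
  have eq: "(v xi * v xi) * (v xi * v xi) = v xi ^ 4" for xi by (simp add: power4_eq_xxxx)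
  have "edif e (%xi. v xi ^ 4 + of_real (\<delta> ^ 4)) (%xi. w1 xi + 0)" using w unfolding sym2_def eq by (intro edif_add edif_const) auto
  moreover have "cmod (v xi ^ 4 + of_real (\<delta> ^ 4)) <= 5185" for xi
  proof -
   have "cmod (cor (\<delta> ^ 4)) <= 1" using d4 by (simp only: norm_of_real)
   moreover have "cmod (v xi ^ 4) <= 5184" using w unfolding sym2_def eq by blast
   ultimately show ?thesis using norm_triangle_ineq[of "v xi ^ 4" "of_real (\<delta> ^ 4)"] by linarith
  qed
  moreover have "cmod (w1 xi) <= 5185" "cmod (w2 xi) <= 5185" for xi
  proof -
   have "cmod (w1 xi) <= 5184" "cmod (w2 xi) <= 5184" using w unfolding sym2_def by blast+
   then show "cmod (w1 xi) <= 5185" "cmod (w2 xi) <= 5185" by linarith+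
  qed
  ultimately show ?thesis using w unfolding sym2_def by simp
 qed
 have "\<delta> ^ 4 <= cmod (v xi ^ 4 + of_real (\<delta> ^ 4))" for xi
 proof -
  have "v xi ^ 4 + of_real (\<delta> ^ 4) = of_real (vel e xi ^ 4 + \<delta> ^ 4)" by (simp add: vc_def[OF e])
  then have "cmod (v xi ^ 4 + of_real (\<delta> ^ 4)) = abs (vel e xi ^ 4 + \<delta> ^ 4)" by (metis norm_of_real)
  then show ?thesis using zero_le_even_power[of 4 "vel e xi"] by simp
 qed
 then obtain r1 r2 where r: "sym2 e (3 * 5185^2 / (\<delta> ^ 4) ^ 3) (%xi. 1 / (v xi ^ 4 + of_real (\<delta> ^ 4))) r1 r2"
  using sym2_inverse[OF q _ d4(2,1)] by auto
 have "4 * (4 * c^2) * (3 * 5185^2 / (\<delta> ^ 4) ^ 3) = low_const * c^2 / \<delta> ^ 12" by (simp add: low_const_def power_mult[symmetric])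
 then show ?thesis using sym2_mult[OF g r] by metis qed

end

section \<open>Weak convergence of abstract orbits\<close>

lemma inner_l2_Re: "inner X Y = Re (cinner X Y)" for X :: "'n::finite l2" by (simp add: inner_l2_def)

lemma inner_mul: "bm m ==> inner (mul m X) Y = inner X (mul (%x. cnj (m x)) Y)" by (simp add: inner_l2_Re cinner_mul_left)

lemma inner_Mop: "bm m ==> inner (Mop m X) Y = inner X (Mop (%x. cnj (m x)) Y)" by (simp add: inner_l2_Re cinner_Mop_left)

lemma inner_U: "inner (U s X) Y = inner X (U (- s) Y)" by (simp add: inner_l2_Re cinner_U)

lemma norm_le_innerI:
 fixes X :: "'a::real_inner"
 assumes "!!Y. inner X Y <= c * norm Y" "0 <= c"
 shows "norm X <= c" using assms(1)[of X] assms(2) by (cases "X = 0") (auto simp: power2_norm_eq_inner[symmetric] power2_eq_square)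

text \<open>The representing vector minimizes the functional \<open>J\<close>: by the parallelogram
  law a minimizing sequence is Cauchy, and stationarity of \<open>J\<close> at the minimizer is the
  claimed identity.\<close>

lemma riesz_representation:
 fixes \<phi> :: "'a::{real_inner, complete_space} => real"
 assumes "bounded_linear \<phi>"
 shows "EX w. ALL x. \<phi> x = inner w x"
proof -
 interpret bounded_linear \<phi> by fact
 obtain b where b: "!!x. norm (\<phi> x) <= norm x * b" using bounded by blast
 define J where "J x = inner x x - 2 * \<phi> x" for x
 have Jlow: "- b\<^sup>2 <= J x" for x
 proof -
  have "0 <= (norm x - b)^2" by simp
  moreover have "\<phi> x <= norm x * b" using b[of x] by simp
  ultimately show ?thesis by (simp add: J_def power2_norm_eq_inner[symmetric] power2_diff)
 qed
 then have bb: "bdd_below (range J)" by (auto simp: bdd_below_def)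
 define m where "m = (INF x. J x)"
 have mJ: "m <= J x" for x unfolding m_def by (rule cINF_lower[OF bb]) simp
 have "EX x. J x < m + inverse (real (Suc n))" for n
 proof -
  have "m < m + inverse (real (Suc n))" by simp
  then show ?thesis unfolding m_def using cINF_less_iff[OF _ bb] by blast
 qed
 then obtain xs where xs: "!!n. J (xs n) < m + inverse (real (Suc n))" by metis
 have par: "(norm (x - y))^2 <= 2 * J x + 2 * J y - 4 * m" for x y
 proof -
  have "J x + J y = 2 * J ((1/2) *r (x + y)) + (norm (x - y))^2 / 2"
   by (simp add: J_def power2_norm_eq_inner scaleR add inner_add_left inner_add_right inner_diff_left inner_diff_right inner_commute field_simps)
  then show ?thesis using mJ[of "(1/2) *r (x + y)"] by (simp add: algebra_simps)
 qed
 have "Cauchy xs"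
 proof (rule metric_CauchyI)
  fix r :: real assume r: "0 < r"
  obtain M where M: "inverse (real (Suc M)) < r^2 / 4" using reals_Archimedean[of "r^2 / 4"] r by auto
  have "dist (xs i) (xs j) < r" if "M <= i" "M <= j" for i j
  proof -
   have "inverse (real (Suc i)) <= inverse (real (Suc M))" "inverse (real (Suc j)) <= inverse (real (Suc M))"
    using that by (auto intro!: le_imp_inverse_le)
   then have "(norm (xs i - xs j))^2 < r^2" using par[of "xs i" "xs j"] xs[of i] xs[of j] M by linarith
   then show ?thesis using r by (simp add: dist_norm power2_less_imp_less)
  qed
  then show "EX M. ALL i>=M. ALL j>=M. dist (xs i) (xs j) < r" by blast
 qed
 then obtain w where w: "xs ----> w" using Cauchy_convergent convergent_def by blast
 have "(%n. J (xs n)) ----> J w" unfolding J_def by (intro tendsto_intros tendsto w)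
 moreover have "(%n. m + inverse (real (Suc n))) ----> m" using LIMSEQ_inverse_real_of_nat_add[of m] by simp
 ultimately have Jw: "J w <= m" using xs by (intro LIMSEQ_le[of "%n. J (xs n)"]) (auto intro: less_imp_le)
 have "\<phi> x = inner w x" for x
 proof -
  define d where "d = inner w x - \<phi> x"
  define q where "q = inner x x"
  have q: "0 <= q" by (simp add: q_def)
  have *: "0 <= 2 * r * d + r^2 * q" for r
  proof -
   have "J (w + r *r x) = J w + (2 * r * d + r^2 * q)"
    by (simp add: J_def d_def q_def add scaleR inner_add_left inner_add_right inner_commute[of x w] power2_eq_square algebra_simps)
   then show ?thesis using Jw mJ[of "w + r *r x"] by linarith
  qed
  \<comment> \<open>A small step against the sign of the derivative \<open>d\<close>; dividing by
    \<open>q + 1\<close> makes the linear term dominate and avoids the case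
    \<open>q = 0\<close>.\<close>
  have "0 <= (2 * (- d / (q + 1)) * d + (- d / (q + 1))^2 * q) * (q + 1)^2" using *[of "- d / (q + 1)"] by (intro mult_nonneg_nonneg) auto
  also have "... = - (d^2 * (q + 2))" using q by (simp add: field_simps power2_eq_square add_nonneg_eq_0_iff)
  finally have "d^2 * (q + 2) <= 0" by linarith
  then have "d = 0" using q by (simp add: mult_le_0_iff)
  then show ?thesis by (simp add: d_def)
 qed
 then show ?thesis by blast
qed

lemma has_integral_powr_affine:
 fixes a c t t' sg :: real
 assumes "0 < c" "0 < a + c * t" "t <= t'" "1 < sg"
 shows "((%\<tau>. (a + c * \<tau>) powr - sg) has_integral ((a + c * t) powr (1 - sg) - (a + c * t') powr (1 - sg)) / (c * (sg - 1))) {t..t'}"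
proof -
 let ?F = "%\<tau>. - ((a + c * \<tau>) powr (1 - sg)) / (c * (sg - 1))"
 have "((%\<tau>. (a + c * \<tau>) powr - sg) has_integral ?F t' - ?F t) {t..t'}"
 proof (rule fundamental_theorem_of_calculus[OF assms(3)])
  fix \<tau> assume "\<tau> : {t..t'}"
  then have "c * t <= c * \<tau>" using assms(1) by simp
  then have p: "0 < a + c * \<tau>" using assms(2) by linarith
  have "((%\<tau>. (a + c * \<tau>) powr (1 - sg)) has_real_derivative ((1 - sg) * (a + c * \<tau>) powr (1 - sg - 1)) * c) (at \<tau>)"
   by (rule DERIV_chain2[where g = "%\<tau>. a + c * \<tau>" and x = \<tau>, OF has_real_derivative_powr[OF p]]) (auto intro!: derivative_eq_intros)
  then have "(?F has_real_derivative - (((1 - sg) * (a + c * \<tau>) powr (1 - sg - 1)) * c) / (c * (sg - 1))) (at \<tau>)"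
   by (intro DERIV_cdivide DERIV_minus)
  moreover have "- (((1 - sg) * X) * c) / (c * (sg - 1)) = X" for X using assms by (simp add: divide_simps) (simp add: algebra_simps)
  ultimately have "(?F has_real_derivative (a + c * \<tau>) powr - sg) (at \<tau>)" by simp
  then show "(?F has_vector_derivative (a + c * \<tau>) powr - sg) (at \<tau> within {t..t'})"
   by (simp add: has_real_derivative_iff_has_vector_derivative has_vector_derivative_at_within)
 qed
 moreover have "?F t' - ?F t = ((a + c * t) powr (1 - sg) - (a + c * t') powr (1 - sg)) / (c * (sg - 1))" by (simp add: diff_divide_distrib)
 ultimately show ?thesis by simp
qed

lemma powr_affine_integral:
 fixes a c t t' sg :: real
 assumes "0 < c" "0 < a + c * t" "t <= t'" "1 < sg"
 shows "EX J. ((%\<tau>. (a + c * \<tau>) powr - sg) has_integral J) {t..t'} & J <= (a + c * t) powr (1 - sg) / (c * (sg - 1))"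
proof (intro exI conjI)
 show "((%\<tau>. (a + c * \<tau>) powr - sg) has_integral ((a + c * t) powr (1 - sg) - (a + c * t') powr (1 - sg)) / (c * (sg - 1))) {t..t'}"
  by (rule has_integral_powr_affine[OF assms])
 show "((a + c * t) powr (1 - sg) - (a + c * t') powr (1 - sg)) / (c * (sg - 1)) <= (a + c * t) powr (1 - sg) / (c * (sg - 1))"
  using assms by (intro divide_right_mono) auto
qed

text \<open>All that the scattering argument retains of the equation: a bounded curve whose
  increments obey Duhamel's formula in weak form, with the source already estimated. The sign
  \<open>s\<close> selects one of the two half waves.\<close>

locale orbit =
 fixes Om :: "real => 'n::finite l2" and s B K sg :: real
 assumes s: "abs s = 1" and sg: "1 < sg" "sg <= 2" and K: "0 <= K"
  and Om_bounded: "!!t. 0 <= t ==> norm (Om t) <= B"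
  and Om_step: "!!t t' X. 0 <= t ==> t <= t' ==> (abs (inner (Om t' - Om t) X)) <= K * integral {t..t'} (%\<tau>. norm (Wt sg (U (s * \<tau>) X)))"
begin

lemma B_nonneg: "0 <= B" using order_trans[OF norm_ge_zero Om_bounded[of 0]] by simp

lemma step_bound:
 assumes t: "0 <= t" "t <= t'" and g: "!!\<tau>. t <= \<tau> ==> \<tau> <= t' ==> norm (Wt sg (U (s * \<tau>) X)) <= g \<tau>"
  and J: "(g has_integral J) {t..t'}"
 shows "abs (inner (Om t' - Om t) X) <= K * J"
proof -
 have "integral {t..t'} (%\<tau>. norm (Wt sg (U (s * \<tau>) X))) <= J"
 proof (rule has_integral_le[OF integrable_integral J])
  show "(%\<tau>. norm (Wt sg (U (s * \<tau>) X))) integrable_on {t..t'}" by (intro integrable_continuous_real continuous_on_Wt_U)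
 qed (use g in auto)
 then show ?thesis using Om_step[OF t, of X] K mult_left_mono by (meson order_trans)
qed

text \<open>Tested against a vector with velocities away from zero, the source decays like
  \<open>(\<tau> + t0) powr - sg\<close>, which is integrable at infinity because
  \<open>1 < sg\<close>. The offset \<open>t0\<close> lets the clock of the test vector differ from
  that of the orbit.\<close>

lemma weak_decay:
 assumes e: "norm e = 1" and d: "sym2 e P d d1 d2" and L: "1 <= L" "- L <= a" and r: "0 <= t" "t <= t'" "0 < t + t0"
 shows "abs (inner (Om t' - Om t) (U (s * t0) (Mop (%xi. vc e xi ^ 4 * d xi) (chi {x. a < x .* e & x .* e <= L} X))))
  <= K * (154 * P * L^2 * norm X * ((t + t0) powr (1 - sg) / (sg - 1)))"
proof -
 let ?Y = "Mop (%xi. vc e xi ^ 4 * d xi) (chi {x. a < x .* e & x .* e <= L} X)"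
 have P: "0 <= P" using d norm_ge_zero order_trans unfolding sym2_def by blast
 define C where "C = 154 * P * L^2 * norm X"
 have C: "0 <= C" using P by (simp add: C_def)
 obtain J where J: "((%\<tau>. (t0 + 1 * \<tau>) powr - sg) has_integral J) {t..t'}" "J <= (t0 + 1 * t) powr (1 - sg) / (1 * (sg - 1))"
  using powr_affine_integral[of 1 t0 t t' sg] r sg by (auto simp: add.commute)
 have "abs (inner (Om t' - Om t) (U (s * t0) ?Y)) <= K * (C * J)"
 proof (rule step_bound[OF r(1,2) _ has_integral_mult_right[OF J(1)]])
  fix \<tau> assume \<tau>: "t <= \<tau>" "\<tau> <= t'"
  have "abs (s * \<tau> + s * t0) = abs s * abs (\<tau> + t0)" by (simp add: abs_mult[symmetric] distrib_left)
  then have a: "abs (s * \<tau> + s * t0) = t0 + 1 * \<tau>" using s r \<tau> by simp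
  have nz: "s * \<tau> + s * t0 ~= 0" using a r \<tau> by auto
  have "norm (Wt sg (U (s * \<tau> + s * t0) ?Y)) <= 154 * P * L^2 * abs (s * \<tau> + s * t0) powr - sg * norm X"
   using sg by (intro decay_estimate[OF e _ _ d L nz]) auto
  then show "norm (Wt sg (U (s * \<tau>) (U (s * t0) ?Y))) <= C * (t0 + 1 * \<tau>) powr - sg" unfolding U_U a C_def by (simp only: mult_ac)
 qed
 also have "... <= K * (C * ((t + t0) powr (1 - sg) / (sg - 1)))" using J(2) C K by (intro mult_left_mono) (auto simp: add.commute)
 finally show ?thesis by (simp add: C_def)
qed

lemma weak_decay_vanishes:
 assumes e: "norm e = 1" and d: "sym2 e P d d1 d2" and L: "1 <= L" "- L <= a" and ep: "0 < ep"
 shows "EV t. ALL t'>=t.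
  (abs (inner (Om t' - Om t) (Mop (%xi. vc e xi ^ 4 * d xi) (chi {x. a < x .* e & x .* e <= L} X)))) < ep"
proof -
 let ?f = "%t. K * (154 * P * L^2 * norm X * (t powr (1 - sg) / (sg - 1)))"
 have "null (%t. t powr (1 - sg))" using sg by (intro tendsto_neg_powr filterlim_ident) auto
 then have "(?f ---> K * (154 * P * L^2 * norm X * (0 / (sg - 1)))) at_top" using sg by (intro tendsto_intros) auto
 then have "EV t. ?f t < ep" using ep by (intro order_tendstoD(2)[of ?f]) auto
 then show ?thesis using eventually_gt_at_top[of 0]
 proof eventually_elim
  case (elim t)
  show ?case using weak_decay[OF e d L, of t _ 0 X] elim by (auto intro: le_less_trans)
 qed
qed

text \<open>A single direction suffices: \<open>vel e\<close> vanishes only on a hyperplane, a null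
  set, so vectors supported in a slab and regularized by
  \<open>v ^ 4 / (v ^ 4 + \<delta> ^ 4)\<close> are dense, and for them \<open>weak_decay\<close>
  applies. Density and boundedness of the orbit give the rest.\<close>

lemma inner_Om_Cauchy:
 assumes ep: "0 < ep"
 shows "EV t. ALL t'>=t. (abs (inner (Om t' - Om t) X)) < ep"
proof -
 define e :: "real ^ 'n" where "e = axis undefined 1"
 have e: "norm e = 1" "e : Basis" by (auto simp: e_def)
 define S where "S k = {x. - real (Suc k) < x .* e & x .* e <= real (Suc k)}" for k
 define m where "m c k xi = vc e xi ^ 4 * (of_real (slgs (c * vel e xi + 0)) * (1 / (vc e xi ^ 4 + of_real (inverse (real (Suc k)) ^ 4))))" for c k xi
 define Xk where "Xk c k = Mop (m c k) (mul (ind (S k)) X)" for c k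
 have Sb: "S k : sets borel" for k unfolding S_def by (rule slab_borel)
 have vr: "vc e xi = of_real (vel e xi)" for xi by (simp add: vc_def[OF e(1)])
 have ms: "m c k xi = of_real (slgs (c * vel e xi) * (vel e xi ^ 4 / (vel e xi ^ 4 + inverse (real (Suc k)) ^ 4)))" for c k xi
  unfolding m_def vr by simp
 have fr: "0 <= v ^ 4 / (v ^ 4 + inverse (real (Suc k)) ^ 4)" "v ^ 4 / (v ^ 4 + inverse (real (Suc k)) ^ 4) <= 1" for v :: real and k
 proof -
  have "0 <= v ^ 4" by simp
  moreover have "0 < inverse (real (Suc k)) ^ 4" by simp
  ultimately show "0 <= v ^ 4 / (v ^ 4 + inverse (real (Suc k)) ^ 4)" "v ^ 4 / (v ^ 4 + inverse (real (Suc k)) ^ 4) <= 1"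
   by (simp_all add: divide_le_eq_1 add_nonneg_pos)
 qed
 have velm [measurable]: "meas (vel e)" unfolding vel_def[abs_def] by measurable
 have slm: "meas (%xi. slgs (c * vel e xi))" for c unfolding slgs_def by measurable
 have mb: "bm (m c k)" for c k
 proof (rule bmI[of _ 1])
  show "meas (m c k)" unfolding ms[abs_def] using slm by measurable
  show "cmod (m c k xi) <= 1" for xi
   unfolding ms norm_of_real abs_mult using slgs_bounds[of "c * vel e xi"] fr[of "vel e xi" k] by (intro mult_le_one) auto
 qed
 have Xk: "EV t. ALL t'>=t. (abs (inner (Om t' - Om t) (Xk c k))) < \<delta>" if \<delta>: "0 < \<delta>" and c: "abs c = 1" for c k \<delta>
 proof -
  obtain f1 f2 where "sym2 e (low_const * c^2 / inverse (real (Suc k)) ^ 12)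
   (%xi. of_real (slgs (c * vel e xi + 0)) * (1 / (vc e xi ^ 4 + of_real (inverse (real (Suc k)) ^ 4)))) f1 f2"
   using sym2_cutoff[OF e(1), of c "inverse (real (Suc k))" 0] c by (auto simp: inverse_le_1_iff)
  from weak_decay_vanishes[OF e(1) this _ _ \<delta>, of "real (Suc k)" "- real (Suc k)" X]
  show ?thesis by (simp add: Xk_def m_def[abs_def] S_def)
 qed
 \<comment> \<open>The decay estimate comes with a logistic factor. The factors for
   \<open>c = 1\<close> and \<open>c = - 1\<close> add up to 1, so the sum of the two vectors is
   free of it.\<close>
 have sum: "Xk 1 k + Xk (- 1) k = Mop (%xi. of_real (vel e xi ^ 4 / (vel e xi ^ 4 + inverse (real (Suc k)) ^ 4))) (mul (ind (S k)) X)" for k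
 proof -
  have "m 1 k xi + m (- 1) k xi = of_real (vel e xi ^ 4 / (vel e xi ^ 4 + inverse (real (Suc k)) ^ 4))" for xi
  proof -
   have "slgs (- 1 * vel e xi) = 1 - slgs (1 * vel e xi)" using slgs_minus[of "vel e xi"] by simp
   then show ?thesis unfolding ms of_real_add[symmetric] distrib_right[symmetric] by (simp only:) simp
  qed
  then show ?thesis unfolding Xk_def by (simp add: Mop_add_left[OF mb mb])
 qed
 have "(%k. Xk 1 k + Xk (- 1) k) ----> X"
 proof -
  let ?r = "%k xi. cor (vel e xi ^ 4 / (vel e xi ^ 4 + inverse (real (Suc k)) ^ 4))"
  have rm: "meas (?r k)" for k by measurable
  have rb: "cmod (?r k xi) <= 1" for k xi unfolding norm_of_real using fr[of "vel e xi" k] by simp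
  have 1: "(%k. mul (ind (S k)) X) ----> mul (%_. 1) X"
  proof (rule mul_tendsto[where B = 1])
   show "AE x in (lborel :: (real ^ 'n) measure). (%k. ind (S k) x) ----> (1 :: complex)"
   proof (intro AE_I2)
    fix x :: "real ^ 'n"
    obtain k0 :: nat where k0: "abs (x .* e) < real k0" using reals_Archimedean2 by blast
    have "\<forall>\<^sub>F k in sequentially. ind (S k) x = (1 :: complex)"
    proof (intro eventually_sequentiallyI[of k0])
     fix k assume "k0 <= k"
     then have "x : S k" using k0 by (simp add: S_def abs_less_iff)
     then show "ind (S k) x = (1 :: complex)" by simp
    qed
    then show "(%k. ind (S k) x) ----> (1 :: complex)" by (rule tendsto_eventually)
   qed
  qed (use Sb in \<open>auto intro!: borel_measurable_indicator simp: indicator_def\<close>)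
  have 2: "(%k. Mop (?r k) X) ----> Mop (%_. 1) X"
  proof (rule Mop_tendsto[OF rm rb])
   show "AE xi in (lborel :: (real ^ 'n) measure). (%k. ?r k xi) ----> 1" using AE_lborel_inner_neq[OF e(2), of 0]
   proof eventually_elim
    case (elim xi)
    then have v: "vel e xi ~= 0" using japanese_nonzero[of xi] by (simp add: vel_def)
    have "(%k. ?r k xi) ----> cor (vel e xi ^ 4 / (vel e xi ^ 4 + 0 ^ 4))" using v by (intro tendsto_intros LIMSEQ_inverse_real_of_nat) auto
    then show ?case using v by simp
   qed
  qed auto
  have 3: "(%k. Mop (?r k) (mul (ind (S k)) X - X)) ----> 0"
  proof (rule Lim_null_comparison)
   show "\<forall>\<^sub>F k in sequentially. norm (Mop (?r k) (mul (ind (S k)) X - X)) <= norm (mul (ind (S k)) X - X)"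
    using norm_Mop_le[OF rm rb] by (intro always_eventually allI) simp
   show "(%k. norm (mul (ind (S k)) X - X)) ----> 0" using 1 by (simp add: LIM_zero tendsto_norm_zero)
  qed
  show ?thesis using tendsto_add[OF 3 2] by (simp add: sum Mop_diff)
 qed
 then have "(%k. norm (X - (Xk 1 k + Xk (- 1) k))) ----> norm (X - X)" by (intro tendsto_intros)
 moreover have "0 < ep / (6 * (B + 1))" using ep B_nonneg by simp
 ultimately obtain k where k: "norm (X - (Xk 1 k + Xk (- 1) k)) < ep / (6 * (B + 1))"
  using order_tendstoD(2)[of _ 0 sequentially "ep / (6 * (B + 1))"] eventually_happens'[OF sequentially_bot] by fastforce
 have e3: "0 < ep / 3" using ep by simp
 have ab: "abs (1 :: real) = 1" "abs (- 1 :: real) = 1" by auto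
 show ?thesis using Xk[OF e3 ab(1), of k] Xk[OF e3 ab(2), of k] eventually_ge_at_top[of 0]
 proof eventually_elim
  case (elim t)
  show ?case
  proof (intro allI impI)
   fix t' assume t': "t <= t'"
   define Z where "Z = X - (Xk 1 k + Xk (- 1) k)"
   have "abs (inner (Om t' - Om t) Z) <= norm (Om t' - Om t) * norm Z" by (rule Cauchy_Schwarz_ineq2)
   also have "... <= (2 * (B + 1)) * (ep / (6 * (B + 1)))"
    using norm_triangle_ineq4[of "Om t'" "Om t"] Om_bounded[of t] Om_bounded[of t'] elim t' k B_nonneg by (intro mult_mono) (auto simp: Z_def)
   also have "... = ep / 3" using B_nonneg by (simp add: field_simps)
   finally have "abs (inner (Om t' - Om t) Z) <= ep / 3" .
   moreover have "inner (Om t' - Om t) X = inner (Om t' - Om t) Z + inner (Om t' - Om t) (Xk 1 k) + inner (Om t' - Om t) (Xk (- 1) k)"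
    by (simp add: Z_def inner_diff_right inner_add_right)
   moreover have "abs (inner (Om t' - Om t) (Xk 1 k)) < ep / 3" "abs (inner (Om t' - Om t) (Xk (- 1) k)) < ep / 3" using elim t' by blast+
   ultimately show "abs (inner (Om t' - Om t) X) < ep" by linarith
  qed
 qed
qed

lemma weak_limit: "EX w. norm w <= B & (ALL X. ((%t. inner (Om t) X) ---> inner w X) at_top)"
proof -
 have conv: "EX l. ((%t. inner (Om t) X) ---> l) at_top" for X
 proof -
  have "Cauchy (%n. inner (Om (real n)) X)"
  proof (rule metric_CauchyI)
   fix r :: real assume "0 < r"
   then have "EV t. ALL t'>=t. (abs (inner (Om t' - Om t) X)) < r / 2" by (intro inner_Om_Cauchy) simp
   then obtain t where t: "!!t'. t' >= t ==> (abs (inner (Om t' - Om t) X)) < r / 2" by (auto simp: eventually_at_top_linorder)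
   obtain M :: nat where M: "t <= real M" using real_arch_simple by blast
   have "dist (inner (Om (real i)) X) (inner (Om (real j)) X) < r" if "M <= i" "M <= j" for i j
    using t[of "real i"] t[of "real j"] M that unfolding dist_real_def inner_diff_left by (smt (verit) field_sum_of_halves of_nat_le_iff)
   then show "EX M. ALL i>=M. ALL j>=M. dist (inner (Om (real i)) X) (inner (Om (real j)) X) < r" by blast
  qed
  then obtain l where l: "(%n. inner (Om (real n)) X) ----> l" using Cauchy_convergent convergent_def by blast
  have "((%t. inner (Om t) X) ---> l) at_top"
  proof (rule tendstoI)
   fix r :: real assume r: "0 < r"
   show "EV t. dist (inner (Om t) X) l < r" using inner_Om_Cauchy[of "r / 2" X, OF half_gt_zero[OF r]]
   proof eventually_elim
    case (elim t)
    have "(%n. (abs (inner (Om (real n)) X - inner (Om t) X))) ----> (abs (l - inner (Om t) X))" by (intro tendsto_intros l)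
    moreover have "\<forall>\<^sub>F n in sequentially. (abs (inner (Om (real n)) X - inner (Om t) X)) <= r / 2"
    proof -
     obtain M :: nat where "t <= real M" using real_arch_simple by blast
     then show ?thesis using elim by (intro eventually_sequentiallyI[of M]) (auto simp: inner_diff_left intro!: less_imp_le)
    qed
    ultimately have "abs (l - inner (Om t) X) <= r / 2" by (intro tendsto_upperbound) auto
    then show ?case using r by (simp add: dist_real_def abs_minus_commute)
   qed
  qed
  then show ?thesis ..
 qed
 then obtain \<phi> where \<phi>: "!!X. ((%t. inner (Om t) X) ---> \<phi> X) at_top" by metis
 have \<phi>B: "abs (\<phi> X) <= B * norm X" for X
 proof (rule tendsto_upperbound)
  show "((%t. (abs (inner (Om t) X))) ---> (abs (\<phi> X))) at_top" by (intro tendsto_intros \<phi>)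
  show "EV t. (abs (inner (Om t) X)) <= B * norm X" using eventually_ge_at_top[of 0]
  proof eventually_elim
   case (elim t)
   then show ?case using Cauchy_Schwarz_ineq2[of "Om t" X] mult_right_mono[OF Om_bounded[of t], of "norm X"] by simp
  qed
 qed auto
 have "bounded_linear \<phi>"
 proof (rule bounded_linear_intro)
  show "\<phi> (X + Y) = \<phi> X + \<phi> Y" for X Y
   using tendsto_add[OF \<phi>[of X] \<phi>[of Y]] tendsto_unique[OF trivial_limit_at_top_linorder \<phi>[of "X + Y"]] by (simp add: inner_add_right)
  show "\<phi> (r *r X) = r *r \<phi> X" for r X
   using tendsto_mult_left[OF \<phi>[of X], of r] tendsto_unique[OF trivial_limit_at_top_linorder \<phi>[of "r *r X"]] by simp
  show "norm (\<phi> X) <= norm X * B" for X using \<phi>B[of X] by (simp add: mult.commute)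
 qed
 then obtain w where w: "!!X. \<phi> X = inner w X" using riesz_representation by blast
 have "norm w <= B" by (rule norm_le_innerI) (use \<phi>B B_nonneg in \<open>auto simp: w abs_le_iff\<close>)
 then show ?thesis using \<phi> w by auto
qed

definition omega where "omega = (SOME w. norm w <= B & (ALL X. ((%t. inner (Om t) X) ---> inner w X) at_top))"

lemma omega: "norm omega <= B" "((%t. inner (Om t) X) ---> inner omega X) at_top" using someI_ex[OF weak_limit] unfolding omega_def by blast+

lemma omega_tail:
 assumes "!!t'. t <= t' ==> (abs (inner (Om t' - Om t) X)) <= J"
 shows "abs (inner (omega - Om t) X) <= J"
proof (rule tendsto_upperbound)
 show "((%t'. (abs (inner (Om t' - Om t) X))) ---> (abs (inner (omega - Om t) X))) at_top" unfolding inner_diff_left by (intro tendsto_intros omega)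
 show "EV t'. (abs (inner (Om t' - Om t) X)) <= J" using eventually_ge_at_top[of t] by eventually_elim (rule assms)
qed auto

end

section \<open>Duhamel estimates for the outgoing and the incoming part\<close>

lemma mul_indicator_idem: "S : sets borel ==> chi S (chi S X) = chi S X" by (simp add: mul_mul bm_indicator indicator_inter_arith[symmetric])

lemma mul_indicator_sub:
 assumes "S : sets borel" "S' : sets borel" "S \<subseteq> S'"
 shows "chi S' (chi S X) = chi S X"
proof -
 have "ind S' x * ind S x = (ind S x :: complex)" for x using assms(3) by (auto simp: indicator_def)
 then show ?thesis unfolding mul_mul[OF bm_indicator[OF assms(2)] bm_indicator[OF assms(1)]] by (simp only:)
qed

lemma norm_mul_indicator_le: "S : sets borel ==> norm (chi S X) <= norm X"
 using norm_mul_le[of "ind S" 1 X] by (auto simp: indicator_def intro!: borel_measurable_indicator)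

lemma norm_mul_indicator_mono:
 "S : sets borel ==> S' : sets borel ==> S \<subseteq> S' ==> norm (chi S X) <= norm (chi S' X)"
 by (intro norm_mul_mono bm_indicator) (auto simp: indicator_def)

lemma vel_measurable [measurable]: "meas (vel e)" unfolding vel_def[abs_def] by measurable

lemma slgs_measurable [measurable]: "meas slgs" unfolding slgs_def[abs_def] by measurable

lemma bm_slgs: "meas f ==> bm (%xi. of_real (slgs (f xi)))" using slgs_bounds by (intro bmI[of _ 1]) (auto simp: less_imp_le abs_of_pos)

context orbit
begin

text \<open>The difference to the weak limit is split at the time \<open>t1\<close>. Before it,
  \<open>outgoing_bound\<close> makes the source small: its exponential error is multiplied by a
  duration of at most \<open>T\<close>, and the weight beyond the moving front integrates to a
  power. After it, the regularized symbol decays by \<open>weak_decay\<close>, and the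
  regularization error is small as a symbol. The parameter \<open>\<tau>0\<close> interpolates
  between the two uses: 0 concerns the solution at time \<open>t\<close>, and \<open>t\<close>
  concerns the profile in the interaction picture.\<close>

lemma outgoing_estimate:
 assumes e: "norm e = 1" and th: "0 < th" "th <= 1" and l: "1 <= l" and \<tau>0: "0 <= \<tau>0" "\<tau>0 <= t" "\<tau>0 <= T" and T: "0 < T"
  and a: "\<tau>0 * th / 2 <= a + \<tau>0 * th" "64 * l^2 <= th * (a + \<tau>0 * th)" and L: "1 <= L" "- L <= a" and \<delta>: "0 < \<delta>" "\<delta> <= 1"
 shows "norm (chi {x. a < x .* e & x .* e <= L} (Mop (%xi. of_real (slgs (4 * l * (s * vel e xi / th - 3)))) (U (s * (t - \<tau>0)) (Om t - omega))))
  <= K * (6 * T * exp (- l / 2) + 2 powr sg * ((a + \<tau>0 * th) powr (1 - sg) / (th * (sg - 1)))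
     + 154 * (low_const * (4 * l / th)^2 / \<delta> ^ 12) * L^2 * (T powr (1 - sg) / (sg - 1)))
   + 2 * B * (exp (- (8 * l)) + \<delta> ^ 4 / th ^ 4)" (is "norm (chi ?S (Mop ?\<phi> _)) <= K * (?b1 + ?b2 + ?b3) + 2 * B * ?\<eta>")
proof -
 define D where "D = Om t - omega"
 define c where "c = 4 * l * s / th"
 define d0 where "d0 = - (12 * l)"
 \<comment> \<open>Measured on the clock of the test vector this is time \<open>T\<close>, while at
   most \<open>T\<close> has elapsed since \<open>t\<close>.\<close>
 define t1 where "t1 = t - \<tau>0 + T"
 have t: "0 <= t" "t <= t1" using \<tau>0 by (auto simp: t1_def)
 have arg: "4 * l * (s * v / th - 3) = c * v + d0" for v using th by (simp add: c_def d0_def field_simps)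
 have c1: "abs c = 4 * l / th" using s l th by (simp add: c_def abs_mult)
 have c2: "c^2 = (4 * l / th)^2" by (metis c1 power2_abs)
 have cge: "1 <= abs c" unfolding c1 using l th by (simp add: le_divide_eq)
 have b\<phi>: "bm ?\<phi>" by (intro bm_slgs) measurable
 have vr: "vc e xi = of_real (vel e xi)" for xi by (simp add: vc_def[OF e])
 define \<rho> where "\<rho> v = v ^ 4 / (v ^ 4 + \<delta> ^ 4)" for v :: real
 have pos4: "0 < v ^ 4 + \<delta> ^ 4" for v :: real using \<delta> by (intro add_nonneg_pos) auto
 define \<phi>1 where "\<phi>1 xi = vc e xi ^ 4 * (of_real (slgs (c * vel e xi + d0)) * (1 / (vc e xi ^ 4 + of_real (\<delta> ^ 4))))" for xi
 have \<phi>1: "\<phi>1 xi = of_real (slgs (c * vel e xi + d0) * \<rho> (vel e xi))" for xi by (simp add: \<phi>1_def vr \<rho>_def)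
 have r01: "0 <= \<rho> v" "\<rho> v <= 1" for v using pos4[of v] \<delta> by (auto simp: \<rho>_def divide_le_eq_1)
 define \<phi>2 where "\<phi>2 xi = cor (slgs (c * vel e xi + d0) * (1 - \<rho> (vel e xi)))" for xi
 have \<rho>m [measurable]: "meas \<rho>" unfolding \<rho>_def[abs_def] by measurable
 have m1: "meas \<phi>1" unfolding \<phi>1[abs_def] by measurable
 have b1: "bm \<phi>1"
 proof (rule bmI[OF m1, of 1])
  show "cmod (\<phi>1 xi) <= 1" for xi unfolding \<phi>1 norm_of_real abs_mult
   using r01[of "vel e xi"] slgs_bounds[of "c * vel e xi + d0"] by (intro mult_le_one) auto
 qed
 have m2: "meas \<phi>2" unfolding \<phi>2_def[abs_def] by measurable
 \<comment> \<open>For \<open>s * v <= th\<close> the logistic function is below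
   \<open>exp (- (8 * l))\<close>, because its argument is at most \<open>4 * l * (1 - 3)\<close>;
   for larger velocities the regularization changes the symbol by at most
   \<open>\<delta> ^ 4 / th ^ 4\<close>.\<close>
 have n2: "cmod (\<phi>2 xi) <= ?\<eta>" for xi
 proof -
  define v where "v = vel e xi"
  have eq: "1 - \<rho> v = \<delta> ^ 4 / (v ^ 4 + \<delta> ^ 4)" using pos4[of v] by (simp add: \<rho>_def field_simps)
  have n: "cmod (\<phi>2 xi) = slgs (c * v + d0) * (1 - \<rho> v)"
   unfolding \<phi>2_def norm_of_real v_def[symmetric] using r01(2)[of v] slgs_bounds(1)[of "c * v + d0"] by (intro abs_of_nonneg mult_nonneg_nonneg) auto
  show ?thesis proof (cases "s * v <= th")
   case True
   have "4 * l * (s * v / th - 3) <= 4 * l * (1 - 3)" using True th l by (intro mult_left_mono diff_right_mono) (auto simp: divide_le_eq)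
   then have "slgs (c * v + d0) <= exp (- (8 * l))" using slgs_bounds(3)[of "c * v + d0"] unfolding arg by (elim order_trans) simp
   then have "slgs (c * v + d0) * (1 - \<rho> v) <= exp (- (8 * l)) * 1" using r01[of v] by (intro mult_mono) auto
   moreover have "0 <= \<delta> ^ 4 / th ^ 4" using \<delta> th by simp
   ultimately show ?thesis unfolding n by linarith
  next
   case False
   have "th <= abs (s * v)" using False by linarith
   then have "th <= abs v" by (simp add: abs_mult s)
   then have "th ^ 4 <= abs v ^ 4" using th by (intro power_mono) auto
   then have v4: "th ^ 4 <= v ^ 4" by (simp add: power_even_abs)
   have "1 - \<rho> v <= \<delta> ^ 4 / th ^ 4" unfolding eq using v4 \<delta> th pos4[of v]
    by (intro divide_left_mono mult_pos_pos) (auto intro: add_increasing2)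
   moreover have "0 < exp (- (8 * l))" by simp
   moreover have "slgs (c * v + d0) * (1 - \<rho> v) <= 1 - \<rho> v" using r01[of v] slgs_bounds[of "c * v + d0"] by (intro mult_left_le_one_le) auto
   ultimately show ?thesis unfolding n by linarith
  qed
 qed
 have b2: "bm \<phi>2" by (rule bmI[OF m2 n2])
 have sum: "Mop ?\<phi> X = Mop \<phi>1 X + Mop \<phi>2 X" for X
 proof -
  have "\<phi>1 xi + \<phi>2 xi = ?\<phi> xi" for xi unfolding arg \<phi>1 \<phi>2_def of_real_add[symmetric] by (simp add: algebra_simps)
  then show ?thesis by (simp add: Mop_add_left[OF b1 b2])
 qed
 show ?thesis proof (rule norm_le_innerI)
  fix h
  define h' where "h' = chi ?S h"
  define X where "X = U (- (s * (t - \<tau>0))) (Mop ?\<phi> h')"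
  have h': "norm h' <= norm h" unfolding h'_def by (rule norm_mul_indicator_le[OF slab_borel(1)])
  have "inner (chi ?S (Mop ?\<phi> (U (s * (t - \<tau>0)) D))) h = inner D X"
   unfolding X_def h'_def by (simp add: inner_mul bm_indicator slab_borel inner_Mop[OF b\<phi>] inner_U)
  moreover have "abs (inner (Om t1 - Om t) X) <= K * ((?b1 + ?b2) * norm h)"
  proof -
   have E0: "0 < a + \<tau>0 * th"
   proof -
    have "1 <= l^2" using l by simp
    then have "0 < th * (a + \<tau>0 * th)" using a(2) by linarith
    then show ?thesis using th by (simp add: zero_less_mult_iff)
   qed
   define a' where "a' = a + th * (\<tau>0 - t)"
   have a't: "a' + th * t = a + \<tau>0 * th" by (simp add: a'_def algebra_simps)
   have E0': "0 < a' + th * t" using E0 by (simp only: a't)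
   obtain J where J: "((%\<tau>. (a' + th * \<tau>) powr - sg) has_integral J) {t..t1}" "J <= (a' + th * t) powr (1 - sg) / (th * (sg - 1))"
    using powr_affine_integral[OF th(1) E0' t(2) sg(1)] by blast
   have "((%\<tau>. 6 * exp (- l / 2) * norm h + 2 powr sg * norm h * (a' + th * \<tau>) powr - sg) has_integral
     (t1 - t) *r (6 * exp (- l / 2) * norm h) + 2 powr sg * norm h * J) {t..t1}"
    using has_integral_const_real[of "6 * exp (- l / 2) * norm h" t t1] t by (intro has_integral_add has_integral_mult_right J) auto
   then have "abs (inner (Om t1 - Om t) X) <= K * ((t1 - t) *r (6 * exp (- l / 2) * norm h) + 2 powr sg * norm h * J)"
   proof (rule step_bound[OF t, rotated])
    fix \<tau> assume \<tau>: "t <= \<tau>" "\<tau> <= t1"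
    define r where "r = \<tau> - t + \<tau>0"
    have r: "0 <= r" "\<tau>0 <= r" using \<tau> \<tau>0 by (auto simp: r_def)
    have ra: "a' + th * \<tau> = a + r * th" by (simp add: a'_def r_def algebra_simps)
    have rr: "\<tau>0 * th <= r * th" using r th by simp
    have c1: "r * th / 2 <= a + r * th" using a(1) rr by linarith
    have c2: "64 * l^2 <= th * (a + r * th)" using a(2) mult_left_mono[OF rr, of th] th unfolding distrib_left by linarith
    have bpos: "0 < (a + r * th) / 2" using E0 rr by simp
    have "U (s * \<tau>) X = U (s * r) (Mop ?\<phi> h')" unfolding X_def U_U by (simp add: r_def algebra_simps)
    then have eq: "U (s * \<tau>) X = Mop (%xi. cis (- (s * r * jb xi)) * ?\<phi> xi) (chi {x. a < x .* e} h')"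
     unfolding U_Mop[OF b\<phi>] h'_def by (subst mul_indicator_sub[OF slab_borel(1) half_space_borel(2)]) auto
    have nX: "norm (U (s * \<tau>) X) <= norm h"
     unfolding X_def norm_U using norm_Mop_le[OF bm_measurable[OF b\<phi>], of 1 h'] slgs_bounds h' by (auto simp: less_imp_le abs_of_pos intro: order_trans)
    have "norm (Wt sg (U (s * \<tau>) X)) <= norm (chi {x. x .* e < (a + r * th) / 2} (U (s * \<tau>) X)) + ((a + r * th) / 2) powr - sg * norm (U (s * \<tau>) X)"
     using sg by (intro weight_split[OF e bpos]) auto
    also have "... <= 6 * exp (- l / 2) * norm h + ((a + r * th) / 2) powr - sg * norm h"
    proof (intro add_mono mult_left_mono nX)
     have "norm (chi {x. x .* e < (a + r * th) / 2} (U (s * \<tau>) X)) <= 6 * exp (- l / 2) * norm h'"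
      unfolding eq by (rule outgoing_bound[OF e s th l r(1) c1 c2])
     also have "... <= 6 * exp (- l / 2) * norm h" using h' by (intro mult_left_mono) auto
     finally show "norm (chi {x. x .* e < (a + r * th) / 2} (U (s * \<tau>) X)) <= 6 * exp (- l / 2) * norm h" .
    qed auto
    also have "((a + r * th) / 2) powr - sg = 2 powr sg * (a' + th * \<tau>) powr - sg"
     unfolding ra using bpos by (simp add: powr_divide powr_minus field_simps)
    finally show "norm (Wt sg (U (s * \<tau>) X)) <= 6 * exp (- l / 2) * norm h + 2 powr sg * norm h * (a' + th * \<tau>) powr - sg"
     by (simp add: mult_ac)
   qed
   also have "... <= K * ((?b1 + ?b2) * norm h)"
   proof (intro mult_left_mono K)
    have "(t1 - t) *r (6 * exp (- l / 2) * norm h) <= T * (6 * exp (- l / 2) * norm h)" using \<tau>0 by (auto simp: t1_def intro!: mult_right_mono)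
    moreover have "2 powr sg * norm h * J <= 2 powr sg * norm h * ((a + \<tau>0 * th) powr (1 - sg) / (th * (sg - 1)))"
     using J(2) unfolding a't by (intro mult_left_mono) auto
    ultimately have "(t1 - t) *r (6 * exp (- l / 2) * norm h) + 2 powr sg * norm h * J
     <= T * (6 * exp (- l / 2) * norm h) + 2 powr sg * norm h * ((a + \<tau>0 * th) powr (1 - sg) / (th * (sg - 1)))" by (rule add_mono)
    then show "(t1 - t) *r (6 * exp (- l / 2) * norm h) + 2 powr sg * norm h * J <= (?b1 + ?b2) * norm h"
     unfolding distrib_right by (simp only: mult_ac)
   qed
   finally show ?thesis .
  qed
  moreover have "abs (inner (omega - Om t1) (U (- (s * (t - \<tau>0))) (Mop \<phi>1 h'))) <= K * (?b3 * norm h)"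
  proof (rule omega_tail)
   fix t' assume t': "t1 <= t'"
   obtain f1 f2 where f: "sym2 e (low_const * c^2 / \<delta> ^ 12)
    (%xi. of_real (slgs (c * vel e xi + d0)) * (1 / (vc e xi ^ 4 + of_real (\<delta> ^ 4)))) f1 f2" using sym2_cutoff[OF e cge \<delta>] by blast
   have "abs (inner (Om t' - Om t1) (U (s * (- (t - \<tau>0))) (Mop \<phi>1 h')))
    <= K * (154 * (low_const * c^2 / \<delta> ^ 12) * L^2 * norm h * ((t1 + (- (t - \<tau>0))) powr (1 - sg) / (sg - 1)))"
    unfolding h'_def \<phi>1_def[abs_def] by (rule weak_decay[OF e f L]) (use t t' T in \<open>auto simp: t1_def\<close>)
   then show "abs (inner (Om t' - Om t1) (U (- (s * (t - \<tau>0))) (Mop \<phi>1 h'))) <= K * (?b3 * norm h)"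
    by (simp add: c2 t1_def mult_ac minus_mult_right)
  qed
  moreover have "abs (inner (omega - Om t1) (U (- (s * (t - \<tau>0))) (Mop \<phi>2 h'))) <= 2 * B * (?\<eta> * norm h)"
  proof -
   have \<eta>: "0 <= ?\<eta>" using \<delta> th by simp
   have "abs (inner (omega - Om t1) (U (- (s * (t - \<tau>0))) (Mop \<phi>2 h'))) <= norm (omega - Om t1) * norm (U (- (s * (t - \<tau>0))) (Mop \<phi>2 h'))"
    by (rule Cauchy_Schwarz_ineq2)
   also have "... <= (2 * B) * (?\<eta> * norm h)"
   proof (rule mult_mono)
    show "norm (omega - Om t1) <= 2 * B" using norm_triangle_ineq4[of omega "Om t1"] omega(1) Om_bounded[of t1] t by simp
    have "norm (Mop \<phi>2 h') <= ?\<eta> * norm h'" by (rule norm_Mop_le[OF m2 n2])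
    also have "... <= ?\<eta> * norm h" using h' \<eta> by (rule mult_left_mono)
    finally show "norm (U (- (s * (t - \<tau>0))) (Mop \<phi>2 h')) <= ?\<eta> * norm h" by (simp only: norm_U)
   qed (use B_nonneg in auto)
   finally show ?thesis .
  qed
  moreover have "inner D X = - inner (Om t1 - Om t) X - inner (omega - Om t1) (U (- (s * (t - \<tau>0))) (Mop \<phi>1 h')) - inner (omega - Om t1) (U (- (s * (t - \<tau>0))) (Mop \<phi>2 h'))"
   unfolding X_def sum U_add D_def by (simp add: inner_add_right inner_diff_left)
  ultimately have "inner (chi ?S (Mop ?\<phi> (U (s * (t - \<tau>0)) D))) h
   <= K * ((?b1 + ?b2) * norm h) + K * (?b3 * norm h) + 2 * B * (?\<eta> * norm h)" by linarith
  also have "... = (K * (?b1 + ?b2 + ?b3) + 2 * B * ?\<eta>) * norm h" by (simp only: distrib_left distrib_right mult_ac add_ac)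
  finally show "inner (chi ?S (Mop ?\<phi> (U (s * (t - \<tau>0)) (Om t - omega)))) h <= (K * (?b1 + ?b2 + ?b3) + 2 * B * ?\<eta>) * norm h"
   unfolding D_def .
 next
  have "0 <= low_const * (4 * l / th)^2 / \<delta> ^ 12"
   using \<delta> by (intro divide_nonneg_nonneg mult_nonneg_nonneg) (auto simp: low_const_def[OF e])
  then show "0 <= K * (?b1 + ?b2 + ?b3) + 2 * B * ?\<eta>" using K B_nonneg th \<delta> sg T by (intro add_nonneg_nonneg mult_nonneg_nonneg) auto
 qed
qed

text \<open>Here Duhamel's formula runs over the past. By \<open>bound\<close>, what lies beyond
  \<open>R\<close> at time \<open>t\<close> came from beyond \<open>R / 2\<close> at all earlier
  times, where the source has size \<open>(R / 2) powr - sg\<close>. The remaining vector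
  \<open>Om 0 - omega\<close> does not depend on \<open>t\<close>, so that only its spatial tail
  counts.\<close>

lemma forward_estimate:
 assumes e: "norm e = 1" and m: "meas m" "!!xi. abs (m xi) <= 1" and R: "0 < R" and t: "0 <= t" and ka: "0 <= ka"
  and bound: "!!\<tau> X. 0 <= \<tau> ==> \<tau> <= t ==>
   norm (chi {x. x .* e < R / 2} (U (- (s * \<tau>)) (Mop (%xi. of_real (m xi)) (chi {x. R < x .* e} X)))) <= ka * norm X"
 shows "norm (chi {x. R < x .* e} (Mop (%xi. of_real (m xi)) (U (s * t) (Om t - omega))))
  <= K * (t * (ka + (R / 2) powr - sg)) + 2 * B * ka + norm (mul (%x. 1 - ind {x. x .* e < R / 2} x) (Om 0 - omega))"
  (is "norm (chi ?S (Mop ?m _)) <= K * ?b1 + 2 * B * ka + ?b2")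
proof (rule norm_le_innerI)
 have bm: "bm ?m" using m by (intro bmI[of _ 1]) auto
 fix h
 define h' where "h' = chi ?S h"
 define X where "X = U (- (s * t)) (Mop ?m h')"
 have Sb: "?S : sets borel" by (rule half_space_borel)
 have h': "norm h' <= norm h" unfolding h'_def by (rule norm_mul_indicator_le[OF Sb])
 have i: "inner (chi ?S (Mop ?m (U (s * t) (Om t - omega)))) h = inner (Om t - omega) X"
  unfolding X_def h'_def by (simp add: inner_mul bm_indicator Sb inner_Mop[OF bm] inner_U)
 have nX: "norm X <= norm h" unfolding X_def norm_U using norm_Mop_le[OF bm_measurable[OF bm], of 1 h'] m h' by (auto intro: order_trans)
 have 1: "abs (inner (Om t - Om 0) X) <= K * (?b1 * norm h)"
 proof -
  have "abs (inner (Om t - Om 0) X) <= K * ((t - 0) *r ((ka + (R / 2) powr - sg) * norm h))"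
  proof (rule step_bound[OF _ t])
   show "((%_. (ka + (R / 2) powr - sg) * norm h) has_integral (t - 0) *r ((ka + (R / 2) powr - sg) * norm h)) {0..t}"
    using has_integral_const_real[of "(ka + (R / 2) powr - sg) * norm h" 0 t] t by simp
   fix \<tau> assume \<tau>: "0 <= \<tau>" "\<tau> <= t"
   have eq: "U (s * \<tau>) X = U (- (s * (t - \<tau>))) (Mop ?m (chi ?S h))" unfolding X_def U_U h'_def by (simp add: algebra_simps)
   have nU: "norm (U (s * \<tau>) X) <= norm h" by (simp add: norm_U nX)
   have "norm (Wt sg (U (s * \<tau>) X)) <= norm (chi {x. x .* e < R / 2} (U (s * \<tau>) X)) + (R / 2) powr - sg * norm (U (s * \<tau>) X)"
    using sg R by (intro weight_split[OF e]) auto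
   also have "... <= ka * norm h + (R / 2) powr - sg * norm h"
    using bound[of "t - \<tau>" h] \<tau> by (intro add_mono mult_left_mono nU) (auto simp: eq)
   finally show "norm (Wt sg (U (s * \<tau>) X)) <= (ka + (R / 2) powr - sg) * norm h" by (simp add: distrib_right)
  qed simp
  then show ?thesis by (simp add: mult_ac)
 qed
 have 2: "abs (inner (Om 0 - omega) X) <= 2 * B * (ka * norm h) + ?b2 * norm h"
 proof -
  let ?I = "ind {x. x .* e < R / 2} :: real ^ 'n => complex"
  have bI: "bm ?I" "bm (%x. 1 - ?I x)" by (intro bm_indicator bm_diff bm_const half_space_borel)+
  have "X = mul ?I X + mul (%x. 1 - ?I x) X" unfolding mul_add_left[OF bI] by simp
  then have "inner (Om 0 - omega) X = inner (Om 0 - omega) (mul ?I X) + inner (Om 0 - omega) (mul (%x. 1 - ?I x) X)" by (metis inner_add_right)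
  also have "inner (Om 0 - omega) (mul (%x. 1 - ?I x) X) = inner (mul (%x. 1 - ?I x) (Om 0 - omega)) X" unfolding inner_mul[OF bI(2)] by simp
  finally have "abs (inner (Om 0 - omega) X) <= norm (Om 0 - omega) * norm (mul ?I X) + norm (mul (%x. 1 - ?I x) (Om 0 - omega)) * norm X"
   using Cauchy_Schwarz_ineq2[of "Om 0 - omega" "mul ?I X"] Cauchy_Schwarz_ineq2[of "mul (%x. 1 - ?I x) (Om 0 - omega)" X] by linarith
  also have "... <= 2 * B * (ka * norm h) + ?b2 * norm h"
  proof (intro add_mono mult_mono)
   show "norm (Om 0 - omega) <= 2 * B" using norm_triangle_ineq4[of "Om 0" omega] omega(1) Om_bounded[of 0] by simp
   show "norm (mul ?I X) <= ka * norm h" using bound[of t h] t by (simp add: X_def h'_def)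
  qed (use B_nonneg nX in auto)
  finally show ?thesis .
 qed
 have "inner (Om t - omega) X = inner (Om t - Om 0) X + inner (Om 0 - omega) X" by (simp add: inner_diff_left)
 then have "inner (Om t - omega) X <= K * (?b1 * norm h) + (2 * B * (ka * norm h) + ?b2 * norm h)" using 1 2 by linarith
 also have "... = (K * ?b1 + 2 * B * ka + ?b2) * norm h" by (simp only: distrib_left distrib_right mult_ac add_ac)
 finally show "inner (chi ?S (Mop ?m (U (s * t) (Om t - omega)))) h <= (K * ?b1 + 2 * B * ka + ?b2) * norm h" unfolding i .
next
 show "0 <= K * ?b1 + 2 * B * ka + ?b2" using K B_nonneg t ka by (intro add_nonneg_nonneg mult_nonneg_nonneg) auto
qed

end

section \<open>Decay outside the sub-ballistic radius\<close>

lemma norm_null_comparison: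
 "\<forall>\<^sub>F t in F. norm (f t) <= g t ==> (g ---> 0) F ==> ((%t. norm (f t)) ---> 0) F" by (rule tendsto_norm_zero[OF Lim_null_comparison])

lemma powr_exp_tendsto_0:
 fixes p c q :: real
 assumes "0 < c" "0 < q"
 shows "null (%t. t powr p * exp (- (c * t powr q)))"
proof -
 have 1: "null (%x. x powr (p / q) * exp (- (c * x)))" using assms by real_asymp
 have 2: "filterlim (%t :: real. t powr q) at_top at_top" using assms by real_asymp
 have "null (%t. (t powr q) powr (p / q) * exp (- (c * t powr q)))" by (rule filterlim_compose[OF 1 2])
 then show ?thesis using assms by (simp add: powr_powr)
qed

lemma exp_powr_tendsto_0:
 fixes c q :: real
 assumes "0 < c" "0 < q"
 shows "null (%t. exp (- (c * t powr q)))" "null (%t. t * exp (- (c * t powr q)))"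
proof -
 have e: "EV t. t powr 0 * exp (- (c * t powr q)) = exp (- (c * t powr q))"
  "EV t. t powr 1 * exp (- (c * t powr q)) = t * exp (- (c * t powr q))"
  using eventually_gt_at_top[of 1] by (eventually_elim, simp)+
 show "null (%t. exp (- (c * t powr q)))" "null (%t. t * exp (- (c * t powr q)))"
  by (rule Lim_transform_eventually[OF powr_exp_tendsto_0[OF assms]], rule e)+
qed

lemma powr_neg_tendsto_0: "p < 0 ==> null (%t :: real. t powr p)" by (intro tendsto_neg_powr filterlim_ident)

lemma eventually_le_powr: "0 < q ==> EV t. (C :: real) <= t powr q"
proof -
 assume "0 < q"
 then have "filterlim (%t :: real. t powr q) at_top at_top" by real_asymp
 then show ?thesis by (simp add: filterlim_at_top)
qed

lemma half_space_tail:
 "null (%r. norm (mul (%x. 1 - ind {x. x .* e < r} x) X))"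
proof (rule tendstoI)
 fix ep :: real assume ep: "0 < ep"
 have b: "bm (%x. 1 - ind {x. x .* e < r} x)" for r by (intro bm_diff bm_const bm_indicator half_space_borel)
 have "(%k. mul (%x. 1 - ind {x. x .* e < real k} x) X) ----> mul (%_. 0) X"
 proof (rule mul_tendsto[where B = 1])
  show "AE x in (lborel :: (real ^ 'a) measure). (%k. 1 - ind {x. x .* e < real k} x) ----> (0 :: complex)"
  proof (intro AE_I2)
   fix x :: "real ^ 'a"
   obtain k0 :: nat where k0: "x .* e < real k0" using reals_Archimedean2 by blast
   have "\<forall>\<^sub>F k in sequentially. 1 - ind {x. x .* e < real k} x = (0 :: complex)"
    by (rule eventually_sequentiallyI[of k0]) (use k0 in auto)
   then show "(%k. 1 - ind {x. x .* e < real k} x) ----> (0 :: complex)" by (rule tendsto_eventually)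
  qed
  show "meas (%x. 1 - ind {x. x .* e < real k} x :: complex)" for k by (rule bm_measurable[OF b])
 qed (auto simp: indicator_def)
 then have "(%k. norm (mul (%x. 1 - ind {x. x .* e < real k} x) X)) ----> 0" using tendsto_norm_zero by fastforce
 then obtain k where k: "norm (mul (%x. 1 - ind {x. x .* e < real k} x) X) < ep"
  using order_tendstoD(2)[of _ 0 sequentially ep] ep eventually_happens'[OF sequentially_bot] by fastforce
 show "EV r. dist (norm (mul (%x. 1 - ind {x. x .* e < r} x) X)) 0 < ep" using eventually_ge_at_top[of "real k"]
 proof eventually_elim
  case (elim r)
  have "norm (mul (%x. 1 - ind {x. x .* e < r} x) X) <= norm (mul (%x. 1 - ind {x. x .* e < real k} x) X)"
   using elim by (intro norm_mul_mono b) (auto simp: indicator_def)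
  then show ?case using k by simp
 qed
qed

context orbit
begin

text \<open>The parameters of \<open>outgoing_estimate\<close> are threshold
  \<open>t powr (- b)\<close>, sharpness \<open>l = t powr \<eta>\<close>,
  \<open>T = exp (l / 4)\<close>, regularization \<open>1 / t\<close> and slab width
  \<open>t powr q\<close>. Then \<open>T * exp (- l / 2)\<close> is \<open>exp (- l / 4)\<close>,
  the regularization error is \<open>t powr (- 4 + 4 * b)\<close>, and
  \<open>T powr (1 - sg)\<close> beats every power of \<open>t\<close>. What remains is the main
  term \<open>t powr (g * (1 - sg) + b)\<close>, where \<open>t powr g\<close> is the distance of
  the front.\<close>

lemma outgoing_vanishes:
 assumes e: "norm e = 1" and b: "0 < b" "b < 1" and \<eta>: "0 < \<eta>" and g: "g * (1 - sg) + b < 0"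
  and ev: "EV t. 0 <= \<tau>0 t & \<tau>0 t <= t & \<tau>0 t <= exp (t powr \<eta> / 4) & t powr g / 2 <= a t + \<tau>0 t * t powr (- b)
   & \<tau>0 t * t powr (- b) / 2 <= a t + \<tau>0 t * t powr (- b) & 64 * (t powr \<eta>)^2 <= t powr (- b) * (a t + \<tau>0 t * t powr (- b))
   & 1 <= t powr q & - (t powr q) <= a t"
 shows "null (%t. norm (chi {x. a t < x .* e & x .* e <= t powr q}
   (Mop (%xi. of_real (slgs (4 * t powr \<eta> * (s * vel e xi / t powr (- b) - 3)))) (U (s * (t - \<tau>0 t)) (Om t - omega)))))"
proof -
 define th where "th t = t powr (- b)" for t :: real
 define l where "l t = t powr \<eta>" for t :: real
 define A where "A t = a t + \<tau>0 t * th t" for t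
 define p1 where "p1 = g * (1 - sg) + b"
 define p2 where "p2 = 2 * (\<eta> + b) + 12 + 2 * q"
 define G where "G t = K * (6 * exp (- l t / 4) + 2 powr sg * 2 powr (sg - 1) / (sg - 1) * t powr p1
    + 154 * low_const * 16 / (sg - 1) * (t powr p2 * exp (- ((sg - 1) / 4 * t powr \<eta>))))
   + 2 * B * (exp (- (8 * l t)) + t powr (- 4 + 4 * b))" for t
 have G: "null G"
 proof -
  have 1: "null (%t. exp (- l t / 4))" and 2: "null (%t. exp (- (8 * l t)))"
   using exp_powr_tendsto_0[of "1/4" \<eta>] exp_powr_tendsto_0[of 8 \<eta>] \<eta> by (simp_all add: l_def)
  have 3: "null (%t. t powr p2 * exp (- ((sg - 1) / 4 * t powr \<eta>)))" using sg \<eta> by (intro powr_exp_tendsto_0) auto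
  have 4: "null (%t :: real. t powr p1)" "null (%t :: real. t powr (- 4 + 4 * b))" using g b by (intro powr_neg_tendsto_0; simp add: p1_def)+
  have "(G ---> K * (6 * 0 + 2 powr sg * 2 powr (sg - 1) / (sg - 1) * 0 + 154 * low_const * 16 / (sg - 1) * 0) + 2 * B * (0 + 0)) at_top"
   unfolding G_def by (intro tendsto_intros 1 2 3 4)
  then show ?thesis by simp
 qed
 have "EV t. norm (chi {x. a t < x .* e & x .* e <= t powr q}
   (Mop (%xi. of_real (slgs (4 * l t * (s * vel e xi / th t - 3)))) (U (s * (t - \<tau>0 t)) (Om t - omega)))) <= G t"
  using eventually_gt_at_top[of 1] ev
 proof eventually_elim
  case (elim t)
  have t: "1 <= t" "0 < t" using elim by auto
  have l1: "1 <= l t" unfolding l_def using t \<eta> by (intro ge_one_powr_ge_zero) auto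
  have th: "0 < th t" "th t <= 1" unfolding th_def using t b powr_mono[of "- b" 0 t] by auto
  have A2: "t powr g / 2 <= A t" using elim by (simp add: A_def th_def)
  have "norm (chi {x. a t < x .* e & x .* e <= t powr q}
   (Mop (%xi. of_real (slgs (4 * l t * (s * vel e xi / th t - 3)))) (U (s * (t - \<tau>0 t)) (Om t - omega))))
   <= K * (6 * exp (l t / 4) * exp (- l t / 2) + 2 powr sg * ((a t + \<tau>0 t * th t) powr (1 - sg) / (th t * (sg - 1)))
     + 154 * (low_const * (4 * l t / th t)^2 / (1 / t) ^ 12) * (t powr q)^2 * (exp (l t / 4) powr (1 - sg) / (sg - 1)))
   + 2 * B * (exp (- (8 * l t)) + (1 / t) ^ 4 / th t ^ 4)"
   by (rule outgoing_estimate[OF e th l1]) (use t elim in \<open>auto simp: l_def th_def\<close>)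
  also have "... = K * (6 * (exp (l t / 4) * exp (- l t / 2)) + 2 powr sg / (sg - 1) * (A t powr (1 - sg) / th t)
     + 154 * low_const / (sg - 1) * ((4 * l t / th t)^2 / (1 / t) ^ 12 * (t powr q)^2) * exp (l t / 4) powr (1 - sg))
   + 2 * B * (exp (- (8 * l t)) + (1 / t) ^ 4 / th t ^ 4)" unfolding A_def[symmetric] by (simp only: divide_inverse inverse_mult_distrib mult_ac)
  also have "exp (l t / 4) * exp (- l t / 2) = exp (- l t / 4)" by (simp add: exp_add[symmetric])
  also have "exp (l t / 4) powr (1 - sg) = exp (- ((sg - 1) / 4 * t powr \<eta>))" unfolding l_def exp_powr_real by (simp add: field_simps)
  also have "(1 / t) ^ 4 / th t ^ 4 = t powr (- 4 + 4 * b)"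
  proof -
   have "1 / t / th t = t powr (- 1 + b)" unfolding powr_add using t by (simp add: th_def powr_minus divide_inverse)
   then have "(1 / t / th t) ^ 4 = (t powr (- 1 + b)) ^ 4" by simp
   also have "... = t powr (- 4 + 4 * b)" using t by (simp add: powr_realpow[symmetric] powr_powr algebra_simps)
   finally show ?thesis unfolding power_divide .
  qed
  also have "(4 * l t / th t)^2 / (1 / t) ^ 12 * (t powr q)^2 = 16 * t powr p2"
  proof -
   have "l t / th t = t powr (\<eta> + b)" by (simp add: l_def th_def powr_diff[symmetric])
   moreover have "(4 * l t / th t)^2 = 16 * (l t / th t)^2" by (simp add: power_divide power_mult_distrib)
   ultimately have "(4 * l t / th t)^2 = 16 * (t powr (\<eta> + b))^2" by (simp only:)
   also have "... = 16 * t powr (2 * (\<eta> + b))" by (simp add: power2_eq_square powr_add[symmetric])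
   finally have "(4 * l t / th t)^2 = 16 * t powr (2 * (\<eta> + b))" .
   moreover have "1 / (1 / t) ^ 12 = t powr 12" using t by (simp add: power_divide powr_numeral)
   moreover have "(t powr q)^2 = t powr (2 * q)" by (simp add: power2_eq_square powr_add[symmetric])
   moreover have "(4 * l t / th t)^2 / (1 / t) ^ 12 * (t powr q)^2 = (4 * l t / th t)^2 * (1 / (1 / t) ^ 12) * (t powr q)^2" by simp
   ultimately show ?thesis unfolding p2_def by (simp only: powr_add mult.assoc)
  qed
  also have "K * (6 * exp (- l t / 4) + 2 powr sg / (sg - 1) * (A t powr (1 - sg) / th t)
     + 154 * low_const / (sg - 1) * (16 * t powr p2) * exp (- ((sg - 1) / 4 * t powr \<eta>)))
   + 2 * B * (exp (- (8 * l t)) + t powr (- 4 + 4 * b)) <= G t"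
  proof -
   have "A t powr (1 - sg) <= (t powr g / 2) powr (1 - sg)" using A2 t sg by (intro powr_mono2') auto
   also have "... = 2 powr (sg - 1) * t powr (g * (1 - sg))" using powr_minus_divide[of 2 "sg - 1"] by (simp add: powr_divide powr_powr)
   finally have "A t powr (1 - sg) / th t <= 2 powr (sg - 1) * t powr (g * (1 - sg)) / th t" using th by (intro divide_right_mono) auto
   also have "... = 2 powr (sg - 1) * t powr p1" by (simp add: th_def p1_def powr_add powr_minus divide_inverse)
   finally have "2 powr sg / (sg - 1) * (A t powr (1 - sg) / th t) <= 2 powr sg / (sg - 1) * (2 powr (sg - 1) * t powr p1)"
    using sg by (intro mult_left_mono) auto
   moreover have "2 powr sg / (sg - 1) * (2 powr (sg - 1) * t powr p1) = 2 powr sg * 2 powr (sg - 1) / (sg - 1) * t powr p1" by simp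
   moreover have "154 * low_const / (sg - 1) * (16 * t powr p2) * exp (- ((sg - 1) / 4 * t powr \<eta>)) = 154 * low_const * 16 / (sg - 1) * (t powr p2 * exp (- ((sg - 1) / 4 * t powr \<eta>)))" by simp
   ultimately show ?thesis unfolding G_def by (intro add_mono[OF mult_left_mono[OF _ K] order_refl] add_mono) (simp_all only: order_refl)
  qed
  finally show ?case .
 qed
 from norm_null_comparison[OF this G] show ?thesis unfolding l_def th_def .
qed

text \<open>Since \<open>m * sg = 1\<close>, the main outgoing term is
  \<open>t powr (ep * (1 - sg))\<close> and the incoming one is \<open>t powr - (sg * ep)\<close>.
  The product of threshold and radius is at least \<open>t powr ep\<close>, because
  \<open>sg <= 2\<close> gives \<open>1/2 <= m\<close>; this leaves room for the sharpness
  \<open>l t = t powr (ep / 4)\<close>.\<close>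

lemma sub_ballistic:
 assumes e: "norm e = 1" and ep: "0 < ep"
 shows "null (%t. norm (chi {x. t powr (1 / sg + ep) < x .* e} (U (s * t) (Om t - omega))))"
proof -
 define m where "m = 1 / sg"
 have m: "m * sg = 1" "1 / 2 <= m" "m < 1" using sg by (auto simp: m_def divide_simps)
 define th where "th t = t powr (- (1 - m))" for t :: real
 define l where "l t = t powr (ep / 4)" for t :: real
 define R where "R t = t powr (m + ep)" for t :: real
 define v where "v t = U (s * t) (Om t - omega)" for t
 define \<phi> where "\<phi> t xi = slgs (4 * l t * (s * vel e xi / th t - 3))" for t xi
 define tl where "tl r = norm (mul (%x. 1 - ind {x. x .* e < r} x) (Om 0 - omega))" for r
 \<comment> \<open>The outgoing estimate needs a slab of finite width. Beyond \<open>t^2\<close> no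
   cut-off is required: speeds are at most 1, so \<open>free_bound\<close> applies as soon as
   \<open>16 * t <= t^2\<close>.\<close>
 define far where "far t = K * (t * (2 * exp (- t / 4) + (t^2 / 2) powr - sg)) + 2 * B * (2 * exp (- t / 4)) + tl (t^2 / 2)" for t
 define inc where "inc t = K * (t * (6 * exp (- l t / 4) + (R t / 2) powr - sg)) + 2 * B * (6 * exp (- l t / 4)) + tl (R t / 2)" for t
 define out where "out t = norm (chi {x. R t < x .* e & x .* e <= t powr 2}
   (Mop (%xi. of_real (\<phi> t xi)) (U (s * (t - 0)) (Om t - omega))))" for t
 have b\<phi>: "bm (%xi. cor (\<phi> t xi))" for t unfolding \<phi>_def by (intro bm_slgs) measurable
 have c1: "EV t. 64 * (l t)^2 <= th t * R t"
  using eventually_ge_at_top[of 1] eventually_le_powr[of "ep / 2" 64, OF half_gt_zero[OF ep]]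
 proof eventually_elim
  case (elim t)
  have l2: "(l t)^2 = t powr (ep / 2)" using elim by (simp add: l_def power2_eq_square powr_add[symmetric])
  have "64 * (l t)^2 <= t powr (ep / 2) * t powr (ep / 2)" unfolding l2 using elim by (intro mult_right_mono) auto
  also have "... = t powr ep" by (simp add: powr_add[symmetric])
  also have "... <= t powr ((m - 1) + (m + ep))" using elim m by (intro powr_mono) auto
  finally show ?case by (simp add: th_def R_def powr_add[symmetric])
 qed
 have bound: "EV t. norm (chi {x. R t < x .* e} (v t)) <= far t + out t + inc t"
  using eventually_ge_at_top[of 16] eventually_le_powr[of "ep / 2" 64, OF half_gt_zero[OF ep]] c1
 proof eventually_elim
  case (elim t)
  have t: "1 <= t" "0 < t" using elim by auto
  have c1: "64 * (l t)^2 <= th t * R t" using elim by blast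
  have l1: "1 <= l t" unfolding l_def using t ep by (intro ge_one_powr_ge_zero) auto
  have th: "0 < th t" "th t <= 1" unfolding th_def using t m powr_mono[of "m - 1" 0 t] by auto
  have R0: "0 < R t" using t by (simp add: R_def)
  have c2: "64 * (t * th t) <= R t"
  proof -
   have "64 <= t powr ep" using elim t powr_mono[of "ep / 2" ep t] ep by linarith
   then have "64 * t powr m <= t powr ep * t powr m" by (rule mult_right_mono) simp
   then show ?thesis using t by (simp add: R_def th_def powr_add[symmetric] powr_diff add.commute)
  qed
  have R1: "1 <= R t" unfolding R_def using t m ep by (intro ge_one_powr_ge_zero) auto
  have t2: "16 * t <= t^2" "1 <= t^2" using elim by (auto simp: power2_eq_square intro: mult_right_mono mult_ge1_I)
  have F: "norm (chi {x. t^2 < x .* e} (v t)) <= far t"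
  proof -
   have "norm (chi {x. t^2 < x .* e} (Mop (%xi. of_real ((%_. 1) xi)) (U (s * t) (Om t - omega)))) <= far t" unfolding far_def tl_def
   proof (rule forward_estimate[OF e])
    fix \<tau> X assume \<tau>: "0 <= \<tau>" "\<tau> <= t"
    have "abs (- (s * \<tau>)) <= t^2 / 16" using \<tau> s t2 by (simp add: abs_mult)
    then have "norm (chi {x. x .* e < t^2 / 2} (Mop (%xi. cis (- (- (s * \<tau>) * jb xi))) (chi {x. t^2 < x .* e} X)))
     <= 2 * exp (- t / 4) * norm X" using t t2 by (intro free_bound[OF e]) auto
    then show "norm (chi {x. x .* e < t^2 / 2} (U (- (s * \<tau>)) (Mop (%xi. of_real 1) (chi {x. t^2 < x .* e} X))))
     <= 2 * exp (- t / 4) * norm X" by (simp add: U_def)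
   qed (use t in auto)
   then show ?thesis by (simp add: v_def)
  qed
  have I: "norm (chi {x. R t < x .* e} (Mop (%xi. of_real (1 - \<phi> t xi)) (v t))) <= inc t" unfolding inc_def tl_def v_def
  proof (rule forward_estimate[OF e])
   show "meas (%xi. 1 - \<phi> t xi)" unfolding \<phi>_def by measurable
   show "abs (1 - \<phi> t xi) <= 1" for xi unfolding \<phi>_def using slgs_bounds[of "4 * l t * (s * vel e xi / th t - 3)"] by (auto simp: abs_le_iff)
   fix \<tau> X assume \<tau>: "0 <= \<tau>" "\<tau> <= t"
   have "64 * (\<tau> * th t) <= 64 * (t * th t)" using \<tau> th by (intro mult_left_mono mult_right_mono) auto
   then have c3: "64 * (\<tau> * th t) <= R t" using c2 by linarith
   have bb: "bm (%xi. cor (1 - \<phi> t xi))" using bm_diff[OF bm_const[of 1] b\<phi>[of t]] by simp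
   have "U (- (s * \<tau>)) (Mop (%xi. of_real (1 - \<phi> t xi)) Z) = Mop (%xi. cis (s * \<tau> * jb xi) * of_real (1 - \<phi> t xi)) Z" for Z
    unfolding U_Mop[OF bb] by simp
   then show "norm (chi {x. x .* e < R t / 2} (U (- (s * \<tau>)) (Mop (%xi. of_real (1 - \<phi> t xi)) (chi {x. R t < x .* e} X))))
    <= 6 * exp (- l t / 4) * norm X" using incoming_bound[OF e s th l1 \<tau>(1) c3 c1, of X] by (simp add: \<phi>_def)
  qed (use t R0 in auto)
  let ?S = "{x. R t < x .* e & x .* e <= t^2}"
  have "norm (chi {x. R t < x .* e} (v t)) <= norm (mul (%x. ind {x. t^2 < x .* e} x + ind ?S x) (v t))"
   by (intro norm_mul_mono bm_indicator bm_add half_space_borel slab_borel) (auto simp: indicator_def)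
  also have "... <= norm (chi {x. t^2 < x .* e} (v t)) + norm (chi ?S (v t))"
   by (subst mul_add_left[symmetric]) (auto intro!: bm_indicator half_space_borel slab_borel norm_triangle_ineq)
  also have "norm (chi ?S (v t)) <= norm (chi ?S (Mop (%xi. of_real (\<phi> t xi)) (v t))) + norm (chi ?S (Mop (%xi. of_real (1 - \<phi> t xi)) (v t)))"
  proof -
   have bb: "bm (%xi. cor (1 - \<phi> t xi))" using bm_diff[OF bm_const[of 1] b\<phi>[of t]] by simp
   have eq: "Mop (%xi. of_real (\<phi> t xi)) (v t) + Mop (%xi. of_real (1 - \<phi> t xi)) (v t) = v t" unfolding Mop_add_left[OF b\<phi> bb] by simp
   have "norm (chi ?S (a + b)) <= norm (chi ?S a) + norm (chi ?S b)" for a b unfolding mul_add by (rule norm_triangle_ineq)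
   from this[of "Mop (%xi. of_real (\<phi> t xi)) (v t)" "Mop (%xi. of_real (1 - \<phi> t xi)) (v t)"]
   show ?thesis unfolding eq .
  qed
  also have "norm (chi ?S (Mop (%xi. of_real (1 - \<phi> t xi)) (v t))) <= norm (chi {x. R t < x .* e} (Mop (%xi. of_real (1 - \<phi> t xi)) (v t)))"
   by (intro norm_mul_indicator_mono half_space_borel slab_borel) auto
  finally show "norm (chi {x. R t < x .* e} (v t)) <= far t + out t + inc t" using F I t by (simp add: out_def v_def)
 qed
 have ev: "EV t :: real. 1 < t" by (rule eventually_gt_at_top)
 have tl: "null tl" unfolding tl_def by (rule half_space_tail)
 have R_top: "filterlim (%t. R t / 2) at_top at_top"
  unfolding R_def using m ep eventually_le_powr[of "m + ep"] by (auto simp: filterlim_at_top le_divide_eq)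
 have "filterlim (%t::real. t^2 / 2) at_top at_top" by real_asymp
 then have tl1: "null (%t. tl (t^2 / 2))" by (rule filterlim_compose[OF tl])
 have tl2: "null (%t. tl (R t / 2))" by (rule filterlim_compose[OF tl R_top])
 have far: "null far"
 proof -
  have 1: "null (%t :: real. t * (2 * exp (- t / 4)))" "null (%t :: real. 2 * exp (- t / 4))" by real_asymp+
  have 2: "null (%t. t * (t^2 / 2) powr - sg)"
  proof -
   have "((%t. 2 powr sg * t powr (1 - 2 * sg)) ---> 2 powr sg * 0) at_top" using sg by (intro tendsto_intros powr_neg_tendsto_0) auto
   moreover have "EV t. 2 powr sg * t powr (1 - 2 * sg) = t * (t^2 / 2) powr - sg" using ev
   proof eventually_elim
    case (elim t)
    have sq: "t^2 = t powr 2" using elim by simp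
    have "(t^2 / 2) powr - sg = t powr (- (2 * sg)) * 2 powr sg"
     unfolding sq using elim by (simp add: powr_divide powr_powr powr_minus divide_simps del: powr_numeral)
    then show ?case using elim by (simp add: powr_diff powr_minus divide_simps)
   qed
   ultimately show ?thesis by (simp add: filterlim_cong)
  qed
  have "(far ---> K * (0 + 0) + 2 * B * 0 + 0) at_top" unfolding far_def distrib_left[of "_ :: real" "2 * exp _"] by (intro tendsto_intros 1 2 tl1)
  then show ?thesis by simp
 qed
 have ex: "null (%t. exp (- l t / 4))" "null (%t. t * exp (- l t / 4))" using exp_powr_tendsto_0[of "1/4" "ep / 4"] ep by (simp_all add: l_def)
 have inc: "null inc"
 proof -
  have 2: "null (%t. t * (R t / 2) powr - sg)"
  proof -
   have "((%t. 2 powr sg * t powr (- (sg * ep))) ---> 2 powr sg * 0) at_top" using sg ep by (intro tendsto_intros powr_neg_tendsto_0) auto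
   moreover have "EV t. 2 powr sg * t powr (- (sg * ep)) = t * (R t / 2) powr - sg" using ev
   proof eventually_elim
    case (elim t)
    have "(R t / 2) powr - sg = t powr (- (1 + sg * ep)) * 2 powr sg"
    proof -
     have ex: "(m + ep) * (- sg) = - (1 + sg * ep)" using m(1) by (simp add: algebra_simps)
     have "(R t / 2) powr - sg = t powr ((m + ep) * (- sg)) / 2 powr - sg" by (simp only: R_def powr_divide powr_powr)
     then show ?thesis unfolding ex powr_minus[of 2 sg] divide_inverse inverse_inverse_eq .
    qed
    then show ?case using elim by (simp add: powr_add powr_diff powr_minus divide_simps)
   qed
   ultimately show ?thesis by (simp add: filterlim_cong)
  qed
  have eq: "inc t = K * (6 * (t * exp (- l t / 4)) + t * (R t / 2) powr - sg) + 2 * B * (6 * exp (- l t / 4)) + tl (R t / 2)" for t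
   by (simp add: inc_def distrib_left mult_ac)
  have "(inc ---> K * (6 * 0 + 0) + 2 * B * (6 * 0) + 0) at_top" unfolding eq by (intro tendsto_intros ex 2 tl2)
  then show ?thesis by simp
 qed
 have out: "null out" unfolding out_def \<phi>_def l_def th_def
 proof (rule outgoing_vanishes[OF e, where g = "m + ep"])
  show "(m + ep) * (1 - sg) + (1 - m) < 0"
  proof -
   have "(m + ep) * (1 - sg) + (1 - m) = ep * (1 - sg)" using m(1) by (simp add: algebra_simps)
   then show ?thesis using ep sg by (simp add: mult_pos_neg)
  qed
  show "EV t. 0 <= (0 :: real) & 0 <= t & 0 <= exp (t powr (ep / 4) / 4) & t powr (m + ep) / 2 <= R t + 0 * t powr - (1 - m) &
   0 * t powr - (1 - m) / 2 <= R t + 0 * t powr - (1 - m) & 64 * (t powr (ep / 4))^2 <= t powr - (1 - m) * (R t + 0 * t powr - (1 - m)) &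
   1 <= t powr 2 & - (t powr 2) <= R t" using c1 eventually_ge_at_top[of 1]
  proof eventually_elim
   case (elim t)
   have "- t\<^sup>2 <= t powr (m + ep)" by (rule order_trans[of _ 0]) auto
   then show ?case using elim by (auto simp: l_def th_def R_def)
  qed
 qed (use m ep in auto)
 have "((%t. far t + out t + inc t) ---> 0 + 0 + 0) at_top" by (intro tendsto_intros far out inc)
 then have "null (%t. norm (chi {x. R t < x .* e} (v t)))" by (intro tendsto_sandwich[OF _ bound tendsto_const]) auto
 then show ?thesis by (simp add: R_def v_def m_def)
qed

end

section \<open>Local decay of the profile\<close>

text \<open>The function \<open>w\<close> is \<rho> times a resolvent of the operator
  \<open>x .* e\<close>. Its commutator with a multiplier \<open>b\<close> is therefore, up to a
  phase, \<open>1 / \<rho>\<close> times \<open>w\<close>, then \<open>b'\<close>, then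
  \<open>w\<close>, in which no unbounded factor is left. The identity \<open>xw\<close> expresses
  this on the level of functions.\<close>

lemma commutator_bound:
 fixes z :: "'n::finite l2" and e :: "real ^ 'n"
 assumes \<rho>: "0 < \<rho>" and b: "edif e b b'" "!!xi. cmod (b xi) <= C" "!!xi. cmod (b' xi) <= \<Lambda>"
 defines "w \<equiv> %x. of_real \<rho> / (of_real (x .* e) + \<i> * of_real \<rho>)"
 shows "norm (mul w (Mop b z) - Mop b (mul w z)) <= \<Lambda> / \<rho> * norm z"
proof -
 have nz: "of_real (x .* e) + \<i> * of_real \<rho> ~= 0" for x using \<rho> by (auto simp: complex_eq_iff)
 have xw: "of_real (x .* e) * w x = of_real \<rho> - \<i> * of_real \<rho> * w x" for x using nz[of x] by (simp add: w_def field_simps)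
 have w1: "cmod (w x) <= 1" for x
 proof -
  have "\<rho> <= cmod (of_real (x .* e) + \<i> * of_real \<rho>)" using abs_Im_le_cmod[of "of_real (x .* e) + \<i> * of_real \<rho>"] \<rho> by simp
  then show ?thesis using \<rho> by (simp add: w_def norm_divide divide_le_eq)
 qed
 have wm: "meas w" unfolding w_def by measurable
 have bw: "bm w" by (rule bmI[OF wm w1])
 have bxw: "bm (%x. of_real (x .* e) * w x)" unfolding xw by (intro bm_diff bm_mult bm_const bw)
 have bb: "bm b" "bm b'" using edif_measurable[OF b(1)] b by (auto intro: bmI)
 have \<Lambda>: "0 <= \<Lambda>" using order_trans[OF norm_ge_zero b(3)] .
 show ?thesis proof (induction z rule: bs_induct)
  case (1 f)
  define h where "h x = w x * f x" for x
  define k where "k x = - \<i> * (x .* e) * h x" for x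
  have h: "bs h" unfolding h_def[abs_def] by (rule bs_bmult[OF 1 bw])
  have keq: "k x = (- \<i> * of_real \<rho>) * f x + (- of_real \<rho>) * h x" for x
  proof -
   have "k x = - \<i> * (of_real (x .* e) * w x) * f x" by (simp add: k_def h_def)
   then show ?thesis unfolding xw by (simp add: h_def algebra_simps)
  qed
  have k: "bs k" unfolding keq[abs_def] by (intro bs_add bs_cmult 1 h)
  have ch: "cls h = mul w (cls f)" unfolding h_def[abs_def] by (rule cls_mul[OF bs_L2[OF 1] bw, symmetric])
  have ck: "cls k = mul (%_. - \<i> * of_real \<rho>) (cls f) + mul (%_. - of_real \<rho>) (cls h)"
   unfolding keq[abs_def] cls_mul[OF bs_L2[OF 1] bm_const] cls_mul[OF bs_L2[OF h] bm_const]
   by (rule cls_add[OF L2_cmult[OF bs_L2[OF 1]] L2_cmult[OF bs_L2[OF h]], symmetric])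
  have Fh: "FT h : L2" "FT k : L2" by (intro plancherel_bs h k)+
  define H where "H xi = b xi * FT h xi" for xi
  define dH where "dH xi = b' xi * FT h xi + b xi * FT k xi" for xi
  have eH: "edif e H dH" unfolding H_def[abs_def] dH_def[abs_def] k_def[abs_def] by (intro edif_mult b edif_fourier_L1 h)
  have HL: "H : L2" "dH : L2" unfolding H_def[abs_def] dH_def[abs_def] by (intro L2_add L2_bm bb Fh)+
  have iH: "FI (cls H) = Mop b (cls h)" unfolding Mop_def FF_bs[OF h] cls_mul[OF Fh(1) bb(1)] H_def[abs_def] ..
  have idH: "FI (cls dH) = Mop b' (cls h) + Mop b (cls k)"
   unfolding Mop_def FF_bs[OF h] FF_bs[OF k] cls_mul[OF Fh(1) bb(2)] cls_mul[OF Fh(2) bb(1)] FI_add[symmetric]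
    cls_add[OF L2_bm[OF bb(2) Fh(1)] L2_bm[OF bb(1) Fh(2)]] dH_def[abs_def] ..
  have Mc: "Mop b (mul (%_. c) X) = mul (%_. c) (Mop b X)" for c X using Mop_commute[OF bb(1) bm_const, of c X] by (simp add: Mop_const)
  define P where "P = Mop b (cls h)"
  have "mul w (FI (cls dH)) = mul (%x. - \<i> * (of_real (x .* e) * w x)) (FI (cls H))" by (rule mul_FI_edif[OF eH HL bw bxw])
  also have "(%x. - \<i> * (of_real (x .* e) * w x)) = (%x. (- \<i> * of_real \<rho>) + (- of_real \<rho>) * w x)"
   unfolding xw by (simp add: algebra_simps)
  finally have "mul w (Mop b' (cls h)) + mul w (Mop b (cls k)) = mul (%_. - \<i> * of_real \<rho>) P + mul (%_. - of_real \<rho>) (mul w P)"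
   unfolding idH iH mul_add P_def[symmetric] mul_add_left[OF bm_const bm_mult[OF bm_const bw], symmetric] mul_mul[OF bm_const bw] .
  moreover have "mul w (Mop b (cls k)) = mul (%_. - \<i> * of_real \<rho>) (mul w (Mop b (cls f))) + mul (%_. - of_real \<rho>) (mul w P)"
   unfolding ck Mop_add Mc mul_add P_def mul_commute[OF bw bm_const] ..
  ultimately have "mul w (Mop b' (cls h)) = mul (%_. - \<i> * of_real \<rho>) P - mul (%_. - \<i> * of_real \<rho>) (mul w (Mop b (cls f)))"
   by (simp add: algebra_simps)
  then have "mul w (Mop b' (cls h)) = mul (%_. - \<i> * of_real \<rho>) (P - mul w (Mop b (cls f)))" by (simp only: mul_diff)
  then have "norm (mul w (Mop b' (cls h))) = \<rho> * norm (P - mul w (Mop b (cls f)))" using \<rho> by (simp add: norm_mul_const norm_mult)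
  moreover have "norm (mul w (Mop b' (cls h))) <= \<Lambda> * norm (cls f)"
  proof -
   have "norm (mul w (Mop b' (cls h))) <= 1 * norm (Mop b' (cls h))" by (rule norm_mul_le[OF wm w1])
   also have "1 * norm (Mop b' (cls h)) <= \<Lambda> * norm (cls h)" unfolding mult_1 by (rule norm_Mop_le[OF edif_measurable(2)[OF b(1)] b(3)])
   also have "... <= \<Lambda> * (1 * norm (cls f))" unfolding ch by (intro mult_left_mono \<Lambda> norm_mul_le[OF wm w1])
   finally show ?thesis by simp
  qed
  ultimately have "norm (P - mul w (Mop b (cls f))) <= \<Lambda> / \<rho> * norm (cls f)" using \<rho> by (simp add: field_simps)
  then show ?case unfolding P_def ch by (simp only: norm_minus_commute)
 next
  case (2 Xs X)
  show ?case by (rule LIMSEQ_le_all[OF 2(1)]; (intro tendsto_norm tendsto_diff bounded_linear.tendsto[OF bounded_linear_mul] bounded_linear.tendsto[OF bounded_linear_Mop] tendsto_intros)?; rule 2(2))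
 qed
qed

text \<open>Cubes stand in for balls because their volume is explicit.\<close>

definition cube :: "real => (real ^ 'n::finite) set" where "cube r = cbox (\<chi> i. - r) (\<chi> i. r)"

lemma cube_borel [measurable, simp]: "cube r : sets borel" by (simp add: cube_def)

lemma mem_cube: "x : cube r \<longleftrightarrow> (ALL k. abs (x $ k) <= r)"
 by (auto simp: cube_def mem_box_cart abs_le_iff neg_le_iff_le) (metis minus_le_iff)+

lemma norm_le_in_cube: "norm x <= r ==> x : cube r" using component_le_norm_cart[of x] by (auto simp: mem_cube intro: order_trans)

lemma cube_L2:
 assumes "0 <= r"
 shows "(ind (cube r :: (real ^ 'n::finite) set) :: _ => complex) : L2"
  and "norm (cls (ind (cube r :: (real ^ 'n) set) :: _ => complex)) = sqrt ((2 * r) ^ CARD('n))"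
proof -
 let ?I = "ind (cube r :: (real ^ 'n) set) :: _ => complex"
 have sq: "(cmod (?I x))^2 = ind (cube r) x" for x by (simp add: indicator_def)
 have int: "integrable lborel (ind (cube r :: (real ^ 'n) set) :: _ => real)"
  unfolding cube_def by (intro integrable_real_indicator) (auto simp: emeasure_lborel_cbox_eq)
 then show L: "?I : L2" by (simp add: L2_def sq)
 have "(LINT x|lborel. (cmod (?I x))^2) = measure lborel (cube r :: (real ^ 'n) set)" unfolding sq by simp
 also have "... = (2 * r) ^ CARD('n)"
 proof -
  have "cbox (\<chi> i. - r) (\<chi> i. r) ~= ({} :: (real ^ 'n) set)" using assms by (auto simp: interval_ne_empty_cart)
  from content_cbox_cart[OF this] show ?thesis by (simp add: cube_def)
 qed
 finally show "norm (cls ?I) = sqrt ((2 * r) ^ CARD('n))" unfolding cls_norm[OF L] L2_norm_def by simp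
qed

text \<open>By Cauchy-Schwarz a function supported in a cube has a bounded transform, and
  restricting the latter to another cube costs the root of its volume. The product is small when
  \<open>r * q\<close> is small, which is how low frequencies inside a small region are
  discarded.\<close>

lemma bernstein:
 fixes X :: "'n::finite l2"
 assumes r: "0 <= r" and q: "0 <= q"
 shows "norm (mul (ind (cube r)) (FI (mul (ind (cube q)) X))) <= ft_const TYPE('n) * sqrt ((4 * r * q) ^ CARD('n)) * norm X"
proof (rule norm_le_innerI)
 let ?r = "ind (cube r) :: real ^ 'n => complex" and ?q = "ind (cube q) :: real ^ 'n => complex"
 have c0: "0 <= ft_const TYPE('n)" by (simp add: ft_const_def)
 show "0 <= ft_const TYPE('n) * sqrt ((4 * r * q) ^ CARD('n)) * norm X" using c0 r q by simp
 fix Y :: "'n l2"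
 obtain f where f: "f : L2" "Y = cls f" using l2_cases by metis
 define g where "g x = ?r x * f x" for x
 have bI: "bm ?r" "bm ?q" by (intro bm_indicator cube_borel)+
 have g: "bs g"
 proof -
  obtain d where d: "!!x. x : (cube r :: (real ^ 'n) set) ==> norm x <= d"
   using bounded_cbox[of "\<chi> i. - r" "\<chi> i. r"] unfolding cube_def bounded_iff by blast
  have "g x = 0" if "d < norm x" for x using d[of x] that by (auto simp: g_def indicator_def)
  then show ?thesis unfolding bs_def g_def[abs_def] using L2_bm[OF bI(1) f(1)] by blast
 qed
 have cg: "mul ?r Y = cls g" unfolding f(2) g_def[abs_def] by (rule cls_mul[OF f(1) bI(1)])
 have int: "(LINT x|lborel. cmod (g x)) <= sqrt ((2 * r) ^ CARD('n)) * norm Y"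
 proof -
  have af: "(%x. cor (cmod (f x))) : L2" using f(1) by (auto simp: L2_def)
  have nf: "norm (cls (%x. cor (cmod (f x)))) = norm Y" unfolding f(2) cls_norm[OF f(1)] cls_norm[OF af] L2_norm_def by simp
  have "(%x. cor (cmod (g x))) = (%x. ?r x * cnj (cor (cmod (f x))))" by (auto simp: g_def indicator_def norm_mult)
  then have "L2_inner ?r (%x. cor (cmod (f x))) = (LINT x|lborel. cor (cmod (g x)))" unfolding L2_inner_def by simp
  also have "... = of_real (LINT x|lborel. cmod (g x))" by simp
  finally have "cinner (cls ?r) (cls (%x. cor (cmod (f x)))) = of_real (LINT x|lborel. cmod (g x))" using cls_cinner[OF cube_L2(1)[OF r] af] by simp
  then have "cmod (of_real (LINT x|lborel. cmod (g x))) <= norm (cls ?r) * norm Y"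
   using cinner_norm_le[of "cls ?r" "cls (%x. cor (cmod (f x)))"] unfolding nf by simp
  then show ?thesis unfolding cube_L2(2)[OF r] norm_of_real by linarith
 qed
 define M where "M = ft_const TYPE('n) * (sqrt ((2 * r) ^ CARD('n)) * norm Y)"
 have FM: "cmod (FT g xi) <= M" for xi unfolding M_def using fourier_L1_bound[of g xi] mult_left_mono[OF int c0] by linarith
 have Fm: "meas (FT g)" by (rule borel_measurable_continuous_onI[OF fourier_L1_continuous[OF bs_integrable[OF g]]])
 have "mul ?q (FF (mul ?r Y)) = mul (FT g) (cls ?q)"
  unfolding cg FF_bs[OF g] cls_mul[OF plancherel_bs(1)[OF g] bI(2)] cls_mul[OF cube_L2(1)[OF q] bmI[OF Fm FM]] by (simp add: mult.commute)
 then have n: "norm (mul ?q (FF (mul ?r Y))) <= M * sqrt ((2 * q) ^ CARD('n))"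
  using norm_mul_le[OF Fm FM, of "cls ?q"] unfolding cube_L2(2)[OF q] by (simp only:)
 have "inner (mul ?r (FI (mul ?q X))) Y = inner X (mul ?q (FF (mul ?r Y)))" by (simp add: inner_l2_Re cinner_mul_left bI cinner_FI_FF)
 also have "... <= norm X * norm (mul ?q (FF (mul ?r Y)))" by (rule norm_cauchy_schwarz)
 also have "... <= norm X * (M * sqrt ((2 * q) ^ CARD('n)))" by (intro mult_left_mono n) auto
 also have "... = ft_const TYPE('n) * (sqrt ((2 * r) ^ CARD('n)) * sqrt ((2 * q) ^ CARD('n))) * norm X * norm Y" by (simp add: M_def mult_ac)
 also have "sqrt ((2 * r) ^ CARD('n)) * sqrt ((2 * q) ^ CARD('n)) = sqrt ((4 * r * q) ^ CARD('n))"
 proof -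
  have "(2 * r) * (2 * q) = 4 * r * q" by simp
  then show ?thesis by (simp only: real_sqrt_mult[symmetric] power_mult_distrib[symmetric])
 qed
 finally show "inner (mul ?r (FI (mul ?q X))) Y <= ft_const TYPE('n) * sqrt ((4 * r * q) ^ CARD('n)) * norm X * norm Y" .
qed

definition lip :: "real => real => (real ^ 'n::finite => complex) => bool" where
 "lip C \<Lambda> b \<longleftrightarrow> (ALL xi. cmod (b xi) <= C) & (ALL e. norm e = 1 --> (EX b'. edif e b b' & (ALL xi. cmod (b' xi) <= \<Lambda>)))"

lemma lip_nonneg: assumes "lip C \<Lambda> b" shows "0 <= C" "0 <= \<Lambda>"
proof -
 show "0 <= C" using assms norm_ge_zero order_trans unfolding lip_def by blast
 obtain b' where "ALL xi. cmod (b' xi) <= \<Lambda>" using assms norm_axis_1[of undefined] unfolding lip_def by blast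
 then show "0 <= \<Lambda>" using norm_ge_zero order_trans by blast
qed

lemma lip_bm: assumes "lip C \<Lambda> b" shows "bm b"
proof -
 obtain b' where "edif (axis undefined 1) b b'" using assms norm_axis_1[of undefined] unfolding lip_def by blast
 then show ?thesis using edif_measurable assms unfolding lip_def by (intro bmI) auto
qed

lemma lip_mono: "lip C \<Lambda> b ==> C <= C' ==> \<Lambda> <= \<Lambda>' ==> lip C' \<Lambda>' b" unfolding lip_def by (meson order_trans)

lemma lip_mult:
 assumes b: "lip C \<Lambda> b" and c: "lip C' \<Lambda>' c"
 shows "lip (C * C') (\<Lambda> * C' + C * \<Lambda>') (%xi. b xi * c xi)" unfolding lip_def
proof (intro conjI allI impI)
 note nn = lip_nonneg[OF b] lip_nonneg[OF c]
 show "cmod (b xi * c xi) <= C * C'" for xi unfolding norm_mult using b c nn by (intro mult_mono) (auto simp: lip_def)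
 fix e :: "real ^ 'a" assume e: "norm e = 1"
 obtain b' c' where d: "edif e b b'" "!!xi. cmod (b' xi) <= \<Lambda>" "edif e c c'" "!!xi. cmod (c' xi) <= \<Lambda>'"
  using b c e unfolding lip_def by metis
  have "cmod (b' xi * c xi + b xi * c' xi) <= \<Lambda> * C' + C * \<Lambda>'" for xi
  using b c nn d by (intro order_trans[OF norm_triangle_ineq] add_mono) (auto simp: norm_mult lip_def intro!: mult_mono)
 then show "EX b'. edif e (%xi. b xi * c xi) b' & (ALL xi. cmod (b' xi) <= \<Lambda> * C' + C * \<Lambda>')" using edif_mult[OF d(1,3)] by blast
qed

lemma lip_affine:
 assumes b: "lip C \<Lambda> b" and C': "!!xi. cmod (u + a * b xi) <= C'"
 shows "lip C' (cmod a * \<Lambda>) (%xi. u + a * b xi)" unfolding lip_def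
proof (intro conjI allI impI C')
 fix e :: "real ^ 'a" assume e: "norm e = 1"
 obtain b' where d: "edif e b b'" "!!xi. cmod (b' xi) <= \<Lambda>" using b e unfolding lip_def by metis
 have "edif e (%xi. u + a * b xi) (%xi. 0 + (0 * b xi + a * b' xi))" by (intro edif_add edif_mult edif_const d)
 moreover have "cmod (0 + (0 * b xi + a * b' xi)) <= cmod a * \<Lambda>" for xi using d(2)[of xi] by (simp add: norm_mult mult_left_mono)
 ultimately show "EX b'. edif e (%xi. u + a * b xi) b' & (ALL xi. cmod (b' xi) <= cmod a * \<Lambda>)" by blast
qed

lemma lip_add:
 assumes b: "lip C \<Lambda> b" and c: "lip C' \<Lambda>' c"
 shows "lip (C + C') (\<Lambda> + \<Lambda>') (%xi. b xi + c xi)" unfolding lip_def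
proof (intro conjI allI impI)
 show "cmod (b xi + c xi) <= C + C'" for xi using b c by (intro order_trans[OF norm_triangle_ineq] add_mono) (auto simp: lip_def)
 fix e :: "real ^ 'a" assume e: "norm e = 1"
 obtain b' c' where d: "edif e b b'" "!!xi. cmod (b' xi) <= \<Lambda>" "edif e c c'" "!!xi. cmod (c' xi) <= \<Lambda>'"
  using b c e unfolding lip_def by metis
 have "cmod (b' xi + c' xi) <= \<Lambda> + \<Lambda>'" for xi using d by (intro order_trans[OF norm_triangle_ineq] add_mono) auto
 then show "EX b'. edif e (%xi. b xi + c xi) b' & (ALL xi. cmod (b' xi) <= \<Lambda> + \<Lambda>')" using edif_add[OF d(1,3)] by blast
qed

lemma edif_vel:
 assumes a: "norm a = 1" and e: "norm e = 1"
 shows "edif e (%xi. of_real (vel a xi)) (%xi. of_real (e .* a) * ic xi + of_real (xi .* a) * (- (ic xi * ic xi) * vc e xi))"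
proof -
 have "edif e (%xi. cor (xi .* a)) (%_. of_real (e .* a))" unfolding edif_def
 proof (intro conjI allI)
  fix xi :: "real ^ 'a"
  have "((%r. cor (xi .* a + r * (e .* a))) has_vector_derivative of_real (e .* a)) (at 0)"
   by (intro has_vector_derivative_of_real) (auto intro!: derivative_eq_intros simp: has_real_derivative_iff_has_vector_derivative[symmetric])
  then show "((%r. cor ((xi + r *r e) .* a)) has_vector_derivative of_real (e .* a)) (at 0)" by (simp add: inner_add_left)
 qed (auto intro!: continuous_intros)
 from edif_mult[OF this edif_ic[OF e]]
 show ?thesis by (simp add: vel_def ic_def[OF e])
qed

lemma lip_slgs_vel:
 assumes a: "norm a = 1"
 shows "lip 1 (2 * abs c) (%xi. of_real (slgs (c * vel a xi + d0)))" unfolding lip_def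
proof (intro conjI allI impI)
 have s01: "0 <= slgs x" "slgs x <= 1" for x using slgs_bounds[of x] by auto
 show "cmod (of_real (slgs (c * vel a xi + d0))) <= 1" for xi using s01 by simp
 fix e :: "real ^ 'a" assume e: "norm e = 1"
 define w where "w xi = of_real (e .* a) * ic xi + of_real (xi .* a) * (- (ic xi * ic xi) * vc e xi)" for xi
 have w: "edif e (%xi. of_real (vel a xi)) w" unfolding w_def[abs_def] by (rule edif_vel[OF a e])
 have w2: "cmod (w xi) <= 2" for xi
 proof -
  have "abs (e .* a) <= 1" using Cauchy_Schwarz_ineq2[of e a] a e by simp
  then have "cmod (of_real (e .* a) * ic xi) <= 1 * 1" unfolding norm_mult using norm_ic[OF e, of xi] by (intro mult_mono) auto
  moreover have "cmod (of_real (vel a xi) * ic xi * vc e xi) <= 1 * 1 * 1"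
   unfolding norm_mult using norm_ic[OF e, of xi] norm_vc[OF e, of xi] abs_vel_le_1[OF a, of xi] by (intro mult_mono) auto
  moreover have "of_real (xi .* a) * (- (ic xi * ic xi) * vc e xi) = - (of_real (vel a xi) * ic xi * vc e xi)" by (simp add: vel_def ic_def[OF e])
  ultimately show ?thesis unfolding w_def using norm_triangle_ineq[of "of_real (e .* a) * ic xi" "of_real (xi .* a) * (- (ic xi * ic xi) * vc e xi)"]
   by (simp only: norm_minus_cancel)
 qed
 have e1: "edif e (%xi. of_real c * of_real (vel a xi) + of_real d0) (%xi. (0 * of_real (vel a xi) + of_real c * w xi) + 0)"
  by (intro edif_add edif_mult edif_const w)
 have r: "of_real c * of_real (vel a xi) + of_real d0 = cor (c * vel a xi + d0)" for xi by simp
 have ne: "1 + exp (- cor x) ~= 0" for x using lgs_bounds(1)[of "of_real x"] by simp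
 have dl: "(lgs has_field_derivative lgs (of_real x) * (1 - lgs (of_real x))) (at (of_real x))" for x :: real
 proof -
  have "(lgs has_field_derivative exp (- of_real x) / (1 + exp (- of_real x))^2) (at (of_real x))"
   unfolding lgs_def[abs_def] using ne[of x] by (auto intro!: derivative_eq_intros simp: power2_eq_square)
  moreover have "exp (- of_real x) / (1 + exp (- of_real x))^2 = lgs (of_real x) * (1 - lgs (of_real x))"
   unfolding lgs_def using ne[of x] by (simp add: field_simps power2_eq_square)
  ultimately show ?thesis by simp
 qed
 have cl: "continuous_on (range (%xi. of_real c * of_real (vel a xi) + of_real d0)) (%z. lgs z * (1 - lgs z))"
 proof -
  have "1 + exp (- (of_real c * of_real (vel a xi) + cor d0)) ~= 0" for xi unfolding r by (rule ne)
  then show ?thesis unfolding lgs_def by (intro continuous_intros) auto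
 qed
 have "edif e (%xi. lgs (of_real c * of_real (vel a xi) + of_real d0))
  (%xi. (lgs (of_real c * of_real (vel a xi) + of_real d0) * (1 - lgs (of_real c * of_real (vel a xi) + of_real d0))) * ((0 * of_real (vel a xi) + of_real c * w xi) + 0))"
  by (rule edif_chain[OF e1 _ cl]) (unfold r, rule dl)
 then have ed: "edif e (%xi. of_real (slgs (c * vel a xi + d0))) (%xi. of_real (slgs (c * vel a xi + d0) * (1 - slgs (c * vel a xi + d0))) * (of_real c * w xi))"
  unfolding r lgs_of_real by simp
 have "cmod (of_real (slgs y * (1 - slgs y)) * (of_real c * w xi)) <= 2 * abs c" for y xi
 proof -
  have "abs (slgs y * (1 - slgs y)) <= 1" using s01[of y] by (auto simp: abs_mult intro!: mult_le_one)
  moreover have "cmod (of_real c * w xi) <= abs c * 2" unfolding norm_mult norm_of_real using w2 by (intro mult_left_mono) auto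
  ultimately have "abs (slgs y * (1 - slgs y)) * cmod (of_real c * w xi) <= 1 * (abs c * 2)" by (intro mult_mono) auto
  then show ?thesis unfolding norm_mult[of "of_real (slgs y * (1 - slgs y))"] norm_of_real by simp
 qed
 then show "EX b'. edif e (%xi. of_real (slgs (c * vel a xi + d0))) b' & (ALL xi. cmod (b' xi) <= 2 * abs c)" using ed by blast
qed

lemma smooth_cutoffD:
 assumes "smooth_cutoff F"
 shows "(F has_real_derivative deriv F x) (at x)" "continuous_on UNIV (deriv F)" "x >= 1 ==> F x = 1" "x < 1/2 ==> F x = 0"
  "x < 1/2 ==> deriv F x = 0"
proof -
 have d: "!!k x. (deriv ^^ k) F field_differentiable (at x)" using assms by (auto simp: smooth_cutoff_def)
 show "(F has_real_derivative deriv F x) (at x)" for x using d[of 0 x] by (simp add: field_differentiable_derivI)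
 show "continuous_on UNIV (deriv F)" using d[of 1] by (intro continuous_at_imp_continuous_on) (auto intro: field_differentiable_imp_continuous_at)
 show "x >= 1 ==> F x = 1" "x < 1/2 ==> F x = 0" using assms by (auto simp: smooth_cutoff_def)
 assume x: "x < 1/2"
 have "deriv F x = deriv (%_. 0 :: real) x"
 proof (rule deriv_cong_ev)
  show "\<forall>\<^sub>F y in nhds x. F y = 0"
   using assms x eventually_nhds_in_open[of "{..<1/2}" x] by (auto simp: smooth_cutoff_def elim: eventually_mono)
 qed simp
 then show "deriv F x = 0" by simp
qed

lemma smooth_cutoff_bounded:
 assumes F: "smooth_cutoff F"
 shows "EX C>=1. ALL x. abs (F x) <= C & abs (deriv F x) <= C"
proof -
 note sc = smooth_cutoffD[OF F]
 have cF: "continuous_on {0..2} F" using sc(1) by (intro continuous_at_imp_continuous_on) (auto intro: DERIV_isCont)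
 have "compact (F ` {0..2})" "compact (deriv F ` {0..2})" by (intro compact_continuous_image cF continuous_on_subset[OF sc(2)]; simp)+
 then obtain C1 C2 where C: "!!x. x : {0..2} ==> abs (F x) <= C1" "!!x. x : {0..2} ==> abs (deriv F x) <= C2"
  by (metis (no_types, lifting) bounded_iff compact_imp_bounded image_eqI real_norm_def)
 have d1: "deriv F x = 0" if "x > 1" for x
 proof -
  have "deriv F x = deriv (%_. 1 :: real) x"
  proof (rule deriv_cong_ev)
   show "\<forall>\<^sub>F y in nhds x. F y = 1"
    using F that eventually_nhds_in_open[of "{1<..}" x] by (auto simp: smooth_cutoff_def elim: eventually_mono)
  qed simp
  then show ?thesis by simp
 qed
 have "abs (F x) <= max 1 (max C1 C2) & abs (deriv F x) <= max 1 (max C1 C2)" for x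
 proof -
  consider "x < 0" | "x : {0..2}" | "x > 2" by fastforce
  then show ?thesis proof cases
   case 2 then show ?thesis using C[of x] by auto
  qed (use sc(3-5)[of x] d1[of x] in auto)
 qed
 then show ?thesis by (intro exI[of _ "max 1 (max C1 C2)"]) auto
qed

text \<open>The norm is not differentiable at the origin, but the cut-off vanishes on a
  neighbourhood of it; elsewhere the chain rule applies.\<close>

lemma lip_radial_cutoff:
 assumes F: "smooth_cutoff F" and C: "!!x. abs (F x) <= C & abs (deriv F x) <= C" and c: "0 < c"
 shows "lip C (C * c) (%xi :: real ^ 'n::finite. of_real (F (c * norm xi)))" unfolding lip_def
proof (intro conjI allI impI)
 show "cmod (of_real (F (c * norm xi))) <= C" for xi :: "real ^ 'n" using C by simp
 fix e :: "real ^ 'n" assume e: "norm e = 1"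
 note sc = smooth_cutoffD[OF F]
 define f' where "f' xi = deriv F (c * norm xi) * (c * ((xi .* e) / norm xi))" for xi
 have cF: "continuous_on UNIV F" using sc(1) by (intro continuous_at_imp_continuous_on) (auto intro: DERIV_isCont)
 have z: "c * norm xi < 1/2" if "xi : ball 0 (1 / (2 * c))" for xi :: "real ^ 'n" using that c by (simp add: field_simps)
 have "edif e (%xi. of_real (F (c * norm xi))) (%xi. of_real (f' xi))" unfolding edif_def
 proof (intro conjI allI)
  show "continuous_on UNIV (%xi :: real ^ 'n. cor (F (c * norm xi)))" by (intro continuous_intros continuous_on_compose2[OF cF]) auto
  have 1: "continuous_on (- {0}) f'" unfolding f'_def by (intro continuous_intros continuous_on_compose2[OF sc(2)]) auto
  have "continuous_on (ball 0 (1 / (2 * c))) f' \<longleftrightarrow> continuous_on (ball 0 (1 / (2 * c)) :: (real ^ 'n) set) (%_. 0 :: real)"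
   by (rule continuous_on_cong[OF refl]) (use z sc(5) in \<open>auto simp: f'_def\<close>)
  then have "continuous_on (- {0} \<union> ball 0 (1 / (2 * c))) f'" by (intro continuous_on_open_Un 1) auto
  moreover have "- {0 :: real ^ 'n} \<union> ball 0 (1 / (2 * c)) = UNIV" using c by auto
  ultimately show "continuous_on UNIV (%xi. cor (f' xi))" by (intro continuous_intros) simp
  fix xi :: "real ^ 'n"
  have "((%r. F (c * norm (xi + r *r e))) has_real_derivative f' xi) (at 0)"
  proof (cases "xi = 0")
   case True
   have "((%_. 0 :: real) has_real_derivative 0) (at 0)" by simp
   then have "((%r. F (c * norm (r *r e))) has_real_derivative 0) (at 0)"
   proof (rule has_field_derivative_transform_within_open[of _ _ _ "ball 0 (1 / (2 * c))"])
    show "0 = F (c * norm (r *r e))" if "r : ball 0 (1 / (2 * c))" for r using that sc(4)[of "c * norm (r *r e)"] e c by (simp add: field_simps)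
   qed (use c in auto)
   then show ?thesis by (simp add: True f'_def)
  next
   case False
   have ee: "e .* e = 1" using e by (simp add: power2_norm_eq_inner[symmetric])
   have n: "norm (xi + r *r e) = sqrt ((norm xi)^2 + 2 * r * (xi .* e) + r^2)" for r
    unfolding power2_norm_eq_inner norm_eq_sqrt_inner[of "xi + r *r e"]
    using ee by (simp add: inner_add_left inner_add_right inner_commute[of e xi] power2_eq_square distrib_left)
   have "((%r. sqrt ((norm xi)^2 + 2 * r * (xi .* e) + r^2)) has_real_derivative (xi .* e) / norm xi) (at 0)"
    using False by (auto intro!: derivative_eq_intros simp: divide_simps)
   then have g: "((%r. c * norm (xi + r *r e)) has_real_derivative c * ((xi .* e) / norm xi)) (at 0)" unfolding n by (intro DERIV_cmult)
   have "(F has_real_derivative deriv F (c * norm xi)) (at (c * norm (xi + 0 *r e)))" using sc(1) by simp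
   from DERIV_chain2[OF this g] show ?thesis unfolding f'_def .
  qed
  then show "((%r. cor (F (c * norm (xi + r *r e)))) has_vector_derivative of_real (f' xi)) (at 0)"
   by (intro has_vector_derivative_of_real) (simp add: has_real_derivative_iff_has_vector_derivative)
 qed
 moreover have "cmod (of_real (f' xi)) <= C * c" for xi
 proof -
  have "abs ((xi .* e) / norm xi) <= 1" using Cauchy_Schwarz_ineq2[of xi e] e by (cases "xi = 0") (auto simp: divide_le_eq_1)
  then have "abs (deriv F (c * norm xi)) * (c * abs ((xi .* e) / norm xi)) <= C * (c * 1)"
   using C[of "c * norm xi"] c by (intro mult_mono mult_left_mono) auto
  then show ?thesis using c unfolding norm_of_real by (simp add: f'_def abs_mult)
 qed
 ultimately show "EX b'. edif e (%xi. of_real (F (c * norm xi))) b' & (ALL xi. cmod (b' xi) <= C * c)" by blast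
qed

lemma norm_mul_add_le: "norm (mul m (X + Y)) <= norm (mul m X) + norm (mul m Y)" unfolding mul_add by (rule norm_triangle_ineq)

lemma vel_minus: "vel (- e) xi = - vel e xi" by (simp add: vel_def)

context orbit
begin

text \<open>The case \<open>\<tau>0 t = t\<close> of \<open>outgoing_vanishes\<close>: undoing the
  whole evolution gives the front a head start of \<open>t powr (1 - b)\<close>, which dominates
  \<open>t powr a'\<close>. The condition \<open>b < (sg - 1) / sg\<close> is exactly the negativity
  of \<open>(1 - b) * (1 - sg) + b\<close>, and \<open>2 * \<eta> < 1 - 2 * b\<close> is the
  uncertainty principle.\<close>

lemma outgoing_local:
 assumes e: "norm e = 1" and b: "0 < b" "b < 1/2" "b < (sg - 1) / sg" and a': "0 < a'" "a' < 1 - b" and \<eta>: "0 < \<eta>" "2 * \<eta> < 1 - 2 * b"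
 shows "null (%t. norm (chi {x. abs (x .* e) < t powr a'}
   (Mop (%xi. of_real (slgs (4 * t powr \<eta> * (s * vel e xi / t powr (- b) - 3)))) (Om t - omega))))"
proof -
 have e1: "EV t. 2 <= t powr (1 - b - a')" and e2: "EV t. 128 <= t powr (1 - 2 * b - 2 * \<eta>)"
  using a' \<eta> by (intro eventually_le_powr; simp)+
 have T: "EV t. t * exp (- (1/4 * t powr \<eta>)) < 1"
  using exp_powr_tendsto_0(2)[of "1/4" \<eta>] \<eta> by (intro order_tendstoD) auto
 have "EV t. 0 <= t & t <= t & t <= exp (t powr \<eta> / 4) & t powr (1 - b) / 2 <= - (t powr a') + t * t powr (- b)
   & t * t powr (- b) / 2 <= - (t powr a') + t * t powr (- b) & 64 * (t powr \<eta>)^2 <= t powr (- b) * (- (t powr a') + t * t powr (- b))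
   & 1 <= t powr a' & - (t powr a') <= - (t powr a')" using eventually_gt_at_top[of 1] T e1 e2
 proof eventually_elim
  case (elim t)
  have t: "1 <= t" using elim by simp
  have tth: "t * t powr (- b) = t powr (1 - b)" using t by (simp add: powr_diff powr_minus divide_inverse)
  have "2 * t powr a' <= t powr (1 - b - a') * t powr a'" using elim by (intro mult_right_mono) auto
  then have half: "t powr (1 - b) / 2 <= - (t powr a') + t powr (1 - b)" by (simp add: powr_add[symmetric])
  have "128 * t powr (2 * \<eta>) <= t powr (1 - 2 * b - 2 * \<eta>) * t powr (2 * \<eta>)" using elim by (intro mult_right_mono) auto
  then have "128 * (t powr \<eta>)^2 <= t powr (1 - 2 * b)" by (simp add: powr_add[symmetric] power2_eq_square)
  also have "... = t powr (- b) * t powr (1 - b)" by (simp add: powr_add[symmetric])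
  finally have "64 * (t powr \<eta>)^2 <= t powr (- b) * (t powr (1 - b) / 2)" by simp
  also have "... <= t powr (- b) * (- (t powr a') + t powr (1 - b))" using half by (intro mult_left_mono) auto
  finally have "64 * (t powr \<eta>)^2 <= t powr (- b) * (- (t powr a') + t powr (1 - b))" .
  moreover have "t <= exp (t powr \<eta> / 4)" using elim(2) by (simp add: exp_minus field_simps)
  ultimately show ?case using t half a' unfolding tth by (auto intro: ge_one_powr_ge_zero)
 qed
 moreover have "(1 - b) * (1 - sg) + b < 0"
 proof -
  have "sg * b < sg - 1" using b(3) sg by (simp add: field_simps)
  moreover have "(1 - b) * (1 - sg) + b = sg * b - (sg - 1)" by (simp add: algebra_simps)
  ultimately show ?thesis by simp
 qed
 ultimately have lim: "null (%t. norm (chi {x. - (t powr a') < x .* e & x .* e <= t powr a'}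
   (Mop (%xi. of_real (slgs (4 * t powr \<eta> * (s * vel e xi / t powr (- b) - 3)))) (U (s * (t - t)) (Om t - omega)))))"
  using b \<eta> by (intro outgoing_vanishes[OF e, where g = "1 - b"]) auto
 show ?thesis by (intro norm_null_comparison[OF always_eventually lim] allI) (auto intro!: norm_mul_indicator_mono slab_borel)
qed

text \<open>A smooth version of the indicator of
  \<open>3 * t powr (- b) < abs (vel (axis k 1) xi)\<close>, assembled from the outgoing cut-offs
  for the two orientations of the axis.\<close>

definition ph :: "real => real => real => 'n => real ^ 'n => real" where
 "ph b \<eta> t k xi = slgs (4 * t powr \<eta> * (s * vel (axis k 1) xi / t powr (- b) - 3)) + slgs (4 * t powr \<eta> * (s * vel (- axis k 1) xi / t powr (- b) - 3))"

lemma ph_arg: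
 fixes t b :: real
 assumes "0 < t"
 shows "4 * t powr \<eta> * (s * vv / t powr (- b) - 3) = (4 * t powr (\<eta> + b) * s) * vv + (- (12 * t powr \<eta>))"
 using assms by (simp add: powr_add powr_minus divide_inverse algebra_simps)

lemma ph_bounds: "abs (1 - ph b \<eta> t k xi) <= 1" unfolding ph_def using slgs_bounds by (smt (verit))

lemma lip_ph:
 assumes t: "1 <= t"
 shows "lip 1 (16 * t powr (\<eta> + b)) (%xi. of_real (1 - ph b \<eta> t k xi))"
proof -
 let ?c = "4 * t powr (\<eta> + b) * s" and ?d = "- (12 * t powr \<eta>)"
 have c: "abs ?c = 4 * t powr (\<eta> + b)" using s by (simp add: abs_mult)
 have n: "norm (axis k 1 :: real ^ 'n) = 1" "norm (- axis k 1 :: real ^ 'n) = 1" by simp_all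
 have b: "cmod (1 + (-1) * (of_real (slgs (?c * vel (axis k 1) xi + ?d)) + of_real (slgs (?c * vel (- axis k 1) xi + ?d)))) <= 1" for xi
 proof -
  have "1 + (-1) * (of_real x + of_real y) = cor (1 - (x + y))" for x y by simp
  then show ?thesis using ph_bounds[of b \<eta> t k xi] t unfolding ph_def by (simp only: norm_of_real ph_arg)
 qed
 have "lip 1 (cmod (-1) * (2 * abs ?c + 2 * abs ?c))
  (%xi. 1 + (-1) * (of_real (slgs (?c * vel (axis k 1) xi + ?d)) + of_real (slgs (?c * vel (- axis k 1) xi + ?d))))"
  by (rule lip_affine[OF lip_add[OF lip_slgs_vel[OF n(1)] lip_slgs_vel[OF n(2)]] b])
 moreover have "1 + (-1) * (of_real (slgs (?c * vel (axis k 1) xi + ?d)) + of_real (slgs (?c * vel (- axis k 1) xi + ?d)))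
  = cor (1 - ph b \<eta> t k xi)" for xi unfolding ph_def using t by (subst (1 2) ph_arg) simp_all
 ultimately show ?thesis unfolding c by simp
qed

text \<open>Symbols whose gradient grows at most like \<open>t powr ka\<close>. By
  \<open>commutator_bound\<close> they commute asymptotically with localizations to regions of size
  \<open>t powr r\<close> if \<open>ka < r\<close>.\<close>

definition good :: "real => (real => real ^ 'n => complex) => bool" where
 "good ka f \<longleftrightarrow> (EX C D. ALL t>=1. lip C (D * t powr ka) (f t))"

lemma good_prod:
 assumes "good ka f" and ka: "\<eta> + b <= ka" and "finite J"
 shows "good ka (%t xi. f t xi * (\<Prod>k\<in>J. of_real (1 - ph b \<eta> t k xi)))" using assms(3)
proof (induction J)
 case empty then show ?case using assms(1) by simp
next
 case (insert j J)
 then obtain C D where l: "!!t. 1 <= t ==> lip C (D * t powr ka) (%xi. f t xi * (\<Prod>k\<in>J. of_real (1 - ph b \<eta> t k xi)))"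
  unfolding good_def by blast
 have C: "0 <= C" using lip_nonneg(1)[OF l[of 1]] by simp
 have "lip C ((D + 16 * C) * t powr ka) (%xi. f t xi * (\<Prod>k\<in>insert j J. of_real (1 - ph b \<eta> t k xi)))" if t: "1 <= t" for t
 proof -
  have "t powr (\<eta> + b) <= t powr ka" using ka t by (intro powr_mono)
  then have "C * (16 * t powr (\<eta> + b)) <= C * (16 * t powr ka)" using C by (intro mult_left_mono) auto
  then have "D * t powr ka * 1 + C * (16 * t powr (\<eta> + b)) <= (D + 16 * C) * t powr ka" by (simp add: algebra_simps)
  from lip_mono[OF lip_mult[OF l[OF t] lip_ph[OF t, of \<eta> b j]] _ this, of C]
  show ?thesis using insert(1,2) by (simp add: mult_ac)
 qed
 then show ?case unfolding good_def by blast
qed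

context
 fixes \<alpha> b :: real
 assumes \<alpha>: "0 < \<alpha>" "\<alpha> < 1 - b" and b: "0 < b" "b < 1/2" "b < (sg - 1) / sg"
begin

definition "y t = Om t - omega"

lemma norm_y: "0 <= t ==> norm (y t) <= 2 * B" unfolding y_def using norm_triangle_ineq4[of "Om t" omega] omega(1) Om_bounded[of t] by simp

lemma bm_ph: "bm (%xi. cor (1 - ph b \<eta> t k xi))" "bm (%xi. cor (ph b \<eta> t k xi))"
proof -
 have m: "meas (ph b \<eta> t k)" unfolding ph_def[abs_def] by measurable
 show 1: "bm (%xi. cor (1 - ph b \<eta> t k xi))"
 proof (rule bmI[of _ 1])
  show "cmod (cor (1 - ph b \<eta> t k xi)) <= 1" for xi unfolding norm_of_real by (rule ph_bounds)
 qed (use m in measurable)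
 show "bm (%xi. cor (ph b \<eta> t k xi))" using bm_diff[OF bm_const[of 1] 1] by simp
qed

text \<open>\<open>outgoing_local\<close> shows that the fast part vanishes in a slab of width
  \<open>t powr a'\<close>, but the symbol \<open>f t\<close> stands in front of it. The resolvent
  weight \<open>w\<close> localizes at the intermediate scale \<open>t powr r\<close> and is moved
  through \<open>f t\<close> at the cost of \<open>commutator_bound\<close>.\<close>

lemma fast_part:
 assumes g: "good ka f" and ka: "ka < 1 - b" and \<eta>: "0 < \<eta>" "2 * \<eta> < 1 - 2 * b"
 shows "null (%t. norm (chi {x. norm x <= t powr \<alpha>} (Mop (f t) (Mop (%xi. of_real (ph b \<eta> t k xi)) (y t)))))"
proof -
 obtain C D where l: "!!t. 1 <= t ==> lip C (D * t powr ka) (f t)" using g unfolding good_def by blast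
 have C: "0 <= C" using lip_nonneg(1)[OF l[of 1]] by simp
 \<comment> \<open>Midpoints in the chain from the larger of \<alpha> and \<open>ka\<close> through
   \<open>r\<close> and \<open>a'\<close> to \<open>1 - b\<close>; each strict inequality supplies a
   negative power of \<open>t\<close>.\<close>
 define r where "r = (max \<alpha> ka + (1 - b)) / 2"
 define a' where "a' = (r + (1 - b)) / 2"
 have r: "\<alpha> < r" "ka < r" "r < a'" "a' < 1 - b" "0 < a'" proof -
  define M where "M = max \<alpha> ka"
  have M: "\<alpha> <= M" "ka <= M" "M < 1 - b" using \<alpha> ka by (auto simp: M_def)
  then show "\<alpha> < r" "ka < r" "r < a'" "a' < 1 - b" "0 < a'" using \<alpha> unfolding r_def a'_def M_def[symmetric] by (auto simp: field_simps)
 qed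
 define e :: "real ^ 'n" where "e = axis k 1"
 have e: "norm e = 1" "norm (- e) = 1" by (simp_all add: e_def)
 define \<phi> where "\<phi> t e xi = cor (slgs (4 * t powr \<eta> * (s * vel e xi / t powr (- b) - 3)))" for t e and xi :: "real ^ 'n"
 have b\<phi>: "bm (\<phi> t e)" for t e unfolding \<phi>_def by (intro bm_slgs) measurable
 define z where "z t = Mop (%xi. of_real (ph b \<eta> t k xi)) (y t)" for t
 define S where "S t = {x :: real ^ 'n. abs (x .* e) < t powr a'}" for t
 have Sb: "S t : sets borel" for t unfolding S_def by (rule slab_borel)
 have z: "z t = Mop (\<phi> t e) (y t) + Mop (\<phi> t (- e)) (y t)" for t
  unfolding z_def Mop_add_left[OF b\<phi> b\<phi>] by (simp add: ph_def \<phi>_def e_def)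
 have lim: "null (%t. norm (mul (ind (S t)) (Mop (\<phi> t e') (y t))))" if "e' = e \<or> e' = - e" for e'
 proof -
  have "norm e' = 1" "!!x. (abs (x .* e')) = abs (x .* e)" using that e by auto
  then show ?thesis using outgoing_local[of e' b a' \<eta>] b r \<eta> unfolding S_def \<phi>_def y_def by simp
 qed
 have lim: "null (%t. norm (mul (ind (S t)) (z t)))"
 proof (rule tendsto_sandwich[OF _ _ tendsto_const])
  show "null (%t. norm (mul (ind (S t)) (Mop (\<phi> t e) (y t))) + norm (mul (ind (S t)) (Mop (\<phi> t (- e)) (y t))))"
   using tendsto_add[OF lim[of e] lim[of "- e"]] by simp
  show "EV t. norm (mul (ind (S t)) (z t)) <= norm (mul (ind (S t)) (Mop (\<phi> t e) (y t))) + norm (mul (ind (S t)) (Mop (\<phi> t (- e)) (y t)))"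
   unfolding z mul_add by (intro always_eventually allI norm_triangle_ineq)
 qed auto
 have nz: "norm (z t) <= 4 * B" if "0 <= t" for t
 proof -
  have "norm (Mop (\<phi> t e) (y t)) <= 1 * norm (y t)" for e
   using slgs_bounds by (intro norm_Mop_le bm_measurable[OF b\<phi>]) (auto simp: \<phi>_def less_imp_le abs_of_pos)
  from this[of e] this[of "- e"] show ?thesis
   unfolding z using norm_y[OF that] norm_triangle_ineq[of "Mop (\<phi> t e) (y t)" "Mop (\<phi> t (- e)) (y t)"] by linarith
 qed
 define w where "w t x = cor (t powr r) / (of_real (x .* e) + \<i> * of_real (t powr r))" for t and x :: "real ^ 'n"
 have bound: "EV t. norm (chi {x. norm x <= t powr \<alpha>} (Mop (f t) (z t)))
  <= 2 * (C * (norm (mul (ind (S t)) (z t)) + t powr (r - a') * (4 * B)) + D * t powr (ka - r) * (4 * B))" using eventually_gt_at_top[of 1]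
 proof eventually_elim
  case (elim t)
  then have t: "1 <= t" "0 < t powr r" by auto
  \<comment> \<open>The weight is at least 1/2 on the ball of radius \<open>t powr \<alpha>\<close>
    and small outside the slab of width \<open>t powr a'\<close>, so it can replace both sharp
    localizations.\<close>
  have wb: "cmod (w t x) <= 1" "abs (x .* e) >= t powr a' ==> cmod (w t x) <= t powr (r - a')" "norm x <= t powr \<alpha> ==> 1 <= cmod (2 * w t x)" for x
  proof -
   define d where "d = cmod (of_real (x .* e) + \<i> * of_real (t powr r))"
   have d: "t powr r <= d" "abs (x .* e) <= d" "d <= abs (x .* e) + t powr r"
    using abs_Im_le_cmod[of "of_real (x .* e) + \<i> * of_real (t powr r)"] abs_Re_le_cmod[of "of_real (x .* e) + \<i> * of_real (t powr r)"]
     norm_triangle_ineq[of "cor (x .* e)" "\<i> * of_real (t powr r)"] by (auto simp: d_def norm_mult)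
   have dp: "0 < d" using d(1) t by linarith
   have wd: "cmod (w t x) = t powr r / d" by (simp add: w_def d_def norm_divide)
   show "cmod (w t x) <= 1" using d(1) dp by (simp add: wd divide_le_eq)
   show "cmod (w t x) <= t powr (r - a')" if "abs (x .* e) >= t powr a'"
   proof -
    have "t powr r / d <= t powr r / t powr a'" using that d(2) dp t by (intro divide_left_mono) auto
    then show ?thesis by (simp add: wd powr_diff)
   qed
   show "1 <= cmod (2 * w t x)" if "norm x <= t powr \<alpha>"
   proof -
    have "abs (x .* e) <= norm x" using Cauchy_Schwarz_ineq2[of x e] e by simp
    also have "... <= t powr r" using that powr_mono[of \<alpha> r t] r t by simp
    finally have "d <= 2 * t powr r" using d(3) by linarith
    then show ?thesis using dp by (simp add: norm_mult wd le_divide_eq)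
   qed
  qed
  have wm: "meas (w t)" unfolding w_def[abs_def] by measurable
  have bw: "bm (w t)" by (rule bmI[OF wm wb(1)])
  obtain f' where f': "edif e (f t) f'" "!!xi. cmod (f' xi) <= D * t powr ka" "!!xi. cmod (f t xi) <= C"
   using l[OF t(1)] e(1) unfolding lip_def by blast
  have "norm (chi {x. norm x <= t powr \<alpha>} (Mop (f t) (z t))) <= norm (mul (%x. 2 * w t x) (Mop (f t) (z t)))"
   using wb(3) by (intro norm_mul_mono bm_indicator ball_borel bm_mult bm_const bw) (auto simp: indicator_def)
  also have "... = 2 * norm (mul (w t) (Mop (f t) (z t)))" unfolding mul_mul[OF bm_const bw, symmetric] norm_mul_const by simp
  also have "norm (mul (w t) (Mop (f t) (z t))) <= norm (Mop (f t) (mul (w t) (z t))) + norm (mul (w t) (Mop (f t) (z t)) - Mop (f t) (mul (w t) (z t)))"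
   by (metis add.commute diff_add_cancel norm_triangle_ineq)
  also have "norm (mul (w t) (Mop (f t) (z t)) - Mop (f t) (mul (w t) (z t))) <= D * t powr ka / t powr r * norm (z t)"
   unfolding w_def by (rule commutator_bound[OF t(2) f'(1) f'(3) f'(2)])
  also have "D * t powr ka / t powr r * norm (z t) <= D * t powr ka / t powr r * (4 * B)"
   using nz[of t] t lip_nonneg(2)[OF l[OF t(1)]] by (intro mult_left_mono divide_nonneg_nonneg) auto
  also have "D * t powr ka / t powr r = D * t powr (ka - r)" by (simp add: powr_diff)
  also have "norm (Mop (f t) (mul (w t) (z t))) <= C * norm (mul (w t) (z t))" by (rule norm_Mop_le[OF bm_measurable[OF lip_bm[OF l[OF t(1)]]] f'(3)])
  also have "C * norm (mul (w t) (z t)) <= C * (norm (mul (ind (S t)) (z t)) + t powr (r - a') * (4 * B))"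
  proof (rule mult_left_mono[OF _ C])
   let ?I = "ind (S t) :: real ^ 'n => complex"
   have bI: "bm ?I" by (rule bm_indicator[OF Sb])
   have b12: "bm (%x. w t x * ?I x)" "bm (%x. w t x * (1 - ?I x))" by (intro bm_mult bm_diff bm_const bw bI)+
   have "mul (%x. w t x * ?I x) (z t) + mul (%x. w t x * (1 - ?I x)) (z t) = mul (w t) (z t)"
    unfolding mul_add_left[OF b12] by (simp add: algebra_simps)
   then have "norm (mul (w t) (z t)) <= norm (mul (%x. w t x * ?I x) (z t)) + norm (mul (%x. w t x * (1 - ?I x)) (z t))"
    using norm_triangle_ineq[of "mul (%x. w t x * ?I x) (z t)" "mul (%x. w t x * (1 - ?I x)) (z t)"] by (simp only:)
   moreover have "norm (mul (%x. w t x * ?I x) (z t)) <= norm (mul ?I (z t))" using wb(1) by (intro norm_mul_mono b12 bI) (auto simp: indicator_def)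
   moreover have "norm (mul (%x. w t x * (1 - ?I x)) (z t)) <= t powr (r - a') * norm (z t)"
    using wb(2) by (intro norm_mul_le bm_measurable[OF b12(2)]) (auto simp: indicator_def S_def)
   moreover have "t powr (r - a') * norm (z t) <= t powr (r - a') * (4 * B)" using nz[of t] t by (intro mult_left_mono) auto
   ultimately show "norm (mul (w t) (z t)) <= norm (mul ?I (z t)) + t powr (r - a') * (4 * B)" by linarith
  qed
  finally show ?case by simp
 qed
 have "((%t. 2 * (C * (norm (mul (ind (S t)) (z t)) + t powr (r - a') * (4 * B)) + D * t powr (ka - r) * (4 * B)))
  ---> 2 * (C * (0 + 0 * (4 * B)) + D * 0 * (4 * B))) at_top" using r by (intro tendsto_intros lim powr_neg_tendsto_0) auto
 then show ?thesis unfolding z_def[symmetric] by (intro tendsto_sandwich[OF _ bound tendsto_const]) auto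
qed

text \<open>The coordinates are removed one after the other; the products of the factors already
  removed with \<open>f t\<close> stay in the class of symbols to which \<open>fast_part\<close>
  applies.\<close>

lemma fast_parts:
 assumes g: "good ka f" and ka: "\<eta> + b <= ka" "ka < 1 - b" and \<eta>: "0 < \<eta>" "2 * \<eta> < 1 - 2 * b" and J: "finite J"
 shows "null (%t. norm (chi {x. norm x <= t powr \<alpha>} (Mop (f t) (y t) -
   Mop (%xi. f t xi * (\<Prod>k\<in>J. of_real (1 - ph b \<eta> t k xi))) (y t))))" using J
proof (induction J)
 case (insert j J)
 let ?f = "%J t xi. f t xi * (\<Prod>k\<in>J. cor (1 - ph b \<eta> t k xi))"
 note gJ = good_prod[OF g ka(1) insert(1)]
 have lim: "((%t. norm (chi {x. norm x <= t powr \<alpha>} (Mop (f t) (y t) - Mop (?f J t) (y t)))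
  + norm (chi {x. norm x <= t powr \<alpha>} (Mop (?f J t) (Mop (%xi. of_real (ph b \<eta> t j xi)) (y t))))) ---> 0 + 0) at_top"
  by (intro tendsto_add insert.IH fast_part[OF gJ ka(2) \<eta>])
 have "EV t. norm (chi {x. norm x <= t powr \<alpha>} (Mop (f t) (y t) - Mop (?f (insert j J) t) (y t)))
  <= norm (chi {x. norm x <= t powr \<alpha>} (Mop (f t) (y t) - Mop (?f J t) (y t)))
  + norm (chi {x. norm x <= t powr \<alpha>} (Mop (?f J t) (Mop (%xi. of_real (ph b \<eta> t j xi)) (y t))))" using eventually_ge_at_top[of 1]
 proof eventually_elim
  case (elim t)
  have bJ: "bm (?f J t)" using gJ elim unfolding good_def by (auto intro: lip_bm)
  have "Mop (?f (insert j J) t) (y t) = Mop (?f J t) (Mop (%xi. of_real (1 - ph b \<eta> t j xi)) (y t))"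
   unfolding Mop_Mop[OF bJ bm_ph(1)] using insert(1,2) by (simp add: mult_ac)
  also have "Mop (%xi. of_real (1 - ph b \<eta> t j xi)) (y t) = y t - Mop (%xi. of_real (ph b \<eta> t j xi)) (y t)"
   using Mop_diff_left[OF bm_const[of 1] bm_ph(2)[of \<eta> t j], of "y t"] by simp
  finally have eq: "Mop (f t) (y t) - Mop (?f (insert j J) t) (y t)
   = (Mop (f t) (y t) - Mop (?f J t) (y t)) + Mop (?f J t) (Mop (%xi. of_real (ph b \<eta> t j xi)) (y t))" by (simp add: Mop_diff)
  show ?case unfolding eq by (rule norm_mul_add_le)
 qed
 then show ?case by (rule norm_null_comparison) (use lim in simp)
qed simp

text \<open>The cut-offs are centred at 3 times the threshold, so a velocity component of 4 times
  the threshold leaves a gap of 1, and the sharpness \<open>4 * t powr \<eta>\<close> turns it into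
  the exponential.\<close>

lemma fast_velocity_symbol:
 assumes t: "1 <= t" and \<eta>: "0 < \<eta>" and k: "4 * t powr (- b) <= abs (vel (axis k 1) xi)"
 shows "cmod (\<Prod>k\<in>UNIV. of_real (1 - ph b \<eta> t k xi)) <= exp (- (4 * t powr \<eta>))"
proof -
 define l where "l = t powr \<eta>"
 have l: "0 <= l" by (simp add: l_def)
 define a where "a = s * vel (axis k 1) xi / t powr (- b)"
 have ph: "ph b \<eta> t k xi = slgs (4 * l * (a - 3)) + slgs (4 * l * (- a - 3))" by (simp add: ph_def a_def l_def vel_minus)
 have a4: "4 <= abs a" using k s t by (simp add: a_def abs_mult abs_divide le_divide_eq)
 have gen: "abs (1 - (x + y)) <= E" if "e1 <= E" "e2 <= E" "1 - x <= e1" "0 < x" "x < 1" "x <= e0" "0 < y" "y < 1" "y <= e2" for x y E e0 e1 e2 :: real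
  using that by auto
 have one: "abs (1 - (slgs (4 * l * (a - 3)) + slgs (4 * l * (- a - 3)))) <= exp (- (4 * l))" if "4 <= a" for a
 proof -
  have "4 * l * 1 <= 4 * l * (a - 3)" "4 * l * (- a - 3) <= 4 * l * (- 1)" using that l by (intro mult_left_mono; simp)+
  then have "exp (- (4 * l * (a - 3))) <= exp (- (4 * l))" "exp (4 * l * (- a - 3)) <= exp (- (4 * l))" by simp_all
  moreover have "1 - slgs (4 * l * (a - 3)) <= exp (- (4 * l * (a - 3)))" unfolding slgs_minus by (rule slgs_bounds)
  ultimately show ?thesis using slgs_bounds[of "4 * l * (a - 3)"] slgs_bounds[of "4 * l * (- a - 3)"] by (intro gen)
 qed
 have qk: "abs (1 - ph b \<eta> t k xi) <= exp (- (4 * l))"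
 proof (cases "4 <= a")
  case True then show ?thesis unfolding ph by (rule one)
 next
  case False
  then have "4 <= - a" using a4 by linarith
  from one[OF this] show ?thesis unfolding ph by (simp add: add.commute)
 qed
 have "cmod (\<Prod>k\<in>UNIV. of_real (1 - ph b \<eta> t k xi)) = (\<Prod>k\<in>UNIV. (abs (1 - ph b \<eta> t k xi)))"
  unfolding prod_norm[symmetric] norm_of_real ..
 also have "... = abs (1 - ph b \<eta> t k xi) * (\<Prod>k\<in>UNIV - {k}. (abs (1 - ph b \<eta> t k xi)))" by (rule prod.remove) auto
 also have "... <= exp (- (4 * l)) * 1" using qk ph_bounds by (intro mult_mono prod_le_1 prod_nonneg) auto
 finally show ?thesis by (simp add: l_def)
qed

text \<open>Each momentum component is the velocity component times the bracket. Summing the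
  squares, the part proportional to \<open>(norm xi)^2\<close> is absorbed on the left because of
  the smallness of \<open>th\<close>.\<close>

lemma slow_velocity:
 fixes xi :: "real ^ 'n"
 assumes "!!k. (abs (vel (axis k 1) xi)) < 4 * th" and th: "0 < th" "32 * real CARD('n) * th^2 <= 1"
 shows "norm xi <= 6 * real CARD('n) * th"
proof -
 let ?n = "real CARD('n)"
 have n: "1 <= ?n" by (simp add: Suc_leI)
 have k: "(xi $ k)^2 <= 16 * th^2 * (1 + (norm xi)^2)" for k
 proof -
  have "abs (xi $ k) = abs (vel (axis k 1) xi) * jb xi" using japanese_pos[of xi] by (simp add: vel_def inner_axis abs_divide abs_of_pos)
  also have "... <= (4 * th) * jb xi" using assms(1)[of k] japanese_pos[of xi] by (intro mult_right_mono) auto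
  finally have "(abs (xi $ k))^2 <= ((4 * th) * jb xi)^2" by (rule power_mono) simp
  then show ?thesis by (simp add: power_mult_distrib japanese_sq)
 qed
 have "(norm xi)^2 = (\<Sum>k\<in>UNIV. (xi $ k)^2)" unfolding power2_norm_eq_inner inner_vec_def by (simp add: power2_eq_square)
 also have "... <= (\<Sum>k\<in>(UNIV :: 'n set). 16 * th^2 * (1 + (norm xi)^2))" by (intro sum_mono k)
 also have "... = 16 * ?n * th^2 + (16 * ?n * th^2) * (norm xi)^2" by (simp add: algebra_simps)
 also have "(16 * ?n * th^2) * (norm xi)^2 <= (1 / 2) * (norm xi)^2" using th by (intro mult_right_mono) auto
 finally have "(norm xi)^2 <= 32 * ?n * th^2" by simp
 also have "... <= (36 * ?n * ?n) * th^2" 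
 proof (rule mult_right_mono)
  have "32 * ?n <= 36 * 1 * ?n" using n by simp
  also have "... <= 36 * ?n * ?n" using n by (intro mult_right_mono mult_left_mono) auto
  finally show "32 * ?n <= 36 * ?n * ?n" .
 qed simp
 also have "... = (6 * ?n * th)^2" by (simp add: power2_eq_square)
 finally show ?thesis by (rule power2_le_imp_le) (use th in simp)
qed

text \<open>After \<open>fast_velocity_symbol\<close> only frequencies of size
  \<open>t powr (- b)\<close> remain. Either the ball of radius \<open>t powr \<alpha>\<close> is
  too small to hold them, and \<open>bernstein\<close> gives a power of
  \<open>t powr (\<alpha> - b)\<close>, or the symbol vanishes there.\<close>

lemma slow_part:
 assumes f: "!!t. 1 <= t ==> bm (f t)" "!!t xi. 1 <= t ==> cmod (f t xi) <= C" and \<eta>: "0 < \<eta>"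
  and alt: "\<alpha> < b \<or> (EV t. ALL xi. norm xi <= 6 * real CARD('n) * t powr (- b) --> f t xi = 0)"
 shows "null (%t. norm (chi {x. norm x <= t powr \<alpha>} (Mop (%xi. f t xi * (\<Prod>k\<in>UNIV. of_real (1 - ph b \<eta> t k xi))) (y t))))"
proof -
 let ?n = "real CARD('n)"
 have C: "0 <= C" using order_trans[OF norm_ge_zero f(2)[of 1]] by simp
 define q where "q t = 6 * ?n * t powr (- b)" for t :: real
 have q0: "0 <= q t" for t by (simp add: q_def)
 define Q where "Q t xi = (\<Prod>k\<in>UNIV. cor (1 - ph b \<eta> t k xi))" for t xi
 define D where "D t = {xi :: real ^ 'n. norm xi <= q t}" for t
 define g1 where "g1 t xi = ind (D t) xi * (f t xi * Q t xi)" for t xi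
 define g2 where "g2 t xi = (1 - ind (D t) xi) * (f t xi * Q t xi)" for t xi
 have Qb: "bm (Q t)" for t
 proof -
  have "bm (%xi. \<Prod>k\<in>J. cor (1 - ph b \<eta> t k xi))" if "finite J" for J using that by (induction J) (auto intro!: bm_mult bm_ph)
  then show ?thesis unfolding Q_def[abs_def] by simp
 qed
 have Q1: "cmod (Q t xi) <= 1" for t xi unfolding Q_def prod_norm[symmetric] norm_of_real using ph_bounds by (intro prod_le_1) auto
 have fQ: "cmod (f t xi * Q t xi) <= C" if "1 <= t" for t xi unfolding norm_mult using mult_mono[OF f(2)[OF that, of xi] Q1[of t xi] C] by simp
 have b12: "bm (g1 t)" "bm (g2 t)" "bm (%xi. f t xi * Q t xi)" if "1 <= t" for t
  unfolding g1_def[abs_def] g2_def[abs_def] D_def by (intro bm_mult bm_diff bm_const bm_indicator ball_borel f that Qb)+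
 define main where "main t = (if \<alpha> < b then ft_const TYPE('n) * sqrt ((4 * t powr \<alpha> * q t) ^ CARD('n)) * (C * (2 * B)) else 0)" for t
 have main: "EV t. norm (chi {x. norm x <= t powr \<alpha>} (Mop (g1 t) (y t))) <= main t"
 proof (cases "\<alpha> < b")
  case True
  show ?thesis using eventually_ge_at_top[of 1]
  proof eventually_elim
   case (elim t)
   have "ind (cube (q t)) xi * g1 t xi = g1 t xi" for xi using norm_le_in_cube[of xi "q t"] by (auto simp: g1_def D_def indicator_def)
   then have "Mop (g1 t) (y t) = FI (mul (ind (cube (q t))) (mul (g1 t) (FF (y t))))"
    unfolding Mop_def mul_mul[OF bm_indicator[OF cube_borel] b12(1)[OF elim]] by (simp only:)
   then have "norm (chi {x. norm x <= t powr \<alpha>} (Mop (g1 t) (y t)))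
    <= norm (mul (ind (cube (t powr \<alpha>))) (FI (mul (ind (cube (q t))) (mul (g1 t) (FF (y t))))))"
    using norm_le_in_cube by (simp only:) (intro norm_mul_indicator_mono ball_borel cube_borel; auto)
   also have "... <= ft_const TYPE('n) * sqrt ((4 * t powr \<alpha> * q t) ^ CARD('n)) * norm (mul (g1 t) (FF (y t)))"
    by (rule bernstein) (auto simp: q0)
   also have "... <= ft_const TYPE('n) * sqrt ((4 * t powr \<alpha> * q t) ^ CARD('n)) * (C * (2 * B))"
   proof (rule mult_left_mono)
    have "norm (mul (g1 t) (FF (y t))) <= C * norm (FF (y t))"
     using fQ[OF elim] C by (intro norm_mul_le bm_measurable[OF b12(1)[OF elim]]) (auto simp: g1_def indicator_def)
    also have "... <= C * (2 * B)" using norm_y[of t] elim C by (intro mult_left_mono) (auto simp: norm_FF)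
    finally show "norm (mul (g1 t) (FF (y t))) <= C * (2 * B)" .
    show "0 <= ft_const TYPE('n) * sqrt ((4 * t powr \<alpha> * q t) ^ CARD('n))" using q0[of t] by (simp add: ft_const_def)
   qed
   finally show ?case using True by (simp add: main_def)
  qed
 next
  case False
  then have "EV t. ALL xi. norm xi <= q t --> f t xi = 0" using alt by (simp add: q_def)
  then show ?thesis proof eventually_elim
   case (elim t)
   have "g1 t = (%_. 0)" using elim by (auto simp: g1_def D_def indicator_def)
   then show ?case using False by (simp add: main_def Mop_const)
  qed
 qed
 have qb: "null q" "null (%t. t powr (- b))"
 proof -
  show 1: "null (%t. t powr (- b))" using b by (intro powr_neg_tendsto_0) auto
  show "null q" using tendsto_mult_left[OF 1, of "6 * ?n"] by (simp add: q_def[abs_def])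
 qed
 have main0: "null main"
 proof (cases "\<alpha> < b")
  case True
  have "null (%t. t powr (\<alpha> - b))" using True by (intro powr_neg_tendsto_0) auto
  then have "((%t. ft_const TYPE('n) * sqrt ((24 * ?n * t powr (\<alpha> - b)) ^ CARD('n)) * (C * (2 * B)))
   ---> ft_const TYPE('n) * sqrt ((24 * ?n * 0) ^ CARD('n)) * (C * (2 * B))) at_top" by (intro tendsto_intros)
  moreover have "24 * ?n * t powr (\<alpha> - b) = 4 * t powr \<alpha> * q t" for t by (simp add: q_def powr_diff powr_minus divide_inverse)
  ultimately show ?thesis using True by (simp add: main_def[abs_def] power_0_left)
 qed (simp add: main_def[abs_def])
 have n1: "0 < 1 / (32 * ?n)" by simp
 have "((%t. (t powr (- b))^2) ---> 0^2) at_top" by (intro tendsto_intros qb)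
 then have "EV t. (t powr (- b))^2 < 1 / (32 * ?n)" by (rule order_tendstoD(2)) (simp add: n1)
 then have small: "EV t. norm (chi {x. norm x <= t powr \<alpha>} (Mop (%xi. f t xi * Q t xi) (y t)))
  <= main t + C * exp (- (4 * t powr \<eta>)) * (2 * B)" using eventually_ge_at_top[of 1] main
 proof eventually_elim
  case (elim t)
  have t: "1 <= t" by fact
  have th: "32 * ?n * (t powr (- b))^2 <= 1" using elim(1) by (simp add: field_simps)
  have g2b: "cmod (g2 t xi) <= C * exp (- (4 * t powr \<eta>))" for xi
  proof (cases "xi : D t")
   case False
   then obtain k where "4 * t powr (- b) <= abs (vel (axis k 1) xi)"
    using slow_velocity[of xi "t powr (- b)"] th t by (auto simp: D_def q_def not_le not_less) (metis not_less)
   from fast_velocity_symbol[OF t \<eta> this] have "cmod (Q t xi) <= exp (- (4 * t powr \<eta>))" by (simp add: Q_def)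
   then show ?thesis using False mult_mono[OF f(2)[OF t, of xi] _ C] by (simp add: g2_def norm_mult)
  qed (use C in \<open>auto simp: g2_def\<close>)
  have eq: "Mop (%xi. f t xi * Q t xi) (y t) = Mop (g1 t) (y t) + Mop (g2 t) (y t)"
   unfolding Mop_add_left[OF b12(1,2)[OF t]] by (simp add: g1_def g2_def algebra_simps)
  have "norm (chi {x. norm x <= t powr \<alpha>} (Mop (g2 t) (y t))) <= norm (Mop (g2 t) (y t))" by (rule norm_mul_indicator_le[OF ball_borel])
  also have "... <= C * exp (- (4 * t powr \<eta>)) * norm (y t)" by (rule norm_Mop_le[OF bm_measurable[OF b12(2)[OF t]] g2b])
  also have "... <= C * exp (- (4 * t powr \<eta>)) * (2 * B)" using norm_y[of t] t C by (intro mult_left_mono) auto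
  finally have "norm (chi {x. norm x <= t powr \<alpha>} (Mop (g2 t) (y t))) <= C * exp (- (4 * t powr \<eta>)) * (2 * B)" .
  then show ?case
   unfolding eq using elim(3) norm_mul_add_le[of "ind {x. norm x <= t powr \<alpha>}" "Mop (g1 t) (y t)" "Mop (g2 t) (y t)"] by linarith
 qed
 have "null (%t. exp (- (4 * t powr \<eta>)))" using \<eta> by (intro exp_powr_tendsto_0) auto
 then have "((%t. main t + C * exp (- (4 * t powr \<eta>)) * (2 * B)) ---> 0 + C * 0 * (2 * B)) at_top" by (intro tendsto_intros main0)
 then have "null (%t. main t + C * exp (- (4 * t powr \<eta>)) * (2 * B))" by simp
 from norm_null_comparison[OF small this] show ?thesis by (simp only: Q_def)
qed

text \<open>The exponent \<open>b\<close> is an auxiliary velocity threshold: the part of the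
  profile faster than \<open>t powr (- b)\<close> leaves by \<open>fast_parts\<close>, the slower
  part is removed by \<open>slow_part\<close>. If \<beta> is below \<open>b\<close>, the
  low-frequency cut-off of the channel itself kills the slow frequencies; otherwise \<alpha>
  is.\<close>

lemma local_decay:
 assumes Fc: "smooth_cutoff Fc" and F1: "smooth_cutoff F1" and \<beta>: "0 < \<beta>" "\<beta> < 1 - b" "\<beta> < b \<or> \<alpha> < b"
 shows "null (%t. norm (mul (%x. of_real (1 - Fc (norm x / t powr \<alpha>))) (Mop (%xi. of_real (F1 (t powr \<beta> * norm xi)))
   (Mop (%xi. of_real (1 - F1 (norm xi / t powr \<beta>))) (y t)))))"
proof -
 \<comment> \<open>Half the distance of \<open>b\<close> from 1/2, so that both
   \<open>2 * \<eta> < 1 - 2 * b\<close> and \<open>\<eta> + b < 1 - b\<close> hold.\<close>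
 define \<eta> where "\<eta> = (1/2 - b) / 2"
 have \<eta>: "0 < \<eta>" "2 * \<eta> < 1 - 2 * b" using b by (auto simp: \<eta>_def)
 define ka where "ka = max \<beta> (\<eta> + b)"
 have ka: "\<eta> + b <= ka" "ka < 1 - b" "\<beta> <= ka" "0 < ka" proof -
  show "\<eta> + b <= ka" "\<beta> <= ka" by (auto simp: ka_def)
  have "\<eta> + b < 1 - b" using b by (simp add: \<eta>_def field_simps)
  then show "ka < 1 - b" "0 < ka" using \<beta> by (auto simp: ka_def)
 qed
 obtain C1 where C1: "1 <= C1" "!!x. abs (F1 x) <= C1 & abs (deriv F1 x) <= C1" using smooth_cutoff_bounded[OF F1] by blast
 obtain C0 where C0: "1 <= C0" "!!x. abs (Fc x) <= C0 & abs (deriv Fc x) <= C0" using smooth_cutoff_bounded[OF Fc] by blast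
 define fa where "fa t xi = cor (F1 (t powr \<beta> * norm xi))" for t and xi :: "real ^ 'n"
 define fb where "fb t xi = cor (1 - F1 (norm xi / t powr \<beta>))" for t and xi :: "real ^ 'n"
 define f where "f t xi = fa t xi * fb t xi" for t and xi :: "real ^ 'n"
 define C where "C = C1 * (1 + C1)"
 define D where "D = C1 * (1 + C1) + C1 * C1"
 have fa: "lip C1 (C1 * t powr \<beta>) (fa t)" if "1 <= t" for t unfolding fa_def using that by (intro lip_radial_cutoff F1 C1) auto
 have fb: "lip (1 + C1) (C1 * t powr (- \<beta>)) (fb t)" if "1 <= t" for t
 proof -
  have 1: "lip C1 (C1 * t powr (- \<beta>)) (%xi :: real ^ 'n. of_real (F1 (t powr (- \<beta>) * norm xi)))"
   using that by (intro lip_radial_cutoff F1 C1) auto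
  have b1: "cmod (1 + (-1) * cor (F1 x)) <= 1 + C1" for x using norm_triangle_ineq4[of 1 "cor (F1 x)"] C1(2)[of x] by simp
  have "fb t = (%xi. 1 + (-1) * of_real (F1 (t powr (- \<beta>) * norm xi)))" by (auto simp: fb_def powr_minus divide_inverse mult.commute)
  then show ?thesis using lip_affine[OF 1 b1] by simp
 qed
 have f: "lip C (D * t powr ka) (f t)" if t: "1 <= t" for t
 proof -
  have "t powr \<beta> <= t powr ka" "t powr (- \<beta>) <= t powr ka" using t ka \<beta> by (auto intro!: powr_mono)
  then have "C1 * t powr \<beta> * (1 + C1) + C1 * (C1 * t powr (- \<beta>)) <= C1 * t powr ka * (1 + C1) + C1 * (C1 * t powr ka)"
   using C1(1) by (intro add_mono mult_left_mono mult_right_mono) auto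
  also have "... = D * t powr ka" by (simp add: D_def algebra_simps)
  finally show ?thesis using lip_mono[OF lip_mult[OF fa[OF t] fb[OF t]]] by (simp add: C_def f_def[abs_def])
 qed
 have good: "good ka f" using f unfolding good_def by blast
 have bounded: "cmod (f t xi) <= C" if "1 <= t" for t xi using f[OF that] by (simp add: lip_def)
 have alt: "\<alpha> < b \<or> (EV t. ALL xi. norm xi <= 6 * real CARD('n) * t powr (- b) --> f t xi = 0)"
 proof (cases "\<alpha> < b")
  case False
  then have bb: "0 < b - \<beta>" using \<beta> by auto
  have "EV t. ALL xi. norm xi <= 6 * real CARD('n) * t powr (- b) --> f t xi = 0"
   using eventually_gt_at_top[of 1] eventually_le_powr[OF bb, of "12 * real CARD('n) + 1"]
  proof eventually_elim
   case (elim t)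
   have "f t xi = 0" if xi: "norm xi <= 6 * real CARD('n) * t powr (- b)" for xi
   proof -
    have "t powr \<beta> * norm xi <= t powr \<beta> * (6 * real CARD('n) * t powr (- b))" using xi by (rule mult_left_mono) simp
    also have "... = 6 * real CARD('n) / t powr (b - \<beta>)" by (simp add: powr_diff powr_minus divide_inverse)
    also have "... < 1 / 2" using elim by (simp add: divide_less_eq)
    finally show ?thesis using smooth_cutoffD(4)[OF F1] by (simp add: f_def fa_def)
   qed
   then show ?case by blast
  qed
  then show ?thesis ..
 qed simp
 have cF: "meas Fc"
  using smooth_cutoffD(1)[OF Fc] by (intro borel_measurable_continuous_onI continuous_at_imp_continuous_on) (auto intro: DERIV_isCont)
 let ?I = "%t. ind {x :: real ^ 'n. norm x <= t powr \<alpha>} :: _ => complex"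
 let ?P = "%t xi. f t xi * (\<Prod>k\<in>UNIV. cor (1 - ph b \<eta> t k xi))"
 have lim: "((%t. (1 + C0) * (norm (mul (?I t) (Mop (f t) (y t) - Mop (?P t) (y t))) + norm (mul (?I t) (Mop (?P t) (y t))))) ---> (1 + C0) * (0 + 0)) at_top"
  by (intro tendsto_intros fast_parts[OF good ka(1,2) \<eta>] slow_part[OF lip_bm[OF f] bounded \<eta>(1) alt]) auto
 have "EV t. norm (mul (%x. of_real (1 - Fc (norm x / t powr \<alpha>))) (Mop (fa t) (Mop (fb t) (y t))))
  <= (1 + C0) * (norm (mul (?I t) (Mop (f t) (y t) - Mop (?P t) (y t))) + norm (mul (?I t) (Mop (?P t) (y t))))" using eventually_ge_at_top[of 1]
 proof eventually_elim
  case (elim t)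
  have bc: "cmod (of_real (1 - Fc r)) <= 1 + C0" for r using C0(2)[of r] unfolding norm_of_real by linarith
  have m: "meas (%x :: real ^ 'n. cor (1 - Fc (norm x / t powr \<alpha>)))" using cF by measurable
  have bF: "bm (%x :: real ^ 'n. cor (1 - Fc (norm x / t powr \<alpha>)))" by (rule bmI[OF m bc])
  have supp: "1 - Fc (norm x / t powr \<alpha>) = 0" if "\<not> norm x <= t powr \<alpha>" for x :: "real ^ 'n"
  proof -
   have "1 <= norm x / t powr \<alpha>" using that elim by (simp add: le_divide_eq)
   then show ?thesis using smooth_cutoffD(3)[OF Fc] by simp
  qed
  have "norm (mul (%x. of_real (1 - Fc (norm x / t powr \<alpha>))) (Mop (fa t) (Mop (fb t) (y t))))
   = norm (mul (%x. of_real (1 - Fc (norm x / t powr \<alpha>))) (Mop (f t) (y t)))"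
   unfolding Mop_Mop[OF lip_bm[OF fa[OF elim]] lip_bm[OF fb[OF elim]]] f_def[abs_def] ..
  also have "... <= norm (mul (%x. of_real (1 + C0) * ?I t x) (Mop (f t) (y t)))"
  proof (intro norm_mul_mono bF bm_mult bm_const bm_indicator ball_borel)
   show "cmod (of_real (1 - Fc (norm x / t powr \<alpha>))) <= cmod (of_real (1 + C0) * ?I t x)" for x
    using bc[of "norm x / t powr \<alpha>"] supp[of x] C0(1) by (auto simp: indicator_def norm_mult simp del: of_real_add of_real_diff)
  qed
  also have "... = (1 + C0) * norm (mul (?I t) (Mop (f t) (y t)))"
   unfolding mul_mul[OF bm_const bm_indicator[OF ball_borel], symmetric] norm_mul_const norm_of_real using C0 by simp
  also have "norm (mul (?I t) (Mop (f t) (y t))) <= norm (mul (?I t) (Mop (f t) (y t) - Mop (?P t) (y t))) + norm (mul (?I t) (Mop (?P t) (y t)))"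
   using norm_mul_add_le[of "?I t" "Mop (f t) (y t) - Mop (?P t) (y t)" "Mop (?P t) (y t)"] by simp
  finally show ?case using C0 by (simp add: mult_left_mono)
 qed
 from norm_null_comparison[OF this] lim show ?thesis unfolding fa_def[abs_def] fb_def[abs_def] by simp
qed

end

end

section \<open>From states of finite energy to pairs of half waves\<close>

definition ijp :: "real ^ 'n::finite => complex" where "ijp xi = of_real (1 / jb xi)"

lemma bm_ijp [simp]: "bm ijp"
proof (rule bmI[of _ 1])
 show "cmod (ijp xi) <= 1" for xi :: "real ^ 'n" using japanese_ge_1[of xi] japanese_pos[of xi] by (simp add: ijp_def norm_divide)
qed (simp add: ijp_def[abs_def])

lemma ijp_japanese: "ijp xi * (of_real (jb xi) * z) = z" "of_real (jb xi) * (ijp xi * z) = z" using japanese_nonzero[of xi] by (simp_all add: ijp_def)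

lemma fourier_mult_L2:
 assumes "(%xi. of_real (m xi) * fourier f xi) : L2"
 shows "fourier_mult m f : L2" "cls (fourier_mult m f) = FI (cls (%xi. of_real (m xi) * fourier f xi))"
 unfolding fourier_mult_def using inv_fourier_L2[OF assms] cls_inv_fourier[OF assms] by auto

lemma fourier_mult_bm:
 assumes f: "f : L2" and m: "bm (%xi. of_real (m xi))"
 shows "fourier_mult m f : L2" "cls (fourier_mult m f) = Mop (%xi. of_real (m xi)) (cls f)"
 using fourier_mult_L2[OF L2_bm[OF m fourier_L2[OF f]]] by (simp_all add: Mop_def FF_cls f cls_mul fourier_L2 m)

lemma H1_jp:
 assumes f: "f : H1"
 shows "f : L2" "jp f : L2" "cls f = Mop ijp (cls (jp f))"
proof -
 have L: "f : L2" "(%xi. of_real (jb xi) * fourier f xi) : L2" using f by (auto simp: H1_def)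
 show "f : L2" "jp f : L2" using L fourier_mult_L2 by auto
 have "mul ijp (cls (%xi. of_real (jb xi) * fourier f xi)) = cls (fourier f)" unfolding cls_mul[OF L(2) bm_ijp] ijp_japanese ..
 then show "cls f = Mop ijp (cls (jp f))" unfolding fourier_mult_L2(2)[OF L(2)] Mop_def using L(1) by (simp add: FF_cls[symmetric])
qed

text \<open>The space \<open>H1\<close> is the range of the bounded operator \<open>Mop ijp\<close>.
  Working with this inverse keeps the unbounded \<open>jp\<close> out of the operator
  algebra.\<close>

lemma H1_I:
 assumes f: "f : L2" and X: "cls f = Mop ijp X"
 shows "f : H1" "cls (jp f) = X"
proof -
 obtain h where h: "h : L2" "FF X = cls h" using l2_cases by metis
 have "cls (fourier f) = cls (%xi. ijp xi * h xi)"
  unfolding cls_fourier[OF f] X using h by (simp add: cls_mul)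
 then have ae: "AE xi in lborel. fourier f xi = ijp xi * h xi" using cls_eq_iff[OF fourier_L2[OF f] L2_bm[OF bm_ijp h(1)]] by simp
 have ae: "AE xi in lborel. of_real (jb xi) * fourier f xi = h xi" using ae by eventually_elim (simp add: ijp_japanese)
 have [measurable]: "meas (fourier f)" "meas h" using L2_D(1) fourier_L2 f h by auto
 have "meas (%xi. of_real (jb xi) * fourier f xi)" by measurable
 note L = L2_AE[OF h(1) this ae]
 show "f : H1" using f L(1) by (simp add: H1_def)
 show "cls (jp f) = X" unfolding fourier_mult_L2(2)[OF L(1)] L(2) using h(2) by (metis FI_FF)
qed

lemma fourier_mult_H1:
 assumes f: "f : H1" and m: "bm (%xi. of_real (m xi))"
 shows "fourier_mult (%xi. m xi * jb xi) f : L2" "cls (fourier_mult (%xi. m xi * jb xi) f) = Mop (%xi. of_real (m xi)) (cls (jp f))"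
proof -
 have L: "(%xi. of_real (jb xi) * fourier f xi) : L2" using f by (auto simp: H1_def)
 have eq: "(%xi. of_real (m xi * jb xi) * fourier f xi) = (%xi. of_real (m xi) * (of_real (jb xi) * fourier f xi))" by (simp add: mult.assoc)
 have L': "(%xi. of_real (m xi * jb xi) * fourier f xi) : L2" unfolding eq by (rule L2_bm[OF m L])
 show "fourier_mult (%xi. m xi * jb xi) f : L2" by (rule fourier_mult_L2[OF L'])
 show "cls (fourier_mult (%xi. m xi * jb xi) f) = Mop (%xi. of_real (m xi)) (cls (jp f))"
  unfolding fourier_mult_L2(2)[OF L'] fourier_mult_L2(2)[OF L] Mop_def FF_FI cls_mul[OF L m] eq ..
qed

lemma jp_inv_H1:
 assumes "f : L2" shows "jp_inv f : H1" "cls (jp (jp_inv f)) = cls f"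
proof -
 have "bm (%xi :: real ^ 'a. cor (1 / jb xi))" using bm_ijp unfolding ijp_def[abs_def] .
 note m = fourier_mult_bm[OF assms this]
 show "jp_inv f : H1" "cls (jp (jp_inv f)) = cls f" using H1_I[OF m(1), of "cls f"] m(2) by (simp_all add: ijp_def[abs_def])
qed

text \<open>Together with \<open>Vc\<close> these coordinates identify the energy space
  isometrically with two copies of the space of classes.\<close>

definition Pc :: "'n::finite state => 'n l2" where "Pc w = cls (jp (fst w))"
definition Vc :: "'n::finite state => 'n l2" where "Vc w = cls (snd w)"

lemma energy_spaceD: "w : energy_space ==> fst w : H1" "w : energy_space ==> snd w : L2" by (auto simp: energy_space_def)

lemma energy_spaceI: "fst w : H1 ==> snd w : L2 ==> w : energy_space" by (cases w) (auto simp: energy_space_def)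

lemma H_inner_l2:
 "w : energy_space ==> w' : energy_space ==> H_inner w w' = cinner (Pc w) (Pc w') + cinner (Vc w) (Vc w')"
 by (simp add: H_inner_def Pc_def Vc_def cls_cinner H1_jp energy_spaceD)

lemma H_norm_l2: "w : energy_space ==> H_norm w = sqrt ((norm (Pc w))^2 + (norm (Vc w))^2)"
 unfolding H_norm_def by (simp add: H_inner_l2 cinner_eq_norm del: of_real_power)

lemma state_diff:
 assumes "w : energy_space" "w' : energy_space"
 shows "w - w' : energy_space" "Pc (w - w') = Pc w - Pc w'" "Vc (w - w') = Vc w - Vc w'"
proof -
 note a = H1_jp[OF energy_spaceD(1)[OF assms(1)]] and b = H1_jp[OF energy_spaceD(1)[OF assms(2)]]
 have m: "fst (w - w') = (%x. fst w x - fst w' x)" "snd (w - w') = (%x. snd w x - snd w' x)" by (auto simp: fun_eq_iff)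
 have "(%x. fst w x - fst w' x) : L2" "cls (%x. fst w x - fst w' x) = Mop ijp (cls (jp (fst w)) - cls (jp (fst w')))"
  unfolding Mop_diff a(3)[symmetric] b(3)[symmetric] using a(1) b(1) by (simp_all add: L2_diff cls_diff)
 from H1_I[OF this] have H: "fst (w - w') : H1" "cls (jp (fst (w - w'))) = Pc w - Pc w'" unfolding m Pc_def .
 moreover have "snd (w - w') : L2" unfolding m using assms by (intro L2_diff energy_spaceD)
 ultimately show "w - w' : energy_space" by (intro energy_spaceI)
 show "Pc (w - w') = Pc w - Pc w'" unfolding Pc_def[of "w - w'"] by (rule H(2))
 show "Vc (w - w') = Vc w - Vc w'" unfolding Vc_def m using assms by (simp add: cls_diff energy_spaceD)
qed

lemma state_exists: "EX w:energy_space. Pc w = X & Vc w = Y"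
 by (rule bexI[of _ "(jp_inv (rp X), rp Y)"]) (auto simp: Pc_def Vc_def jp_inv_H1 intro!: energy_spaceI)

lemma U0_l2:
 assumes w: "w : energy_space"
 shows "U0 t w : energy_space"
  "Pc (U0 t w) = Mop (%xi. of_real (cos (t * jb xi))) (Pc w) + Mop (%xi. of_real (sin (t * jb xi))) (Vc w)"
  "Vc (U0 t w) = Mop (%xi. of_real (cos (t * jb xi))) (Vc w) - Mop (%xi. of_real (sin (t * jb xi))) (Pc w)"
proof -
 note a = H1_jp[OF energy_spaceD(1)[OF w]] and g = energy_spaceD(2)[OF w]
 have bc: "bm (%xi :: real ^ 'a. cor (cos (t * jb xi)))" and bs: "bm (%xi :: real ^ 'a. cor (sin (t * jb xi)))"
  and bs': "bm (%xi :: real ^ 'a. cor (- sin (t * jb xi)))" by (intro bmI[of _ 1]; simp)+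
 have beq: "cor (sin (t * jb xi) / jb xi) = ijp xi * of_real (sin (t * jb xi))" for xi :: "real ^ 'a" by (simp add: ijp_def)
 have bsi: "bm (%xi :: real ^ 'a. cor (sin (t * jb xi) / jb xi))" unfolding beq by (rule bm_mult[OF bm_ijp bs])
 note c1 = fourier_mult_bm[OF a(1) bc] and s1 = fourier_mult_bm[OF g bsi]
  and s2 = fourier_mult_H1[OF energy_spaceD(1)[OF w] bs'] and c2 = fourier_mult_bm[OF g bc]
 have m: "fst (U0 t w) = (%x. fourier_mult (%xi. cos (t * jb xi)) (fst w) x + fourier_mult (%xi. sin (t * jb xi) / jb xi) (snd w) x)"
  "snd (U0 t w) = (%x. fourier_mult (%xi. - sin (t * jb xi) * jb xi) (fst w) x + fourier_mult (%xi. cos (t * jb xi)) (snd w) x)"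
  by (auto simp: U0_def fun_eq_iff)
 have L: "fst (U0 t w) : L2" "snd (U0 t w) : L2" unfolding m by (intro L2_add c1 s1 s2 c2)+
 have "cls (fst (U0 t w)) = Mop ijp (Mop (%xi. of_real (cos (t * jb xi))) (Pc w) + Mop (%xi. of_real (sin (t * jb xi))) (Vc w))"
  unfolding m cls_add[OF c1(1) s1(1), symmetric] c1(2) s1(2) beq a(3) Mop_add Pc_def Vc_def
   Mop_Mop[OF bm_ijp bs, symmetric] by (simp only: Mop_commute[OF bm_ijp bc])
 from H1_I[OF L(1) this] show "U0 t w : energy_space"
  "Pc (U0 t w) = Mop (%xi. of_real (cos (t * jb xi))) (Pc w) + Mop (%xi. of_real (sin (t * jb xi))) (Vc w)"
  using L(2) unfolding Pc_def by (auto intro: energy_spaceI)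
 have "Mop (%xi. of_real (- sin (t * jb xi))) X = - Mop (%xi. of_real (sin (t * jb xi))) X" for X :: "'a l2"
  using Mop_add_left[OF bs' bs, of X] by (simp add: eq_neg_iff_add_eq_0 Mop_const)
 then show "Vc (U0 t w) = Mop (%xi. of_real (cos (t * jb xi))) (Vc w) - Mop (%xi. of_real (sin (t * jb xi))) (Pc w)"
  unfolding Vc_def Pc_def m cls_add[OF s2(1) c2(1), symmetric] s2(2) c2(2) by (simp only: add.commute[of "- _"] diff_conv_add_uminus)
qed

text \<open>The combinations \<open>\<langle>p\<rangle>u \<plusminus> i u'\<close> diagonalize the free evolution.\<close>

definition Zc :: "real => 'n::finite state => 'n l2" where "Zc s w = Pc w + mul (%_. \<i> * of_real s) (Vc w)"

lemma Zc_U0: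
 assumes w: "w : energy_space" and s: "s = 1 \<or> s = -1"
 shows "Zc s (U0 t w) = U (s * t) (Zc s w)"
proof -
 have bc: "bm (%xi :: real ^ 'a. cor (cos (t * jb xi)))" and bs: "bm (%xi :: real ^ 'a. cor (sin (t * jb xi)))" by (intro bmI[of _ 1]; simp)+
 define P Q where "P = Pc w" and "Q = Vc w"
 let ?c = "Mop (%xi. cor (cos (t * jb xi)))" and ?s = "Mop (%xi. cor (sin (t * jb xi)))"
 have Mc: "Mop m (mul (%_. c) X) = mul (%_. c) (Mop m X)" if "bm m" for m c and X :: "'a l2"
  using Mop_commute[OF that bm_const, of c X] by (simp add: Mop_const)
 have "cis (- (s * t * jb xi)) = of_real (cos (t * jb xi)) - \<i> * of_real s * of_real (sin (t * jb xi))" for xi :: "real ^ 'a"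
  using s by (auto simp: complex_eq_iff)
 then have U: "U (s * t) X = ?c X - mul (%_. \<i> * of_real s) (?s X)" for X :: "'a l2"
  unfolding U_def using Mop_diff_left[OF bc bm_mult[OF bm_const bs], of X "\<i> * of_real s"] Mop_Mop[OF bm_const bs, of "\<i> * of_real s" X]
  by (simp add: Mop_const)
 have ss: "mul (%_. \<i> * of_real s) (mul (%_. \<i> * of_real s) X) = - X" for X :: "'a l2"
 proof -
  have eq: "(\<i> * of_real s) * (\<i> * of_real s) = cor (-1)" using s by auto
  show ?thesis unfolding mul_mul[OF bm_const bm_const] eq mul_of_real by simp
 qed
 have "Zc s (U0 t w) = ?c P + ?s Q + mul (%_. \<i> * of_real s) (?c Q - ?s P)" unfolding Zc_def U0_l2[OF w] P_def Q_def ..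
 also have "... = ?c P + ?s Q + (mul (%_. \<i> * of_real s) (?c Q) - mul (%_. \<i> * of_real s) (?s P))" by (simp only: mul_diff)
 also have "... = U (s * t) (P + mul (%_. \<i> * of_real s) Q)" unfolding U Mop_add mul_add Mc[OF bc] Mc[OF bs] ss by (simp add: algebra_simps)
 finally show ?thesis by (simp add: Zc_def P_def Q_def)
qed

lemma Zc_diff: "w : energy_space ==> w' : energy_space ==> Zc s (w - w') = Zc s w - Zc s w'" by (simp add: Zc_def state_diff mul_diff)

lemma Pc_Vc_Zc:
 "Pc w = (1/2) *r (Zc 1 w + Zc (-1) w)" "Vc w = mul (%_. - \<i> / 2) (Zc 1 w - Zc (-1) w)"
proof -
 have neg: "mul (%_. \<i> * of_real (-1)) X = - mul (%_. \<i> * of_real 1) X" for X :: "'a l2"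
  using mul_add_left[of "%_. \<i> * of_real (-1)" "%_. \<i> * of_real 1" X] by (simp add: eq_neg_iff_add_eq_0)
 show "Pc w = (1/2) *r (Zc 1 w + Zc (-1) w)" unfolding Zc_def neg by (simp add: scaleR_2[symmetric] del: scaleR_2)
 have "Zc 1 w - Zc (-1) w = 2 *r mul (%_. \<i>) (Vc w)" unfolding Zc_def neg by (simp add: scaleR_2)
 then have "mul (%_. - \<i> / 2) (Zc 1 w - Zc (-1) w) = 2 *r mul (%_. cor (1/2)) (Vc w)" by (simp only: mul_scaleR mul_mul[OF bm_const bm_const]) simp
 then show "Vc w = mul (%_. - \<i> / 2) (Zc 1 w - Zc (-1) w)" unfolding mul_of_real by simp
qed

lemma norm_Zc_le: "w : energy_space ==> (abs s) = 1 ==> norm (Zc s w) <= 2 * H_norm w"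
proof -
 assume w: "w : energy_space" and s: "abs s = 1"
 have "norm (Zc s w) <= norm (Pc w) + norm (Vc w)"
  unfolding Zc_def using norm_triangle_ineq[of "Pc w" "mul (%_. \<i> * of_real s) (Vc w)"] s by (simp add: norm_mul_const norm_mult)
 moreover have "norm (Pc w) <= H_norm w" "norm (Vc w) <= H_norm w" unfolding H_norm_l2[OF w] by (auto intro: real_le_rsqrt)
 ultimately show ?thesis by simp
qed

lemma H_norm_le_Zc: "w : energy_space ==> H_norm w <= norm (Zc 1 w) + norm (Zc (-1) w)"
proof -
 assume w: "w : energy_space"
 have "H_norm w <= norm (Pc w) + norm (Vc w)" unfolding H_norm_l2[OF w] by (rule sqrt_sum_squares_le_sum) auto
 moreover have "norm (Pc w) <= (1/2) * (norm (Zc 1 w) + norm (Zc (-1) w))"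
  unfolding Pc_Vc_Zc(1)[of w] norm_scaleR using norm_triangle_ineq[of "Zc 1 w" "Zc (-1) w"] by simp
 moreover have "norm (Vc w) <= (1/2) * (norm (Zc 1 w) + norm (Zc (-1) w))"
  unfolding Pc_Vc_Zc(2)[of w] norm_mul_const using norm_triangle_ineq4[of "Zc 1 w" "Zc (-1) w"] by (simp add: norm_divide)
 ultimately show ?thesis by simp
qed

section \<open>The equation in the interaction picture\<close>

lemma eventually_small_right: "0 < m ==> \<forall>\<^sub>F h :: real in at_right 0. 0 < h & h < m" by (auto simp: eventually_at_right_field)

lemma right_dini_bound:
 fixes G :: "real => 'a::real_normed_vector" and g :: "real => real"
 assumes ab: "a <= b" and G: "continuous_on {a..b} G" and g: "continuous_on {a..b} g"
  and D: "!!t ep. a <= t ==> t < b ==> 0 < ep ==> \<forall>\<^sub>F h in at_right 0. norm (G (t + h) - G t) <= h * (g t + ep)"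
 shows "norm (G b - G a) <= integral {a..b} g"
proof (rule field_le_epsilon)
 fix ep' :: real assume "0 < ep'"
 define ep where "ep = ep' / (2 * (b - a + 1))"
 have ep: "0 < ep" using \<open>0 < ep'\<close> ab by (simp add: ep_def)
 \<comment> \<open>One \<open>ep\<close> pays for the error in the difference quotient, the other
   for the variation of \<open>g\<close> near the point.\<close>
 define \<Phi> where "\<Phi> t = integral {a..t} g + 2 * ep * (t - a)" for t
 have int: "g integrable_on {c..d}" if "a <= c" "d <= b" for c d using that by (intro integrable_continuous_real continuous_on_subset[OF g]) auto
 have c\<Phi>: "continuous_on {a..b} \<Phi>" unfolding \<Phi>_def using int[of a b] by (intro continuous_intros indefinite_integral_continuous_1) auto
 define S where "S = {t : {a..b}. norm (G t - G a) <= \<Phi> t}"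
 have "closed S" unfolding S_def by (intro continuous_on_closed_Collect_le continuous_intros G c\<Phi>)
 then have "compact S" unfolding S_def by (auto intro: bounded_subset[of "{a..b}"] simp: compact_eq_bounded_closed)
 moreover have "a : S" using ab by (simp add: S_def \<Phi>_def)
 ultimately obtain c where c: "c : S" "!!t. t : S ==> t <= c" using compact_attains_sup[of S] by auto
 have "c = b"
 proof (rule ccontr)
  assume "c ~= b"
  then have cb: "a <= c" "c < b" using c(1) by (auto simp: S_def)
  have "(g ---> g c) (at c within {a..b})" using g cb by (auto simp: continuous_on_def)
  then have "\<forall>\<^sub>F t in at c within {a..b}. g c - ep < g t" using ep by (intro order_tendstoD) auto
  then obtain d where d: "0 < d" "!!t. t : {a..b} ==> t ~= c ==> dist t c < d ==> g c - ep < g t" unfolding eventually_at by blast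
  have gd: "g c - ep <= g t" if "t : {c..<c + d}" "t <= b" for t using d(2)[of t] that cb ep by (cases "t = c") (auto simp: dist_real_def)
  have "\<forall>\<^sub>F h in at_right 0. 0 < h & h < min d (b - c)" using d(1) cb by (intro eventually_small_right) simp
  then have "\<forall>\<^sub>F h in at_right 0. c + h : S & 0 < h" using D[OF cb ep]
  proof eventually_elim
   case (elim h)
   then have h: "0 < h" "c + h < c + d" "c + h <= b" by auto
   have "h * (g c - ep) = integral {c..c + h} (%_. g c - ep)" using h by simp
   also have "... <= integral {c..c + h} g" using h cb gd by (intro integral_le int integrable_const_ivl) auto
   finally have "integral {a..c} g + h * (g c - ep) <= integral {a..c + h} g"
    using Henstock_Kurzweil_Integration.integral_combine[of a c "c + h" g] int[of a "c + h"] h cb by auto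
   moreover have "norm (G (c + h) - G a) <= norm (G (c + h) - G c) + norm (G c - G a)"
    using norm_triangle_ineq[of "G (c + h) - G c" "G c - G a"] by simp
   moreover have "norm (G c - G a) <= integral {a..c} g + 2 * ep * (c - a)" using c(1) by (simp add: S_def \<Phi>_def)
   ultimately have "norm (G (c + h) - G a) <= \<Phi> (c + h)" using elim(2) by (simp add: \<Phi>_def algebra_simps)
   then show ?case using h cb by (simp add: S_def)
  qed
  then obtain h where "c + h : S" "0 < h" using eventually_happens'[of "at_right (0 :: real)"] by auto
  then show False using c(2)[of "c + h"] by simp
 qed
 then have "norm (G b - G a) <= \<Phi> b" using c(1) by (simp add: S_def)
 also have "2 * ep * (b - a) <= ep'"
 proof -
  have "2 * ep * (b - a) <= 2 * ep * (b - a + 1)" using ep by (intro mult_left_mono) auto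
  also have "... = ep'"
  proof -
   have "0 < 2 * (b - a + 1)" using ab by simp
   then show ?thesis unfolding ep_def by (simp only: times_divide_eq_left nonzero_mult_div_cancel_right mult.commute mult.left_commute) (simp add: field_simps)
  qed
  finally show ?thesis .
 qed
 then have "\<Phi> b <= integral {a..b} g + ep'" by (simp add: \<Phi>_def)
 finally show "norm (G b - G a) <= integral {a..b} g + ep'" .
qed

text \<open>The bracket cut off to a ball, hence a bounded symbol; on vectors with frequencies in
  that ball it acts like the bracket itself.\<close>

definition jcut :: "real => real ^ 'n::finite => complex" where "jcut R xi = ind (cball 0 R) xi * of_real (jb xi)"

lemma japanese_le: "xi : cball 0 R ==> jb xi <= 1 + abs R"
proof -
 assume "xi : cball 0 R"
 then have "norm xi <= abs R" by simp
 moreover have "jb xi <= 1 + norm xi" unfolding japanese_def by (rule real_le_lsqrt) (auto simp: power2_eq_square algebra_simps)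
 ultimately show ?thesis by linarith
qed

lemma bm_jcut: "bm (jcut R :: real ^ 'n::finite => complex)"
proof (rule bmI[of _ "1 + abs R"])
 show "cmod (jcut R xi) <= 1 + abs R" for xi :: "real ^ 'n" using japanese_le[of xi R] japanese_pos[of xi] by (auto simp: jcut_def indicator_def)
 have "meas (ind (cball 0 R) :: real ^ 'n => complex)" by (rule borel_measurable_indicator) simp
 then show "meas (jcut R :: real ^ 'n => complex)" unfolding jcut_def[abs_def] by measurable
qed

text \<open>For vectors with frequencies in a ball the bracket is bounded. They are thus admissible
  test functions in the weak formulation, and the bracket can be moved to them from the
  solution.\<close>

lemma Pc_band_limited:
 assumes w: "w : H1" and Y: "Mop (ind (cball 0 R)) Y = Y"
 shows "rp Y : H1" "cls (jp (rp Y)) = Mop (jcut R) Y"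
  and "cinner (cls (jp w)) Y = cinner (cls w) (Mop (jcut R) Y)"
proof -
 let ?j = "jcut R :: real ^ 'a => complex"
 note bj = bm_jcut[of R]
 have ij: "(%xi. ijp xi * ?j xi) = ind (cball 0 R)"
 proof
  show "ijp xi * ?j xi = ind (cball 0 R) xi" for xi using ijp_japanese(1)[of xi 1] by (cases "xi : cball 0 R") (simp_all add: jcut_def)
 qed
 have "cls (rp Y) = Mop ijp (Mop ?j Y)" unfolding Mop_Mop[OF bm_ijp bj] ij by (simp add: Y)
 from H1_I[OF rp_L2 this] show "rp Y : H1" "cls (jp (rp Y)) = Mop ?j Y" .
 have cj: "(%xi. cnj (ijp xi)) = ijp" "(%xi. cnj (?j xi)) = ?j" by (auto simp: ijp_def jcut_def)
 have "cinner (cls w) (Mop ?j Y) = cinner (cls (jp w)) (Mop ijp (Mop ?j Y))" unfolding H1_jp(3)[OF w] cinner_Mop_left[OF bm_ijp] cj ..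
 also have "Mop ijp (Mop ?j Y) = Y" unfolding Mop_Mop[OF bm_ijp bj] ij by (rule Y)
 finally show "cinner (cls (jp w)) Y = cinner (cls w) (Mop ?j Y)" ..
qed

lemma U_difference:
 assumes s: "abs s = 1" and h: "0 <= h" "h <= 1" and Y: "Mop (ind (cball 0 R)) Y = Y"
 shows "norm (U (s * h) Y - Y + mul (%_. \<i> * of_real (s * h)) (Mop (jcut R) Y)) <= h^2 * (exp (1 + abs R) * (1 + abs R)^2) * norm Y"
proof -
 let ?I = "ind (cball 0 R) :: real ^ 'a => complex"
 let ?j = "jcut R :: real ^ 'a => complex"
 have jb: "abs (s * h * jb xi) <= h * (1 + abs R)" if "xi : cball 0 R" for xi :: "real ^ 'a"
  using s h japanese_pos[of xi] japanese_le[OF that] by (simp add: abs_mult abs_of_pos mult_left_mono)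
 note bj = bm_jcut[of R]
 have bI: "bm ?I" by (intro bm_indicator) simp
 let ?m = "%xi. cis (- (s * h * jb xi)) * ?I xi - ?I xi + \<i> * of_real (s * h) * ?j xi"
 have bm: "bm ?m" by (intro bm_add bm_diff bm_mult bI bj bm_U bm_const)
 have "U (s * h) Y - Y + mul (%_. \<i> * of_real (s * h)) (Mop ?j Y) = U (s * h) (Mop ?I Y) - Mop ?I Y + Mop (%_. \<i> * of_real (s * h)) (Mop ?j Y)"
  unfolding Y Mop_const ..
 also have "... = Mop ?m Y" unfolding U_Mop[OF bI] Mop_Mop[OF bm_const bj] Mop_diff_left[OF bm_mult[OF bm_U bI] bI]
   Mop_add_left[OF bm_diff[OF bm_mult[OF bm_U bI] bI] bm_mult[OF bm_const bj]] ..
 finally have eq: "U (s * h) Y - Y + mul (%_. \<i> * of_real (s * h)) (Mop ?j Y) = Mop ?m Y" .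
 show ?thesis unfolding eq
 proof (rule norm_Mop_le[OF bm_measurable[OF bm]])
  fix xi :: "real ^ 'a"
  let ?u = "- \<i> * of_real (s * h * jb xi)"
  have m: "?m xi = ?I xi * (exp ?u - 1 - ?u)" by (simp add: jcut_def cis_conv_exp algebra_simps)
  show "cmod (?m xi) <= h^2 * (exp (1 + abs R) * (1 + abs R)^2)"
  proof (cases "xi : cball 0 R")
   case True
   have u: "cmod ?u <= h * (1 + abs R)" using jb[OF True] by (simp only: norm_mult norm_of_real) simp
   have hR: "h * (1 + abs R) <= 1 * (1 + abs R)" using h by (intro mult_right_mono) auto
   have "cmod (?m xi) = cmod (exp ?u - 1 - ?u)" unfolding m using True by simp
   also have "... <= exp (cmod ?u) * (cmod ?u)^2" by (rule exp_minus_linear_bound)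
   also have "... <= exp (1 + abs R) * (h * (1 + abs R))^2" using u hR by (intro mult_mono power_mono) auto
   finally show ?thesis by (simp add: power_mult_distrib mult_ac)
  next
   case False then show ?thesis unfolding m by simp
  qed
 qed
qed

locale kg =
 fixes N :: "'n::finite interaction" and u :: "real => 'n state" and sg K E :: real
 assumes sol: "KG_solution N u" and sg: "1 < sg" "sg <= 2"
  and energy: "!!t. 0 <= t ==> H_norm (u t) <= E"
  and weighted: "!!t. 0 <= t ==> pos_mult (%x. jb x powr sg) (interaction N u t) : L2"
   "!!t. 0 <= t ==> L2_norm (pos_mult (%x. jb x powr sg) (interaction N u t)) <= K"
begin

lemma u_in: "0 <= t ==> u t : energy_space" and f_in: "0 <= t ==> interaction N u t : L2" using sol by (auto simp: KG_solution_def)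

lemma K_nonneg: "0 <= K"
proof -
 have "0 <= L2_norm (pos_mult (%x. jb x powr sg) (interaction N u 0))" by (simp add: L2_norm_def)
 then show ?thesis using weighted(2)[of 0] by simp
qed

text \<open>The source is \<open>Wt sg\<close> applied to its weighted version, and the weight is
  moved to the other side of the pairing.\<close>

lemma force_bound: "0 <= t ==> cmod (cinner (cls (interaction N u t)) Y) <= K * norm (Wt sg Y)"
proof -
 assume t: "0 <= t"
 let ?f = "interaction N u t" and ?g = "pos_mult (%x. jb x powr sg) (interaction N u t)"
 have bW: "bm (%x :: real ^ 'n. cor (jb x powr - sg))" using sg by (intro bm_Wt) simp
 have "jb x powr - sg * jb x powr sg = 1" for x :: "real ^ 'n" using japanese_nonzero[of x] by (simp add: powr_add[symmetric])
 then have "cor (jb x powr - sg) * cor (jb x powr sg) = 1" for x :: "real ^ 'n" by (metis of_real_1 of_real_mult)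
 then have "(%x. of_real (jb x powr - sg) * ?g x) = ?f" by (simp add: pos_mult_def mult.assoc[symmetric])
 then have "Wt sg (cls ?g) = cls ?f" unfolding Wt_def cls_mul[OF weighted(1)[OF t] bW] by simp
 then have "cinner (cls ?f) Y = cinner (Wt sg (cls ?g)) Y" by (simp only:)
 also have "... = cinner (cls ?g) (Wt sg Y)" unfolding Wt_def cinner_mul_left[OF bW] by simp
 finally have "cmod (cinner (cls ?f) Y) <= norm (cls ?g) * norm (Wt sg Y)" using cinner_norm_le by simp
 also have "... <= K * norm (Wt sg Y)" using weighted[OF t] by (intro mult_right_mono) (auto simp: cls_norm)
 finally show ?thesis .
qed

lemma u_continuous:
 assumes s: "0 <= s"
 shows "((%t. Pc (u t)) ---> Pc (u s)) (at s within {0..})" "((%t. Vc (u t)) ---> Vc (u s)) (at s within {0..})"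
proof -
 have lim: "((%t. H_norm (u t - u s)) ---> 0) (at s within {0..})" using sol s by (auto simp: KG_solution_def)
 have ev: "\<forall>\<^sub>F t in at s within {0..}. t : {0..}" by (auto simp: eventually_at_filter)
 have "norm (Pc (u t) - Pc (u s)) <= H_norm (u t - u s)" "norm (Vc (u t) - Vc (u s)) <= H_norm (u t - u s)" if "0 <= t" for t
  unfolding H_norm_l2[OF state_diff(1)[OF u_in[OF that] u_in[OF s]]] state_diff[OF u_in[OF that] u_in[OF s]] by (auto intro: real_le_rsqrt)
 then have "\<forall>\<^sub>F t in at s within {0..}. norm (Pc (u t) - Pc (u s)) <= H_norm (u t - u s)"
  "\<forall>\<^sub>F t in at s within {0..}. norm (Vc (u t) - Vc (u s)) <= H_norm (u t - u s)" using ev by (auto elim: eventually_mono)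
 then show "((%t. Pc (u t)) ---> Pc (u s)) (at s within {0..})" "((%t. Vc (u t)) ---> Vc (u s)) (at s within {0..})"
  by (auto intro: LIM_zero_cancel Lim_null_comparison[OF _ lim])
qed

lemma Zc_continuous: "0 <= t ==> ((%r. Zc s (u r)) ---> Zc s (u t)) (at t within {0..})"
 unfolding Zc_def by (intro tendsto_add bounded_linear.tendsto[OF bounded_linear_mul] u_continuous)

definition Om :: "real => real => 'n l2" where "Om s t = U (- (s * t)) (Zc s (u t))"

lemma velocity_increment:
 assumes "0 <= t" "0 <= h" and Y: "Mop (ind (cball 0 R)) Y = Y"
 defines "JY \<equiv> Mop (jcut R) Y"
 shows "((%r. cinner (cls (interaction N u r)) Y - cinner (Pc (u r)) JY) has_integral cinner (Vc (u (t + h)) - Vc (u t)) Y) {t..t + h}"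
proof -
 define F where "F r = cinner (cls (interaction N u r)) Y - cinner (Pc (u r)) JY" for r
 have rY: "rp Y : H1" "cls (jp (rp Y)) = JY" using Pc_band_limited[OF energy_spaceD(1)[OF u_in[of 0]] Y] by (auto simp: JY_def)
 have V: "(F has_integral cinner (Vc (u r)) Y - cinner (Vc (u 0)) Y) {0..r}" if r: "0 <= r" for r
 proof -
  have "((%s. L2_inner (interaction N u s) (rp Y) - L2_inner (jp (fst (u s))) (jp (rp Y)))
            has_integral (L2_inner (snd (u r)) (rp Y) - L2_inner (snd (u 0)) (rp Y))) {0..r}" using sol r rY by (auto simp: KG_solution_def)
  moreover have "L2_inner (snd (u r)) (rp Y) - L2_inner (snd (u 0)) (rp Y) = cinner (Vc (u r)) Y - cinner (Vc (u 0)) Y"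
   using r u_in[OF r] u_in[of 0] by (simp add: Vc_def energy_spaceD cls_cinner[symmetric])
  moreover have "L2_inner (interaction N u s) (rp Y) - L2_inner (jp (fst (u s))) (jp (rp Y)) = F s" if "s : {0..r}" for s
   using that u_in[of s] f_in[of s] rY H1_jp(2)[OF rY(1)] H1_jp(2)[OF energy_spaceD(1)[OF u_in[of s]]]
   by (simp add: F_def Pc_def cls_cinner[symmetric] rY(2)[symmetric])
  ultimately show ?thesis by (metis (no_types, lifting) has_integral_eq)
 qed
 have h: "0 <= t + h" "t <= t + h" using assms by auto
 have iF: "F integrable_on {t..t + h}" using integrable_on_subinterval[OF has_integral_integrable[OF V[OF h(1)]], of t "t + h"] assms by auto
 have "integral {0..t} F + integral {t..t + h} F = integral {0..t + h} F"
  using Henstock_Kurzweil_Integration.integral_combine[OF assms(1) h(2) has_integral_integrable[OF V[OF h(1)]]] .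
 then have "integral {t..t + h} F = cinner (Vc (u (t + h)) - Vc (u t)) Y"
  using V[OF assms(1), THEN integral_unique] V[OF h(1), THEN integral_unique] by (simp add: cinner_diff_left algebra_simps)
 then show ?thesis unfolding F_def[symmetric, abs_def] using iF by (simp add: has_integral_integrable_integral)
qed

text \<open>To first order in \<open>h\<close> the pairing of \<open>Zc s (u r)\<close> with
  \<open>U (s * r) X\<close> changes through both components of the state and through the
  propagator. Because \<open>s * s = 1\<close>, the linear contributions cancel and only the source
  survives. Test vectors are band-limited to make the first order expansion of the propagator
  uniform.\<close>

lemma Om_right_increment:
 assumes s: "abs s = 1" and t: "0 <= t" and X: "Mop (ind (cball 0 R)) X = X" and ep: "0 < ep"
 shows "\<forall>\<^sub>F h in at_right 0. norm (cinner (Om s (t + h)) X - cinner (Om s t) X) <= h * (K * norm (Wt sg (U (s * t) X)) + ep)"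
proof -
 have bI: "bm (ind (cball 0 R) :: real ^ 'n => complex)" by (intro bm_indicator) simp
 define Y where "Y = U (s * t) X"
 have Y: "Mop (ind (cball 0 R)) Y = Y" unfolding Y_def U_Mop_commute[OF bI, symmetric] X ..
 define JY where "JY = Mop (jcut R) Y"
 define Z where "Z r = Zc s (u r)" for r
 define M where "M = exp (1 + abs R) * (1 + abs R)^2 * norm Y"
 have M: "0 <= M" by (simp add: M_def)
 \<comment> \<open>Four errors, each at most \<open>h * d\<close>, have to fit under
   \<open>h * ep\<close>.\<close>
 define d where "d = ep / 4"
 have d: "0 < d" using ep by (simp add: d_def)
 \<comment> \<open>A tolerance in norm under which pairings with \<open>JY\<close> stay below
   \<open>d\<close>; the added 1 excludes division by zero.\<close>
 define D where "D = d / (norm JY + 1)"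
 have D: "0 < D" using d by (simp add: D_def add_nonneg_pos)
 have DJ: "D * norm JY <= d"
 proof -
  have "D * norm JY <= D * (norm JY + 1)" using D by (intro mult_left_mono) auto
  also have "... = d" using add_nonneg_pos[OF norm_ge_zero[of JY] zero_less_one] unfolding D_def by (metis less_numeral_extra(3) nonzero_eq_divide_eq)
  finally show ?thesis .
 qed
 have E0: "0 <= E" using energy[of 0] H_norm_l2[OF u_in[of 0]] by (simp add: order_trans[of 0 "H_norm (u 0)"])
 have nZ: "norm (Z r) <= 2 * E" if "0 <= r" for r using norm_Zc_le[OF u_in[OF that] s] energy[OF that] by (simp add: Z_def)
 have right: "\<forall>\<^sub>F h in at_right 0. P (t + h)" if "\<forall>\<^sub>F r in at t within {0..}. P r" for P
 proof -
  have "\<forall>\<^sub>F r in at_right t. P r" using that t by (auto simp: eventually_at_filter elim!: eventually_mono)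
  then show ?thesis by (subst (asm) at_right_to_0) (simp add: eventually_filtermap add.commute)
 qed
 have "\<forall>\<^sub>F r in at t within {0..}. dist (Z r) (Z t) < D" unfolding Z_def using Zc_continuous[OF t] D by (rule tendstoD)
 from right[OF this] have e1: "\<forall>\<^sub>F h in at_right 0. dist (Z (t + h)) (Z t) < D" .
 have "\<forall>\<^sub>F r in at t within {0..}. dist (Pc (u r)) (Pc (u t)) < D" using u_continuous(1)[OF t] D by (rule tendstoD)
 then obtain \<delta> where \<delta>: "0 < \<delta>" "!!r. 0 <= r ==> r ~= t ==> dist r t < \<delta> ==> dist (Pc (u r)) (Pc (u t)) < D"
  unfolding eventually_at by auto
 have rJ: "rp JY : H1"
 proof -
  have "Mop (ind (cball 0 R)) JY = JY" unfolding JY_def Mop_commute[OF bI bm_jcut] Y ..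
  then show ?thesis by (rule Pc_band_limited(1)[OF energy_spaceD(1)[OF u_in[OF order_refl]]])
 qed
 have "((%r. L2_inner (fst (u r)) (rp JY)) has_vector_derivative L2_inner (snd (u t)) (rp JY)) (at t within {0..})"
  using sol t rJ by (auto simp: KG_solution_def)
 then have "\<forall>\<^sub>F r in at t within {0..}. norm (L2_inner (fst (u r)) (rp JY) - L2_inner (fst (u t)) (rp JY) - (r - t) *r L2_inner (snd (u t)) (rp JY)) <= d * norm (r - t)"
  using d unfolding has_vector_derivative_def has_derivative_within_alt2 by blast
 from right[OF this] have e3: "\<forall>\<^sub>F h in at_right 0. norm (L2_inner (fst (u (t + h))) (rp JY) - L2_inner (fst (u t)) (rp JY) - h *r L2_inner (snd (u t)) (rp JY)) <= d * norm h"
  by simp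
 have "0 < min \<delta> (min 1 (d / (2 * E * M + 1)))" using \<delta>(1) d E0 M by (simp add: add_nonneg_pos)
 then have e4: "\<forall>\<^sub>F h in at_right 0. 0 < h & h < min \<delta> (min 1 (d / (2 * E * M + 1)))" by (rule eventually_small_right)
 show ?thesis using e1 e3 e4
 proof eventually_elim
  case (elim h)
  have h: "0 < h" "h < \<delta>" "h <= 1" "h * (2 * E * M + 1) <= d" using elim E0 M by (auto simp: less_divide_eq add_nonneg_pos)
  define p v where "p = cinner (Pc (u t)) JY" and "v = cinner (Vc (u t)) JY"
  define c where "c = \<i> * cor (s * h)"
  have Pt: "cinner (Pc (u r)) Y = cinner (cls (fst (u r))) JY" if "0 <= r" for r
   unfolding Pc_def JY_def by (rule Pc_band_limited(3)[OF energy_spaceD(1)[OF u_in[OF that]] Y])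
  have th: "0 <= t + h" using t h by simp
  \<comment> \<open>\<open>E1\<close> is the second order remainder of the propagator and
    \<open>E2\<close> comes from the continuity of the state. \<open>E3\<close> and
    \<open>E4\<close> are the increments of the two components after subtraction of their linear
    parts, so that \<open>E4\<close> contains the source.\<close>
  define E1 where "E1 = cinner (Z (t + h)) (U (s * h) Y - Y + mul (%_. c) JY)"
  define E2 where "E2 = cinner (Z (t + h) - Z t) JY"
  define E3 where "E3 = cinner (Pc (u (t + h)) - Pc (u t)) Y - of_real h * v"
  define E4 where "E4 = cinner (Vc (u (t + h)) - Vc (u t)) Y + of_real h * p"
  have E1b: "cmod E1 <= h * d"
  proof -
   have "norm (U (s * h) Y - Y + mul (%_. c) JY) <= h^2 * M"
    using U_difference[OF s _ h(3) Y] h(1) unfolding c_def JY_def M_def by (simp add: mult.assoc)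
   then have "cmod E1 <= (2 * E) * (h^2 * M)" unfolding E1_def using nZ[OF th] E0 by (intro order_trans[OF cinner_norm_le] mult_mono) auto
   also have "... = h * (h * (2 * E * M))" by (simp add: power2_eq_square)
   also have "... <= h * d" using h by (intro mult_left_mono) (auto simp: distrib_left)
   finally show ?thesis .
  qed
  have E2b: "cmod E2 <= d"
  proof -
   have "cmod E2 <= D * norm JY" unfolding E2_def using elim(1) by (intro order_trans[OF cinner_norm_le] mult_right_mono) (auto simp: dist_norm)
   then show ?thesis using DJ by linarith
  qed
  have E3b: "cmod E3 <= h * d"
  proof -
   have "E3 = (L2_inner (fst (u (t + h))) (rp JY) - L2_inner (fst (u t)) (rp JY)) - of_real h * L2_inner (snd (u t)) (rp JY)"
    unfolding E3_def v_def Vc_def cinner_diff_left Pt[OF th] Pt[OF t]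
    using u_in[OF th] u_in[OF t] by (simp add: cls_cinner[symmetric] energy_spaceD H1_jp(1))
   then show ?thesis using elim(2) h by (simp add: scaleR_conv_of_real mult.commute)
  qed
  have E4b: "cmod E4 <= h * (K * norm (Wt sg Y) + d)"
  proof -
   have "((%r. cinner (cls (interaction N u r)) Y - cinner (Pc (u r)) JY + p) has_integral cinner (Vc (u (t + h)) - Vc (u t)) Y + h *r p) {t..t + h}"
    using has_integral_add[OF velocity_increment[OF t _ Y, of h] has_integral_const_real[of p t "t + h"]] h by (simp add: JY_def)
   then have I: "((%r. cinner (cls (interaction N u r)) Y - cinner (Pc (u r)) JY + p) has_integral E4) (cbox t (t + h))"
    by (simp add: E4_def scaleR_conv_of_real)
   have "norm E4 <= (K * norm (Wt sg Y) + d) * measure lborel (cbox t (t + h))"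
   proof (rule has_integral_bound[OF _ I])
    show "0 <= K * norm (Wt sg Y) + d" using K_nonneg d by simp
    fix r assume r: "r : cbox t (t + h)"
    then have r0: "0 <= r" using t by auto
    have "cmod (cinner (Pc (u r)) JY - p) <= d"
    proof (cases "r = t")
     case False
     then have "dist (Pc (u r)) (Pc (u t)) < D" using \<delta>(2)[of r] r r0 h by (auto simp: dist_real_def)
     then have "cmod (cinner (Pc (u r) - Pc (u t)) JY) <= D * norm JY"
      by (intro order_trans[OF cinner_norm_le] mult_right_mono) (auto simp: dist_norm)
     then show ?thesis using DJ by (simp add: p_def cinner_diff_left)
    qed (use d in \<open>simp add: p_def\<close>)
    moreover have "cinner (cls (interaction N u r)) Y - cinner (Pc (u r)) JY + p = cinner (cls (interaction N u r)) Y - (cinner (Pc (u r)) JY - p)" by simp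
    ultimately show "norm (cinner (cls (interaction N u r)) Y - cinner (Pc (u r)) JY + p) <= K * norm (Wt sg Y) + d"
     using force_bound[OF r0, of Y] norm_triangle_ineq4[of "cinner (cls (interaction N u r)) Y" "cinner (Pc (u r)) JY - p"] by (simp only:)
   qed
   then show ?thesis using h by (simp add: mult.commute)
  qed
  have Omr: "cinner (Om s r) X = cinner (Z r) (U (s * r) X)" for r unfolding Om_def Z_def cinner_U by simp
  have Uh: "U (s * (t + h)) X = U (s * h) Y" unfolding Y_def U_U by (simp add: algebra_simps)
  have ZJ: "cinner (Z t) JY = p + \<i> * of_real s * v" by (simp add: Z_def Zc_def cinner_add_left cinner_const_left p_def v_def)
  have ZY: "cinner (Z (t + h) - Z t) Y = (of_real h * v + E3) + \<i> * of_real s * (E4 - of_real h * p)"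
   by (simp add: Z_def Zc_def cinner_diff_left cinner_add_left cinner_const_left E3_def E4_def algebra_simps)
  have ss: "cor s * cor s = 1"
  proof -
   have "s * s = 1" using s by (metis abs_mult_self_eq mult_1)
   then show ?thesis by (metis of_real_1 of_real_mult)
  qed
  have cc: "cnj c = - c" by (simp add: c_def)
  have "cinner (Om s (t + h)) X - cinner (Om s t) X = cinner (Z (t + h)) (U (s * h) Y) - cinner (Z t) Y" unfolding Omr Uh Y_def ..
  also have "... = E1 + c * (cinner (Z t) JY + E2) + cinner (Z (t + h) - Z t) Y"
   by (simp add: E1_def E2_def cinner_add_right cinner_diff_right cinner_diff_left cinner_const_right cc algebra_simps)
  also have "... = E1 + c * E2 + E3 + \<i> * of_real s * E4"
  proof -
   have "c * (\<i> * of_real s * v) = - (cor h * v * (cor s * cor s))" by (simp add: c_def mult_ac)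
   then have cv: "c * (\<i> * of_real s * v) = - (of_real h * v)" unfolding ss by simp
   show ?thesis unfolding ZJ ZY distrib_left cv by (simp add: c_def algebra_simps)
  qed
  finally have n: "norm (cinner (Om s (t + h)) X - cinner (Om s t) X) <= cmod E1 + cmod (c * E2) + cmod E3 + cmod (\<i> * of_real s * E4)"
   using norm_triangle_ineq[of "E1 + c * E2 + E3" "\<i> * of_real s * E4"] norm_triangle_ineq[of "E1 + c * E2" E3] norm_triangle_ineq[of E1 "c * E2"] by simp
  have cE2: "cmod (c * E2) <= h * d" using E2b h s by (simp add: c_def norm_mult abs_mult mult_left_mono)
  have cE4: "cmod (\<i> * of_real s * E4) <= h * (K * norm (Wt sg Y) + d)" using s E4b by (simp add: norm_mult)
  have "norm (cinner (Om s (t + h)) X - cinner (Om s t) X) <= h * d + h * d + h * d + h * (K * norm (Wt sg Y) + d)"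
   by (rule order_trans[OF n]) (intro add_mono E1b cE2 E3b cE4)
  also have "... = h * (K * norm (Wt sg Y) + ep)" by (simp add: d_def algebra_simps)
  finally show ?case by (simp add: Y_def)
 qed
qed

lemma Om_step_band_limited:
 assumes s: "abs s = 1" and t: "0 <= t" "t <= t'" and X: "Mop (ind (cball 0 R)) X = X"
 shows "abs (inner (Om s t' - Om s t) X) <= K * integral {t..t'} (%\<tau>. norm (Wt sg (U (s * \<tau>) X)))"
proof -
 have "norm (cinner (Om s t') X - cinner (Om s t) X) <= integral {t..t'} (%\<tau>. K * norm (Wt sg (U (s * \<tau>) X)))"
 proof (rule right_dini_bound[OF t(2)])
  have "continuous_on {t..t'} (%\<tau>. cinner (Zc s (u \<tau>)) (U (s * \<tau>) X))"
  proof (rule bounded_bilinear.continuous_on[OF bounded_bilinear_cinner])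
   show "continuous_on {t..t'} (%\<tau>. Zc s (u \<tau>))"
    unfolding continuous_on_def using t by (auto intro: tendsto_within_subset[OF Zc_continuous])
   show "continuous_on {t..t'} (%\<tau>. U (s * \<tau>) X)" by (intro continuous_on_compose2[OF continuous_on_U[of UNIV]] continuous_intros) auto
  qed
  then show "continuous_on {t..t'} (%\<tau>. cinner (Om s \<tau>) X)" by (simp add: Om_def cinner_U)
  show "continuous_on {t..t'} (%\<tau>. K * norm (Wt sg (U (s * \<tau>) X)))" by (intro continuous_intros continuous_on_Wt_U)
  show "\<forall>\<^sub>F h in at_right 0. norm (cinner (Om s (r + h)) X - cinner (Om s r) X) <= h * (K * norm (Wt sg (U (s * r) X)) + ep)"
   if "t <= r" "0 < ep" for r ep using Om_right_increment[OF s _ X that(2), of r] that t by simp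
 qed
 moreover have "abs (inner (Om s t' - Om s t) X) <= norm (cinner (Om s t') X - cinner (Om s t) X)"
  unfolding inner_l2_Re cinner_diff_left by (rule abs_Re_le_cmod)
 ultimately show ?thesis by simp
qed

text \<open>Band-limited vectors are dense, and both sides depend continuously on \<open>X\<close>:
  the weights are contractions and the group is isometric, so the integral changes by at most
  \<open>(t' - t) * norm (Xk k - X)\<close>.\<close>

lemma Om_step:
 assumes s: "abs s = 1" and t: "0 <= t" "t <= t'"
 shows "abs (inner (Om s t' - Om s t) X) <= K * integral {t..t'} (%\<tau>. norm (Wt sg (U (s * \<tau>) X)))"
proof -
 define Xk where "Xk k = Mop (ind (cball 0 (real k))) X" for k :: nat
 have Xk: "Xk ----> X" unfolding Xk_def Mop_def using FI_tendsto[OF tr_tendsto[of "FF X"]] by (simp add: tr_def)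
 define I where "I = integral {t..t'} (%\<tau>. norm (Wt sg (U (s * \<tau>) X)))"
 have int: "(%\<tau>. norm (Wt sg (U (s * \<tau>) Y))) integrable_on {t..t'}" for Y :: "'n l2"
  by (intro integrable_continuous_real continuous_on_Wt_U)
 have "abs (inner (Om s t' - Om s t) (Xk k)) <= K * (I + (t' - t) * norm (Xk k - X))" for k
 proof -
  have "Mop (ind (cball 0 (real k))) (Xk k) = Xk k" unfolding Xk_def Mop_def FF_FI by (simp add: mul_indicator_idem)
  from Om_step_band_limited[OF s t this]
  have "abs (inner (Om s t' - Om s t) (Xk k)) <= K * integral {t..t'} (%\<tau>. norm (Wt sg (U (s * \<tau>) (Xk k))))" .
  also have "... <= K * integral {t..t'} (%\<tau>. norm (Wt sg (U (s * \<tau>) X)) + norm (Xk k - X))"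
  proof (intro mult_left_mono K_nonneg integral_le int integrable_add)
   fix \<tau>
   have "norm (Wt sg (U (s * \<tau>) (Xk k - X))) <= norm (Xk k - X)" using norm_Wt_le[of sg "U (s * \<tau>) (Xk k - X)"] sg by (simp add: norm_U)
   then show "norm (Wt sg (U (s * \<tau>) (Xk k))) <= norm (Wt sg (U (s * \<tau>) X)) + norm (Xk k - X)"
    using norm_triangle_sub[of "Wt sg (U (s * \<tau>) (Xk k))" "Wt sg (U (s * \<tau>) X)"] by (simp add: U_diff Wt_diff)
  qed auto
  also have "integral {t..t'} (%\<tau>. norm (Wt sg (U (s * \<tau>) X)) + norm (Xk k - X)) = I + (t' - t) * norm (Xk k - X)"
   unfolding I_def using t by (subst Henstock_Kurzweil_Integration.integral_add[OF int]) auto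
  finally show ?thesis .
 qed
 moreover have "(%k. (abs (inner (Om s t' - Om s t) (Xk k)))) ----> (abs (inner (Om s t' - Om s t) X))" by (intro tendsto_intros Xk)
 moreover have "(%k. K * (I + (t' - t) * norm (Xk k - X))) ----> K * (I + (t' - t) * norm (X - X))" by (intro tendsto_intros Xk)
 ultimately have "abs (inner (Om s t' - Om s t) X) <= K * (I + (t' - t) * norm (X - X))" by (intro LIMSEQ_le) auto
 then show ?thesis by (simp add: I_def)
qed

lemma orbit_Om: "abs s = 1 ==> orbit (Om s) s (2 * E) K sg"
proof
 fix t :: real assume s: "abs s = 1" and t: "0 <= t"
 show "norm (Om s t) <= 2 * E" using norm_Zc_le[OF u_in[OF t] s] energy[OF t] by (simp add: Om_def norm_U)
qed (use sg K_nonneg Om_step in auto)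

end

section \<open>Assembling the free channel and the remainder\<close>

lemma norm_mul_sum_le:
 assumes "finite J" "!!k. bm (g k)"
 shows "norm (mul (%x. \<Sum>k\<in>J. g k x) X) <= (\<Sum>k\<in>J. norm (mul (g k) X))" using assms(1)
proof (induction J)
 case (insert j J)
 have "bm (%x. \<Sum>k\<in>J. g k x)" using insert(1) by (induction J) (auto intro!: bm_add assms(2))
 then have "mul (%x. \<Sum>k\<in>insert j J. g k x) X = mul (g j) X + mul (%x. \<Sum>k\<in>J. g k x) X"
  using insert(1,2) by (simp add: mul_add_left assms(2))
 then show ?case using insert norm_triangle_ineq[of "mul (g j) X" "mul (%x. \<Sum>k\<in>J. g k x) X"] by simp
qed simp

text \<open>The exterior of a ball is covered by the half spaces along the coordinate axes in both
  orientations. The dimensional constant in this covering is absorbed by half of the exponent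
  \<open>ep\<close>.\<close>

lemma (in orbit) sub_ballistic_norm:
 assumes ep: "0 < ep"
 shows "null (%t. norm (mul (%x. 1 - ind {x. norm x <= t powr (1 / sg + ep)} x) (U (s * t) (Om t - omega))))"
proof -
 define v where "v t = U (s * t) (Om t - omega)" for t
 define g where "g t e = (ind {x. t powr (1 / sg + ep / 2) < x .* e} :: real ^ 'n => complex)" for t e
 have bg: "bm (g t e)" for t e unfolding g_def by (intro bm_indicator half_space_borel)
 have lim: "((%t. \<Sum>k\<in>(UNIV :: 'n set). norm (mul (g t (axis k 1)) (v t)) + norm (mul (g t (- axis k 1)) (v t))) ---> (\<Sum>k\<in>(UNIV :: 'n set). 0 + 0)) at_top"
  unfolding g_def v_def using ep by (intro tendsto_sum tendsto_add sub_ballistic) auto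
 have "EV t. norm (mul (%x. 1 - ind {x. norm x <= t powr (1 / sg + ep)} x) (v t))
   <= (\<Sum>k\<in>(UNIV :: 'n set). norm (mul (g t (axis k 1)) (v t)) + norm (mul (g t (- axis k 1)) (v t)))"
  using eventually_le_powr[OF half_gt_zero[OF ep], of "real CARD('n)"]
 proof eventually_elim
  case (elim t)
  let ?G = "%x. \<Sum>k\<in>UNIV. (g t (axis k 1) x + g t (- axis k 1) x)"
  have cover: "cmod (1 - ind {x. norm x <= t powr (1 / sg + ep)} x) <= cmod (?G x)" for x :: "real ^ 'n"
  proof (cases "norm x <= t powr (1 / sg + ep)")
   case False
   define r where "r = t powr (1 / sg + ep / 2)"
   have "EX k. r < abs (x $ k)"
   proof (rule ccontr)
    assume "\<not> ?thesis"
    then have "(\<Sum>k\<in>UNIV. (abs (x $ k))) <= (\<Sum>k\<in>(UNIV :: 'n set). r)" by (intro sum_mono) (auto simp: not_less)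
    then have "norm x <= real CARD('n) * r" using norm_le_l1_cart[of x] by simp
    also have "... <= t powr (ep / 2) * r" using elim by (intro mult_right_mono) (auto simp: r_def)
    also have "... = t powr (1 / sg + ep)" by (simp add: r_def powr_add[symmetric] add.commute)
    finally show False using False by simp
   qed
   then obtain k where k: "r < abs (x $ k)" ..
   define G where "G k = (if r < x $ k then 1 else 0) + (if r < - x $ k then 1 else (0 :: real))" for k
   have "1 <= G k" using k by (auto simp: G_def)
   also have "... <= (\<Sum>k\<in>UNIV. G k)" by (rule member_le_sum) (auto simp: G_def)
   finally have "1 <= abs (\<Sum>k\<in>UNIV. G k)" by simp
   moreover have "?G x = of_real (\<Sum>k\<in>UNIV. G k)" by (auto simp: g_def G_def r_def inner_axis indicator_def intro!: sum.cong)
   ultimately show ?thesis using False by (simp only: norm_of_real) simp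
  qed simp
  have bG: "bm ?G"
  proof -
   have "bm (%x. \<Sum>k\<in>J. (g t (axis k 1) x + g t (- axis k 1) x))" if "finite J" for J using that by (induction J) (auto intro!: bm_add bg)
   then show ?thesis by simp
  qed
  have "norm (mul (%x. 1 - ind {x. norm x <= t powr (1 / sg + ep)} x) (v t)) <= norm (mul ?G (v t))"
   by (intro norm_mul_mono bG bm_diff bm_const bm_indicator ball_borel cover)
  also have "... <= (\<Sum>k\<in>(UNIV :: 'n set). norm (mul (%x. g t (axis k 1) x + g t (- axis k 1) x) (v t)))"
   by (intro norm_mul_sum_le bm_add bg) simp
  also have "... <= (\<Sum>k\<in>(UNIV :: 'n set). norm (mul (g t (axis k 1)) (v t)) + norm (mul (g t (- axis k 1)) (v t)))"
   unfolding mul_add_left[OF bg bg, symmetric] by (intro sum_mono norm_triangle_ineq)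
  finally show ?case .
 qed
 from norm_null_comparison[OF this] lim show ?thesis unfolding v_def by simp
qed

text \<open>The remainder must not depend on the tolerance in the exponent, so the tolerance has to
  shrink with time, slowly enough for each estimate to have become effective: \<open>ka t\<close> is
  the largest index whose estimate holds from time \<open>t\<close> on.\<close>

lemma diagonal_limit:
 fixes f :: "nat => real => real"
 assumes "!!k. null (f k)"
 shows "EX ka. filterlim ka at_top at_top & null (%t. f (ka t) t)"
proof -
 have "EX T. ALL t>=T. abs (f k t) < inverse (real (Suc k))" for k
  using tendstoD[OF assms[of k], of "inverse (real (Suc k))"] by (auto simp: eventually_at_top_linorder dist_real_def)
 then obtain T where T: "!!k t. T k <= t ==> abs (f k t) < inverse (real (Suc k))" by metis
 \<comment> \<open>The constraint \<open>real k <= t\<close> keeps the set finite, so that its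
   maximum exists.\<close>
 define S where "S t = {k. real k <= t & T k <= t}" for t
 have fin: "finite (S t)" for t by (rule finite_subset[of _ "{..nat \<lfloor>t\<rfloor>}"]) (auto simp: S_def le_nat_floor)
 define ka where "ka t = Max (S t)" for t
 have ge: "k <= ka t" if "real k <= t" "T k <= t" for k t unfolding ka_def using that by (intro Max_ge fin) (simp add: S_def)
 have top: "filterlim ka at_top at_top" unfolding filterlim_at_top
 proof
  show "EV t. k <= ka t" for k using eventually_ge_at_top[of "max (real k) (T k)"] by eventually_elim (auto intro: ge)
 qed
 have "(%k. inverse (real (Suc k))) ----> 0" by (rule LIMSEQ_inverse_real_of_nat)
 from filterlim_compose[OF this top] have lim: "null (%t. inverse (real (Suc (ka t))))" .
 have "EV t. norm (f (ka t) t) <= inverse (real (Suc (ka t)))" using eventually_ge_at_top[of "max 0 (T 0)"]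
 proof eventually_elim
  case (elim t)
  then have "S t ~= {}" by (auto simp: S_def intro!: exI[of _ 0])
  then have "ka t : S t" unfolding ka_def using fin by (rule Max_in[rotated])
  then show ?case using T[of "ka t" t] by (simp add: S_def)
 qed
 then have "null (%t. f (ka t) t)" by (rule Lim_null_comparison) (rule lim)
 then show ?thesis using top by blast
qed

lemma state_of_Zc: "EX w:energy_space. Zc 1 w = X & Zc (-1) w = Y"
proof -
 obtain w where w: "w : energy_space" "Pc w = (1/2) *r (X + Y)" "Vc w = mul (%_. - \<i> / 2) (X - Y)" using state_exists by blast
 have i: "mul (%_. \<i> * of_real s) (Vc w) = (s / 2) *r (X - Y)" for s
 proof -
  have e: "\<i> * of_real s * (- \<i> / 2) = cor (s / 2)" by (simp add: complex_eq_iff)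
  show ?thesis unfolding w mul_mul[OF bm_const bm_const] e mul_of_real ..
 qed
 have "Zc 1 w = (1/2) *r ((X + Y) + (X - Y))" "Zc (-1) w = (1/2) *r ((X + Y) - (X - Y))"
  unfolding Zc_def i w(2) by (simp_all add: scaleR_add_right scaleR_diff_right)
 then have "Zc 1 w = X" "Zc (-1) w = Y" by (simp_all add: scaleR_2[symmetric] del: scaleR_2)
 then show ?thesis using w(1) by blast
qed

lemma smooth_cutoff_measurable: "smooth_cutoff F ==> meas F"
 by (intro borel_measurable_continuous_onI continuous_at_imp_continuous_on) (auto intro: DERIV_isCont dest: smooth_cutoffD(1))

lemma bm_cutoff:
 assumes F: "smooth_cutoff F" and m: "meas f"
 shows "bm (%x. cor (F (f x)))" "bm (%x. cor (1 - F (f x)))"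
proof -
 obtain C where C: "!!x. abs (F x) <= C" using smooth_cutoff_bounded[OF F] by blast
 have "meas (%x. F (f x))" using measurable_compose[OF m smooth_cutoff_measurable[OF F]] .
 then show 1: "bm (%x. cor (F (f x)))" using C by (intro bmI[of _ C]) auto
 show "bm (%x. cor (1 - F (f x)))" using bm_diff[OF bm_const[of 1] 1] by simp
qed

context
 fixes Fc F1 :: "real => real"
 assumes Fc: "smooth_cutoff Fc" and F1: "smooth_cutoff F1"
begin

definition FL :: "real => real => real => 'n::finite l2 => 'n l2" where
 "FL \<alpha> \<beta> t X = mul (%x. of_real (1 - Fc (norm x / t powr \<alpha>))) (Mop (%xi. of_real (F1 (t powr \<beta> * norm xi)))
   (Mop (%xi. of_real (1 - F1 (norm xi / t powr \<beta>))) X))"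

lemma bm_FL: "bm (%x :: real ^ 'n::finite. cor (1 - Fc (norm x / t powr \<alpha>)))"
 "bm (%xi :: real ^ 'n. cor (F1 (t powr \<beta> * norm xi)))"
 "bm (%xi :: real ^ 'n. cor (1 - F1 (norm xi / t powr \<beta>)))" by (rule bm_cutoff(2)[OF Fc] bm_cutoff(1)[OF F1] bm_cutoff(2)[OF F1]; measurable)+

lemma F_loc_l2:
 assumes "f : L2" shows "F_loc Fc F1 \<alpha> \<beta> t f : L2" "cls (F_loc Fc F1 \<alpha> \<beta> t f) = FL \<alpha> \<beta> t (cls f)"
proof -
 note a = fourier_mult_bm[OF assms bm_FL(3)[of t \<beta>]]
 note b = fourier_mult_bm[OF a(1) bm_FL(2)[of t \<beta>]]
 show "F_loc Fc F1 \<alpha> \<beta> t f : L2" unfolding F_loc_def pos_mult_def[abs_def] by (rule L2_bm[OF bm_FL(1) b(1)])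
 show "cls (F_loc Fc F1 \<alpha> \<beta> t f) = FL \<alpha> \<beta> t (cls f)"
  unfolding F_loc_def pos_mult_def[abs_def] cls_mul[OF b(1) bm_FL(1), symmetric] b(2) a(2) FL_def ..
qed

lemma F_mat_l2:
 assumes w: "w : energy_space"
 shows "F_mat Fc F1 \<alpha> \<beta> t w : energy_space" "Zc s (F_mat Fc F1 \<alpha> \<beta> t w) = FL \<alpha> \<beta> t (Zc s w)"
proof -
 note a = F_loc_l2[OF H1_jp(2)[OF energy_spaceD(1)[OF w]], of \<alpha> \<beta> t] and b = F_loc_l2[OF energy_spaceD(2)[OF w], of \<alpha> \<beta> t]
 show "F_mat Fc F1 \<alpha> \<beta> t w : energy_space" unfolding F_mat_def using a b by (intro energy_spaceI) (auto intro: jp_inv_H1)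
 have P: "Pc (F_mat Fc F1 \<alpha> \<beta> t w) = FL \<alpha> \<beta> t (Pc w)" "Vc (F_mat Fc F1 \<alpha> \<beta> t w) = FL \<alpha> \<beta> t (Vc w)"
  using jp_inv_H1(2)[OF a(1)] a(2) b(2) by (simp_all add: F_mat_def Pc_def Vc_def)
 have Mc: "Mop m (mul (%_. c) X) = mul (%_. c) (Mop m X)" if "bm m" for m c and X :: "'a l2"
  using Mop_commute[OF that bm_const, of c X] by (simp add: Mop_const)
 have c: "FL \<alpha> \<beta> t (mul (%_. c) X) = mul (%_. c) (FL \<alpha> \<beta> t X)" for c and X :: "'a l2"
  unfolding FL_def Mc[OF bm_FL(3)] Mc[OF bm_FL(2)] mul_commute[OF bm_FL(1) bm_const] ..
 show "Zc s (F_mat Fc F1 \<alpha> \<beta> t w) = FL \<alpha> \<beta> t (Zc s w)" unfolding Zc_def P c[symmetric] by (simp add: FL_def Mop_add mul_add)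
qed

lemma FL_diff: "FL \<alpha> \<beta> t (X - Y) = FL \<alpha> \<beta> t X - FL \<alpha> \<beta> t Y" by (simp add: FL_def Mop_diff mul_diff)

text \<open>All three cut-offs tend to 1 pointwise, the low-frequency one off the origin, which is a
  null set; uniform boundedness turns this into strong convergence.\<close>

lemma FL_tendsto:
 fixes X :: "'n::finite l2"
 assumes ab: "0 < \<alpha>" "0 < \<beta>"
 shows "((%t. FL \<alpha> \<beta> t X) ---> X) at_top"
proof (rule tendsto_at_topI_sequentially)
 fix r :: "nat => real" assume r: "filterlim r at_top sequentially"
 obtain C1 where C1: "1 <= C1" "!!x. abs (F1 x) <= C1 & abs (deriv F1 x) <= C1" using smooth_cutoff_bounded[OF F1] by blast
 obtain C0 where C0: "1 <= C0" "!!x. abs (Fc x) <= C0 & abs (deriv Fc x) <= C0" using smooth_cutoff_bounded[OF Fc] by blast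
 define C where "C = 1 + C0 + C1"
 define A where "A k = (%x :: real ^ 'n. cor (1 - Fc (norm x / r k powr \<alpha>)))" for k
 define F where "F k = (%xi :: real ^ 'n. cor (F1 (r k powr \<beta> * norm xi)))" for k
 define G where "G k = (%xi :: real ^ 'n. cor (1 - F1 (norm xi / r k powr \<beta>)))" for k
 have m: "meas (A k)" "meas (F k)" "meas (G k)" for k unfolding A_def F_def G_def by (intro bm_measurable bm_FL)+
 have cb: "cmod (A k x) <= C" "cmod (F k x) <= C" "cmod (G k x) <= C" "cmod 1 <= C" for k x
  using C0(1) C0(2)[of "norm x / r k powr \<alpha>"] C1(1) C1(2)[of "r k powr \<beta> * norm x"] C1(2)[of "norm x / r k powr \<beta>"]
  unfolding A_def F_def G_def C_def norm_of_real by auto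
 have large: "\<forall>\<^sub>F k in sequentially. c <= r k powr q" if "0 < q" for c q
  using filterlim_compose[of "%t. t powr q" at_top at_top r] r eventually_le_powr[OF that] by (auto simp: filterlim_at_top)
 have low: "\<forall>\<^sub>F k in sequentially. FF (norm x / r k powr q) = 0" if "0 < q" "smooth_cutoff FF" for FF q and x :: "real ^ 'n"
  using large[OF that(1), of "2 * norm x + 1"]
 proof eventually_elim
  case (elim k)
  have "0 < r k powr q" using elim norm_ge_zero[of x] by linarith
  then have "norm x / r k powr q < 1 / 2" using elim by (simp add: divide_less_eq)
  then show ?case by (rule smooth_cutoffD(4)[OF that(2)])
 qed
 have A1: "(%k. mul (A k) X) ----> mul (%_. 1) X"
 proof (rule mul_tendsto[OF m(1) cb(1)])
  show "AE x in (lborel :: (real ^ 'n) measure). (%k. A k x) ----> 1"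
  proof (intro AE_I2)
   fix x
   have "\<forall>\<^sub>F k in sequentially. A k x = 1" using low[OF ab(1) Fc, of x] by eventually_elim (simp add: A_def)
   then show "(%k. A k x) ----> 1" by (rule tendsto_eventually)
  qed
 qed (use cb(4) in auto)
 have G1: "(%k. Mop (G k) X) ----> Mop (%_. 1) X"
 proof (rule Mop_tendsto[OF m(3) cb(3)])
  show "AE x in (lborel :: (real ^ 'n) measure). (%k. G k x) ----> 1"
  proof (intro AE_I2)
   fix x
   have "\<forall>\<^sub>F k in sequentially. G k x = 1" using low[OF ab(2) F1, of x] by eventually_elim (simp add: G_def)
   then show "(%k. G k x) ----> 1" by (rule tendsto_eventually)
  qed
 qed (use cb(4) in auto)
 have F1': "(%k. Mop (F k) X) ----> Mop (%_. 1) X"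
 proof (rule Mop_tendsto[OF m(2) cb(2)])
  show "AE x in (lborel :: (real ^ 'n) measure). (%k. F k x) ----> 1" using AE_lborel_singleton[of 0]
  proof eventually_elim
   case (elim x)
   have "\<forall>\<^sub>F k in sequentially. F k x = 1" using large[OF ab(2), of "1 / norm x"]
   proof eventually_elim
    case (elim k)
    then have "1 <= r k powr \<beta> * norm x" using \<open>x ~= 0\<close> by (simp add: divide_le_eq)
    then show ?case using smooth_cutoffD(3)[OF F1] by (simp add: F_def)
   qed
   then show ?case by (rule tendsto_eventually)
  qed
 qed (use cb(4) in auto)
 have C: "0 <= C" using C0 C1 by (simp add: C_def)
 have "norm (FL \<alpha> \<beta> (r k) X - X) <= C * (C * norm (Mop (G k) X - X) + norm (Mop (F k) X - X)) + norm (mul (A k) X - X)" for k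
 proof -
  have eq: "FL \<alpha> \<beta> (r k) X - X = mul (A k) (Mop (F k) (Mop (G k) X - X) + (Mop (F k) X - X)) + (mul (A k) X - X)"
   by (simp add: FL_def A_def F_def G_def mul_add mul_diff Mop_diff)
  have "norm (mul (A k) (Mop (F k) (Mop (G k) X - X) + (Mop (F k) X - X))) <= C * norm (Mop (F k) (Mop (G k) X - X) + (Mop (F k) X - X))"
   by (rule norm_mul_le[OF m(1) cb(1)])
  also have "... <= C * (C * norm (Mop (G k) X - X) + norm (Mop (F k) X - X))"
   by (intro mult_left_mono C order_trans[OF norm_triangle_ineq] add_right_mono norm_Mop_le[OF m(2) cb(2)])
  finally show ?thesis unfolding eq by (rule order_trans[OF norm_triangle_ineq add_right_mono])
 qed
 then have ev: "\<forall>\<^sub>F k in sequentially. norm (FL \<alpha> \<beta> (r k) X - X) <= C * (C * norm (Mop (G k) X - X) + norm (Mop (F k) X - X)) + norm (mul (A k) X - X)"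
  by (intro always_eventually allI)
 have lim: "(%k. C * (C * norm (Mop (G k) X - X) + norm (Mop (F k) X - X)) + norm (mul (A k) X - X)) ----> C * (C * norm (X - X) + norm (X - X)) + norm (X - X)"
  using A1 F1' G1 by (intro tendsto_intros) auto
 have "(%k. FL \<alpha> \<beta> (r k) X - X) ----> 0" by (rule Lim_null_comparison[OF ev]) (use lim in simp)
 then show "(%k. FL \<alpha> \<beta> (r k) X) ----> X" by (rule LIM_zero_cancel)
qed

text \<open>Let \<open>m\<close> be the upper limit \<open>(min sg 2 - 1) / min sg 2\<close>. If
  \<beta> is below \<open>m\<close>, any \<open>b\<close> strictly between \<beta> and the minimum
  of \<open>m\<close> and \<open>1 - \<alpha>\<close> works. Otherwise the bound on \<beta> forces
  \<open>m = 1/2\<close>, so that \<alpha> is less than \<open>1 - \<beta>\<close>, which is at most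
  1/2, and \<open>b\<close> is taken between these two.\<close>

lemma channel_exponent:
 assumes "(\<alpha>, \<beta>) : I_loc sg" "1 < sg"
 shows "EX b. 0 < b & b < 1/2 & b < (min sg 2 - 1) / min sg 2 & \<alpha> < 1 - b & \<beta> < 1 - b & (\<beta> < b \<or> \<alpha> < b)"
proof -
 have I: "0 < \<alpha>" "0 < \<beta>" "\<beta> < 1 - \<alpha>" "\<beta> < (sg - 1) / sg" using assms(1) by (auto simp: I_loc_def)
 define m where "m = (min sg 2 - 1) / min sg 2"
 have m: "m = (if sg <= 2 then (sg - 1) / sg else 1/2)" by (auto simp: m_def)
 have m2: "m <= 1/2" using assms(2) by (auto simp: m divide_le_eq)
 show ?thesis proof (cases "\<beta> < m")
  case True
  obtain b where b: "\<beta> < b" "b < min m (1 - \<alpha>)" using dense[of \<beta> "min m (1 - \<alpha>)"] True I by auto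
  then show ?thesis using I m2 by (intro exI[of _ b]) (auto simp: m_def[symmetric])
 next
  case False
  then have h: "m = 1/2" using I(4) by (auto simp: m split: if_splits)
  then have "\<alpha> < 1 - \<beta>" "1 - \<beta> <= 1/2" using False I by auto
  then obtain b where b: "\<alpha> < b" "b < 1 - \<beta>" using dense by blast
  then show ?thesis using I h \<open>1 - \<beta> <= 1/2\<close> by (intro exI[of _ b]) (auto simp: m_def[symmetric])
 qed
qed

end

lemma localized_weight:
 fixes f :: "'n::finite scalar_field"
 assumes f: "f : L2" "chi {x. norm x <= r} (cls f) = cls f" and c: "!!x :: real ^ 'n. norm x <= r ==> jb x powr M <= c" and c0: "0 <= c"
 shows "pos_mult (%x. jb x powr M) f : L2" "norm (cls (pos_mult (%x. jb x powr M) f)) <= c * norm (cls f)"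
proof -
 let ?I = "ind {x :: real ^ 'n. norm x <= r} :: _ => complex"
 let ?m = "%x. ?I x * of_real (jb x powr M)"
 have bI: "bm ?I" by (intro bm_indicator ball_borel)
 have mb: "cmod (?m x) <= c" for x using c[of x] c0 by (auto simp: indicator_def)
 have mm: "meas ?m" using bm_measurable[OF bI] by measurable
 have bm: "bm ?m" by (rule bmI[OF mm mb])
 have "cls (%x. ?I x * f x) = cls f" using f(2) unfolding cls_mul[OF f(1) bI] .
 then have ae: "AE x in lborel. ?I x * f x = f x" using cls_eq_iff[OF L2_bm[OF bI f(1)] f(1)] by simp
 have ae: "AE x in lborel. pos_mult (%x. jb x powr M) f x = ?m x * f x"
  using ae by eventually_elim (simp add: pos_mult_def mult.assoc mult.left_commute)
 have "meas f" using L2_D(1)[OF f(1)] .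
 then have "pos_mult (%x. jb x powr M) f : borel_measurable borel" unfolding pos_mult_def[abs_def] by measurable
 note L = L2_AE[OF L2_bm[OF bm f(1)] this ae]
 show "pos_mult (%x. jb x powr M) f : L2" by (rule L)
 show "norm (cls (pos_mult (%x. jb x powr M) f)) <= c * norm (cls f)" unfolding L(2) cls_mul[OF f(1) bm, symmetric] by (rule norm_mul_le[OF mm mb])
qed

lemma weighted_energy:
 assumes w: "w : energy_space" and loc: "chi {x. norm x <= r} (Pc w) = Pc w" "chi {x. norm x <= r} (Vc w) = Vc w"
  and c: "!!x :: real ^ 'n::finite. norm x <= r ==> jb x powr M <= c" "0 <= c"
 shows "(w :: 'n state) : X_dom M" "cmod (H_inner w (X_pow M w)) <= c * (H_norm w)^2"
proof -
 note P = localized_weight[OF H1_jp(2)[OF energy_spaceD(1)[OF w]] loc(1)[unfolded Pc_def] c]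
  and V = localized_weight[OF energy_spaceD(2)[OF w] loc(2)[unfolded Vc_def] c]
 show "w : X_dom M" using w P(1) V(1) by (simp add: X_dom_def)
 note J = jp_inv_H1[OF P(1)]
 have X: "X_pow M w : energy_space" unfolding X_pow_def using J(1) V(1) by (intro energy_spaceI) auto
 have n: "norm (Pc (X_pow M w)) <= c * norm (Pc w)" "norm (Vc (X_pow M w)) <= c * norm (Vc w)"
  using P(2) V(2) J(2) by (simp_all add: X_pow_def Pc_def Vc_def)
 have "cmod (H_inner w (X_pow M w)) <= norm (Pc w) * norm (Pc (X_pow M w)) + norm (Vc w) * norm (Vc (X_pow M w))"
  unfolding H_inner_l2[OF w X] by (intro order_trans[OF norm_triangle_ineq] add_mono cinner_norm_le)
 also have "... <= norm (Pc w) * (c * norm (Pc w)) + norm (Vc w) * (c * norm (Vc w))" by (intro add_mono mult_left_mono n) auto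
 also have "... = c * (H_norm w)^2" unfolding H_norm_l2[OF w] by (simp add: power2_eq_square algebra_simps)
 finally show "cmod (H_inner w (X_pow M w)) <= c * (H_norm w)^2" .
qed

text \<open>The two half waves are treated as separate orbits, and their weak limits are the half
  waves of one state \<open>w0\<close>. Local decay of \<open>Om s t\<close> minus its limit,
  together with the strong convergence of the cut-offs to the identity, makes \<open>w0\<close> the
  free channel for all admissible exponents at once.\<close>

lemma kg_main:
 fixes N :: "'n::finite interaction" and u :: "real => 'n state"
 assumes Fc: "smooth_cutoff Fc" and F1: "smooth_cutoff F1" and sg0: "1 < sg0" and kg: "kg N u (min sg0 2) K E"
 shows "EX \<omega>:energy_space. (ALL (\<alpha>, \<beta>):I_loc sg0. is_free_channel Fc F1 \<alpha> \<beta> u \<omega>) &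
  (EX w :: real => 'n state. (ALL t>=0. w t : energy_space) & null (%t. H_norm (u t - U0 t \<omega> - w t)) &
    (ALL ep:{0<..<1/2}. EV t. ALL M>=0. w t : X_dom M &
     cmod (H_inner (w t) (X_pow M (w t))) <= (64 * E^2 + 1) * max (t powr (M * (1/2 + ep))) (t powr (M * (1/sg0 + ep)))))"
proof -
 define sg where "sg = min sg0 2"
 interpret kg N u sg K E unfolding sg_def by (rule kg)
 interpret p: orbit "Om 1" 1 "2 * E" K sg by (rule orbit_Om) simp
 interpret m: orbit "Om (-1)" "-1" "2 * E" K sg by (rule orbit_Om) simp
 obtain w0 where w0: "w0 : energy_space" "Zc 1 w0 = p.omega" "Zc (-1) w0 = m.omega" using state_of_Zc by blast
 have OmU: "Zc s (U0 (- t) (u t)) = Om s t" if "0 <= t" "s = 1 \<or> s = -1" for s t unfolding Zc_U0[OF u_in[OF that(1)] that(2)] Om_def by simp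
 have channel: "is_free_channel Fc F1 \<alpha> \<beta> u w0" if I: "(\<alpha>, \<beta>) : I_loc sg0" for \<alpha> \<beta>
  unfolding is_free_channel_def
 proof (intro conjI w0)
  obtain b where b: "0 < b" "b < 1/2" "b < (sg - 1) / sg" "\<alpha> < 1 - b" "\<beta> < 1 - b" "\<beta> < b \<or> \<alpha> < b"
   using channel_exponent[OF Fc F1 I sg0] unfolding sg_def by blast
  have ab: "0 < \<alpha>" "0 < \<beta>" using I by (auto simp: I_loc_def)
  have 1: "null (%t. norm (FL Fc F1 \<alpha> \<beta> t (Om 1 t - p.omega)))"
   using p.local_decay[OF ab(1) b(4) b(1-3) Fc F1 ab(2) b(5,6)] unfolding FL_def[OF Fc F1] p.y_def[OF ab(1) b(4) b(1-3)] .
  have 2: "null (%t. norm (FL Fc F1 \<alpha> \<beta> t (Om (-1) t - m.omega)))"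
   using m.local_decay[OF ab(1) b(4) b(1-3) Fc F1 ab(2) b(5,6)] unfolding FL_def[OF Fc F1] m.y_def[OF ab(1) b(4) b(1-3)] .
  have 3: "null (%t. norm (FL Fc F1 \<alpha> \<beta> t X - X))" for X :: "'n l2" by (rule tendsto_norm_zero[OF LIM_zero[OF FL_tendsto[OF Fc F1 ab]]])
  have lim: "((%t. (norm (FL Fc F1 \<alpha> \<beta> t (Om 1 t - p.omega)) + norm (FL Fc F1 \<alpha> \<beta> t p.omega - p.omega))
   + (norm (FL Fc F1 \<alpha> \<beta> t (Om (-1) t - m.omega)) + norm (FL Fc F1 \<alpha> \<beta> t m.omega - m.omega))) ---> (0 + 0) + (0 + 0)) at_top"
   by (intro tendsto_add 1 2 3)
  have "EV t. norm (H_norm (F_mat Fc F1 \<alpha> \<beta> t (U0 (- t) (u t)) - w0))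
   <= (norm (FL Fc F1 \<alpha> \<beta> t (Om 1 t - p.omega)) + norm (FL Fc F1 \<alpha> \<beta> t p.omega - p.omega))
   + (norm (FL Fc F1 \<alpha> \<beta> t (Om (-1) t - m.omega)) + norm (FL Fc F1 \<alpha> \<beta> t m.omega - m.omega))"
   using eventually_ge_at_top[of 0]
  proof eventually_elim
   case (elim t)
   have in1: "U0 (- t) (u t) : energy_space" by (rule U0_l2[OF u_in[OF elim]])
   note Fin = F_mat_l2[OF Fc F1 in1, where \<alpha> = \<alpha> and \<beta> = \<beta> and t = t]
   have z: "norm (Zc s (F_mat Fc F1 \<alpha> \<beta> t (U0 (- t) (u t)) - w0))
    <= norm (FL Fc F1 \<alpha> \<beta> t (Om s t - Zc s w0)) + norm (FL Fc F1 \<alpha> \<beta> t (Zc s w0) - Zc s w0)" if "s = 1 \<or> s = -1" for s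
   proof -
    have "Zc s (F_mat Fc F1 \<alpha> \<beta> t (U0 (- t) (u t)) - w0) = FL Fc F1 \<alpha> \<beta> t (Om s t - Zc s w0) + (FL Fc F1 \<alpha> \<beta> t (Zc s w0) - Zc s w0)"
     unfolding Zc_diff[OF Fin(1) w0(1)] Fin(2) OmU[OF elim that] FL_diff[OF Fc F1] by simp
    then show ?thesis by (simp only: norm_triangle_ineq)
   qed
   have "H_norm (F_mat Fc F1 \<alpha> \<beta> t (U0 (- t) (u t)) - w0)
    <= norm (Zc 1 (F_mat Fc F1 \<alpha> \<beta> t (U0 (- t) (u t)) - w0)) + norm (Zc (-1) (F_mat Fc F1 \<alpha> \<beta> t (U0 (- t) (u t)) - w0))"
    by (rule H_norm_le_Zc[OF state_diff(1)[OF Fin(1) w0(1)]])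
   moreover have "0 <= H_norm (F_mat Fc F1 \<alpha> \<beta> t (U0 (- t) (u t)) - w0)" unfolding H_norm_l2[OF state_diff(1)[OF Fin(1) w0(1)]] by simp
   ultimately show ?case using z[of 1] z[of "-1"] by (simp add: w0)
  qed
  then show "null (%t. H_norm (F_mat Fc F1 \<alpha> \<beta> t (U0 (- t) (u t)) - w0))" by (rule Lim_null_comparison) (use lim in simp)
 qed
 define D where "D t = u t - U0 t w0" for t
 define v where "v s t = U (s * t) (Om s t - Zc s w0)" for s t
 have D: "D t : energy_space" "s = 1 \<or> s = -1 ==> Zc s (D t) = v s t" if t: "0 <= t" for s t
 proof -
  note U0w = U0_l2(1)[OF w0(1), of t]
  show "D t : energy_space" unfolding D_def by (rule state_diff(1)[OF u_in[OF t] U0w])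
  show "Zc s (D t) = v s t" if "s = 1 \<or> s = -1" unfolding D_def v_def Zc_diff[OF u_in[OF t] U0w] Zc_U0[OF w0(1) that] Om_def U_diff U_U by simp
 qed
 have nv: "norm (v s t) <= 4 * E" if "0 <= t" "s = 1 \<or> s = -1" for s t
  using that(2) norm_triangle_ineq4[of "Om s t" "Zc s w0"] p.Om_bounded[OF that(1)] m.Om_bounded[OF that(1)] p.omega(1) m.omega(1)
  by (auto simp: v_def norm_U w0)
 \<comment> \<open>The tolerances \<open>1 / real (Suc k)\<close> are fed to
   \<open>diagonal_limit\<close>; the resulting radius \<open>r t\<close> works eventually for every
   fixed tolerance.\<close>
 define f where "f k t = norm (mul (%x. 1 - ind {x. norm x <= t powr (1 / sg + 1 / real (Suc k))} x) (v 1 t))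
   + norm (mul (%x. 1 - ind {x. norm x <= t powr (1 / sg + 1 / real (Suc k))} x) (v (-1) t))" for k t
 have "(f k ---> 0 + 0) at_top" for k unfolding f_def v_def w0 by (intro tendsto_add p.sub_ballistic_norm m.sub_ballistic_norm) auto
 then obtain ka where ka: "filterlim ka at_top at_top" "null (%t. f (ka t) t)" using diagonal_limit[of f] by auto
 define r where "r t = t powr (1 / sg + 1 / real (Suc (ka t)))" for t
 define I where "I t = (ind {x :: real ^ 'n. norm x <= r t} :: _ => complex)" for t
 have bI: "bm (I t)" for t unfolding I_def by (intro bm_indicator ball_borel)
 have II: "mul (I t) (mul (I t) X) = mul (I t) X" for t X unfolding I_def by (rule mul_indicator_idem[OF ball_borel])
 \<comment> \<open>The remainder is the difference \<open>D t\<close> truncated in space, not in the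
   field itself but in the coordinates \<open>Pc\<close> and \<open>Vc\<close>, in which the weight
   acts as a multiplication and the truncation commutes with the passage to half waves.\<close>
 have "EX w:energy_space. Pc w = mul (I t) (Pc (D t)) & Vc w = mul (I t) (Vc (D t))" for t by (rule state_exists)
 then obtain w where w: "!!t. w t : energy_space" "!!t. Pc (w t) = mul (I t) (Pc (D t))" "!!t. Vc (w t) = mul (I t) (Vc (D t))" by metis
 have Zw: "Zc s (w t) = mul (I t) (Zc s (D t))" for s t unfolding Zc_def w mul_add mul_commute[OF bI bm_const] ..
 have conv: "null (%t. H_norm (u t - U0 t w0 - w t))"
 proof (rule Lim_null_comparison[OF _ ka(2)])
  show "EV t. norm (H_norm (u t - U0 t w0 - w t)) <= f (ka t) t" using eventually_ge_at_top[of 0]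
  proof eventually_elim
   case (elim t)
   note Dw = state_diff(1)[OF D(1)[OF elim] w(1), of t]
   have "Zc s (D t - w t) = mul (%x. 1 - I t x) (v s t)" if "s = 1 \<or> s = -1" for s
    unfolding Zc_diff[OF D(1)[OF elim] w(1)] Zw D(2)[OF elim that] using mul_diff_left[OF bm_const[of 1] bI[of t], of "v s t"] by simp
   then have "f (ka t) t = norm (Zc 1 (D t - w t)) + norm (Zc (-1) (D t - w t))" by (simp add: f_def I_def r_def)
   then show ?case using H_norm_le_Zc[OF Dw] H_norm_l2[OF Dw] by (simp add: D_def)
  qed
 qed
 have "EV t. ALL M>=0. w t : X_dom M &
   cmod (H_inner (w t) (X_pow M (w t))) <= (64 * E^2 + 1) * max (t powr (M * (1/2 + ep))) (t powr (M * (1/sg0 + ep)))" if ep: "ep : {0<..<1/2}" for ep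
 proof -
  have ep0: "0 < ep" using ep by simp
  \<comment> \<open>Half of \<open>ep\<close> dominates the current tolerance, the other half
    absorbs the factor 2 in passing from \<open>norm x\<close> to \<open>jb x\<close>.\<close>
  obtain k where k: "inverse (real (Suc k)) < ep / 2" using reals_Archimedean[of "ep / 2"] ep0 by auto
  have "EV t. k <= ka t" using ka(1) by (simp add: filterlim_at_top)
  then show ?thesis using eventually_ge_at_top[of 1] eventually_le_powr[OF half_gt_zero[OF ep0], of 2]
  proof eventually_elim
   case (elim t)
   have t: "0 <= t" "1 <= t" using elim by auto
   have s: "0 < 1 / sg" using sg by simp
   have "1 / real (Suc (ka t)) <= 1 / real (Suc k)" using elim(1) by (intro divide_left_mono) auto
   then have "1 / real (Suc (ka t)) <= ep / 2" using k by (simp add: inverse_eq_divide)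
   then have r1: "r t <= t powr (1 / sg + ep / 2)" unfolding r_def using t by (intro powr_mono) auto
   have r2: "1 <= t powr (1 / sg + ep / 2)" using t s ep0 by (intro ge_one_powr_ge_zero) auto
   have jb: "jb x <= t powr (1 / sg + ep)" if "norm x <= r t" for x :: "real ^ 'n"
   proof -
    have "jb x <= 1 + norm x" using japanese_le[of x "norm x"] by simp
    also have "... <= 2 * t powr (1 / sg + ep / 2)" using that r1 r2 by linarith
    also have "... <= t powr (ep / 2) * t powr (1 / sg + ep / 2)" using elim by (intro mult_right_mono) auto
    also have "... = t powr (1 / sg + ep)" by (simp add: powr_add[symmetric] add.commute)
    finally show ?thesis .
   qed
   have Hw: "(H_norm (w t))^2 <= 64 * E^2"
   proof -
    \<comment> \<open>Each half wave of the difference is at most \<open>2 * E + 2 * E\<close>; two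
      half waves give \<open>8 * E\<close>, whose square is the 64 in the constant.\<close>
    have "norm (Zc s (w t)) <= 4 * E" if "s = 1 \<or> s = -1" for s
    proof -
     have "norm (Zc s (w t)) <= norm (v s t)" unfolding Zw D(2)[OF t(1) that] I_def by (rule norm_mul_indicator_le[OF ball_borel])
     then show ?thesis using nv[OF t(1) that] by linarith
    qed
    from this[of 1] this[of "-1"] have "H_norm (w t) <= 8 * E" using H_norm_le_Zc[OF w(1)[of t]] by simp
    moreover have "0 <= H_norm (w t)" unfolding H_norm_l2[OF w(1)] by simp
    ultimately have "(H_norm (w t))^2 <= (8 * E)^2" by (intro power_mono)
    then show ?thesis by (simp add: power_mult_distrib)
   qed
   show ?case
   proof (intro allI impI)
    fix M :: real assume M: "0 <= M"
    define c where "c = (t powr (1 / sg + ep)) powr M"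
    have c: "jb x powr M <= c" if "norm x <= r t" for x :: "real ^ 'n"
     unfolding c_def using jb[OF that] M japanese_pos[of x] by (intro powr_mono2) auto
    have cm: "c <= max (t powr (M * (1/2 + ep))) (t powr (M * (1/sg0 + ep)))"
    proof -
     have "c = t powr (M * (1 / sg + ep))" by (simp add: c_def powr_powr mult.commute)
     then show ?thesis by (cases "sg0 <= 2") (auto simp: sg_def)
    qed
    have c0: "0 <= c" by (simp add: c_def)
    have loc: "chi {x. norm x <= r t} (Pc (w t)) = Pc (w t)" "chi {x. norm x <= r t} (Vc (w t)) = Vc (w t)" unfolding w I_def[symmetric] II by auto
    have W: "w t : X_dom M" "cmod (H_inner (w t) (X_pow M (w t))) <= c * (H_norm (w t))^2"
     by (rule weighted_energy[OF w(1)[of t] loc]; use c c0 in auto)+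
    have "cmod (H_inner (w t) (X_pow M (w t))) <= c * (64 * E^2 + 1)" using W(2) Hw c0 by (elim order_trans) (intro mult_left_mono, auto)
    also have "... <= max (t powr (M * (1/2 + ep))) (t powr (M * (1/sg0 + ep))) * (64 * E^2 + 1)" using cm by (intro mult_right_mono) auto
    finally show "w t : X_dom M & cmod (H_inner (w t) (X_pow M (w t))) <= (64 * E^2 + 1) * max (t powr (M * (1/2 + ep))) (t powr (M * (1/sg0 + ep)))"
     using W(1) by (simp add: mult.commute)
   qed
  qed
 qed
 then show ?thesis using w0(1) channel w(1) conv by (intro bexI[of _ w0] conjI exI[of _ w]) auto
qed

text \<open>The witness for the constant is \<open>64 * E^2 + 1\<close>, where the summand 1 makes
  it positive even for \<open>E = 0\<close>. The size of the weighted source affects only the time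
  from which the estimates hold.\<close>

theorem theorem1p8:
  fixes Fc F1 :: "real \<Rightarrow> real"
  assumes "smooth_cutoff Fc" and "smooth_cutoff F1"
  shows "\<exists>C :: real \<Rightarrow> real \<Rightarrow> real. (\<forall>E \<epsilon>. C E \<epsilon> > 0) \<and>
    (\<forall>(N :: 'n::finite interaction) (u :: real \<Rightarrow> 'n state) (\<sigma> :: real) (E :: real).
       KG_solution N u \<longrightarrow>
       bdd_above ((\<lambda>t. H_norm (u t)) ` {0..}) \<longrightarrow>
       E = (SUP t\<in>{0..}. H_norm (u t)) \<longrightarrow>
       \<sigma> > 1 \<longrightarrow>
       (\<forall>t\<ge>0. pos_mult (\<lambda>x. japanese x powr \<sigma>) (interaction N u t) \<in> L2) \<longrightarrow>
       bdd_above ((\<lambda>t. L2_norm (pos_mult (\<lambda>x. japanese x powr \<sigma>) (interaction N u t))) ` {0..}) \<longrightarrow>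
       (\<exists>\<omega>\<in>energy_space. (\<forall>(\<alpha>, \<beta>)\<in>I_loc \<sigma>. is_free_channel Fc F1 \<alpha> \<beta> u \<omega>) \<and>
          (\<exists>w :: real \<Rightarrow> 'n state.
             (\<forall>t\<ge>0. w t \<in> energy_space) \<and>
             ((\<lambda>t. H_norm (u t - U0 t \<omega> - w t)) \<longlongrightarrow> 0) at_top \<and>
             (\<forall>\<epsilon>\<in>{0<..<1/2}. \<forall>\<^sub>F t in at_top. \<forall>M\<ge>0.
                w t \<in> X_dom M \<and>
                cmod (H_inner (w t) (X_pow M (w t)))
                  \<le> C E \<epsilon> * max (t powr (M * (1/2 + \<epsilon>))) (t powr (M * (1/\<sigma> + \<epsilon>)))))))"
proof (intro exI[of _ "\<lambda>E \<epsilon>. 64 * E\<^sup>2 + 1"] conjI allI impI)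
  show "0 < 64 * E\<^sup>2 + 1" for E :: real by (simp add: add_nonneg_pos)
  fix N :: "'n interaction" and u :: "real \<Rightarrow> 'n state" and \<sigma> E :: real
  assume sol: "KG_solution N u" and bE: "bdd_above ((\<lambda>t. H_norm (u t)) ` {0..})" and E: "E = (SUP t\<in>{0..}. H_norm (u t))"
    and \<sigma>: "1 < \<sigma>" and g: "\<forall>t\<ge>0. pos_mult (\<lambda>x. japanese x powr \<sigma>) (interaction N u t) \<in> L2"
    and bK: "bdd_above ((\<lambda>t. L2_norm (pos_mult (\<lambda>x. japanese x powr \<sigma>) (interaction N u t))) ` {0..})"
  define K where "K = (SUP t\<in>{0..}. L2_norm (pos_mult (\<lambda>x. japanese x powr \<sigma>) (interaction N u t)))"
  have kg: "kg N u (min \<sigma> 2) K E"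
  proof
    fix t :: real assume t: "0 \<le> t"
    show "H_norm (u t) \<le> E" unfolding E using t by (intro cSUP_upper bE) auto
    let ?g = "pos_mult (\<lambda>x. japanese x powr \<sigma>) (interaction N u t)"
    have gK: "L2_norm ?g \<le> K" unfolding K_def using t by (intro cSUP_upper bK) auto
    have gL: "?g \<in> L2" using g t by blast
    \<comment> \<open>Lowering the weight exponent from \<sigma> to \<open>min \<sigma> 2\<close>
      multiplies the weighted source by \<open>jb x powr - q\<close>, a contraction, so the bound
      \<open>K\<close> is inherited.\<close>
    define q where "q = \<sigma> - min \<sigma> 2"
    have bW: "bm (\<lambda>x :: real ^ 'n. complex_of_real (japanese x powr - q))" by (rule bm_Wt) (simp add: q_def)
    have "japanese x powr min \<sigma> 2 = japanese x powr - q * japanese x powr \<sigma>" for x :: "real ^ 'n"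
      by (simp add: powr_add[symmetric] q_def)
    then have eq: "pos_mult (\<lambda>x. japanese x powr min \<sigma> 2) (interaction N u t) = (\<lambda>x. of_real (japanese x powr - q) * ?g x)"
      by (auto simp: pos_mult_def)
    show L: "pos_mult (\<lambda>x. japanese x powr min \<sigma> 2) (interaction N u t) \<in> L2" unfolding eq by (rule L2_bm[OF bW gL])
    have "L2_norm (pos_mult (\<lambda>x. japanese x powr min \<sigma> 2) (interaction N u t)) = norm (Wt q (cls ?g))"
      unfolding cls_norm[OF L, symmetric] Wt_def cls_mul[OF gL bW] unfolding eq ..
    also have "\<dots> \<le> norm (cls ?g)" by (rule norm_Wt_le) (simp add: q_def)
    also have "\<dots> \<le> K" using gK cls_norm[OF gL] by simp
    finally show "L2_norm (pos_mult (\<lambda>x. japanese x powr min \<sigma> 2) (interaction N u t)) \<le> K" .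
  qed (use sol \<sigma> in auto)
  show "\<exists>\<omega>\<in>energy_space. (\<forall>(\<alpha>, \<beta>)\<in>I_loc \<sigma>. is_free_channel Fc F1 \<alpha> \<beta> u \<omega>) \<and>
          (\<exists>w :: real \<Rightarrow> 'n state.
             (\<forall>t\<ge>0. w t \<in> energy_space) \<and>
             ((\<lambda>t. H_norm (u t - U0 t \<omega> - w t)) \<longlongrightarrow> 0) at_top \<and>
             (\<forall>\<epsilon>\<in>{0<..<1/2}. \<forall>\<^sub>F t in at_top. \<forall>M\<ge>0.
                w t \<in> X_dom M \<and>
                cmod (H_inner (w t) (X_pow M (w t)))
                  \<le> (64 * E\<^sup>2 + 1) * max (t powr (M * (1/2 + \<epsilon>))) (t powr (M * (1/\<sigma> + \<epsilon>)))))"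
    by (rule kg_main[OF assms \<sigma> kg])
qed

end
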